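(* Let $\Omega=[0,2\pi]^3$, $\beta\in\mathbb{R}$, $\gamma>0$, $T>0$, and let $u(t,\mathbf{x})$ be the solution of $$\mathrm{i}u_t+\Delta u+\beta e^{-2\gamma t}|u|^2u=0,\quad \mathbf{x}\in\Omega,\ 0<t\le T,$$ which is $2\pi$-periodic in each space variable and satisfies $u(0,\mathbf{x})=\psi_0(\mathbf{x})$. Assume that $u\in C^{3}\big(0,T;H_{p}^{s}(\Omega)\big)$ with $s>\frac32$. Let $\mathbf{U}^n$, $0\le n\le M$, be the numerical solution of the LI-CFP scheme (described in the context) with $N_1=N_2=N_3=N$, $h=2\pi/N$, $\tau=T/M$, $t_n=n\tau$. Then there exists a constant $s_0>0$ such that, whenever $0<\tau,h\le s_0$, $$\|\mathbf{u}^{n}-\mathbf{U}^{n}\|_{h}\leq C_{0}(N^{-s}+\tau^{2}),\quad 1\leq n\leq M,$$ that is, $$\|\boldsymbol{\psi}^{n}-\boldsymbol{\Psi}^{n}\|_{h}\leq C_{0}e^{-\gamma t_{n}}(N^{-s}+\tau^{2}),\quad 1\leq n\leq M,$$ where $C_0$ is a positive constant independent of $n,\tau$ and $h$.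
   Context: Function spaces: $C_p^\infty(\Omega)$ is the set of infinitely differentiable (complex-valued) functions that are $2\pi$-periodic in each variable; $H_p^r(\Omega)$ is the closure of $C_p^\infty(\Omega)$ in the Sobolev space $H^r(\Omega)$. $C^3(0,T;X)$ denotes three times continuously differentiable functions of $t\in[0,T]$ with values in $X$. Grid: $N$ is an even positive integer, $h=2\pi/N$, $J_h=\{\vec j=(j_1,j_2,j_3):0\le j_r\le N-1\}$, grid points $\mathbf{x}_{\vec j}=(x_{j_1},y_{j_2},z_{j_3})=(j_1h,j_2h,j_3h)$. $\mathbb{V}_h$ is the space of complex grid functions $\mathbf U=(U_{\vec j})_{\vec j\in J_h}$, extended periodically with period $N$ in each index. $\langle\mathbf U,\mathbf V\rangle_h=h^3\sum_{\vec j\in J_h}U_{\vec j}\overline{V_{\vec j}}$, $\|\mathbf U\|_h=\langle\mathbf U,\mathbf U\rangle_h^{1/2}$. The dot $\cdot$ between grid functions is the componentwise product and $|\mathbf U|^2=\mathbf U\cdot\bar{\mathbf U}$. Fourier pseudo-spectral Laplacian: let $g_j(x)=\frac1N\sum_{l=-N/2}^{N/2}\frac1{a_l}e^{\mathrm{i}l(x-x_j)}$, with $a_l=1$ for $|l|<N/2$, $a_l=2$ for $|l|=N/2$, and let $\mathbf D_2$ be the $N\times N$ matrix with entries $(\mathbf D_2)_{k,j}=g_j''(x_k)$, $0\le k,j\le N-1$. Then $$(\mathbf\Delta_h\mathbf U)_{\vec j}=\sum_{j=0}^{N-1}(\mathbf D_2)_{j_1,j}U_{j,j_2,j_3}+\sum_{k=0}^{N-1}(\mathbf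 D_2)_{j_2,k}U_{j_1,k,j_3}+\sum_{m=0}^{N-1}(\mathbf D_2)_{j_3,m}U_{j_1,j_2,m}.$$ Time discretization: $M$ is a positive integer, $\tau=T/M$, $t_n=n\tau$, $t_{1/2}=\tau/2$. $\delta_t\mathbf U^n=\frac{\mathbf U^{n+1}-\mathbf U^{n-1}}{2\tau}$, $\delta_t^+\mathbf U^n=\frac{\mathbf U^{n+1}-\mathbf U^n}{\tau}$, $\widehat{\mathbf U}^n=\frac{\mathbf U^{n+1}+\mathbf U^{n-1}}2$, $\mathbf U^{n+\frac12}=\frac{\mathbf U^{n+1}+\mathbf U^n}2$. LI-CFP scheme: $U^0_{\vec j}=\psi_0(\mathbf x_{\vec j})$; $\mathbf U^1\in\mathbb V_h$ is determined by $$\mathrm i\delta_t^+\mathbf U^0+\mathbf\Delta_h\mathbf U^{\frac12}+\beta e^{-2\gamma t_{1/2}}|\mathbf U^{(\frac12)}|^2\cdot\mathbf U^{\frac12}=0,$$ $$U^{(\frac12)}_{\vec j}=u(0,\mathbf x_{\vec j})+\frac{\tau}{2}\mathrm i\Big(\Delta u(0,\mathbf x_{\vec j})+\beta|u(0,\mathbf x_{\vec j})|^2u(0,\mathbf x_{\vec j})\Big),\quad \vec j\in J_h,$$ and for $n=1,\dots,M-1$, $\mathbf U^{n+1}\in\mathbb V_h$ is determined by $$\mathrm i\delta_t\mathbf U^n+\mathbf\Delta_h\widehat{\mathbf U}^n+\beta e^{-2\gamma t_n}|\mathbf U^n|^2\cdot\widehat{\mathbf U}^n=0.$$ Exact and numerical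 values: $\mathbf u^n=(u(t_n,\mathbf x_{\vec j}))_{\vec j\in J_h}$, $\psi(t,\mathbf x)=e^{-\gamma t}u(t,\mathbf x)$, $\boldsymbol\psi^n=(\psi(t_n,\mathbf x_{\vec j}))_{\vec j\in J_h}$, $\boldsymbol\Psi^n=e^{-\gamma t_n}\mathbf U^n$. *)

theory Defs
  imports "HOL-Analysis.Analysis"
begin

section \<open>Periodic Sobolev spaces on the cube\<close>

definition Omega :: "(real^3) set" where
  "Omega = {x. \<forall>i. 0 \<le> x $ i \<and> x $ i \<le> 2 * pi}"

definition pdiff :: "3 \<Rightarrow> (real^3 \<Rightarrow> complex) \<Rightarrow> real^3 \<Rightarrow> complex" where
  "pdiff i f x = vector_derivative (\<lambda>r. f (x + r *\<^sub>R axis i 1)) (at 0)"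

primrec C_k :: "nat \<Rightarrow> (real^3 \<Rightarrow> complex) \<Rightarrow> bool" where
  "C_k 0 f \<longleftrightarrow> continuous_on UNIV f"
| "C_k (Suc k) f \<longleftrightarrow> continuous_on UNIV f \<and>
     (\<forall>i x. (\<lambda>r. f (x + r *\<^sub>R axis i 1)) differentiable (at 0)) \<and>
     (\<forall>i. C_k k (pdiff i f))"

definition smooth :: "(real^3 \<Rightarrow> complex) \<Rightarrow> bool" where
  "smooth f \<longleftrightarrow> (\<forall>k. C_k k f)"

definition periodic :: "(real^3 \<Rightarrow> complex) \<Rightarrow> bool" where
  "periodic f \<longleftrightarrow> (\<forall>i x. f (x + axis i (2 * pi)) = f x)"

definition C_p_inf :: "(real^3 \<Rightarrow> complex) set" where
  "C_p_inf = {f. smooth f \<and> periodic f}"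

definition laplacian :: "(real^3 \<Rightarrow> complex) \<Rightarrow> real^3 \<Rightarrow> complex" where
  "laplacian f x = (\<Sum>i\<in>UNIV. pdiff i (pdiff i f) x)"

definition mi_order :: "nat^3 \<Rightarrow> nat" where
  "mi_order \<alpha> = (\<Sum>i\<in>UNIV. \<alpha> $ i)"

definition mdiff :: "nat^3 \<Rightarrow> (real^3 \<Rightarrow> complex) \<Rightarrow> real^3 \<Rightarrow> complex" where
  "mdiff \<alpha> f = (pdiff 1 ^^ (\<alpha> $ 1)) ((pdiff 2 ^^ (\<alpha> $ 2)) ((pdiff 3 ^^ (\<alpha> $ 3)) f))"

definition test_functions :: "(real^3 \<Rightarrow> complex) set" where
  "test_functions =
     {\<phi>. smooth \<phi> \<and> (\<exists>K. compact K \<and> K \<subseteq> interior Omega \<and> (\<forall>x. x \<notin> K \<longrightarrow> \<phi> x = 0))}"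

definition L2 :: "(real^3 \<Rightarrow> complex) set" where
  "L2 = {f. f \<in> borel_measurable (lebesgue_on Omega) \<and>
            integrable (lebesgue_on Omega) (\<lambda>x. (cmod (f x))\<^sup>2)}"

definition is_weak_deriv :: "nat^3 \<Rightarrow> (real^3 \<Rightarrow> complex) \<Rightarrow> (real^3 \<Rightarrow> complex) \<Rightarrow> bool" where
  "is_weak_deriv \<alpha> f g \<longleftrightarrow> f \<in> L2 \<and> g \<in> L2 \<and>
     (\<forall>\<phi>\<in>test_functions.
        (LINT x|lebesgue_on Omega. f x * mdiff \<alpha> \<phi> x) =
        (-1) ^ mi_order \<alpha> * (LINT x|lebesgue_on Omega. g x * \<phi> x))"

text \<open>A weak derivative is determined up to null sets; the quantities below do not depend
  on the representative that is chosen here.\<close>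

definition wderiv :: "nat^3 \<Rightarrow> (real^3 \<Rightarrow> complex) \<Rightarrow> real^3 \<Rightarrow> complex" where
  "wderiv \<alpha> f = (SOME g. is_weak_deriv \<alpha> f g)"

definition slobodeckij_quotient :: "real \<Rightarrow> (real^3 \<Rightarrow> complex) \<Rightarrow> (real^3) \<times> (real^3) \<Rightarrow> real" where
  "slobodeckij_quotient \<sigma> g = (\<lambda>(x, y). (cmod (g x - g y))\<^sup>2 / norm (x - y) powr (3 + 2 * \<sigma>))"

text \<open>The Sobolev space of real order \<open>r \<ge> 0\<close>: weak derivatives up to order
  \<open>\<lfloor>r\<rfloor>\<close> in the Lebesgue space of square-integrable functions and, for non-integer \<open>r\<close>,
  finite Sobolev--Slobodeckij (Gagliardo) seminorm of order \<open>frac r\<close> for the derivatives of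
  order \<open>\<lfloor>r\<rfloor>\<close>.  Its elements are functions on the whole space, but only their restrictions to
  the cube matter, up to null sets.\<close>

definition Sobolev :: "real \<Rightarrow> (real^3 \<Rightarrow> complex) set" where
  "Sobolev r = {f.
     (\<forall>\<alpha>. mi_order \<alpha> \<le> nat \<lfloor>r\<rfloor> \<longrightarrow> (\<exists>g. is_weak_deriv \<alpha> f g)) \<and>
     (frac r \<noteq> 0 \<longrightarrow> (\<forall>\<alpha>. mi_order \<alpha> = nat \<lfloor>r\<rfloor> \<longrightarrow>
        integrable (lebesgue_on Omega \<Otimes>\<^sub>M lebesgue_on Omega)
          (slobodeckij_quotient (frac r) (wderiv \<alpha> f))))}"

definition sobolev_norm :: "real \<Rightarrow> (real^3 \<Rightarrow> complex) \<Rightarrow> real" where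
  "sobolev_norm r f = sqrt (
     (\<Sum>\<alpha> | mi_order \<alpha> \<le> nat \<lfloor>r\<rfloor>. LINT x|lebesgue_on Omega. (cmod (wderiv \<alpha> f x))\<^sup>2) +
     (if frac r = 0 then 0
      else (\<Sum>\<alpha> | mi_order \<alpha> = nat \<lfloor>r\<rfloor>.
              LINT p|(lebesgue_on Omega \<Otimes>\<^sub>M lebesgue_on Omega).
                slobodeckij_quotient (frac r) (wderiv \<alpha> f) p)))"

definition H_p :: "real \<Rightarrow> (real^3 \<Rightarrow> complex) set" where
  "H_p r = {f \<in> Sobolev r. \<forall>\<epsilon>>0. \<exists>\<phi>\<in>C_p_inf. sobolev_norm r (\<lambda>x. f x - \<phi> x) < \<epsilon>}"

text \<open>\<open>k\<close> times continuously differentiable functions on \<open>[0,T]\<close> with values in \<open>X\<close>, with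
  respect to the seminorm \<open>nrm\<close> (one-sided derivatives at the end points).\<close>

primrec C_time ::
  "nat \<Rightarrow> real \<Rightarrow> (real^3 \<Rightarrow> complex) set \<Rightarrow> ((real^3 \<Rightarrow> complex) \<Rightarrow> real)
   \<Rightarrow> (real \<Rightarrow> real^3 \<Rightarrow> complex) \<Rightarrow> bool" where
  "C_time 0 T X nrm v \<longleftrightarrow> (\<forall>t\<in>{0..T}. v t \<in> X \<and>
     ((\<lambda>r. nrm (\<lambda>x. v r x - v t x)) \<longlongrightarrow> 0) (at t within {0..T}))"
| "C_time (Suc k) T X nrm v \<longleftrightarrow> (\<forall>t\<in>{0..T}. v t \<in> X) \<and>
     (\<exists>v'. C_time k T X nrm v' \<and>
       (\<forall>t\<in>{0..T}.
          ((\<lambda>r. nrm (\<lambda>x. (v r x - v t x) /\<^sub>R (r - t) - v' t x)) \<longlongrightarrow> 0) (at t within {0..T})))"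


section \<open>The equation\<close>

text \<open>Classical periodic solution.  Spatial \<open>C\<^sup>2\<close> regularity is also required at \<open>t = 0\<close>,
  since the scheme uses the values of the Laplacian of \<open>u(0,\<cdot>)\<close> at the grid points.\<close>

definition nls_solution ::
  "real \<Rightarrow> real \<Rightarrow> real \<Rightarrow> (real^3 \<Rightarrow> complex) \<Rightarrow> (real \<Rightarrow> real^3 \<Rightarrow> complex) \<Rightarrow> bool" where
  "nls_solution \<beta> \<gamma> T \<psi>\<^sub>0 u \<longleftrightarrow>
     (\<forall>t\<in>{0..T}. C_k 2 (u t) \<and> periodic (u t)) \<and>
     (\<forall>x\<in>Omega. u 0 x = \<psi>\<^sub>0 x) \<and>
     (\<forall>t\<in>{0<..T}. \<forall>x\<in>Omega.
        (\<lambda>r. u r x) differentiable (at t within {0..T}) \<and>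
        \<i> * vector_derivative (\<lambda>r. u r x) (at t within {0..T}) + laplacian (u t) x
          + of_real (\<beta> * exp (- 2 * \<gamma> * t) * (cmod (u t x))\<^sup>2) * u t x = 0)"


section \<open>Grid functions and the Fourier pseudo-spectral Laplacian\<close>

type_synonym gridfun = "int \<times> int \<times> int \<Rightarrow> complex"

definition mesh :: "nat \<Rightarrow> real" where
  "mesh N = 2 * pi / real N"

definition J_h :: "nat \<Rightarrow> (int \<times> int \<times> int) set" where
  "J_h N = {0..<int N} \<times> {0..<int N} \<times> {0..<int N}"

definition grid_point :: "nat \<Rightarrow> int \<times> int \<times> int \<Rightarrow> real^3" where
  "grid_point N = (\<lambda>(j\<^sub>1, j\<^sub>2, j\<^sub>3). vector [of_int j\<^sub>1 * mesh N, of_int j\<^sub>2 * mesh N, of_int j\<^sub>3 * mesh N])"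

definition V_h :: "nat \<Rightarrow> gridfun set" where
  "V_h N = {U. \<forall>j k l. U (j + int N, k, l) = U (j, k, l) \<and>
                       U (j, k + int N, l) = U (j, k, l) \<and>
                       U (j, k, l + int N) = U (j, k, l)}"

definition grid_inner :: "nat \<Rightarrow> gridfun \<Rightarrow> gridfun \<Rightarrow> complex" where
  "grid_inner N U V = of_real (mesh N ^ 3) * (\<Sum>j\<in>J_h N. U j * cnj (V j))"

text \<open>The inner product of a grid function with itself is a nonnegative real number.\<close>

definition grid_norm :: "nat \<Rightarrow> gridfun \<Rightarrow> real" where
  "grid_norm N U = sqrt (Re (grid_inner N U U))"

definition a_coeff :: "nat \<Rightarrow> int \<Rightarrow> complex" where
  "a_coeff N l = (if \<bar>l\<bar> = int N div 2 then 2 else 1)"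

definition g_basis :: "nat \<Rightarrow> int \<Rightarrow> real \<Rightarrow> complex" where
  "g_basis N j x = (1 / of_nat N) *
     (\<Sum>l\<in>{- (int N div 2)..int N div 2}.
        (1 / a_coeff N l) * exp (\<i> * of_int l * of_real (x - of_int j * mesh N)))"

definition D2 :: "nat \<Rightarrow> int \<Rightarrow> int \<Rightarrow> complex" where
  "D2 N k j = vector_derivative (\<lambda>x. vector_derivative (g_basis N j) (at x)) (at (of_int k * mesh N))"

definition Delta_h :: "nat \<Rightarrow> gridfun \<Rightarrow> gridfun" where
  "Delta_h N U = (\<lambda>(j\<^sub>1, j\<^sub>2, j\<^sub>3).
     (\<Sum>j\<in>{0..<int N}. D2 N j\<^sub>1 j * U (j, j\<^sub>2, j\<^sub>3)) +
     (\<Sum>k\<in>{0..<int N}. D2 N j\<^sub>2 k * U (j\<^sub>1, k, j\<^sub>3)) +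
     (\<Sum>m\<in>{0..<int N}. D2 N j\<^sub>3 m * U (j\<^sub>1, j\<^sub>2, m)))"


section \<open>The LI-CFP scheme\<close>

definition delta_t :: "real \<Rightarrow> (nat \<Rightarrow> gridfun) \<Rightarrow> nat \<Rightarrow> gridfun" where
  "delta_t \<tau> U n = (\<lambda>j. (U (n + 1) j - U (n - 1) j) / of_real (2 * \<tau>))"

definition delta_t_plus :: "real \<Rightarrow> (nat \<Rightarrow> gridfun) \<Rightarrow> nat \<Rightarrow> gridfun" where
  "delta_t_plus \<tau> U n = (\<lambda>j. (U (n + 1) j - U n j) / of_real \<tau>)"

definition avg_hat :: "(nat \<Rightarrow> gridfun) \<Rightarrow> nat \<Rightarrow> gridfun" where
  "avg_hat U n = (\<lambda>j. (U (n + 1) j + U (n - 1) j) / 2)"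

definition avg_half :: "(nat \<Rightarrow> gridfun) \<Rightarrow> nat \<Rightarrow> gridfun" where
  "avg_half U n = (\<lambda>j. (U (n + 1) j + U n j) / 2)"

text \<open>The predicted value at half a time step, to be distinguished from the average \<open>avg_half U 0\<close>.\<close>

definition predictor :: "real \<Rightarrow> nat \<Rightarrow> real \<Rightarrow> (real^3 \<Rightarrow> complex) \<Rightarrow> gridfun" where
  "predictor \<beta> N \<tau> v = (\<lambda>j. let x = grid_point N j in
     v x + of_real (\<tau> / 2) * \<i> * (laplacian v x + of_real (\<beta> * (cmod (v x))\<^sup>2) * v x))"

definition LI_CFP ::
  "real \<Rightarrow> real \<Rightarrow> real \<Rightarrow> (real^3 \<Rightarrow> complex) \<Rightarrow> (real \<Rightarrow> real^3 \<Rightarrow> complex)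
   \<Rightarrow> nat \<Rightarrow> nat \<Rightarrow> (nat \<Rightarrow> gridfun) \<Rightarrow> bool" where
  "LI_CFP \<beta> \<gamma> T \<psi>\<^sub>0 u N M U \<longleftrightarrow> (let \<tau> = T / real M in
     (\<forall>n\<le>M. U n \<in> V_h N) \<and>
     (\<forall>j\<in>J_h N. U 0 j = \<psi>\<^sub>0 (grid_point N j)) \<and>
     (\<forall>j\<in>J_h N.
        \<i> * delta_t_plus \<tau> U 0 j + Delta_h N (avg_half U 0) j
          + of_real (\<beta> * exp (- 2 * \<gamma> * (\<tau> / 2)) * (cmod (predictor \<beta> N \<tau> (u 0) j))\<^sup>2)
            * avg_half U 0 j = 0) \<and>
     (\<forall>n. 1 \<le> n \<and> n \<le> M - 1 \<longrightarrow> (\<forall>j\<in>J_h N.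
        \<i> * delta_t \<tau> U n j + Delta_h N (avg_hat U n) j
          + of_real (\<beta> * exp (- 2 * \<gamma> * (real n * \<tau>)) * (cmod (U n j))\<^sup>2)
            * avg_hat U n j = 0)))"

end

theory Submission
  imports Defs
begin

text \<open>
  Why the scheme converges.  The discrete Fourier transform diagonalises the pseudo-spectral
  Laplacian with real eigenvalues, so a Crank--Nicolson step multiplies every discrete frequency by a
  number of modulus one and adds the contribution of the source (\<open>cn_step\<close>).  Applied to the
  difference between the exact and the numerical solution this says that, in every norm that depends
  monotonically on the moduli of the discrete Fourier coefficients, the error grows in one step by at
  most the step length times the norm of the source.  The source has two parts: the residual of the
  exact solution in the scheme, and the difference of the two cubic terms.

  The difference of the cubic terms is Lipschitz in the error as long as the numerical solution stays
  bounded.  Boundedness without any coupling between \<open>\<tau>\<close> and \<open>h\<close> comes from a second norm: the sum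
  \<open>wiener\<close> of the moduli of the discrete Fourier coefficients.  It dominates the maximum norm,
  it is submultiplicative, and it is monotone in the above sense, so the whole error recursion
  can be run in it.  In this norm the residual is small for small \<open>\<tau>\<close> and \<open>h\<close>, and the discrete
  Gronwall inequality \<open>gronwall_two_step\<close> shows by induction over the time levels that the
  numerical solution never leaves a ball of twice the radius of the exact one
  (\<open>wiener_scheme_bounded\<close>).  With that bound the same recursion, \<open>error_bound\<close>, is run once more in
  the norm \<open>grid_norm\<close>, where the residual is of second order in \<open>\<tau>\<close> and of order
  \<open>N powr (- (m + 2))\<close> in space, where \<open>m = \<lfloor>s\<rfloor>\<close>.  Since \<open>s < m + 1\<close>, this is more than enough.

  The residual needs more spatial regularity than \<open>H_p s\<close>.  It is supplied by the equation: it expresses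
  the Laplacian of \<open>u\<close> by the time derivative and the cubic term, so a time derivative with values in
  \<open>H_p s\<close> is worth two derivatives in space (\<open>elliptic_gain\<close>).  Doing this twice bounds the solution
  in order \<open>m + 4\<close> and its time derivative in order \<open>m + 2\<close> (\<open>regularity\<close>).  All regularity is
  measured by weighted square sums of Fourier coefficients; \<open>fder_sobolev_bound\<close> extracts them from
  the Sobolev norm.  On the grid, frequencies that differ by multiples of \<open>N\<close> coincide; the
  aliasing estimate \<open>rep_grid_norm\<close> shows that this folding costs no more than the decay of the
  coefficients beyond the frequency \<open>N / 2\<close>.
\<close>

section \<open>The periodic cube\<close>

lemma Omega_cbox: "Omega = cbox 0 (\<chi> i. 2 * pi)"
  by (auto simp: Omega_def mem_box_cart)

lemma Omega_sets [measurable]: "Omega \<in> sets lebesgue"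
  by (simp add: Omega_cbox)

lemma measure_Omega: "measure lebesgue Omega = (2 * pi) ^ 3"
  proof -
  have "measure lebesgue Omega = measure lborel (cbox 0 (\<chi> i. 2 * pi) :: (real^3) set)"
    by (simp add: Omega_cbox)
  also have "\<dots> = (2 * pi) ^ 3"
    by (subst content_cbox_cart) (auto simp: interval_ne_empty_cart)
  finally show ?thesis .
qed

lemma Omega_lmeasurable: "Omega \<in> lmeasurable"
  by (simp add: Omega_cbox)

lemma finite_measure_Omega: "finite_measure (lebesgue_on Omega)"
  using Omega_lmeasurable by (simp add: finite_measure_lebesgue_on)

lemma measure_lebesgue_on_Omega: "measure (lebesgue_on Omega) Omega = (2 * pi) ^ 3"
  by (simp add: measure_restrict_space measure_Omega)

lemma LINT_const_Omega_real: "(LINT x|lebesgue_on Omega. c) = (2 * pi) ^ 3 * (c::real)"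
  by (simp add: measure_lebesgue_on_Omega)

lemma integrable_continuous_Omega:
  "continuous_on UNIV f \<Longrightarrow> integrable (lebesgue_on Omega) (f :: real^3 \<Rightarrow> 'b::euclidean_space)"
  unfolding Omega_cbox
  by (rule continuous_imp_integrable) (erule continuous_on_subset, simp)

lemma LINT_eq_integral_Omega:
  "continuous_on UNIV f \<Longrightarrow>
    (LINT x|lebesgue_on Omega. f x) = integral Omega (f :: real^3 \<Rightarrow> 'b::euclidean_space)"
  by (rule lebesgue_integral_eq_integral[OF integrable_continuous_Omega]) auto

text \<open>The partial derivative as a relation, so that product rules can be chained without differentiability
side conditions.\<close>

definition has_pd :: "(real^3 \<Rightarrow> complex) \<Rightarrow> 3 \<Rightarrow> (real^3 \<Rightarrow> complex) \<Rightarrow> bool" where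
  "has_pd F i G \<longleftrightarrow> (\<forall>x. ((\<lambda>r. F (x + r *\<^sub>R axis i 1)) has_vector_derivative G x) (at 0))"

lemma has_pd_pdiff: "has_pd F i G \<Longrightarrow> pdiff i F = G"
  by (rule ext) (auto simp: has_pd_def pdiff_def vector_derivative_at)

lemma C_k_Suc_has_pd: "C_k (Suc k) f \<Longrightarrow> has_pd f i (pdiff i f)"
  by (auto simp: has_pd_def pdiff_def vector_derivative_works)

lemma has_pd_mult:
  assumes "has_pd F i F'" "has_pd G i G'"
  shows "has_pd (\<lambda>x. F x * G x) i (\<lambda>x. F x * G' x + F' x * G x)"
  unfolding has_pd_def
proof
  fix x
  show "((\<lambda>r. F (x + r *\<^sub>R axis i 1) * G (x + r *\<^sub>R axis i 1)) has_vector_derivative F x * G' x + F' x * G x) (at 0)"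
    using has_vector_derivative_mult[of "\<lambda>r. F (x + r *\<^sub>R axis i 1)" "F' x" 0 UNIV "\<lambda>r. G (x + r *\<^sub>R axis i 1)" "G' x"]
      assms by (simp add: has_pd_def)
qed

lemma has_pd_shift:
  assumes "has_pd F i G"
  shows "((\<lambda>r. F (x + r *\<^sub>R axis i 1)) has_vector_derivative G (x + r0 *\<^sub>R axis i 1)) (at r0)"
proof -
  have "((\<lambda>r. F ((x + r0 *\<^sub>R axis i 1) + r *\<^sub>R axis i 1)) has_vector_derivative G (x + r0 *\<^sub>R axis i 1)) (at 0)"
    using assms by (simp add: has_pd_def)
  then have "((\<lambda>r. F ((x + r0 *\<^sub>R axis i 1) + r *\<^sub>R axis i 1)) has_vector_derivative G (x + r0 *\<^sub>R axis i 1)) (at (r0 + (- r0)))"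
    by simp
  from this[unfolded has_vector_derivative_def]
  have "(((\<lambda>r. F ((x + r0 *\<^sub>R axis i 1) + r *\<^sub>R axis i 1)) \<circ> (\<lambda>r. r + (-r0))) has_derivative
      (\<lambda>h. h *\<^sub>R G (x + r0 *\<^sub>R axis i 1)) \<circ> (\<lambda>h. h)) (at r0)"
    by (intro diff_chain_at) (auto intro!: derivative_eq_intros simp: has_vector_derivative_def)
  then show ?thesis
    by (simp add: has_vector_derivative_def o_def algebra_simps)
qed

text \<open>Integration by parts in disguise.  Periodicity of \<open>F\<close> is required only on a thin slab at the
face \<open>x $ i = 0\<close>: this covers periodic functions as well as products with test functions, which
vanish near that face and near the opposite one.  The integral of \<open>F\<close> over translates of the cube
is then constant for small translations, and differentiating under the integral sign gives the claim.\<close>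

lemma integral_pd_eq_0:
  assumes F: "continuous_on UNIV F" and pd: "has_pd F i G" and G: "continuous_on UNIV G"
    and \<delta>: "\<delta> > 0"
    and per: "\<And>x. 0 \<le> x $ i \<Longrightarrow> x $ i \<le> \<delta> \<Longrightarrow> (\<And>j. j \<noteq> i \<Longrightarrow> 0 \<le> x $ j \<and> x $ j \<le> 2 * pi)
            \<Longrightarrow> F (x + axis i (2 * pi)) = F x"
  shows "(LINT x|lebesgue_on Omega. G x) = 0"
proof -
  define lo where "lo a = (\<chi> j. if j = i then a else (0 :: real))" for a :: real
  define hi where "hi b = (\<chi> j. if j = i then b else (2 * pi :: real))" for b :: real
  define I where "I a b = integral (cbox (lo a) (hi b)) F" for a b
  have Om: "Omega = cbox (lo 0) (hi (2 * pi))"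
    by (auto simp: Omega_def mem_box_cart lo_def hi_def)
  have int: "F integrable_on cbox a b" for a b
    using F continuous_on_subset integrable_continuous by blast
  have mem: "x \<in> cbox (lo a) (hi b) \<longleftrightarrow> a \<le> x $ i \<and> x $ i \<le> b \<and> (\<forall>j. j \<noteq> i \<longrightarrow> 0 \<le> x $ j \<and> x $ j \<le> 2 * pi)" for x a b
    by (auto simp: mem_box_cart lo_def hi_def)
  have split: "I a c = I a b + I b c" if "a \<le> b" "b \<le> c" for a b c
  proof -
    have "I a c = integral (cbox (lo a) (hi c) \<inter> {x. x \<bullet> axis i 1 \<le> b}) F
        + integral (cbox (lo a) (hi c) \<inter> {x. x \<bullet> axis i 1 \<ge> b}) F"
      unfolding I_def by (rule integral_split[OF int]) (auto simp: axis_in_Basis_iff)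
    also have "cbox (lo a) (hi c) \<inter> {x. x \<bullet> axis i 1 \<le> b} = cbox (lo a) (hi b)"
      using that by (auto simp: mem inner_axis)
    also have "cbox (lo a) (hi c) \<inter> {x. x \<bullet> axis i 1 \<ge> b} = cbox (lo b) (hi c)"
      using that by (auto simp: mem inner_axis)
    finally show ?thesis by (simp add: I_def)
  qed
  have shift: "integral (cbox (lo a) (hi b)) (\<lambda>x. F (x + r *\<^sub>R axis i 1)) = I (a + r) (b + r)" for a b r
  proof -
    have "lo a + r *\<^sub>R axis i 1 = lo (a + r)" "hi b + r *\<^sub>R axis i 1 = hi (b + r)"
      by (auto simp: vec_eq_iff lo_def hi_def axis_def)
    then show ?thesis
      using integral_shift_cbox_plus[of "lo a" "hi b" F "r *\<^sub>R axis i 1"]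
      by (simp add: I_def o_def add.commute)
  qed
  define d where "d = min \<delta> pi"
  have d: "0 < d" "d \<le> \<delta>" "d \<le> 2 * pi" using \<delta> pi_gt_zero unfolding d_def by (auto simp: min_def simp del: pi_gt_zero)
  \<comment> \<open>Translating the cube by \<open>r\<close> removes a slab on one side and adds its periodic copy on the other.\<close>
  have const: "integral Omega (\<lambda>x. F (x + r *\<^sub>R axis i 1)) = integral Omega F" if "r \<in> {0..d}" for r
  proof -
    have "I 0 r = I (2 * pi) (2 * pi + r)"
    proof -
      have "I (2 * pi) (2 * pi + r) = integral (cbox (lo 0) (hi r)) (\<lambda>x. F (x + (2*pi) *\<^sub>R axis i 1))"
        by (simp add: shift add.commute)
      also have "\<dots> = I 0 r"
        unfolding I_def
      proof (rule integral_cong)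
        fix x assume x: "x \<in> cbox (lo 0) (hi r)"
        have "F (x + axis i (2 * pi)) = F x"
        proof (rule per)
          show "0 \<le> x $ i" "x $ i \<le> \<delta>"
            using x that d by (auto simp: mem)
          show "0 \<le> x $ j \<and> x $ j \<le> 2 * pi" if "j \<noteq> i" for j
            using x that by (auto simp: mem)
        qed
        moreover have "(2*pi) *\<^sub>R axis i 1 = (axis i (2 * pi) :: real^3)"
          by (auto simp: vec_eq_iff axis_def)
        ultimately show "F (x + (2*pi) *\<^sub>R axis i 1) = F x" by simp
      qed
      finally show ?thesis by simp
    qed
    moreover have "I 0 (2 * pi + r) = I 0 r + I r (2 * pi + r)"
      "I 0 (2 * pi + r) = I 0 (2 * pi) + I (2 * pi) (2 * pi + r)"
      using that by (auto intro!: split)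
    ultimately have "I r (2 * pi + r) = I 0 (2 * pi)" by simp
    then show ?thesis by (simp add: Om shift) (simp add: I_def)
  qed
  have "((\<lambda>r. integral (cbox (lo 0) (hi (2*pi))) (\<lambda>x. F (x + r *\<^sub>R axis i 1))) has_vector_derivative
     integral (cbox (lo 0) (hi (2*pi))) (\<lambda>x. G (x + 0 *\<^sub>R axis i 1))) (at 0 within {0..d})"
  proof (rule leibniz_rule_vector_derivative)
    show "((\<lambda>r. F (x + r *\<^sub>R axis i 1)) has_vector_derivative G (x + r0 *\<^sub>R axis i 1)) (at r0 within {0..d})" for x r0
      by (rule has_vector_derivative_at_within[OF has_pd_shift[OF pd]])
    show "(\<lambda>x. F (x + r *\<^sub>R axis i 1)) integrable_on cbox (lo 0) (hi (2 * pi))" for r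
      by (intro integrable_continuous continuous_on_compose2[OF F] continuous_intros) auto
    show "continuous_on ({0..d} \<times> cbox (lo 0) (hi (2 * pi))) (\<lambda>(r, x). G (x + r *\<^sub>R axis i 1))"
      unfolding split_beta by (intro continuous_on_compose2[OF G] continuous_intros) auto
  qed (use d in auto)
  then have 1: "((\<lambda>r. integral Omega (\<lambda>x. F (x + r *\<^sub>R axis i 1))) has_vector_derivative integral Omega G) (at 0 within {0..d})"
    by (simp add: Om)
  have "((\<lambda>r. integral Omega F) has_vector_derivative integral Omega G) (at 0 within {0..d})"
    by (rule has_vector_derivative_transform[OF _ _ 1]) (use d const in auto)
  moreover have "((\<lambda>r. integral Omega F) has_vector_derivative 0) (at 0 within {0..d})"
    by simp
  ultimately have "integral Omega G = 0"
    by (rule vector_derivative_unique_within[rotated]) (use d in \<open>simp add: at_within_Icc_at_right\<close>)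
  then show ?thesis using LINT_eq_integral_Omega[OF G] by simp
qed

section \<open>Characters and Fourier coefficients\<close>

type_synonym freq = "int \<times> int \<times> int"

definition kc :: "freq \<Rightarrow> 3 \<Rightarrow> int" where
  "kc k i = (if i = 1 then fst k else if i = 2 then fst (snd k) else snd (snd k))"

lemma kc_add [simp]: "kc (k + l) i = kc k i + kc l i"
  and kc_diff [simp]: "kc (k - l) i = kc k i - kc l i"
  and kc_minus [simp]: "kc (- k) i = - kc k i"
  and kc_0 [simp]: "kc 0 i = 0"
  by (auto simp: kc_def)

lemma kc_eq_iff: "k = l \<longleftrightarrow> (\<forall>i. kc k i = kc l i)"
  by (auto simp: kc_def prod_eq_iff forall_3)

definition fchar :: "freq \<Rightarrow> real^3 \<Rightarrow> complex" where
  "fchar k x = cis (\<Sum>i\<in>UNIV. of_int (kc k i) * x $ i)"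

lemma fchar_add: "fchar (k + l) x = fchar k x * fchar l x"
  by (simp add: fchar_def cis_mult sum.distrib distrib_right)

lemma fchar_0 [simp]: "fchar 0 x = 1"
  by (simp add: fchar_def)

lemma fchar_minus: "fchar (- k) x = cnj (fchar k x)"
  by (simp add: fchar_def cis_cnj sum_negf)

lemma cnj_fchar [simp]: "cnj (fchar k x) = fchar (- k) x"
  by (simp add: fchar_minus)

lemma norm_fchar [simp]: "cmod (fchar k x) = 1"
  by (simp add: fchar_def)

lemma continuous_fchar [continuous_intros]: "continuous_on S (fchar k)"
  unfolding fchar_def by (intro continuous_intros)

lemma sum_kc_axis:
  "(\<Sum>j\<in>UNIV. of_int (kc k j) * (x + axis i c) $ j) = (\<Sum>j\<in>UNIV. of_int (kc k j) * x $ j) + of_int (kc k i) * (c::real)"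
proof -
  have "(\<Sum>j\<in>UNIV. of_int (kc k j) * (x + axis i c) $ j)
      = (\<Sum>j\<in>UNIV. of_int (kc k j) * x $ j) + (\<Sum>j\<in>UNIV. if j = i then of_int (kc k j) * c else 0)"
    unfolding sum.distrib[symmetric] by (rule sum.cong) (auto simp: axis_def distrib_left)
  then show ?thesis by simp
qed

lemma periodic_fchar: "periodic (fchar k)"
  unfolding periodic_def
proof (intro allI)
  fix i x
  have "(\<Sum>j\<in>UNIV. of_int (kc k j) * (x + axis i (2 * pi)) $ j)
      = (\<Sum>j\<in>UNIV. of_int (kc k j) * x $ j) + of_int (kc k i) * (2 * pi)"
    by (rule sum_kc_axis)
  then show "fchar k (x + axis i (2 * pi)) = fchar k x"
    by (simp add: fchar_def cis_mult[symmetric] mult.commute[of _ "2*pi"])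
qed

lemma has_pd_fchar: "has_pd (fchar k) i (\<lambda>x. \<i> * of_int (kc k i) * fchar k x)"
  unfolding has_pd_def
proof
  fix x
  have "(\<Sum>j\<in>UNIV. of_int (kc k j) * (x + r *\<^sub>R axis i 1) $ j)
      = (\<Sum>j\<in>UNIV. of_int (kc k j) * x $ j) + r * of_int (kc k i)" for r
  proof -
    have "r *\<^sub>R axis i 1 = (axis i r :: real^3)" by (auto simp: vec_eq_iff axis_def)
    then show ?thesis by (simp only: sum_kc_axis mult.commute)
  qed
  then have eq: "fchar k (x + r *\<^sub>R axis i 1) = fchar k x * exp (\<i> * of_int (kc k i) * of_real r)" for r
    by (simp add: fchar_def cis_mult[symmetric]) (simp add: cis_conv_exp mult_ac)
  have "((\<lambda>z. fchar k x * exp (\<i> * of_int (kc k i) * z)) has_field_derivative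
      \<i> * of_int (kc k i) * fchar k x) (at (of_real 0))"
    by (auto intro!: derivative_eq_intros)
  then show "((\<lambda>r. fchar k (x + r *\<^sub>R axis i 1)) has_vector_derivative \<i> * of_int (kc k i) * fchar k x) (at 0)"
    unfolding eq by (intro has_vector_derivative_real_field)
qed

text \<open>A nonzero frequency has a nonzero component \<open>kc k i\<close>, and then the character is, up to a constant factor,
its own derivative in that direction.\<close>

lemma integral_fchar: "(LINT x|lebesgue_on Omega. fchar k x) = (if k = 0 then (2 * pi) ^ 3 else 0)"
proof (cases "k = 0")
  case True
  then show ?thesis by (simp add: measure_lebesgue_on_Omega scaleR_conv_of_real)
next
  case False
  then obtain i where i: "kc k i \<noteq> 0" by (auto simp: kc_eq_iff)
  have "(LINT x|lebesgue_on Omega. \<i> * of_int (kc k i) * fchar k x) = 0"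
    by (rule integral_pd_eq_0[OF _ has_pd_fchar, of k i 1])
      (use periodic_fchar in \<open>auto intro!: continuous_intros simp: periodic_def\<close>)
  then show ?thesis using i False by simp
qed

definition coef :: "(real^3 \<Rightarrow> complex) \<Rightarrow> freq \<Rightarrow> complex" where
  "coef f k = (LINT x|lebesgue_on Omega. f x * fchar (- k) x) / of_real ((2 * pi) ^ 3)"

lemma coef_fchar: "coef (fchar l) k = (if k = l then 1 else 0)"
proof -
  have "coef (fchar l) k = (LINT x|lebesgue_on Omega. fchar (l - k) x) / of_real ((2 * pi) ^ 3)"
    by (simp add: coef_def fchar_add[symmetric])
  then show ?thesis by (auto simp: integral_fchar)
qed

lemma coef_pd:
  assumes "continuous_on UNIV f" "periodic f" "has_pd f i g" "continuous_on UNIV g"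
  shows "coef g k = \<i> * of_int (kc k i) * coef f k"
proof -
  let ?h = "\<lambda>x. f x * (\<i> * of_int (kc (-k) i) * fchar (-k) x) + g x * fchar (-k) x"
  have "(LINT x|lebesgue_on Omega. ?h x) = 0"
    by (rule integral_pd_eq_0[OF _ has_pd_mult[OF assms(3) has_pd_fchar], where \<delta> = 1])
      (use periodic_fchar assms in \<open>auto intro!: continuous_intros simp: periodic_def\<close>)
  moreover have "(LINT x|lebesgue_on Omega. ?h x) =
     (LINT x|lebesgue_on Omega. - (\<i> * of_int (kc k i)) * (f x * fchar (-k) x)) + (LINT x|lebesgue_on Omega. g x * fchar (-k) x)"
    by (subst Bochner_Integration.integral_add[symmetric])
      (auto intro!: integrable_continuous_Omega continuous_intros assms simp: algebra_simps)
  ultimately have "(LINT x|lebesgue_on Omega. g x * fchar (-k) x) = \<i> * of_int (kc k i) * (LINT x|lebesgue_on Omega. f x * fchar (-k) x)"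
    by (simp only: integral_mult_right_zero) simp
  then show ?thesis
    by (simp add: coef_def)
qed

section \<open>Test functions on the cube\<close>

text \<open>Up to linear combinations, the family is closed under differentiation, which makes smoothness of \<open>bmp 0\<close>, and of everything
built from it, a matter of closure properties.\<close>

definition bmp :: "nat \<Rightarrow> real \<Rightarrow> real" where
  "bmp k y = (if y > 0 then exp (- (1 / y)) / y ^ k else 0)"

lemma bmp_tendsto_0: "(bmp k \<longlongrightarrow> 0) (at 0)"
proof -
  have "((\<lambda>y. (inverse y) ^ k / exp (inverse y)) \<longlongrightarrow> (0::real)) (at_right 0)"
    by (rule filterlim_compose[OF tendsto_power_div_exp_0 filterlim_inverse_at_top_right])
  then have "(bmp k \<longlongrightarrow> 0) (at_right 0)"
    by (rule Lim_transform_eventually)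
      (auto simp: eventually_at_filter bmp_def exp_minus field_simps intro!: always_eventually)
  moreover have "((\<lambda>y. 0) \<longlongrightarrow> (0::real)) (at_left 0)" by simp
  then have "(bmp k \<longlongrightarrow> 0) (at_left 0)"
    by (rule Lim_transform_eventually)
      (auto simp: eventually_at_filter bmp_def intro!: always_eventually)
  ultimately show ?thesis by (simp add: filterlim_split_at)
qed

lemma bmp_deriv: "(bmp k has_real_derivative bmp (k + 2) y - real k * bmp (k + 1) y) (at y)"
proof -
  consider "y > 0" | "y < 0" | "y = 0" by linarith
  then show ?thesis
  proof cases
    case 1
    have "((\<lambda>y. exp (- inverse y) * inverse y ^ k) has_real_derivative bmp (k + 2) y - real k * bmp (k + 1) y) (at y)"
    proof -
      have "((\<lambda>y. exp (- inverse y) * inverse y ^ k) has_real_derivative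
        exp (- inverse y) * (inverse y)\<^sup>2 * inverse y ^ k + exp (- inverse y) * (real k * inverse y ^ (k - 1) * (- (inverse y)\<^sup>2))) (at y)"
        using 1 by (auto intro!: derivative_eq_intros simp: power2_eq_square)
      moreover have "real k * inverse y ^ (k - 1) * (- (inverse y)\<^sup>2) = - real k * inverse y ^ (k + 1)"
        by (cases k) (auto simp: power2_eq_square algebra_simps)
      moreover have "bmp (k + 2) y - real k * bmp (k + 1) y
          = exp (- inverse y) * (inverse y)\<^sup>2 * inverse y ^ k + exp (- inverse y) * (- real k * inverse y ^ (k + 1))"
        using 1 by (simp add: bmp_def divide_inverse power_inverse power2_eq_square algebra_simps)
      ultimately show ?thesis by (simp only:)
    qed
    then show ?thesis
      by (rule has_field_derivative_transform_within_open[of _ _ _ "{0<..}"]) (use 1 in \<open>auto simp: bmp_def divide_inverse power_inverse\<close>)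
  next
    case 2
    have "((\<lambda>y. 0) has_real_derivative 0) (at y)" by simp
    then have "(bmp k has_real_derivative 0) (at y)"
      by (rule has_field_derivative_transform_within_open[of _ _ _ "{..<0}"]) (use 2 in \<open>auto simp: bmp_def\<close>)
    then show ?thesis using 2 by (simp add: bmp_def)
  next
    case 3
    have "((\<lambda>h. (bmp k h - bmp k 0) / (h - 0)) \<longlongrightarrow> 0) (at 0)"
      by (rule Lim_transform_eventually[OF bmp_tendsto_0[of "k + 1"]])
        (auto simp: eventually_at_filter bmp_def intro!: always_eventually)
    then show ?thesis using 3 by (simp add: has_field_derivative_iff bmp_def)
  qed
qed

text \<open>Every member has a derivative that is again a member, so all members are smooth.\<close>

inductive_set Gen :: "(real \<Rightarrow> complex) set" where
  Gen_bmp: "(\<lambda>r. of_real (bmp k (a + b * r))) \<in> Gen"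
| Gen_exp: "(\<lambda>r. exp (c * of_real r)) \<in> Gen"
| Gen_const: "(\<lambda>r. c) \<in> Gen"
| Gen_add: "f \<in> Gen \<Longrightarrow> g \<in> Gen \<Longrightarrow> (\<lambda>r. f r + g r) \<in> Gen"
| Gen_mult: "f \<in> Gen \<Longrightarrow> g \<in> Gen \<Longrightarrow> (\<lambda>r. f r * g r) \<in> Gen"

lemma Gen_deriv: "f \<in> Gen \<Longrightarrow> \<exists>f'\<in>Gen. \<forall>x. (f has_vector_derivative f' x) (at x)"
proof (induction rule: Gen.induct)
  case (Gen_bmp k a b)
  let ?f = "\<lambda>r. of_real b * (of_real (bmp (k + 2) (a + b * r)) + (- of_nat k) * of_real (bmp (k + 1) (a + b * r)))"
  have "?f \<in> Gen" by (intro Gen.intros)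
  moreover have "((\<lambda>r. complex_of_real (bmp k (a + b * r))) has_vector_derivative ?f x) (at x)" for x
  proof -
    have "((\<lambda>r. bmp k (a + b * r)) has_real_derivative (bmp (k + 2) (a + b * x) - real k * bmp (k + 1) (a + b * x)) * b) (at x)"
      by (rule DERIV_chain2[OF bmp_deriv]) (auto intro!: derivative_eq_intros)
    from has_vector_derivative_of_real[OF this] show ?thesis
      by (simp add: mult.commute)
  qed
  ultimately show ?case by (intro bexI[of _ ?f]) auto
next
  case (Gen_exp c)
  have "(\<lambda>r. c * exp (c * of_real r)) \<in> Gen" by (intro Gen.intros)
  moreover have "((\<lambda>r. exp (c * of_real r)) has_vector_derivative c * exp (c * of_real x)) (at x)" for x
  proof -
    have "((\<lambda>z. exp (c * z)) has_field_derivative c * exp (c * of_real x)) (at (of_real x))"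
      by (auto intro!: derivative_eq_intros)
    then show ?thesis by (rule has_vector_derivative_real_field)
  qed
  ultimately show ?case by (intro bexI[of _ "\<lambda>r. c * exp (c * of_real r)"]) auto
next
  case (Gen_const c)
  show ?case by (intro bexI[of _ "\<lambda>r. 0"] Gen.intros) auto
next
  case (Gen_add f g)
  then obtain f' g' where "f' \<in> Gen" "g' \<in> Gen"
    "\<forall>x. (f has_vector_derivative f' x) (at x)" "\<forall>x. (g has_vector_derivative g' x) (at x)" by auto
  then show ?case
    by (intro bexI[of _ "\<lambda>r. f' r + g' r"] Gen.intros) (auto intro!: has_vector_derivative_add)
next
  case (Gen_mult f g)
  then obtain f' g' where *: "f' \<in> Gen" "g' \<in> Gen"
    "\<forall>x. (f has_vector_derivative f' x) (at x)" "\<forall>x. (g has_vector_derivative g' x) (at x)" by auto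
  show ?case
    by (intro bexI[of _ "\<lambda>r. f r * g' r + f' r * g r"] Gen.intros)
      (use * Gen_mult in \<open>auto intro!: has_vector_derivative_mult\<close>)
qed

lemma Gen_continuous: "f \<in> Gen \<Longrightarrow> continuous_on UNIV f"
  using Gen_deriv
  by (metis UNIV_I continuous_at_imp_continuous_on has_vector_derivative_continuous)

definition tens :: "(3 \<Rightarrow> real \<Rightarrow> complex) \<Rightarrow> real^3 \<Rightarrow> complex" where
  "tens G x = (\<Prod>i\<in>UNIV. G i (x $ i))"

lemma tens_pd:
  assumes "\<And>x. (G j has_vector_derivative g x) (at x)"
  shows "has_pd (tens G) j (tens (G(j := g)))"
  unfolding has_pd_def
proof
  fix x
  let ?c = "\<Prod>i\<in>UNIV - {j}. G i (x $ i)"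
  have 1: "tens (G(j := g)) x = g (x $ j) * ?c"
    by (simp add: tens_def prod.remove[of UNIV j])
  have 2: "tens G (x + r *\<^sub>R axis j 1) = G j (x $ j + r) * ?c" for r
    by (simp add: tens_def prod.remove[of UNIV j] axis_def)
  have "((\<lambda>r. r + x $ j) has_vector_derivative 1) (at 0)"
    unfolding has_real_derivative_iff_has_vector_derivative[symmetric] by (auto intro!: derivative_eq_intros)
  from vector_diff_chain_at[OF this, of "G j" "g (x $ j)"]
  have "((\<lambda>r. G j (x $ j + r)) has_vector_derivative g (x $ j)) (at 0)"
    using assms by (simp add: o_def add.commute)
  then show "((\<lambda>r. tens G (x + r *\<^sub>R axis j 1)) has_vector_derivative tens (G(j := g)) x) (at 0)"
    unfolding 1 2 using has_vector_derivative_mult_left by blast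
qed

lemma tens_continuous:
  assumes "\<And>i. G i \<in> Gen" shows "continuous_on UNIV (tens G)"
  unfolding tens_def
  by (intro continuous_on_prod continuous_on_compose2[OF Gen_continuous[OF assms]] continuous_intros) auto

lemma smooth_tens:
  assumes "\<And>i. G i \<in> Gen" shows "smooth (tens G)"
proof -
  have "C_k k (tens G)" for k
    using assms
  proof (induction k arbitrary: G)
    case 0
    then show ?case by (simp add: tens_continuous)
  next
    case (Suc k)
    have "\<exists>H. has_pd (tens G) j (tens H) \<and> (\<forall>i. H i \<in> Gen)" for j
    proof -
      obtain g where g: "g \<in> Gen" "\<forall>x. (G j has_vector_derivative g x) (at x)"
        using Gen_deriv[OF Suc.prems] by blast
      show ?thesis
        by (rule exI[of _ "G(j := g)"]) (use g Suc.prems in \<open>auto intro!: tens_pd\<close>)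
    qed
    then obtain H where H: "\<And>j. has_pd (tens G) j (tens (H j))" "\<And>j i. H j i \<in> Gen" by metis
    have "C_k k (pdiff j (tens G))" for j
      using Suc.IH[of "H j"] H by (simp add: has_pd_pdiff[OF H(1)])
    moreover have "(\<lambda>r. tens G (x + r *\<^sub>R axis j 1)) differentiable (at 0)" for j x
      using H(1)[of j] unfolding has_pd_def differentiable_def has_vector_derivative_def by blast
    ultimately show ?case using tens_continuous[OF Suc.prems] by simp
  qed
  then show ?thesis by (simp add: smooth_def)
qed

text \<open>The two affine arguments are positive exactly for
\<open>1 / (n + 1) < r\<close> and \<open>r < 2 * pi - 1 / (n + 1)\<close>; for fixed \<open>r\<close> inside the interval both tend to infinity
because the square outgrows the linear term, so the product tends to one.\<close>

definition cutoff :: "nat \<Rightarrow> real \<Rightarrow> real" where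
  "cutoff n r = bmp 0 (- (real n + 1) + (real n + 1)\<^sup>2 * r)
     * bmp 0 (((real n + 1)\<^sup>2 * (2 * pi) - (real n + 1)) + (- (real n + 1)\<^sup>2) * r)"

text \<open>Test functions approximating a character.  They transfer identities that hold for all test
functions to Fourier coefficients.\<close>

definition cutchar :: "nat \<Rightarrow> freq \<Rightarrow> real^3 \<Rightarrow> complex" where
  "cutchar n k = tens (\<lambda>i r. of_real (cutoff n r) * exp ((\<i> * of_int (kc k i)) * of_real r))"

lemma cutchar_eq: "cutchar n k x = (\<Prod>i\<in>UNIV. of_real (cutoff n (x $ i))) * fchar k x"
proof -
  have "fchar k x = exp (\<Sum>i\<in>UNIV. \<i> * of_int (kc k i) * of_real (x $ i))"
    by (simp add: fchar_def cis_conv_exp sum_distrib_left mult_ac)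
  also have "\<dots> = (\<Prod>i\<in>UNIV. exp (\<i> * of_int (kc k i) * of_real (x $ i)))"
    by (simp add: exp_sum)
  finally show ?thesis by (simp add: cutchar_def tens_def prod.distrib)
qed

lemma smooth_cutchar: "smooth (cutchar n k)"
  unfolding cutchar_def cutoff_def of_real_mult
  by (intro smooth_tens Gen.intros)

lemma bmp_0_bounds: "0 \<le> bmp 0 y" "bmp 0 y \<le> 1"
  by (auto simp: bmp_def)

lemma cutoff_bounds: "0 \<le> cutoff n r" "cutoff n r \<le> 1"
  using bmp_0_bounds by (auto simp: cutoff_def intro!: mult_le_one)

lemma bmp_0_tendsto_1: "filterlim g at_top F \<Longrightarrow> ((\<lambda>n. bmp 0 (g n)) \<longlongrightarrow> 1) F"
proof -
  assume g: "filterlim g at_top F"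
  have "((\<lambda>n. exp (- inverse (g n))) \<longlongrightarrow> exp (- 0)) F"
    by (intro tendsto_intros filterlim_compose[OF tendsto_inverse_0_at_top[OF filterlim_ident] g])
  then have "((\<lambda>n. exp (- inverse (g n))) \<longlongrightarrow> 1) F" by simp
  then show ?thesis
  proof (rule Lim_transform_eventually)
    have "eventually (\<lambda>n. g n > 0) F"
      using g by (simp add: filterlim_at_top_dense)
    then show "eventually (\<lambda>n. exp (- inverse (g n)) = bmp 0 (g n)) F"
      by eventually_elim (simp add: bmp_def inverse_eq_divide)
  qed
qed

lemma quad_at_top: "d > 0 \<Longrightarrow> filterlim (\<lambda>n. (real n + 1)\<^sup>2 * d - (real n + 1)) at_top sequentially"
proof -
  assume d: "d > 0"
  have a: "filterlim (\<lambda>n. real n + 1) at_top sequentially"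
    by (rule filterlim_at_top_mono[OF filterlim_real_sequentially]) auto
  have "filterlim (\<lambda>n. (-1) + d * (real n + 1)) at_top sequentially"
    by (intro filterlim_tendsto_add_at_top[OF tendsto_const] filterlim_tendsto_pos_mult_at_top[OF tendsto_const d a])
  from filterlim_at_top_mult_at_top[OF a this] show ?thesis
    by (simp add: power2_eq_square algebra_simps)
qed

lemma cutoff_tendsto: "0 < r \<Longrightarrow> r < 2 * pi \<Longrightarrow> (\<lambda>n. cutoff n r) \<longlonglongrightarrow> 1"
proof -
  assume r: "0 < r" "r < 2 * pi"
  have "(\<lambda>n. bmp 0 ((real n + 1)\<^sup>2 * r - (real n + 1)) * bmp 0 ((real n + 1)\<^sup>2 * (2 * pi - r) - (real n + 1))) \<longlonglongrightarrow> 1 * 1"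
    by (intro tendsto_mult bmp_0_tendsto_1 quad_at_top) (use r in auto)
  then show ?thesis by (simp add: cutoff_def algebra_simps)
qed

lemma interior_Omega: "interior Omega = {x. \<forall>i. 0 < x $ i \<and> x $ i < 2 * pi}"
  by (auto simp: Omega_cbox interior_cbox mem_box_cart)

lemma cutchar_test: "cutchar n k \<in> test_functions"
proof -
  let ?d = "1 / (real n + 1)"
  let ?K = "cbox (\<chi> i. ?d) (\<chi> i. 2 * pi - ?d) :: (real^3) set"
  have "cutchar n k x = 0" if x: "x \<notin> ?K" for x
  proof -
    obtain i where i: "x $ i < ?d \<or> x $ i > 2 * pi - ?d"
      using x unfolding mem_box_cart vec_lambda_beta by (meson not_le)
    have "cutoff n (x $ i) = 0"
    proof (cases "x $ i < ?d")
      case True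
      then have "(real n + 1) * ((real n + 1) * x $ i) \<le> (real n + 1) * 1"
        by (intro mult_left_mono) (auto simp: field_simps)
      then show ?thesis by (simp add: cutoff_def bmp_def power2_eq_square algebra_simps)
    next
      case False
      with i have "2 * pi - x $ i < ?d" by simp
      then have "(real n + 1) * ((real n + 1) * (2 * pi - x $ i)) \<le> (real n + 1) * 1"
        by (intro mult_left_mono) (auto simp: field_simps)
      then have "((real n + 1)\<^sup>2 * (2 * pi) - (real n + 1)) + (- (real n + 1)\<^sup>2) * x $ i \<le> 0"
        by (simp add: power2_eq_square algebra_simps)
      then show ?thesis by (simp only: cutoff_def bmp_def) simp
    qed
    then have "(\<Prod>i\<in>UNIV. complex_of_real (cutoff n (x $ i))) = 0"
      by (auto simp: prod_zero_iff)
    then show ?thesis by (simp add: cutchar_eq)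
  qed
  moreover have "?K \<subseteq> interior Omega"
    unfolding interior_Omega
  proof clarify
    fix x i assume "x \<in> ?K"
    then have "?d \<le> x $ i" "x $ i \<le> 2 * pi - ?d" by (auto simp: mem_box_cart)
    moreover have "0 < ?d" by simp
    ultimately show "0 < x $ i \<and> x $ i < 2 * pi" by linarith
  qed
  ultimately show ?thesis
    unfolding test_functions_def using smooth_cutchar by (auto intro!: exI[of _ ?K])
qed

lemma cutchar_tendsto: "x \<in> interior Omega \<Longrightarrow> (\<lambda>n. cutchar n k x) \<longlonglongrightarrow> fchar k x"
proof -
  assume x: "x \<in> interior Omega"
  have "(\<lambda>n. (\<Prod>i\<in>UNIV. complex_of_real (cutoff n (x $ i))) * fchar k x) \<longlonglongrightarrow> (\<Prod>i\<in>(UNIV::3 set). of_real 1) * fchar k x"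
    by (intro tendsto_intros cutoff_tendsto) (use x in \<open>auto simp: interior_Omega\<close>)
  then show ?thesis by (simp add: cutchar_eq)
qed

lemma norm_cutchar: "cmod (cutchar n k x) \<le> 1"
  using cutoff_bounds by (auto simp: cutchar_eq norm_mult prod_norm[symmetric] intro!: prod_le_1)

lemma AE_interior_Omega: "AE x in lebesgue_on Omega. x \<in> interior Omega"
proof -
  have "negligible (Omega - interior Omega)"
    unfolding Omega_cbox by (simp add: interior_cbox negligible_frontier_interval)
  then have "Omega - interior Omega \<in> null_sets lebesgue"
    by (simp add: negligible_iff_null_sets)
  then show ?thesis
    by (subst AE_restrict_space_iff) (auto intro!: AE_I'[of "Omega - interior Omega"])
qed

section \<open>Square-integrable functions and their Fourier coefficients\<close>

lemma L2_integrable: "f \<in> L2 \<Longrightarrow> integrable (lebesgue_on Omega) f"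
proof -
  assume f: "f \<in> L2"
  interpret finite_measure "lebesgue_on Omega" by (rule finite_measure_Omega)
  have "integrable (lebesgue_on Omega) (\<lambda>x. cmod (f x))"
    by (rule square_integrable_imp_integrable) (use f in \<open>auto simp: L2_def\<close>)
  then show ?thesis using f by (auto simp: L2_def integrable_norm_iff)
qed

lemma continuous_L2: "continuous_on UNIV f \<Longrightarrow> f \<in> L2"
  by (auto simp: L2_def intro!: integrable_continuous_Omega continuous_intros
        borel_measurable_integrable)

lemma L2_lincomb:
  assumes "f \<in> L2" "g \<in> L2" shows "(\<lambda>x. a * f x + b * g x) \<in> L2"
proof -
  have [measurable]: "f \<in> borel_measurable (lebesgue_on Omega)" "g \<in> borel_measurable (lebesgue_on Omega)"
    using assms by (auto simp: L2_def)
  have "integrable (lebesgue_on Omega) (\<lambda>x. 2 * (cmod a)\<^sup>2 * (cmod (f x))\<^sup>2 + 2 * (cmod b)\<^sup>2 * (cmod (g x))\<^sup>2)"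
    using assms by (auto simp: L2_def)
  then have "integrable (lebesgue_on Omega) (\<lambda>x. (cmod (a * f x + b * g x))\<^sup>2)"
  proof (rule Bochner_Integration.integrable_bound, goal_cases)
    case 2
    have "(cmod (a * f x + b * g x))\<^sup>2 \<le> 2 * (cmod a)\<^sup>2 * (cmod (f x))\<^sup>2 + 2 * (cmod b)\<^sup>2 * (cmod (g x))\<^sup>2" for x
    proof -
      have "(cmod (a * f x + b * g x))\<^sup>2 \<le> (cmod (a * f x) + cmod (b * g x))\<^sup>2"
        by (intro power_mono norm_triangle_ineq) auto
      also have "\<dots> \<le> 2 * (cmod (a * f x))\<^sup>2 + 2 * (cmod (b * g x))\<^sup>2"
        using sum_squares_bound[of "cmod (a * f x)" "cmod (b * g x)"] by (simp add: power2_sum)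
      finally show ?thesis by (simp add: norm_mult power_mult_distrib)
    qed
    then show ?case by (intro AE_I2) (auto intro: order_trans)
  qed measurable
  then show ?thesis by (simp add: L2_def)
qed

lemma integrable_mult_bounded:
  fixes f :: "real^3 \<Rightarrow> complex"
  assumes "integrable (lebesgue_on Omega) f" "continuous_on UNIV g"
  shows "integrable (lebesgue_on Omega) (\<lambda>x. f x * g x)"
proof -
  have "compact Omega" by (simp add: Omega_cbox)
  then have "bounded (g ` Omega)"
    using assms(2) by (intro compact_imp_bounded compact_continuous_image) (auto intro: continuous_on_subset)
  then obtain B where B: "\<And>x. x \<in> Omega \<Longrightarrow> cmod (g x) \<le> B" by (auto simp: bounded_iff)
  have [measurable]: "g \<in> borel_measurable (lebesgue_on Omega)" "f \<in> borel_measurable (lebesgue_on Omega)"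
    using assms integrable_continuous_Omega by (auto intro!: borel_measurable_integrable)
  have "integrable (lebesgue_on Omega) (\<lambda>x. of_real B * f x)" using assms by simp
  then show ?thesis
  proof (rule Bochner_Integration.integrable_bound, goal_cases)
    case 2
    have "cmod (f x) * cmod (g x) \<le> \<bar>B\<bar> * cmod (f x)" if "x \<in> Omega" for x
      using mult_left_mono[OF order_trans[OF B[OF that] abs_ge_self], of "cmod (f x)"] by (simp add: mult.commute)
    then show ?case by (intro AE_I2) (auto simp: norm_mult)
  qed measurable
qed

lemma coef_lincomb:
  assumes "integrable (lebesgue_on Omega) f" "integrable (lebesgue_on Omega) g"
  shows "coef (\<lambda>x. a * f x + b * g x) k = a * coef f k + b * coef g k"
proof -
  have "(LINT x|lebesgue_on Omega. (a * f x + b * g x) * fchar (-k) x) =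
    (LINT x|lebesgue_on Omega. a * (f x * fchar (-k) x) + b * (g x * fchar (-k) x))"
    by (simp add: algebra_simps)
  also have "\<dots> = a * (LINT x|lebesgue_on Omega. f x * fchar (-k) x) + b * (LINT x|lebesgue_on Omega. g x * fchar (-k) x)"
    by (subst Bochner_Integration.integral_add)
      (auto intro!: integrable_mult_right integrable_mult_bounded[OF assms(1)] integrable_mult_bounded[OF assms(2)] continuous_intros)
  finally show ?thesis by (simp add: coef_def add_divide_distrib)
qed

lemma coef_diff:
  "f \<in> L2 \<Longrightarrow> g \<in> L2 \<Longrightarrow> coef (\<lambda>x. f x - g x) k = coef f k - coef g k"
  using coef_lincomb[OF L2_integrable L2_integrable, of f g 1 "-1" k] by simp

text \<open>Expanding the square of the distance to a Fourier partial sum; Bessel's inequality says that this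
square is nonnegative.\<close>

lemma bessel:
  assumes f: "f \<in> L2" and F: "finite F"
  shows "(\<Sum>k\<in>F. (cmod (coef f k))\<^sup>2) \<le> (LINT x|lebesgue_on Omega. (cmod (f x))\<^sup>2) / (2 * pi) ^ 3"
    (is "?S \<le> ?I / _")
    and bessel_identity: "(LINT x|lebesgue_on Omega. (cmod (f x - (\<Sum>k\<in>F. coef f k * fchar k x)))\<^sup>2)
      = (LINT x|lebesgue_on Omega. (cmod (f x))\<^sup>2) - (2 * pi) ^ 3 * (\<Sum>k\<in>F. (cmod (coef f k))\<^sup>2)"
proof -
  define S where "S x = (\<Sum>k\<in>F. coef f k * fchar k x)" for x
  have contS: "continuous_on UNIV S" unfolding S_def by (intro continuous_intros)
  have fi: "integrable (lebesgue_on Omega) f" using f by (rule L2_integrable)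
  have f2: "integrable (lebesgue_on Omega) (\<lambda>x. (cmod (f x))\<^sup>2)" using f by (simp add: L2_def)
  define V where "V = (2 * pi) ^ 3"
  have V: "V > 0" by (simp add: V_def)
  have co: "(LINT x|lebesgue_on Omega. g x * fchar (-k) x) = of_real V * coef g k" for g k
    using V by (simp add: coef_def V_def)
  have cS: "cnj (S x) = (\<Sum>k\<in>F. cnj (coef f k) * fchar (-k) x)" for x
    by (simp add: S_def)
  have fS: "(LINT x|lebesgue_on Omega. g x * cnj (S x)) = of_real V * (\<Sum>k\<in>F. cnj (coef f k) * coef g k)"
    if "integrable (lebesgue_on Omega) g" for g
  proof -
    have "(LINT x|lebesgue_on Omega. g x * cnj (S x)) = (LINT x|lebesgue_on Omega. (\<Sum>k\<in>F. cnj (coef f k) * (g x * fchar (-k) x)))"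
      by (simp add: cS sum_distrib_left mult_ac)
    also have "\<dots> = (\<Sum>k\<in>F. cnj (coef f k) * (LINT x|lebesgue_on Omega. g x * fchar (-k) x))"
      by (subst Bochner_Integration.integral_sum)
        (auto intro!: integrable_mult_right integrable_mult_bounded[OF that] continuous_intros simp del: split_paired_All)
    finally show ?thesis by (simp add: co sum_distrib_left mult_ac)
  qed
  have cfS: "coef S k = coef f k" if "k \<in> F" for k
  proof -
    have "(LINT x|lebesgue_on Omega. S x * fchar (-k) x) = (LINT x|lebesgue_on Omega. (\<Sum>l\<in>F. coef f l * (fchar l x * fchar (-k) x)))"
      by (simp add: S_def sum_distrib_right mult.assoc)
    also have "\<dots> = (\<Sum>l\<in>F. coef f l * (LINT x|lebesgue_on Omega. fchar l x * fchar (-k) x))"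
      by (subst Bochner_Integration.integral_sum)
        (auto intro!: integrable_continuous_Omega continuous_intros)
    also have "\<dots> = (\<Sum>l\<in>F. coef f l * (of_real V * (if k = l then 1 else 0)))"
      by (simp add: co coef_fchar)
    also have "\<dots> = of_real V * coef f k" using F that by (simp add: if_distrib cong: if_cong)
    finally show ?thesis using V by (simp add: coef_def V_def)
  qed
  have sq: "cnj (coef f k) * coef f k = of_real ((cmod (coef f k))\<^sup>2)" for k
    by (metis complex_norm_square mult.commute of_real_power)
  have 1: "(LINT x|lebesgue_on Omega. f x * cnj (S x)) = of_real (V * ?S)"
    by (simp add: fS[OF fi] sq)
  have 2: "(LINT x|lebesgue_on Omega. S x * cnj (S x)) = of_real (V * ?S)"
    by (simp add: fS[OF integrable_continuous_Omega[OF contS]] cfS sq)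
  have "complex_of_real ((cmod (f x - S x))\<^sup>2) = of_real ((cmod (f x))\<^sup>2) - f x * cnj (S x) - cnj (f x * cnj (S x)) + S x * cnj (S x)" for x
    by (simp only: complex_norm_square) (simp add: algebra_simps)
  then have "(LINT x|lebesgue_on Omega. complex_of_real ((cmod (f x - S x))\<^sup>2)) =
     (LINT x|lebesgue_on Omega. of_real ((cmod (f x))\<^sup>2) - f x * cnj (S x) - cnj (f x * cnj (S x)) + S x * cnj (S x))"
    by simp
  also have "\<dots> = (LINT x|lebesgue_on Omega. of_real ((cmod (f x))\<^sup>2)) - (LINT x|lebesgue_on Omega. f x * cnj (S x))
     - (LINT x|lebesgue_on Omega. cnj (f x * cnj (S x))) + (LINT x|lebesgue_on Omega. S x * cnj (S x))"
  proof -
    have i1: "integrable (lebesgue_on Omega) (\<lambda>x. complex_of_real ((cmod (f x))\<^sup>2))"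
      using f2 by (rule integrable_of_real)
    have i2: "integrable (lebesgue_on Omega) (\<lambda>x. f x * cnj (S x))"
      by (intro integrable_mult_bounded fi continuous_intros contS)
    have i3: "integrable (lebesgue_on Omega) (\<lambda>x. cnj (f x * cnj (S x)))"
      using i2 by (simp only: integrable_cnj)
    have i4: "integrable (lebesgue_on Omega) (\<lambda>x. S x * cnj (S x))"
      by (intro integrable_continuous_Omega continuous_intros contS)
    show ?thesis
      by (simp only: Bochner_Integration.integral_add Bochner_Integration.integral_diff i1 i2 i3 i4
          Bochner_Integration.integrable_diff)
  qed
  also have "\<dots> = of_real ((LINT x|lebesgue_on Omega. (cmod (f x))\<^sup>2) - V * ?S)"
  proof -
    have "(LINT x|lebesgue_on Omega. cnj (f x * cnj (S x))) = cnj (LINT x|lebesgue_on Omega. f x * cnj (S x))"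
      by (rule Bochner_Integration.integral_cnj)
    also have "\<dots> = of_real (V * ?S)" unfolding 1 by (rule complex_cnj_complex_of_real)
    finally show ?thesis by (simp only: 1 2 integral_complex_of_real) simp
  qed
  finally have main: "(LINT x|lebesgue_on Omega. (cmod (f x - S x))\<^sup>2) = (LINT x|lebesgue_on Omega. (cmod (f x))\<^sup>2) - V * ?S"
    by (simp only: integral_complex_of_real of_real_eq_iff)
  then show "(LINT x|lebesgue_on Omega. (cmod (f x - (\<Sum>k\<in>F. coef f k * fchar k x)))\<^sup>2)
      = ?I - (2 * pi) ^ 3 * (\<Sum>k\<in>F. (cmod (coef f k))\<^sup>2)"
    by (simp add: S_def V_def)
  have "0 \<le> (LINT x|lebesgue_on Omega. (cmod (f x - S x))\<^sup>2)" by simp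
  with main have "?S * V \<le> ?I" by (simp add: mult.commute)
  then show "?S \<le> ?I / (2 * pi) ^ 3"
    using V by (simp add: pos_le_divide_eq V_def)
qed

section \<open>Weak derivatives and Fourier coefficients\<close>

text \<open>Pure powers of one partial derivative, together with the function itself, control the weighted
square sums of Fourier coefficients.\<close>

definition sing :: "3 \<Rightarrow> nat \<Rightarrow> nat^3" where
  "sing i m = (\<chi> j. if j = i then m else 0)"

lemma mi_order_sing [simp]: "mi_order (sing i m) = m"
  by (simp add: mi_order_def sing_def)

lemma mdiff_sing: "mdiff (sing i m) f = (pdiff i ^^ m) f"
  using exhaust_3[of i] by (auto simp: mdiff_def sing_def)

lemma smooth_pd: "smooth f \<Longrightarrow> has_pd f i (pdiff i f)"
  unfolding smooth_def using C_k_Suc_has_pd[of 0 f i] by blast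

lemma smooth_pdiff: "smooth f \<Longrightarrow> smooth (pdiff i f)"
  unfolding smooth_def by (metis C_k.simps(2))

lemma smooth_continuous: "smooth f \<Longrightarrow> continuous_on UNIV f"
  unfolding smooth_def by (metis C_k.simps(1))

lemma periodic_pdiff: "periodic f \<Longrightarrow> periodic (pdiff i f)"
  unfolding periodic_def pdiff_def by (simp add: add.assoc add.commute[of "axis _ _"]) (simp add: add.assoc[symmetric])

lemma smooth_pdiff_pow: "smooth f \<Longrightarrow> smooth ((pdiff i ^^ m) f)"
  by (induction m) (auto intro: smooth_pdiff)

lemma periodic_pdiff_pow: "periodic f \<Longrightarrow> periodic ((pdiff i ^^ m) f)"
  by (induction m) (auto intro: periodic_pdiff)

lemma test_functions_pdiff: "\<psi> \<in> test_functions \<Longrightarrow> pdiff i \<psi> \<in> test_functions"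
proof -
  assume "\<psi> \<in> test_functions"
  then obtain K where s: "smooth \<psi>" and K: "compact K" "K \<subseteq> interior Omega" "\<And>x. x \<notin> K \<Longrightarrow> \<psi> x = 0"
    by (auto simp: test_functions_def)
  have "pdiff i \<psi> x = 0" if x: "x \<notin> K" for x
  proof -
    have "open ((\<lambda>r. x + r *\<^sub>R axis i 1) -` (- K))"
      using K(1) by (intro open_vimage continuous_intros open_Compl compact_imp_closed)
    moreover have "((\<lambda>r. 0) has_vector_derivative (0::complex)) (at 0)" by simp
    ultimately have "((\<lambda>r. \<psi> (x + r *\<^sub>R axis i 1)) has_vector_derivative 0) (at 0)"
      by (elim has_vector_derivative_transform_within_open[rotated 1]) (use x K in auto)
    then show ?thesis by (simp add: pdiff_def vector_derivative_at)
  qed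
  then show ?thesis using smooth_pdiff[OF s] K by (auto simp: test_functions_def)
qed

lemma integration_by_parts_test:
  assumes \<phi>: "smooth \<phi>" and \<psi>: "\<psi> \<in> test_functions"
  shows "(LINT x|lebesgue_on Omega. \<phi> x * pdiff i \<psi> x) = - (LINT x|lebesgue_on Omega. pdiff i \<phi> x * \<psi> x)"
proof -
  obtain K where s: "smooth \<psi>" and K: "compact K" "K \<subseteq> interior Omega" "\<And>x. x \<notin> K \<Longrightarrow> \<psi> x = 0"
    using \<psi> by (auto simp: test_functions_def)
  note cont = smooth_continuous[OF \<phi>] smooth_continuous[OF s]
    smooth_continuous[OF smooth_pdiff[OF \<phi>]] smooth_continuous[OF smooth_pdiff[OF s]]
  obtain d where d: "d > 0" "\<And>x. x \<in> K \<Longrightarrow> d \<le> x $ i"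
  proof (cases "K = {}")
    case True
    then show ?thesis using that[of 1] by simp
  next
    case False
    have "continuous_on K (\<lambda>x. x $ i)" by (intro continuous_intros)
    from continuous_attains_inf[OF K(1) False this] obtain z where "z \<in> K" "\<And>y. y \<in> K \<Longrightarrow> z $ i \<le> y $ i" by blast
    moreover have "z $ i > 0" using \<open>z \<in> K\<close> K(2) by (auto simp: interior_Omega)
    ultimately show ?thesis using that by blast
  qed
  have "(LINT x|lebesgue_on Omega. \<phi> x * pdiff i \<psi> x + pdiff i \<phi> x * \<psi> x) = 0"
  proof (rule integral_pd_eq_0[OF _ has_pd_mult[OF smooth_pd[OF \<phi>] smooth_pd[OF s]], where \<delta> = "d / 2"])
    fix x :: "real^3" assume x: "0 \<le> x $ i" "x $ i \<le> d / 2"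
    then have "\<not> d \<le> x $ i" using d by auto
    then have "x \<notin> K" using d(2) by blast
    moreover have "x + axis i (2 * pi) \<notin> interior Omega"
      using x unfolding interior_Omega by (auto simp: not_less intro!: exI[of _ i])
    then have "x + axis i (2 * pi) \<notin> K" using K(2) by blast
    ultimately show "\<phi> (x + axis i (2 * pi)) * \<psi> (x + axis i (2 * pi)) = \<phi> x * \<psi> x"
      using K(3) by simp
  qed (use d in \<open>auto intro!: continuous_intros cont\<close>)
  moreover have "(LINT x|lebesgue_on Omega. \<phi> x * pdiff i \<psi> x + pdiff i \<phi> x * \<psi> x) =
    (LINT x|lebesgue_on Omega. \<phi> x * pdiff i \<psi> x) + (LINT x|lebesgue_on Omega. pdiff i \<phi> x * \<psi> x)"
    by (intro Bochner_Integration.integral_add integrable_continuous_Omega continuous_intros cont)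
  ultimately show ?thesis by (simp add: eq_neg_iff_add_eq_0)
qed

lemma smooth_weak_deriv:
  assumes "smooth \<phi>" shows "is_weak_deriv (sing i m) \<phi> ((pdiff i ^^ m) \<phi>)"
proof -
  have "(LINT x|lebesgue_on Omega. \<phi> x * (pdiff i ^^ m) \<psi> x) = (-1) ^ m * (LINT x|lebesgue_on Omega. (pdiff i ^^ m) \<phi> x * \<psi> x)"
    if "\<psi> \<in> test_functions" for \<psi>
    using that assms
  proof (induction m arbitrary: \<psi> \<phi>)
    case (Suc m)
    have "(LINT x|lebesgue_on Omega. \<phi> x * (pdiff i ^^ Suc m) \<psi> x) = (-1) ^ m * (LINT x|lebesgue_on Omega. (pdiff i ^^ m) \<phi> x * pdiff i \<psi> x)"
      using Suc.IH[OF test_functions_pdiff[OF Suc.prems(1)] Suc.prems(2)] by (simp only: funpow_Suc_right o_def)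
    also have "\<dots> = (-1) ^ Suc m * (LINT x|lebesgue_on Omega. (pdiff i ^^ Suc m) \<phi> x * \<psi> x)"
      by (simp add: integration_by_parts_test[OF smooth_pdiff_pow[OF Suc.prems(2)] Suc.prems(1)])
    finally show ?case .
  qed simp
  then show ?thesis
    using assms by (auto simp: is_weak_deriv_def mdiff_sing intro!: continuous_L2 smooth_continuous smooth_pdiff_pow)
qed

text \<open>Characters are not test functions on the cube, but they are bounded limits of test functions, and dominated
convergence applies.\<close>

lemma coef_eqI_test:
  assumes "f \<in> L2" "g \<in> L2"
    and eq: "\<And>\<psi>. \<psi> \<in> test_functions \<Longrightarrow> (LINT x|lebesgue_on Omega. f x * \<psi> x) = (LINT x|lebesgue_on Omega. g x * \<psi> x)"
  shows "coef f k = coef g k"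
proof -
  have lim: "(\<lambda>n. LINT x|lebesgue_on Omega. f x * cutchar n (-k) x) \<longlonglongrightarrow> (LINT x|lebesgue_on Omega. f x * fchar (-k) x)"
    if "f \<in> L2" for f
  proof (rule integral_dominated_convergence)
    have [measurable]: "f \<in> borel_measurable (lebesgue_on Omega)" using that by (simp add: L2_def)
    have [measurable]: "fchar k \<in> borel_measurable (lebesgue_on Omega)" "cutchar n k \<in> borel_measurable (lebesgue_on Omega)" for k n
      by (auto intro!: borel_measurable_integrable integrable_continuous_Omega continuous_intros
         smooth_continuous smooth_cutchar)
    show "(\<lambda>x. f x * fchar (-k) x) \<in> borel_measurable (lebesgue_on Omega)"
      "(\<lambda>x. f x * cutchar n (-k) x) \<in> borel_measurable (lebesgue_on Omega)" for n by measurable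
    show "integrable (lebesgue_on Omega) (\<lambda>x. cmod (f x))" using L2_integrable[OF that] by simp
    show "AE x in lebesgue_on Omega. (\<lambda>n. f x * cutchar n (-k) x) \<longlonglongrightarrow> f x * fchar (-k) x"
      using AE_interior_Omega by eventually_elim (intro tendsto_intros cutchar_tendsto)
    show "AE x in lebesgue_on Omega. norm (f x * cutchar n (-k) x) \<le> cmod (f x)" for n
      by (intro AE_I2) (simp add: norm_mult mult_left_le norm_cutchar)
  qed
  have "(LINT x|lebesgue_on Omega. f x * fchar (-k) x) = (LINT x|lebesgue_on Omega. g x * fchar (-k) x)"
    using lim[OF assms(1)] lim[OF assms(2)] eq[OF cutchar_test] by (simp add: LIMSEQ_unique)
  then show ?thesis by (simp add: coef_def)
qed

lemma weak_deriv_coef_unique: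
  assumes "is_weak_deriv \<alpha> f g" "is_weak_deriv \<alpha> f g'" shows "coef g k = coef g' k"
  using assms by (intro coef_eqI_test) (auto simp: is_weak_deriv_def)

lemma weak_deriv_lincomb:
  assumes f: "is_weak_deriv (sing i m) f f'" and g: "is_weak_deriv (sing i m) g g'"
  shows "is_weak_deriv (sing i m) (\<lambda>x. a * f x + b * g x) (\<lambda>x. a * f' x + b * g' x)"
proof -
  have L: "f \<in> L2" "g \<in> L2" "f' \<in> L2" "g' \<in> L2" using f g by (auto simp: is_weak_deriv_def)
  have eq: "(LINT x|lebesgue_on Omega. (a * f x + b * g x) * h x) =
     a * (LINT x|lebesgue_on Omega. f x * h x) + b * (LINT x|lebesgue_on Omega. g x * h x)"
    if "f \<in> L2" "g \<in> L2" "continuous_on UNIV h" for f g h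
  proof -
    have "(LINT x|lebesgue_on Omega. (a * f x + b * g x) * h x) = (LINT x|lebesgue_on Omega. a * (f x * h x) + b * (g x * h x))"
      by (simp add: algebra_simps)
    then show ?thesis
      using that integrable_mult_right[OF integrable_mult_bounded[OF L2_integrable[OF that(1)] that(3)], of a]
        integrable_mult_right[OF integrable_mult_bounded[OF L2_integrable[OF that(2)] that(3)], of b] by simp
  qed
  show ?thesis
    unfolding is_weak_deriv_def
  proof (intro conjI ballI L2_lincomb L)
    fix \<psi> assume \<psi>: "\<psi> \<in> test_functions"
    then have "smooth \<psi>" by (simp add: test_functions_def)
    then have c: "continuous_on UNIV \<psi>" "continuous_on UNIV (mdiff (sing i m) \<psi>)"
      by (auto simp: mdiff_sing intro!: smooth_continuous smooth_pdiff_pow)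
    show "(LINT x|lebesgue_on Omega. (a * f x + b * g x) * mdiff (sing i m) \<psi> x) =
      (- 1) ^ mi_order (sing i m) * (LINT x|lebesgue_on Omega. (a * f' x + b * g' x) * \<psi> x)"
      using f g \<psi> unfolding eq[OF L(1,2) c(2)] eq[OF L(3,4) c(1)] by (simp add: is_weak_deriv_def algebra_simps)
  qed
qed

lemma weak_deriv_0: "f \<in> L2 \<Longrightarrow> is_weak_deriv (sing i 0) f f"
  by (auto simp: is_weak_deriv_def mdiff_sing)

lemma coef_pdiff_pow:
  assumes "smooth \<phi>" "periodic \<phi>"
  shows "coef ((pdiff i ^^ m) \<phi>) k = (\<i> * of_int (kc k i)) ^ m * coef \<phi> k"
proof (induction m)
  case (Suc m)
  have s: "smooth ((pdiff i ^^ m) \<phi>)" using assms by (simp add: smooth_pdiff_pow)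
  have "coef (pdiff i ((pdiff i ^^ m) \<phi>)) k = \<i> * of_int (kc k i) * coef ((pdiff i ^^ m) \<phi>) k"
    by (intro coef_pd smooth_continuous s periodic_pdiff_pow assms smooth_pd smooth_pdiff)
  then show ?case using Suc by simp
qed simp

text \<open>The derivatives of order \<open>m\<close> act on Fourier coefficients as they do for smooth periodic functions.  A function that
is merely weakly differentiable inside the cube may lack this property, since it need not match across opposite
faces.\<close>

definition fder :: "nat \<Rightarrow> (real^3 \<Rightarrow> complex) \<Rightarrow> bool" where
  "fder m f \<longleftrightarrow> f \<in> L2 \<and> (\<forall>i. \<exists>g. is_weak_deriv (sing i m) f g) \<and>
     (\<forall>i g k. is_weak_deriv (sing i m) f g \<longrightarrow> coef g k = (\<i> * of_int (kc k i)) ^ m * coef f k)"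

lemma fderI:
  assumes "f \<in> L2"
    and "\<And>i. \<exists>g. is_weak_deriv (sing i m) f g \<and> (\<forall>k. coef g k = (\<i> * of_int (kc k i)) ^ m * coef f k)"
  shows "fder m f"
  unfolding fder_def using assms weak_deriv_coef_unique by metis

lemma fder_lincomb:
  assumes "fder m f" "fder m g" shows "fder m (\<lambda>x. a * f x + b * g x)"
proof (rule fderI)
  show "(\<lambda>x. a * f x + b * g x) \<in> L2" using assms by (auto simp: fder_def intro!: L2_lincomb)
  fix i
  obtain f' g' where d: "is_weak_deriv (sing i m) f f'" "is_weak_deriv (sing i m) g g'"
    using assms by (metis fder_def)
  have L: "f \<in> L2" "g \<in> L2" "f' \<in> L2" "g' \<in> L2" using d by (auto simp: is_weak_deriv_def)
  show "\<exists>h. is_weak_deriv (sing i m) (\<lambda>x. a * f x + b * g x) h \<and>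
     (\<forall>k. coef h k = (\<i> * of_int (kc k i)) ^ m * coef (\<lambda>x. a * f x + b * g x) k)"
    by (rule exI, rule conjI[OF weak_deriv_lincomb[OF d, of a b]])
      (use d assms in \<open>auto simp: coef_lincomb[OF L(1,2)[THEN L2_integrable]] coef_lincomb[OF L(3,4)[THEN L2_integrable]]
         fder_def algebra_simps\<close>)
qed

lemma finite_mi_order: "finite {\<alpha>::nat^3. mi_order \<alpha> \<le> m}"
proof -
  have "{\<alpha>::nat^3. mi_order \<alpha> \<le> m} \<subseteq> (\<lambda>(a, b, c). vector [a, b, c]) ` ({..m} \<times> {..m} \<times> {..m})"
  proof clarify
    fix \<alpha> :: "nat^3" assume "mi_order \<alpha> \<le> m"
    then have "\<alpha> $ 1 \<le> m" "\<alpha> $ 2 \<le> m" "\<alpha> $ 3 \<le> m" by (auto simp: mi_order_def sum_3)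
    moreover have "\<alpha> = vector [\<alpha> $ 1, \<alpha> $ 2, \<alpha> $ 3]" by (simp add: vec_eq_iff forall_3)
    ultimately show "\<alpha> \<in> (\<lambda>(a, b, c). vector [a, b, c]) ` ({..m} \<times> {..m} \<times> {..m})"
      by (intro image_eqI[of _ _ "(\<alpha> $ 1, \<alpha> $ 2, \<alpha> $ 3)"]) auto
  qed
  then show ?thesis by (rule finite_subset) auto
qed

lemma slobodeckij_nonneg: "0 \<le> slobodeckij_quotient \<sigma> g p"
  by (auto simp: slobodeckij_quotient_def split: prod.split)

lemma wderiv_le_sobolev_norm:
  assumes "mi_order \<alpha> \<le> nat \<lfloor>s\<rfloor>"
  shows "(LINT x|lebesgue_on Omega. (cmod (wderiv \<alpha> f x))\<^sup>2) \<le> (sobolev_norm s f)\<^sup>2"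
proof -
  let ?A = "\<Sum>\<alpha> | mi_order \<alpha> \<le> nat \<lfloor>s\<rfloor>. LINT x|lebesgue_on Omega. (cmod (wderiv \<alpha> f x))\<^sup>2"
  let ?B = "if frac s = 0 then 0
      else (\<Sum>\<alpha> | mi_order \<alpha> = nat \<lfloor>s\<rfloor>.
              LINT p|(lebesgue_on Omega \<Otimes>\<^sub>M lebesgue_on Omega).
                slobodeckij_quotient (frac s) (wderiv \<alpha> f) p)"
  have "(LINT x|lebesgue_on Omega. (cmod (wderiv \<alpha> f x))\<^sup>2) \<le> ?A"
    by (rule member_le_sum[OF _ _ finite_mi_order]) (use assms in auto)
  moreover have B: "0 \<le> ?B" by (auto intro!: sum_nonneg Bochner_Integration.integral_nonneg slobodeckij_nonneg)
  moreover have "0 \<le> ?A" by (auto intro!: sum_nonneg)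
  ultimately show ?thesis unfolding sobolev_norm_def by simp
qed

lemma is_weak_deriv_wderiv: "is_weak_deriv \<alpha> f g \<Longrightarrow> is_weak_deriv \<alpha> f (wderiv \<alpha> f)"
  unfolding wderiv_def by (rule someI[of "is_weak_deriv \<alpha> f"])

lemma sobolev_norm_nonneg: "0 \<le> sobolev_norm s f"
  unfolding sobolev_norm_def
  by (auto intro!: sum_nonneg Bochner_Integration.integral_nonneg slobodeckij_nonneg add_nonneg_nonneg)

text \<open>Through the Sobolev norm, which is blind to the choice of the weak derivative, Fourier
coefficients of a weak derivative depend continuously on the function.\<close>

lemma coef_wderiv_bound:
  assumes "is_weak_deriv (sing i m) f g" "m \<le> nat \<lfloor>s\<rfloor>"
  shows "cmod (coef g k) \<le> sobolev_norm s f"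
proof -
  have w: "is_weak_deriv (sing i m) f (wderiv (sing i m) f)" by (rule is_weak_deriv_wderiv[OF assms(1)])
  then have L: "wderiv (sing i m) f \<in> L2" by (simp add: is_weak_deriv_def)
  have "(cmod (coef g k))\<^sup>2 = (\<Sum>k\<in>{k}. (cmod (coef (wderiv (sing i m) f) k))\<^sup>2)"
    using weak_deriv_coef_unique[OF assms(1) w] by simp
  also have "\<dots> \<le> (LINT x|lebesgue_on Omega. (cmod (wderiv (sing i m) f x))\<^sup>2) / (2 * pi) ^ 3"
    by (rule bessel[OF L]) simp
  also have "\<dots> \<le> (LINT x|lebesgue_on Omega. (cmod (wderiv (sing i m) f x))\<^sup>2) / 1"
    using pi_ge_two by (intro divide_left_mono one_le_power) auto
  also have "\<dots> \<le> (sobolev_norm s f)\<^sup>2"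
    using wderiv_le_sobolev_norm[of "sing i m" s f] assms by simp
  finally show ?thesis using sobolev_norm_nonneg power2_le_imp_le by blast
qed

text \<open>The multiplier identity holds for smooth periodic functions and survives limits in the Sobolev
norm, because both of its sides are continuous in that norm.  This is where the closure in the
definition of \<open>H_p\<close> enters.\<close>

lemma H_p_fder:
  assumes f: "f \<in> H_p s" and m: "m \<le> nat \<lfloor>s\<rfloor>"
  shows "fder m f"
proof -
  have S: "f \<in> Sobolev s" using f by (simp add: H_p_def)
  have "\<exists>g. is_weak_deriv (sing undefined 0) f g"
    using S by (simp add: Sobolev_def)
  then have fL: "f \<in> L2" by (auto simp: is_weak_deriv_def)
  show ?thesis
  proof (rule fderI[OF fL])
    fix i
    obtain g where g: "is_weak_deriv (sing i m) f g"
      proof -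
      have "\<forall>\<alpha>. mi_order \<alpha> \<le> nat \<lfloor>s\<rfloor> \<longrightarrow> (\<exists>g. is_weak_deriv \<alpha> f g)" using S by (simp add: Sobolev_def)
      from this[rule_format, of "sing i m"] m that show ?thesis by auto
    qed
    have gL: "g \<in> L2" using g by (simp add: is_weak_deriv_def)
    have "coef g k = (\<i> * of_int (kc k i)) ^ m * coef f k" for k
    proof -
      let ?q = "(\<i> * of_int (kc k i)) ^ m"
      have "cmod (coef g k - ?q * coef f k) \<le> e" if e: "e > 0" for e
      proof -
        define \<epsilon> where "\<epsilon> = e / (1 + cmod ?q)"
        have \<epsilon>: "\<epsilon> > 0" using e by (simp add: \<epsilon>_def add_pos_nonneg)
        obtain \<phi> where \<phi>: "smooth \<phi>" "periodic \<phi>" and n: "sobolev_norm s (\<lambda>x. f x - \<phi> x) < \<epsilon>"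
          using f \<epsilon> by (auto simp: H_p_def C_p_inf_def)
        have pL: "\<phi> \<in> L2" "(pdiff i ^^ m) \<phi> \<in> L2"
          by (auto intro!: continuous_L2 smooth_continuous smooth_pdiff_pow \<phi>)
        have "is_weak_deriv (sing i m) (\<lambda>x. f x - \<phi> x) (\<lambda>x. g x - (pdiff i ^^ m) \<phi> x)"
          using weak_deriv_lincomb[OF g smooth_weak_deriv[OF \<phi>(1)], of 1 "-1"] by simp
        from coef_wderiv_bound[OF this m, of k]
        have 1: "cmod (coef g k - ?q * coef \<phi> k) \<le> \<epsilon>"
          using n by (simp add: coef_diff gL pL coef_pdiff_pow \<phi>)
        have "is_weak_deriv (sing i 0) (\<lambda>x. f x - \<phi> x) (\<lambda>x. f x - \<phi> x)"
          using weak_deriv_0[of "\<lambda>x. 1 * f x + (-1) * \<phi> x" i] L2_lincomb[OF fL pL(1), of 1 "-1"] by simp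
        from coef_wderiv_bound[OF this, of s k]
        have 2: "cmod (coef f k - coef \<phi> k) \<le> \<epsilon>"
          using n by (simp add: coef_diff fL pL)
        have "coef g k - ?q * coef f k = (coef g k - ?q * coef \<phi> k) - ?q * (coef f k - coef \<phi> k)"
          by (simp add: algebra_simps)
        then have "cmod (coef g k - ?q * coef f k) \<le> cmod (coef g k - ?q * coef \<phi> k) + cmod ?q * cmod (coef f k - coef \<phi> k)"
          by (metis norm_triangle_ineq4 norm_mult)
        also have "\<dots> \<le> \<epsilon> + cmod ?q * \<epsilon>" by (intro add_mono 1 mult_left_mono 2) auto
        also have "\<dots> = (1 + cmod ?q) * \<epsilon>" by (simp add: algebra_simps)
        also have "\<dots> = e" unfolding \<epsilon>_def using norm_ge_zero[of ?q] by (simp del: norm_ge_zero)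
        finally show ?thesis .
      qed
      then have "cmod (coef g k - ?q * coef f k) \<le> 0" by (rule field_le_epsilon[of _ 0, simplified])
      then show ?thesis by simp
    qed
    then show "\<exists>g. is_weak_deriv (sing i m) f g \<and> (\<forall>k. coef g k = (\<i> * of_int (kc k i)) ^ m * coef f k)"
      using g by blast
  qed
qed

section \<open>Weights\<close>

text \<open>Comparable with the usual weight \<open>sqrt (1 + \<bar>k\<bar>\<^sup>2)\<close>, and chosen because its triangle and product
inequalities are immediate.\<close>

definition wt :: "freq \<Rightarrow> real" where
  "wt k = 1 + (\<Sum>i\<in>UNIV. \<bar>of_int (kc k i)\<bar>)"

lemma wt_ge_1: "1 \<le> wt k"
  by (simp add: wt_def sum_nonneg)

lemma wt_pos [simp]: "0 < wt k" "0 \<le> wt k" "wt k \<noteq> 0"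
  using wt_ge_1[of k] by linarith+

lemma wt_minus [simp]: "wt (- k) = wt k"
  by (simp add: wt_def)

lemma wt_add: "wt (k + l) \<le> wt k + wt l"
proof -
  have "\<bar>real_of_int (kc k i + kc l i)\<bar> \<le> \<bar>real_of_int (kc k i)\<bar> + \<bar>real_of_int (kc l i)\<bar>" for i
    by simp
  then have "(\<Sum>i\<in>UNIV. \<bar>real_of_int (kc k i + kc l i)\<bar>) \<le> (\<Sum>i\<in>UNIV. \<bar>real_of_int (kc k i)\<bar> + \<bar>real_of_int (kc l i)\<bar>)"
    by (intro sum_mono)
  then show ?thesis by (simp add: wt_def sum.distrib)
qed

lemma wt_triangle: "wt k \<le> wt l + wt (k - l)"
  using wt_add[of l "k - l"] by simp

lemma wt_add_mult: "wt (k + l) \<le> wt k * wt l"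
proof -
  define a b where "a = (\<Sum>i\<in>UNIV. \<bar>real_of_int (kc k i)\<bar>)" and "b = (\<Sum>i\<in>UNIV. \<bar>real_of_int (kc l i)\<bar>)"
  have "0 \<le> a" "0 \<le> b" by (auto simp: a_def b_def sum_nonneg)
  then have "0 \<le> a * b" by simp
  moreover have "wt (k + l) \<le> 1 + a + b"
  proof -
    have "(\<Sum>i\<in>UNIV. \<bar>real_of_int (kc k i + kc l i)\<bar>) \<le> (\<Sum>i\<in>UNIV. \<bar>real_of_int (kc k i)\<bar> + \<bar>real_of_int (kc l i)\<bar>)"
      by (intro sum_mono) (simp add: abs_triangle_ineq)
    then show ?thesis by (simp add: wt_def a_def b_def sum.distrib)
  qed
  ultimately show ?thesis by (simp add: wt_def a_def[symmetric] b_def[symmetric] algebra_simps)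
qed

lemma wt_pow_le:
  "wt k ^ n \<le> 4 ^ n * (1 + (\<Sum>i\<in>UNIV. \<bar>of_int (kc k i)\<bar> ^ n))"
proof -
  define M where "M = Max (insert 1 ((\<lambda>i. \<bar>real_of_int (kc k i)\<bar>) ` UNIV))"
  have le: "1 \<le> M" "\<bar>real_of_int (kc k i)\<bar> \<le> M" for i
    unfolding M_def by (rule Max_ge; simp)+
  have "wt k \<le> 1 + (\<Sum>i\<in>(UNIV::3 set). M)" unfolding wt_def by (intro add_mono sum_mono le) auto
  also have "\<dots> \<le> 4 * M" using le(1) by simp
  finally have "wt k ^ n \<le> (4 * M) ^ n" by (intro power_mono) auto
  also have "\<dots> = 4 ^ n * M ^ n" by (simp add: power_mult_distrib)
  also have "M ^ n \<le> 1 + (\<Sum>i\<in>UNIV. \<bar>of_int (kc k i)\<bar> ^ n)"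
  proof -
    have "M \<in> insert 1 ((\<lambda>i. \<bar>real_of_int (kc k i)\<bar>) ` UNIV)"
      unfolding M_def by (rule Max_in) auto
    then consider "M = 1" | i where "M = \<bar>real_of_int (kc k i)\<bar>" by auto
    then show ?thesis
    proof cases
      case 1 then show ?thesis by (simp add: sum_nonneg)
    next
      case 2
      have "\<bar>real_of_int (kc k i)\<bar> ^ n \<le> (\<Sum>i\<in>UNIV. \<bar>real_of_int (kc k i)\<bar> ^ n)"
        by (rule member_le_sum) auto
      then show ?thesis using 2 by simp
    qed
  qed
  finally show ?thesis by simp
qed

text \<open>Bessel's inequality for the function and for its pure derivatives of order \<open>m\<close>; the weight
\<open>wt k ^ m\<close> is controlled by one and the powers \<open>\<bar>kc k i\<bar> ^ m\<close>.\<close>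

lemma fder_sobolev_bound:
  assumes f: "fder m f" and m: "m \<le> nat \<lfloor>s\<rfloor>" and F: "finite F"
  shows "(\<Sum>k\<in>F. (wt k ^ m * cmod (coef f k))\<^sup>2) \<le> (4 ^ m * 2 * sobolev_norm s f)\<^sup>2"
proof -
  have bd: "(\<Sum>k\<in>F. (cmod (coef g k))\<^sup>2) \<le> (sobolev_norm s f)\<^sup>2" if g: "is_weak_deriv (sing i n) f g" and n: "n \<le> m" for g i n
  proof -
    have w: "is_weak_deriv (sing i n) f (wderiv (sing i n) f)" by (rule is_weak_deriv_wderiv[OF g])
    then have L: "wderiv (sing i n) f \<in> L2" by (simp add: is_weak_deriv_def)
    have "(\<Sum>k\<in>F. (cmod (coef g k))\<^sup>2) = (\<Sum>k\<in>F. (cmod (coef (wderiv (sing i n) f) k))\<^sup>2)"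
      using weak_deriv_coef_unique[OF g w] by simp
    also have "\<dots> \<le> (LINT x|lebesgue_on Omega. (cmod (wderiv (sing i n) f x))\<^sup>2) / (2 * pi) ^ 3"
      by (rule bessel[OF L F])
    also have "\<dots> \<le> (LINT x|lebesgue_on Omega. (cmod (wderiv (sing i n) f x))\<^sup>2) / 1"
      using pi_ge_two by (intro divide_left_mono one_le_power) auto
    also have "\<dots> \<le> (sobolev_norm s f)\<^sup>2"
      using wderiv_le_sobolev_norm[of "sing i n" s f] n m by simp
    finally show ?thesis .
  qed
  have b0: "(\<Sum>k\<in>F. (cmod (coef f k))\<^sup>2) \<le> (sobolev_norm s f)\<^sup>2"
    by (rule bd[OF weak_deriv_0[of f undefined]]) (use f in \<open>auto simp: fder_def\<close>)
  have bi: "(\<Sum>k\<in>F. (\<bar>of_int (kc k i)\<bar> ^ m * cmod (coef f k))\<^sup>2) \<le> (sobolev_norm s f)\<^sup>2" for i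
  proof -
    obtain g where g: "is_weak_deriv (sing i m) f g" using f by (metis fder_def)
    then have "coef g k = (\<i> * of_int (kc k i)) ^ m * coef f k" for k using f by (metis fder_def)
    then show ?thesis using bd[OF g] by (simp add: norm_mult norm_power)
  qed
  have "(\<Sum>k\<in>F. (wt k ^ m * cmod (coef f k))\<^sup>2) \<le> (\<Sum>k\<in>F. (4 ^ m)\<^sup>2 * ((cmod (coef f k))\<^sup>2 + (\<Sum>i\<in>UNIV. (\<bar>of_int (kc k i)\<bar> ^ m * cmod (coef f k))\<^sup>2)))"
  proof (rule sum_mono)
    fix k
    have "(wt k ^ m)\<^sup>2 = wt k ^ (m * 2)" by (simp add: power_mult)
    also have "\<dots> \<le> 4 ^ (m * 2) * (1 + (\<Sum>i\<in>UNIV. \<bar>of_int (kc k i)\<bar> ^ (m * 2)))" by (rule wt_pow_le)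
    finally have "(wt k ^ m)\<^sup>2 \<le> (4 ^ m)\<^sup>2 * (1 + (\<Sum>i\<in>UNIV. (\<bar>of_int (kc k i)\<bar> ^ m)\<^sup>2))"
      by (simp add: power_mult)
    then have "(wt k ^ m)\<^sup>2 * (cmod (coef f k))\<^sup>2 \<le> (4 ^ m)\<^sup>2 * (1 + (\<Sum>i\<in>UNIV. (\<bar>of_int (kc k i)\<bar> ^ m)\<^sup>2)) * (cmod (coef f k))\<^sup>2"
      by (rule mult_right_mono) auto
    then show "(wt k ^ m * cmod (coef f k))\<^sup>2 \<le> (4 ^ m)\<^sup>2 * ((cmod (coef f k))\<^sup>2 + (\<Sum>i\<in>UNIV. (\<bar>of_int (kc k i)\<bar> ^ m * cmod (coef f k))\<^sup>2))"
      by (simp add: power_mult_distrib sum_3 algebra_simps)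
  qed
  also have "\<dots> = (4 ^ m)\<^sup>2 * ((\<Sum>k\<in>F. (cmod (coef f k))\<^sup>2) + (\<Sum>i\<in>UNIV. \<Sum>k\<in>F. (\<bar>of_int (kc k i)\<bar> ^ m * cmod (coef f k))\<^sup>2))"
    by (simp add: sum_distrib_left sum.distrib sum_3 distrib_left)
  also have "\<dots> \<le> (4 ^ m)\<^sup>2 * ((sobolev_norm s f)\<^sup>2 + (\<Sum>i\<in>(UNIV::3 set). (sobolev_norm s f)\<^sup>2))"
    by (intro mult_left_mono add_mono sum_mono b0 bi) auto
  also have "\<dots> = (4 ^ m * 2 * sobolev_norm s f)\<^sup>2" by (simp add: power_mult_distrib)
  finally show ?thesis .
qed

section \<open>Summability of the weights\<close>

lemma summable_int_powr:
  assumes q: "q > 1"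
  shows "(\<lambda>n::int. (1 + \<bar>of_int n\<bar>) powr (- q) :: real) summable_on UNIV"
proof -
  have "summable (\<lambda>n. real n powr (- q))" using q by (simp add: summable_real_powr_iff)
  then have "summable (\<lambda>n. real (Suc n) powr (- q))" by (subst summable_Suc_iff)
  then have nat: "(\<lambda>n::nat. (1 + real n) powr (- q)) summable_on UNIV"
    by (intro norm_summable_imp_summable_on) (simp add: add.commute)
  let ?f = "\<lambda>n::int. (1 + \<bar>of_int n\<bar>) powr (- q) :: real"
  have 1: "?f summable_on range int"
    using nat by (subst summable_on_reindex) (auto simp: o_def)
  have 2: "?f summable_on range (\<lambda>n. - int n)"
    using nat by (subst summable_on_reindex) (auto simp: o_def inj_on_def)
  have "?f summable_on (range int \<union> range (\<lambda>n. - int n))"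
    using 1 2 by (rule summable_on_union)
  also have "range int \<union> range (\<lambda>n. - int n) = UNIV"
    using int_cases2 by (metis (no_types, lifting) UNIV_eq_I Un_iff rangeI)
  finally show ?thesis .
qed

text \<open>The weight dominates each of the three one-dimensional weights, so its negative powers are bounded by products of
three one-dimensional summable sequences.\<close>

lemma summable_wt_powr:
  assumes p: "p > 3"
  shows "(\<lambda>k. wt k powr (- p)) summable_on UNIV"
proof -
  define h where "h n = (1 + \<bar>of_int n\<bar>) powr (- (p / 3)) " for n :: int
  have h: "h summable_on UNIV" unfolding h_def by (rule summable_int_powr) (use p in auto)
  have h0: "0 \<le> h n" for n by (simp add: h_def)
  define B where "B = infsum h UNIV"
  have hB: "sum h A \<le> B" if "finite A" for A
    unfolding B_def by (rule finite_sum_le_infsum[OF h that]) (auto simp: h0)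
  have B0: "0 \<le> B" using hB[of "{}"] by simp
  have le: "wt k powr (- p) \<le> h (fst k) * (h (fst (snd k)) * h (snd (snd k)))" for k
  proof -
    define a b c where "a = 1 + \<bar>real_of_int (fst k)\<bar>" and "b = 1 + \<bar>real_of_int (fst (snd k))\<bar>" and "c = 1 + \<bar>real_of_int (snd (snd k))\<bar>"
    have abc: "a \<ge> 1" "b \<ge> 1" "c \<ge> 1" by (auto simp: a_def b_def c_def)
    have w: "wt k = a + b + c - 2" by (simp add: wt_def sum_3 kc_def a_def b_def c_def)
    have "a * b * c \<le> wt k * wt k * wt k"
      by (intro mult_mono) (use abc w in auto)
    also have "\<dots> = wt k powr 3" by (simp add: powr_numeral power3_eq_cube)
    finally have "(a * b * c) powr (p / 3) \<le> (wt k powr 3) powr (p / 3)"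
      using p abc by (intro powr_mono2) auto
    also have "\<dots> = wt k powr p" by (subst powr_powr) simp
    finally have "wt k powr (- p) \<le> (a * b * c) powr (- (p / 3))"
      unfolding powr_minus using abc by (intro le_imp_inverse_le) auto
    also have "\<dots> = h (fst k) * (h (fst (snd k)) * h (snd (snd k)))"
      using abc by (simp add: h_def a_def b_def c_def powr_mult mult_ac)
    finally show ?thesis .
  qed
  show ?thesis
  proof (rule nonneg_bounded_partial_sums_imp_summable_on)
    show "\<forall>\<^sub>F F in finite_subsets_at_top UNIV. (\<Sum>k\<in>F. wt k powr (- p)) \<le> B * (B * B)"
    proof (rule eventually_finite_subsets_at_top_weakI)
      fix F :: "freq set" assume F: "finite F"
      let ?X = "fst ` F" and ?Y = "fst ` snd ` F" and ?Z = "snd ` snd ` F"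
      have sub: "F \<subseteq> ?X \<times> ?Y \<times> ?Z" by force
      have "(\<Sum>k\<in>F. wt k powr (- p)) \<le> (\<Sum>k\<in>F. h (fst k) * (h (fst (snd k)) * h (snd (snd k))))"
        by (intro sum_mono le)
      also have "\<dots> \<le> (\<Sum>k\<in>?X \<times> ?Y \<times> ?Z. h (fst k) * (h (fst (snd k)) * h (snd (snd k))))"
        by (rule sum_mono2[OF _ sub]) (use F h0 in auto)
      also have "\<dots> = (\<Sum>x\<in>?X. \<Sum>yz\<in>?Y \<times> ?Z. h x * (h (fst yz) * h (snd yz)))"
        by (simp add: sum.cartesian_product case_prod_unfold)
      also have "\<dots> = sum h ?X * (sum h ?Y * sum h ?Z)"
        by (simp add: sum_product sum.cartesian_product case_prod_unfold)
      also have "\<dots> \<le> B * (B * B)"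
        using F by (intro mult_mono hB sum_nonneg h0 mult_nonneg_nonneg B0) auto
      finally show "(\<Sum>k\<in>F. wt k powr (- p)) \<le> B * (B * B)" .
    qed
  qed auto
qed

text \<open>The exponent \<open>7/2\<close> lies strictly between \<open>3\<close>, where summability in three dimensions begins, and \<open>4\<close>.
The gap to \<open>4\<close> leaves room for interpolation.\<close>

definition S\<^sub>w :: real where "S\<^sub>w = infsum (\<lambda>k. wt k powr (- (7/2))) UNIV"

lemma sum_wt_powr_le: "finite F \<Longrightarrow> (\<Sum>k\<in>F. wt k powr (- (7/2))) \<le> S\<^sub>w"
  unfolding S\<^sub>w_def by (rule finite_sum_le_infsum) (auto intro: summable_wt_powr)

lemma S\<^sub>w_nonneg: "0 \<le> S\<^sub>w"
  using sum_wt_powr_le[of "{}"] by simp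

lemma wt_pow_le_powr: "n \<ge> 4 \<Longrightarrow> 1 / wt k ^ n \<le> wt k powr (- (7/2))"
proof -
  assume n: "n \<ge> 4"
  have "wt k powr (7/2) \<le> wt k powr real n" using wt_ge_1[of k] n by (intro powr_mono) auto
  then have "wt k powr (7/2) \<le> wt k ^ n" by (simp add: powr_realpow)
  then show ?thesis unfolding powr_minus inverse_eq_divide by (intro divide_left_mono) auto
qed

lemma sum_wt_pow_le: "finite F \<Longrightarrow> n \<ge> 4 \<Longrightarrow> (\<Sum>k\<in>F. 1 / wt k ^ n) \<le> S\<^sub>w"
  by (rule order_trans[OF sum_mono[OF wt_pow_le_powr] sum_wt_powr_le])

section \<open>Completeness of the characters\<close>

definition unitf :: "3 \<Rightarrow> freq" where
  "unitf i = (if i = 1 then 1 else 0, if i = 2 then 1 else 0, if i = 3 then 1 else 0)"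

lemma kc_unitf: "kc (unitf i) j = (if j = i then 1 else 0)"
  using exhaust_3[of i] exhaust_3[of j] by (auto simp: kc_def unitf_def)

lemma fchar_unitf: "fchar (unitf i) x = cis (x $ i)"
proof -
  have "(\<Sum>j\<in>UNIV. of_int (kc (unitf i) j) * x $ j) = (\<Sum>j\<in>UNIV. if j = i then x $ j else 0)"
    by (rule sum.cong) (auto simp: kc_unitf)
  then show ?thesis by (simp add: fchar_def)
qed

lemma cos_le_far:
  assumes "\<delta> \<le> \<bar>t\<bar>" "\<bar>t\<bar> \<le> 2 * pi - \<delta>" "0 \<le> \<delta>"
  shows "cos t \<le> cos \<delta>"
proof (cases "\<bar>t\<bar> \<le> pi")
  case True
  then have "cos \<bar>t\<bar> \<le> cos \<delta>" using assms by (intro cos_monotone_0_pi_le) auto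
  then show ?thesis by simp
next
  case False
  have "cos (2 * pi - \<bar>t\<bar>) \<le> cos \<delta>" using assms False by (intro cos_monotone_0_pi_le) auto
  then show ?thesis by (simp add: cos_diff)
qed

text \<open>The trigonometric polynomials \<open>K n\<close>, powers of products of \<open>(1 + cos (x $ i - y $ i)) / 2\<close>, concentrate at
\<open>y\<close>.  If all coefficients of \<open>g\<close> vanish, then \<open>g\<close> is orthogonal to them.  Their mass near
\<open>y\<close> is at least a multiple of \<open>(r ^ 3) ^ n\<close>, whereas away from \<open>y\<close> they are at most \<open>q ^ n\<close> with
\<open>q < r ^ 3\<close>, which is incompatible with orthogonality if \<open>g y \<noteq> 0\<close>.\<close>

lemma zero_if_coefs_zero:
  assumes g: "continuous_on UNIV g" and z: "\<And>k. coef g k = 0" and y: "y \<in> interior Omega"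
  shows "g y = 0"
proof (rule ccontr)
  assume gy: "g y \<noteq> 0"
  define a where "a = cmod (g y) / 2"
  have a: "a > 0" using gy by (simp add: a_def)
  define c where "c i x = (1 + cos (x $ i - y $ i)) / 2" for i and x :: "real^3"
  have c01: "0 \<le> c i x" "c i x \<le> 1" for i x
    using cos_ge_minus_one[of "x $ i - y $ i"] by (auto simp: c_def simp del: cos_ge_minus_one)
  have contc: "continuous_on UNIV (c i)" for i unfolding c_def by (intro continuous_intros) auto
  \<comment> \<open>Closed under multiplication by the trigonometric factors, because they only shift the frequency.\<close>
  define Q where "Q P \<longleftrightarrow> continuous_on UNIV P \<and> (\<forall>k. (LINT x|lebesgue_on Omega. g x * P x * fchar k x) = 0)" for P
  have Q1: "Q (\<lambda>x. 1)"
    unfolding Q_def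
  proof (intro conjI allI continuous_on_const)
    fix k
    have "coef g (- k) = 0" by (rule z)
    then show "(LINT x|lebesgue_on Omega. g x * 1 * fchar k x) = 0" by (simp add: coef_def)
  qed
  have Qc: "Q (\<lambda>x. P x * of_real (c i x))" if P: "Q P" for P i
    unfolding Q_def
  proof (intro conjI allI)
    have Pc: "continuous_on UNIV P" using P by (simp add: Q_def)
    show "continuous_on UNIV (\<lambda>x. P x * of_real (c i x))" by (intro continuous_intros Pc contc)
    fix k
    have eq: "of_real (c i x) = 1/2 + (cis (- y $ i) / 4) * fchar (unitf i) x + (cis (y $ i) / 4) * fchar (- unitf i) x" for x
      by (simp add: complex_eq_iff c_def fchar_minus fchar_unitf cos_diff field_simps)
    have "(LINT x|lebesgue_on Omega. g x * (P x * of_real (c i x)) * fchar k x) =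
      (LINT x|lebesgue_on Omega. 1/2 * (g x * P x * fchar k x) + (cis (- y $ i) / 4) * (g x * P x * fchar (unitf i + k) x)
         + (cis (y $ i) / 4) * (g x * P x * fchar (- unitf i + k) x))"
      by (simp only: fchar_add eq) (simp add: algebra_simps)
    also have "\<dots> = 1/2 * (LINT x|lebesgue_on Omega. g x * P x * fchar k x) + (cis (- y $ i) / 4) * (LINT x|lebesgue_on Omega. g x * P x * fchar (unitf i + k) x)
         + (cis (y $ i) / 4) * (LINT x|lebesgue_on Omega. g x * P x * fchar (- unitf i + k) x)"
      by (subst Bochner_Integration.integral_add, (intro integrable_continuous_Omega continuous_intros g Pc)+)+
        (simp only: integral_mult_right_zero)
    also have "\<dots> = 0"
    proof -
      have "\<And>k. (LINT x|lebesgue_on Omega. g x * P x * fchar k x) = 0" using P unfolding Q_def by blast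
      then show ?thesis by (simp only:) simp
    qed
    finally show "(LINT x|lebesgue_on Omega. g x * (P x * of_real (c i x)) * fchar k x) = 0" .
  qed
  have Qcn: "Q (\<lambda>x. P x * of_real (c i x ^ n))" if P: "Q P" for P i n
  proof (induction n)
    case (Suc n)
    from Qc[OF this, of i] show ?case by (simp add: mult_ac)
  qed (use P in simp)
  define K where "K n x = c 1 x ^ n * c 2 x ^ n * c 3 x ^ n" for n x
  have contK: "continuous_on UNIV (K n)" for n unfolding K_def by (intro continuous_intros contc)
  have "Q (\<lambda>x. 1 * of_real (c 1 x ^ n) * of_real (c 2 x ^ n) * of_real (c 3 x ^ n))" for n
    by (intro Qcn Q1)
  then have "Q (\<lambda>x. of_real (K n x))" for n by (simp add: K_def)
  then have "(LINT x|lebesgue_on Omega. g x * of_real (K n x) * fchar 0 x) = 0" for n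
    unfolding Q_def by blast
  then have gK: "(LINT x|lebesgue_on Omega. g x * of_real (K n x)) = 0" for n by simp
  have K0: "0 \<le> K n x" for n x using c01 by (simp add: K_def)
  \<comment> \<open>The cube of half-width \<open>\<delta>\<close> about \<open>y\<close>, on which \<open>g\<close> varies by at most half of its value at \<open>y\<close>,
    lies inside \<open>Omega\<close>; outside of it some factor is at most \<open>q\<close> because the distance to
    \<open>y\<close> modulo \<open>2 * pi\<close> is at least \<open>\<delta>\<close>.\<close>
  have yi: "0 < y $ i" "y $ i < 2 * pi" for i using y by (auto simp: interior_Omega)
  have "isCont g y" using g by (simp add: continuous_on_eq_continuous_at)
  then obtain e where e: "e > 0" "\<And>x. dist x y < e \<Longrightarrow> dist (g x) (g y) < a"
    using a unfolding continuous_at_eps_delta by blast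
  define \<delta> where "\<delta> = Min (insert (e / 4) (insert (pi / 2) (range (\<lambda>i. min (y $ i) (2 * pi - y $ i)))))"
  have \<delta>: "\<delta> > 0" unfolding \<delta>_def using e(1) yi by (subst Min_gr_iff) auto
  have \<delta>le: "\<delta> \<le> e / 4" "\<delta> \<le> pi / 2" unfolding \<delta>_def by (auto intro!: Min_le)
  have \<delta>y: "\<delta> \<le> y $ i" "\<delta> \<le> 2 * pi - y $ i" for i
  proof -
    have "\<delta> \<le> min (y $ i) (2 * pi - y $ i)" unfolding \<delta>_def by (rule Min_le) auto
    then show "\<delta> \<le> y $ i" "\<delta> \<le> 2 * pi - y $ i" by auto
  qed
  have near: "cmod (g y - g x) \<le> a" if "\<And>i. \<bar>x $ i - y $ i\<bar> < \<delta>" for x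
  proof -
    have "dist x y \<le> (\<Sum>i\<in>UNIV. \<bar>(x - y) $ i\<bar>)" unfolding dist_norm by (rule norm_le_l1_cart)
    also have "\<dots> \<le> (\<Sum>i\<in>(UNIV::3 set). \<delta>)" by (rule sum_mono) (use that in \<open>auto intro: less_imp_le\<close>)
    also have "\<dots> = 3 * \<delta>" by simp
    also have "\<dots> < e" using \<delta>le e by linarith
    finally have "dist (g x) (g y) < a" by (rule e(2))
    then show ?thesis by (simp add: dist_norm norm_minus_commute)
  qed
  define q where "q = (1 + cos \<delta>) / 2"
  have q0: "0 \<le> q" unfolding q_def using cos_ge_minus_one[of \<delta>] by (auto simp del: cos_ge_minus_one)
  have "cos \<delta> < cos 0" using \<delta> \<delta>le by (intro cos_monotone_0_pi) auto
  then have q1: "q < 1" by (simp add: q_def)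
  have "compact Omega" by (simp add: Omega_cbox)
  then have "bounded (g ` Omega)"
    using g by (intro compact_imp_bounded compact_continuous_image) (auto intro: continuous_on_subset)
  then obtain M where M: "\<And>x. x \<in> Omega \<Longrightarrow> cmod (g x) \<le> M" by (auto simp: bounded_iff)
  have yO: "y \<in> Omega" using y interior_subset by blast
  have M0: "0 \<le> M" using M[OF yO] norm_ge_zero order_trans by blast
  have ptw: "cmod (g y - g x) * K n x \<le> a * K n x + 2 * M * q ^ n" if x: "x \<in> Omega" for x n
  proof (cases "\<forall>i. \<bar>x $ i - y $ i\<bar> < \<delta>")
    case True
    then have "cmod (g y - g x) * K n x \<le> a * K n x" by (intro mult_right_mono near K0) auto
    then show ?thesis using M0 q0 by (simp add: add_increasing2)
  next
    case False
    then obtain i where i: "\<delta> \<le> \<bar>x $ i - y $ i\<bar>" by (auto simp: not_less)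
    have "\<bar>x $ i - y $ i\<bar> \<le> 2 * pi - \<delta>"
    proof -
      have "0 \<le> x $ i" "x $ i \<le> 2 * pi" using x by (auto simp: Omega_def)
      then show ?thesis using \<delta>y[of i] unfolding abs_le_iff by linarith
    qed
    then have "c i x \<le> q" unfolding c_def q_def using cos_le_far[OF i] \<delta> by simp
    then have ci: "c i x ^ n \<le> q ^ n" by (intro power_mono c01)
    have one: "c j x ^ n \<le> 1" for j by (intro power_le_one c01)
    have nn: "0 \<le> c j x ^ n" for j using c01 by simp
    have "K n x \<le> q ^ n"
    proof -
      consider "i = 1" | "i = 2" | "i = 3" using exhaust_3 by blast
      then show ?thesis
      proof cases
        case 1
        have "K n x = c 1 x ^ n * (c 2 x ^ n * c 3 x ^ n)" by (simp add: K_def)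
        also have "\<dots> \<le> q ^ n * (1 * 1)" using ci 1 q0 by (intro mult_mono one nn mult_nonneg_nonneg) auto
        finally show ?thesis by simp
      next
        case 2
        have "K n x = c 2 x ^ n * (c 1 x ^ n * c 3 x ^ n)" by (simp add: K_def)
        also have "\<dots> \<le> q ^ n * (1 * 1)" using ci 2 q0 by (intro mult_mono one nn mult_nonneg_nonneg) auto
        finally show ?thesis by simp
      next
        case 3
        have "K n x = c 3 x ^ n * (c 1 x ^ n * c 2 x ^ n)" by (simp add: K_def)
        also have "\<dots> \<le> q ^ n * (1 * 1)" using ci 3 q0 by (intro mult_mono one nn mult_nonneg_nonneg) auto
        finally show ?thesis by simp
      qed
    qed
    moreover have "cmod (g y - g x) \<le> 2 * M"
      using norm_triangle_ineq4[of "g y" "g x"] M[OF x] M[OF yO] by linarith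
    ultimately have "cmod (g y - g x) * K n x \<le> (2 * M) * q ^ n"
      using M0 by (intro mult_mono K0) auto
    then show ?thesis using K0 a by (simp add: add_increasing)
  qed
  define I where "I n = (LINT x|lebesgue_on Omega. K n x)" for n
  have up: "a * I n \<le> 2 * M * (2 * pi) ^ 3 * q ^ n" for n
  proof -
    have "g y * of_real (I n) = (LINT x|lebesgue_on Omega. g y * of_real (K n x))"
      by (simp only: integral_mult_right_zero I_def integral_complex_of_real)
    also have "\<dots> = (LINT x|lebesgue_on Omega. g y * of_real (K n x)) - (LINT x|lebesgue_on Omega. g x * of_real (K n x))"
      by (simp add: gK)
    also have "\<dots> = (LINT x|lebesgue_on Omega. g y * of_real (K n x) - g x * of_real (K n x))"
      by (rule Bochner_Integration.integral_diff[symmetric]; intro integrable_continuous_Omega continuous_intros g contK)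
    finally have "cmod (g y) * I n = cmod (LINT x|lebesgue_on Omega. g y * of_real (K n x) - g x * of_real (K n x))"
      using K0 by (metis I_def Bochner_Integration.integral_nonneg abs_of_nonneg norm_mult norm_of_real)
    also have "\<dots> \<le> (LINT x|lebesgue_on Omega. a * K n x + 2 * M * q ^ n)"
    proof (rule Bochner_Integration.integral_norm_bound_integral)
      fix x assume "x \<in> space (lebesgue_on Omega)"
      then have "x \<in> Omega" by simp
      from ptw[OF this, of n] show "cmod (g y * of_real (K n x) - g x * of_real (K n x)) \<le> a * K n x + 2 * M * q ^ n"
        using K0[of n x] by (simp add: left_diff_distrib[symmetric] norm_mult)
    qed (intro integrable_continuous_Omega continuous_intros g contK)+
    also have "\<dots> = a * I n + (2 * pi) ^ 3 * (2 * M * q ^ n)"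
      by (subst Bochner_Integration.integral_add, (intro integrable_continuous_Omega continuous_intros contK)+)
       (simp add: I_def measure_lebesgue_on_Omega)
    finally show ?thesis by (simp add: a_def algebra_simps)
  qed
  \<comment> \<open>A smaller cube on which every factor is so close to one that the product of the three still exceeds \<open>q\<close>.\<close>
  have "\<exists>\<eta>>0. \<eta> \<le> \<delta> \<and> ((1 + cos \<eta>) / 2) ^ 3 > q"
  proof -
    have "isCont (\<lambda>t. ((1 + cos t) / 2) ^ 3) (0::real)" by (intro continuous_intros) auto
    then have "((\<lambda>t. ((1 + cos t) / 2) ^ 3) \<longlongrightarrow> (1::real)) (at_right 0)"
      by (simp add: isCont_def filterlim_at_split)
    then have "\<forall>\<^sub>F t in at_right 0. ((1 + cos t) / 2) ^ 3 > q" using q1 by (rule order_tendstoD)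
    moreover have "\<forall>\<^sub>F t in at_right 0. t \<in> {0<..<\<delta>}" by (rule eventually_at_right_real[OF \<delta>])
    ultimately have "\<forall>\<^sub>F t in at_right 0. ((1 + cos t) / 2) ^ 3 > q \<and> t \<in> {0<..<\<delta>}"
      by eventually_elim auto
    then obtain t where "((1 + cos t) / 2) ^ 3 > q" "t \<in> {0<..<\<delta>}"
      using eventually_happens'[OF trivial_limit_at_right_real] by blast
    then show ?thesis by (intro exI[of _ t]) auto
  qed
  then obtain \<eta> where \<eta>: "\<eta> > 0" "\<eta> \<le> \<delta>" and p: "((1 + cos \<eta>) / 2) ^ 3 > q" by blast
  define r where "r = (1 + cos \<eta>) / 2"
  have r0: "0 \<le> r" unfolding r_def using cos_ge_minus_one[of \<eta>] by (auto simp del: cos_ge_minus_one)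
  define B where "B = (cbox (\<chi> i. y $ i - \<eta>) (\<chi> i. y $ i + \<eta>) :: (real^3) set)"
  have BO: "B \<subseteq> Omega"
  proof
    fix x assume "x \<in> B"
    then have "y $ i - \<eta> \<le> x $ i" "x $ i \<le> y $ i + \<eta>" for i by (auto simp: B_def mem_box_cart)
    then show "x \<in> Omega" unfolding Omega_def mem_Collect_eq
      using order_trans[OF \<eta>(2) \<delta>y(1)] order_trans[OF \<eta>(2) \<delta>y(2)] by (metis (no_types, opaque_lifting) diff_ge_0_iff_ge le_diff_eq order_trans add.commute)
  qed
  have KB: "(r ^ 3) ^ n \<le> K n x" if x: "x \<in> B" for x n
  proof -
    have "r \<le> c i x" for i
    proof -
      have "\<bar>x $ i - y $ i\<bar> \<le> \<eta>" using x unfolding B_def mem_box_cart vec_lambda_beta abs_le_iff by (metis add.commute add_le_cancel_left diff_le_eq le_diff_eq minus_diff_eq)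
      then have "cos \<eta> \<le> cos \<bar>x $ i - y $ i\<bar>" using \<eta> \<delta>le pi_gt_zero by (intro cos_monotone_0_pi_le) linarith+
      then show ?thesis by (simp add: r_def c_def)
    qed
    then have ri: "r ^ n \<le> c i x ^ n" for i by (intro power_mono r0)
    have "r ^ n * r ^ n * r ^ n \<le> K n x" unfolding K_def by (intro mult_mono ri mult_nonneg_nonneg zero_le_power r0 c01)
    then show ?thesis by (simp add: power3_eq_cube power_mult_distrib)
  qed
  define v where "v = measure lebesgue B"
  have v: "v > 0"
  proof -
    have "v = measure lborel B" by (simp add: v_def B_def)
    also have "\<dots> = (\<Prod>i\<in>(UNIV::3 set). 2 * \<eta>)" unfolding B_def
      by (subst content_cbox_cart) (use \<eta> in \<open>auto simp: interval_ne_empty_cart\<close>)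
    finally show ?thesis using \<eta> by simp
  qed
  have low: "v * (r ^ 3) ^ n \<le> I n" for n
  proof -
    have m: "measure (lebesgue_on Omega) B = v"
      unfolding v_def using BO by (subst measure_restrict_space) (auto simp: B_def)
    have "v * (r ^ 3) ^ n = (LINT x|lebesgue_on Omega. indicator B x * (r ^ 3) ^ n)"
      using BO by (simp add: m Int_absorb2)
    also have "\<dots> \<le> I n" unfolding I_def
    proof (rule integral_mono)
      have "B \<in> sets (lebesgue_on Omega)"
        using BO by (subst sets_restrict_space_iff) (auto simp: B_def)
      then show "integrable (lebesgue_on Omega) (\<lambda>x. indicator B x * (r ^ 3) ^ n)"
        using finite_measure.emeasure_finite[OF finite_measure_Omega]
        by (intro integrable_mult_left integrable_real_indicator) (auto simp: less_top)
      show "integrable (lebesgue_on Omega) (K n)" by (intro integrable_continuous_Omega contK)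
      show "indicator B x * (r ^ 3) ^ n \<le> K n x" for x
        using KB[of x n] K0[of n x] by (cases "x \<in> B") auto
    qed
    finally show ?thesis .
  qed
  define C where "C = 2 * M * (2 * pi) ^ 3"
  have all: "a * v * (r ^ 3) ^ n \<le> C * q ^ n" for n
  proof -
    have "a * (v * (r ^ 3) ^ n) \<le> a * I n" using low a by (intro mult_left_mono) auto
    also have "\<dots> \<le> C * q ^ n" using up by (simp add: C_def)
    finally show ?thesis by simp
  qed
  have r3: "r ^ 3 > q" using p by (simp add: r_def)
  then have r3p: "r ^ 3 > 0" using q0 by linarith
  have "(\<lambda>n. C * (q / r ^ 3) ^ n) \<longlonglongrightarrow> C * 0"
    using q0 r3 r3p by (intro tendsto_intros LIMSEQ_power_zero) (auto simp: abs_of_nonneg)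
  then have "\<forall>\<^sub>F n in sequentially. C * (q / r ^ 3) ^ n < a * v"
    using a v by (intro order_tendstoD(2)[of _ 0]) auto
  then obtain n where n: "C * (q / r ^ 3) ^ n < a * v" by (auto simp: eventually_sequentially)
  have "C * q ^ n < a * v * (r ^ 3) ^ n"
    using n r3p by (simp add: power_divide divide_less_eq pos_divide_less_eq)
  with all[of n] show False by simp
qed

lemma zero_on_Omega:
  assumes g: "continuous_on UNIV g" and z: "\<And>k. coef g k = 0" and x: "x \<in> Omega"
  shows "g x = 0"
proof -
  have "closure (interior Omega) = Omega"
    unfolding Omega_cbox interior_cbox by (rule closure_box) (auto simp: interval_ne_empty_cart)
  then have "x \<in> closure (interior Omega)" using x by simp
  then show ?thesis
    by (rule continuous_constant_on_closure[rotated 2, where S = "interior Omega"])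
      (use zero_if_coefs_zero[OF g z] g in \<open>auto intro: continuous_on_subset\<close>)
qed

section \<open>Functions with summable Fourier coefficients\<close>

text \<open>Bounds for square sums are stated over finite sets of frequencies, which avoids
summability side conditions and passes to limits directly.\<close>

definition wb :: "(freq \<Rightarrow> real) \<Rightarrow> (real^3 \<Rightarrow> complex) \<Rightarrow> real \<Rightarrow> bool" where
  "wb \<theta> f C \<longleftrightarrow> (\<forall>F. finite F \<longrightarrow> (\<Sum>k\<in>F. (\<theta> k * cmod (coef f k))\<^sup>2) \<le> C)"

abbreviation Hb :: "nat \<Rightarrow> (real^3 \<Rightarrow> complex) \<Rightarrow> real \<Rightarrow> bool" where
  "Hb r \<equiv> wb (\<lambda>k. wt k ^ r)"

lemma wb_nonneg: "wb \<theta> f C \<Longrightarrow> 0 \<le> C"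
  unfolding wb_def by (metis finite.emptyI sum.empty)

lemma wb_mono: "wb \<theta> f C \<Longrightarrow> C \<le> D \<Longrightarrow> wb \<theta> f D"
  unfolding wb_def by (meson order_trans)

lemma wb_coef_le:
  assumes "wb \<theta> f C" "\<And>k. \<bar>\<eta> k\<bar> * cmod (coef g k) \<le> \<bar>\<theta> k\<bar> * cmod (coef f k)"
  shows "wb \<eta> g C"
  unfolding wb_def
proof (intro allI impI)
  fix F :: "freq set" assume F: "finite F"
  have "(\<Sum>k\<in>F. (\<eta> k * cmod (coef g k))\<^sup>2) \<le> (\<Sum>k\<in>F. (\<theta> k * cmod (coef f k))\<^sup>2)"
  proof (rule sum_mono)
    fix k
    have "(\<bar>\<eta> k\<bar> * cmod (coef g k))\<^sup>2 \<le> (\<bar>\<theta> k\<bar> * cmod (coef f k))\<^sup>2"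
      using assms(2) by (intro power_mono) auto
    then show "(\<eta> k * cmod (coef g k))\<^sup>2 \<le> (\<theta> k * cmod (coef f k))\<^sup>2"
      by (simp add: power_mult_distrib)
  qed
  also have "\<dots> \<le> C" using assms(1) F by (simp add: wb_def)
  finally show "(\<Sum>k\<in>F. (\<eta> k * cmod (coef g k))\<^sup>2) \<le> C" .
qed

lemma Hb_le: "Hb r f C \<Longrightarrow> q \<le> r \<Longrightarrow> Hb q f C"
  by (rule wb_coef_le) (auto intro!: mult_right_mono power_increasing wt_ge_1)

lemma Hb_max: "Hb q f A \<Longrightarrow> Hb r f B \<Longrightarrow> Hb (max q r) f (max A B)"
  by (cases "q \<le> r") (auto simp: max_def intro: wb_mono)

lemma wb_add_coef:
  assumes f: "wb \<theta> f A" and g: "wb \<theta> g B" and h: "\<And>k. cmod (coef h k) \<le> cmod (coef f k) + cmod (coef g k)"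
  shows "wb \<theta> h (2 * A + 2 * B)"
  unfolding wb_def
proof (intro allI impI)
  fix F :: "freq set" assume F: "finite F"
  have "(\<Sum>k\<in>F. (\<theta> k * cmod (coef h k))\<^sup>2) \<le> (\<Sum>k\<in>F. 2 * (\<theta> k * cmod (coef f k))\<^sup>2 + 2 * (\<theta> k * cmod (coef g k))\<^sup>2)"
  proof (rule sum_mono)
    fix k
    have "(cmod (coef h k))\<^sup>2 \<le> (cmod (coef f k) + cmod (coef g k))\<^sup>2" by (rule power_mono[OF h]) simp
    also have "\<dots> \<le> 2 * (cmod (coef f k))\<^sup>2 + 2 * (cmod (coef g k))\<^sup>2"
      using sum_squares_bound[of "cmod (coef f k)" "cmod (coef g k)"] by (simp add: power2_sum)
    finally have "(\<theta> k)\<^sup>2 * (cmod (coef h k))\<^sup>2 \<le> (\<theta> k)\<^sup>2 * (2 * (cmod (coef f k))\<^sup>2 + 2 * (cmod (coef g k))\<^sup>2)"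
      by (rule mult_left_mono) simp
    then show "(\<theta> k * cmod (coef h k))\<^sup>2 \<le> 2 * (\<theta> k * cmod (coef f k))\<^sup>2 + 2 * (\<theta> k * cmod (coef g k))\<^sup>2"
      by (simp add: power_mult_distrib algebra_simps)
  qed
  also have "\<dots> \<le> 2 * A + 2 * B"
    using f g F by (simp add: sum.distrib sum_distrib_left[symmetric] wb_def add_mono)
  finally show "(\<Sum>k\<in>F. (\<theta> k * cmod (coef h k))\<^sup>2) \<le> 2 * A + 2 * B" .
qed

lemma wb_scale_coef:
  assumes f: "wb \<theta> f A" and h: "\<And>k. cmod (coef h k) \<le> c * cmod (coef f k)"
  shows "wb \<theta> h (c\<^sup>2 * A)"
  unfolding wb_def
proof (intro allI impI)
  fix F :: "freq set" assume F: "finite F"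
  have "(\<Sum>k\<in>F. (\<theta> k * cmod (coef h k))\<^sup>2) \<le> (\<Sum>k\<in>F. c\<^sup>2 * (\<theta> k * cmod (coef f k))\<^sup>2)"
  proof (rule sum_mono)
    fix k
    have "(cmod (coef h k))\<^sup>2 \<le> (c * cmod (coef f k))\<^sup>2" by (rule power_mono[OF h]) simp
    then have "(\<theta> k)\<^sup>2 * (cmod (coef h k))\<^sup>2 \<le> (\<theta> k)\<^sup>2 * (c * cmod (coef f k))\<^sup>2"
      by (rule mult_left_mono) simp
    then show "(\<theta> k * cmod (coef h k))\<^sup>2 \<le> c\<^sup>2 * (\<theta> k * cmod (coef f k))\<^sup>2"
      by (simp add: power_mult_distrib algebra_simps)
  qed
  also have "\<dots> \<le> c\<^sup>2 * A"
    unfolding sum_distrib_left[symmetric] using f F by (intro mult_left_mono) (auto simp: wb_def)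
  finally show "(\<Sum>k\<in>F. (\<theta> k * cmod (coef h k))\<^sup>2) \<le> c\<^sup>2 * A" .
qed

lemma coef_cnj: "coef (\<lambda>x. cnj (f x)) k = cnj (coef f (- k))"
proof -
  have "(LINT x|lebesgue_on Omega. cnj (f x) * fchar (-k) x) = (LINT x|lebesgue_on Omega. cnj (f x * fchar (- (- k)) x))"
    by simp
  also have "\<dots> = cnj (LINT x|lebesgue_on Omega. f x * fchar (- (-k)) x)"
    by (rule Bochner_Integration.integral_cnj)
  finally show ?thesis by (simp add: coef_def)
qed

lemma Hb_cnj: "Hb r f C \<Longrightarrow> Hb r (\<lambda>x. cnj (f x)) C"
  unfolding wb_def
proof (intro allI impI)
  fix F :: "freq set" assume *: "\<forall>F. finite F \<longrightarrow> (\<Sum>k\<in>F. (wt k ^ r * cmod (coef f k))\<^sup>2) \<le> C" and F: "finite F"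
  have "(\<Sum>k\<in>F. (wt k ^ r * cmod (coef (\<lambda>x. cnj (f x)) k))\<^sup>2) = (\<Sum>k\<in>uminus ` F. (wt k ^ r * cmod (coef f k))\<^sup>2)"
    by (subst sum.reindex) (auto simp: coef_cnj)
  then show "(\<Sum>k\<in>F. (wt k ^ r * cmod (coef (\<lambda>x. cnj (f x)) k))\<^sup>2) \<le> C"
    using * F by simp
qed

text \<open>Two derivatives are worth absolute summability in three dimensions.\<close>

lemma l1_le_weighted_l2:
  fixes c :: "freq \<Rightarrow> complex"
  assumes C: "(\<Sum>k\<in>F. ((wt k)\<^sup>2 * cmod (c k))\<^sup>2) \<le> C" and F: "finite F"
  shows "(\<Sum>k\<in>F. cmod (c k)) \<le> sqrt (S\<^sub>w * C)"
proof -
  have "(\<Sum>k\<in>F. cmod (c k))\<^sup>2 = (\<Sum>k\<in>F. 1 / wt k ^ 2 * (wt k ^ 2 * cmod (c k)))\<^sup>2" by simp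
  also have "\<dots> \<le> (\<Sum>k\<in>F. (1 / wt k ^ 2)\<^sup>2) * (\<Sum>k\<in>F. (wt k ^ 2 * cmod (c k))\<^sup>2)"
    by (rule Cauchy_Schwarz_ineq_sum)
  also have "(\<Sum>k\<in>F. (1 / wt k ^ 2)\<^sup>2) = (\<Sum>k\<in>F. 1 / wt k ^ 4)"
    by (simp add: power_divide power_mult[symmetric])
  also have "(\<Sum>k\<in>F. 1 / wt k ^ 4) * (\<Sum>k\<in>F. (wt k ^ 2 * cmod (c k))\<^sup>2) \<le> S\<^sub>w * C"
    using C F S\<^sub>w_nonneg by (intro mult_mono sum_wt_pow_le) (auto intro: sum_nonneg)
  finally show ?thesis by (intro real_le_rsqrt)
qed

lemma Hb_sum_le:
  assumes "Hb 2 f C" "finite F"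
  shows "(\<Sum>k\<in>F. cmod (coef f k)) \<le> sqrt (S\<^sub>w * C)"
  by (rule l1_le_weighted_l2) (use assms in \<open>auto simp: wb_def\<close>)

text \<open>The functions that are represented pointwise by an absolutely convergent Fourier series.\<close>

definition reg :: "(real^3 \<Rightarrow> complex) \<Rightarrow> bool" where
  "reg f \<longleftrightarrow> continuous_on UNIV f \<and> periodic f \<and> (\<exists>C. Hb 2 f C)"

lemma reg_continuous: "reg f \<Longrightarrow> continuous_on UNIV f"
  and reg_periodic: "reg f \<Longrightarrow> periodic f"
  by (auto simp: reg_def)

lemma reg_summable: "reg f \<Longrightarrow> (\<lambda>k. cmod (coef f k)) summable_on UNIV"
proof -
  assume "reg f"
  then obtain C where C: "Hb 2 f C" by (auto simp: reg_def)
  show ?thesis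
    by (rule nonneg_bdd_above_summable_on) (auto intro!: bdd_aboveI2[where M = "sqrt (S\<^sub>w * C)"] Hb_sum_le C)
qed

lemma coef_norm_le:
  assumes "continuous_on UNIV f" "\<And>x. x \<in> Omega \<Longrightarrow> cmod (f x) \<le> B"
  shows "cmod (coef f k) \<le> B"
proof -
  have "cmod (LINT x|lebesgue_on Omega. f x * fchar (-k) x) \<le> (LINT x|lebesgue_on Omega. B)"
    using assms finite_measure.integrable_const[OF finite_measure_Omega]
    by (intro Bochner_Integration.integral_norm_bound_integral integrable_continuous_Omega continuous_intros)
      (auto simp: norm_mult)
  then show ?thesis
    by (simp only: LINT_const_Omega_real coef_def norm_divide norm_of_real) (simp add: divide_le_eq mult.commute)
qed

lemma coef_sum_fchar:
  assumes F: "finite F" shows "coef (\<lambda>x. \<Sum>k\<in>F. c k * fchar k x) l = (if l \<in> F then c l else 0)"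
proof -
  have "(LINT x|lebesgue_on Omega. (\<Sum>k\<in>F. c k * fchar k x) * fchar (-l) x) =
    (LINT x|lebesgue_on Omega. (\<Sum>k\<in>F. c k * (fchar k x * fchar (-l) x)))"
    by (simp add: sum_distrib_right mult.assoc)
  also have "\<dots> = (\<Sum>k\<in>F. c k * (LINT x|lebesgue_on Omega. fchar k x * fchar (-l) x))"
    by (subst Bochner_Integration.integral_sum)
      (auto intro!: integrable_continuous_Omega continuous_intros)
  finally have "coef (\<lambda>x. \<Sum>k\<in>F. c k * fchar k x) l = (\<Sum>k\<in>F. c k * coef (fchar k) l)"
    by (simp add: coef_def sum_divide_distrib)
  then show ?thesis using F by (simp add: coef_fchar if_distrib cong: if_cong)
qed

lemma coef_diff_cont:
  "continuous_on UNIV f \<Longrightarrow> continuous_on UNIV g \<Longrightarrow> coef (\<lambda>x. f x - g x) k = coef f k - coef g k"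
  by (intro coef_diff continuous_L2)

lemma coef_add_cont:
  "continuous_on UNIV f \<Longrightarrow> continuous_on UNIV g \<Longrightarrow> coef (\<lambda>x. f x + g x) k = coef f k + coef g k"
  using coef_lincomb[of f g 1 1 k] by (simp add: integrable_continuous_Omega)

lemma coef_scale: "coef (\<lambda>x. c * f x) k = c * coef f k"
proof -
  have "(LINT x|lebesgue_on Omega. c * f x * fchar (-k) x) = c * (LINT x|lebesgue_on Omega. f x * fchar (-k) x)"
    unfolding mult.assoc by (rule integral_mult_right_zero)
  then show ?thesis by (simp add: coef_def)
qed

text \<open>The series converges uniformly to a continuous function with the same coefficients, and
continuous functions with equal coefficients agree on the cube.\<close>

lemma fourier_uniform:
  assumes "reg f"
  shows "uniform_limit Omega (\<lambda>F x. \<Sum>k\<in>F. coef f k * fchar k x) f (finite_subsets_at_top UNIV)"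
proof -
  define S where "S x = (\<Sum>\<^sub>\<infinity>k\<in>UNIV. coef f k * fchar k x)" for x
  have f: "continuous_on UNIV f" using assms by (rule reg_continuous)
  have ul: "uniform_limit UNIV (\<lambda>F x. \<Sum>k\<in>F. coef f k * fchar k x) S (finite_subsets_at_top UNIV)"
    unfolding S_def
    by (rule Weierstrass_m_test_general[OF _ reg_summable[OF assms]]) (auto simp: norm_mult)
  have contS: "continuous_on UNIV S"
    by (rule uniform_limit_theorem[OF _ ul]) (auto intro!: always_eventually continuous_intros)
  have "coef S l = coef f l" for l
  proof -
    have "cmod (coef S l - coef f l) \<le> e" if e: "e > 0" for e
    proof -
      have "\<forall>\<^sub>F F in finite_subsets_at_top UNIV. \<forall>x\<in>UNIV. dist (\<Sum>k\<in>F. coef f k * fchar k x) (S x) < e"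
        using ul e by (rule uniform_limitD)
      moreover have "\<forall>\<^sub>F F in finite_subsets_at_top UNIV. finite F \<and> {l} \<subseteq> F"
        unfolding eventually_finite_subsets_at_top by (intro exI[of _ "{l}"]) auto
      ultimately have "\<forall>\<^sub>F F in finite_subsets_at_top UNIV. (\<forall>x\<in>UNIV. dist (\<Sum>k\<in>F. coef f k * fchar k x) (S x) < e) \<and> finite F \<and> {l} \<subseteq> F"
        by eventually_elim simp
      then obtain F where F: "\<And>x. dist (\<Sum>k\<in>F. coef f k * fchar k x) (S x) < e" "finite F" "l \<in> F"
        using eventually_happens'[OF finite_subsets_at_top_neq_bot] by fastforce
      have "coef S l - coef f l = coef (\<lambda>x. S x - (\<Sum>k\<in>F. coef f k * fchar k x)) l"
        using F by (subst coef_diff_cont) (auto intro!: contS continuous_intros simp: coef_sum_fchar)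
      also have "cmod \<dots> \<le> e"
        by (rule coef_norm_le)
          (use F(1) in \<open>auto intro!: contS continuous_intros simp: dist_norm norm_minus_commute less_imp_le\<close>)
      finally show ?thesis .
    qed
    then have "cmod (coef S l - coef f l) \<le> 0" by (rule field_le_epsilon[of _ 0, simplified])
    then show ?thesis by simp
  qed
  with coef_diff_cont[OF f contS] have z: "coef (\<lambda>x. f x - S x) l = 0" for l by simp
  have "f x - S x = 0" if "x \<in> Omega" for x
  proof (rule zero_on_Omega[OF _ _ that])
    show "continuous_on UNIV (\<lambda>x. f x - S x)" by (intro continuous_intros f contS)
  qed (rule z)
  then have eq: "f x = S x" if "x \<in> Omega" for x using that by fastforce
  have "uniform_limit Omega (\<lambda>F x. \<Sum>k\<in>F. coef f k * fchar k x) S (finite_subsets_at_top UNIV)"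
    by (rule uniform_limit_on_subset[OF ul]) auto
  then show ?thesis
    by (rule uniform_limit_cong'[THEN iffD1, rotated 2]) (auto simp: eq)
qed

lemma fourier_inversion:
  assumes "reg f" "x \<in> Omega"
  shows "((\<lambda>k. coef f k * fchar k x) has_sum f x) UNIV"
  unfolding has_sum_def using tendsto_uniform_limitI[OF fourier_uniform[OF assms(1)] assms(2)] .

lemma parseval_le:
  assumes f: "reg f" and C: "Hb 0 f C"
  shows "(LINT x|lebesgue_on Omega. (cmod (f x))\<^sup>2) \<le> (2 * pi) ^ 3 * C"
proof -
  have fc: "continuous_on UNIV f" using f by (rule reg_continuous)
  have "(LINT x|lebesgue_on Omega. (cmod (f x))\<^sup>2) \<le> (2 * pi) ^ 3 * C + e" if e: "e > 0" for e
  proof -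
    define d where "d = sqrt (e / (2 * pi) ^ 3)"
    have d: "d > 0" using e by (simp add: d_def)
    have "\<forall>\<^sub>F F in finite_subsets_at_top UNIV. \<forall>x\<in>Omega. dist (\<Sum>k\<in>F. coef f k * fchar k x) (f x) < d"
      using fourier_uniform[OF f] d by (rule uniform_limitD)
    moreover have "\<forall>\<^sub>F F in finite_subsets_at_top (UNIV :: freq set). finite F"
      by (rule eventually_finite_subsets_at_top_weakI)
    ultimately have "\<forall>\<^sub>F F in finite_subsets_at_top UNIV. (\<forall>x\<in>Omega. dist (\<Sum>k\<in>F. coef f k * fchar k x) (f x) < d) \<and> finite F"
      by eventually_elim simp
    then obtain F where F: "\<And>x. x \<in> Omega \<Longrightarrow> dist (\<Sum>k\<in>F. coef f k * fchar k x) (f x) < d" "finite F"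
      using eventually_happens'[OF finite_subsets_at_top_neq_bot] by fastforce
    have "(LINT x|lebesgue_on Omega. (cmod (f x - (\<Sum>k\<in>F. coef f k * fchar k x)))\<^sup>2) \<le> (LINT x|lebesgue_on Omega. d\<^sup>2)"
    proof (rule integral_mono)
      show "integrable (lebesgue_on Omega) (\<lambda>x. (cmod (f x - (\<Sum>k\<in>F. coef f k * fchar k x)))\<^sup>2)"
        by (intro integrable_continuous_Omega continuous_intros fc)
      show "integrable (lebesgue_on Omega) (\<lambda>x. d\<^sup>2)"
        by (intro integrable_continuous_Omega continuous_intros)
      fix x assume "x \<in> space (lebesgue_on Omega)"
      then have "cmod (f x - (\<Sum>k\<in>F. coef f k * fchar k x)) < d" using F(1)[of x] by (simp add: dist_norm norm_minus_commute)
      then show "(cmod (f x - (\<Sum>k\<in>F. coef f k * fchar k x)))\<^sup>2 \<le> d\<^sup>2" by (intro power_mono) auto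
    qed
    also have "\<dots> = e" using e by (simp only: LINT_const_Omega_real d_def) simp
    finally have "(LINT x|lebesgue_on Omega. (cmod (f x))\<^sup>2) \<le> e + (2 * pi) ^ 3 * (\<Sum>k\<in>F. (cmod (coef f k))\<^sup>2)"
      using bessel_identity[OF continuous_L2[OF fc] F(2)] by simp
    also have "\<dots> \<le> e + (2 * pi) ^ 3 * C"
      using C F(2) by (intro add_left_mono mult_left_mono) (auto simp: wb_def)
    finally show ?thesis by simp
  qed
  then show ?thesis by (rule field_le_epsilon)
qed

section \<open>Products\<close>

lemma coef_mult_fchar: "coef (\<lambda>x. fchar l x * v x) k = coef v (k - l)"
proof -
  have "fchar l x * v x * fchar (-k) x = v x * fchar (- (k - l)) x" for x
  proof -
    have "fchar (- (k - l)) x = fchar l x * fchar (- k) x" using fchar_add[of l "- k" x] by simp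
    then show ?thesis by (simp only: mult_ac)
  qed
  then show ?thesis unfolding coef_def by (simp only:)
qed

lemma coef_product:
  assumes u: "reg u" and v: "continuous_on UNIV v"
  shows "((\<lambda>l. coef u l * coef v (k - l)) has_sum coef (\<lambda>x. u x * v x) k) UNIV"
  unfolding has_sum_def
proof (rule tendstoI)
  fix e :: real assume e: "e > 0"
  have uc: "continuous_on UNIV u" using u by (rule reg_continuous)
  have "compact Omega" by (simp add: Omega_cbox)
  then have "bounded (v ` Omega)"
    using v by (intro compact_imp_bounded compact_continuous_image) (auto intro: continuous_on_subset)
  then obtain M where M: "M > 0" "\<And>x. x \<in> Omega \<Longrightarrow> cmod (v x) \<le> M" by (auto simp: bounded_pos)
  have "\<forall>\<^sub>F F in finite_subsets_at_top UNIV. \<forall>x\<in>Omega. dist (\<Sum>k\<in>F. coef u k * fchar k x) (u x) < e / (2 * M)"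
    by (rule uniform_limitD[OF fourier_uniform[OF u]]) (use e M in auto)
  moreover have "\<forall>\<^sub>F F in finite_subsets_at_top (UNIV :: freq set). finite F"
    by (rule eventually_finite_subsets_at_top_weakI)
  ultimately show "\<forall>\<^sub>F F in finite_subsets_at_top UNIV. dist (\<Sum>l\<in>F. coef u l * coef v (k - l)) (coef (\<lambda>x. u x * v x) k) < e"
  proof eventually_elim
    case (elim F)
    let ?S = "\<lambda>x. \<Sum>k\<in>F. coef u k * fchar k x"
    have "coef (\<lambda>x. ?S x * v x) k = (\<Sum>l\<in>F. coef u l * coef v (k - l))"
    proof -
      have "(LINT x|lebesgue_on Omega. ?S x * v x * fchar (-k) x) =
        (LINT x|lebesgue_on Omega. (\<Sum>l\<in>F. coef u l * (fchar l x * v x * fchar (-k) x)))"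
        by (simp add: sum_distrib_right mult.assoc)
      also have "\<dots> = (\<Sum>l\<in>F. coef u l * (LINT x|lebesgue_on Omega. fchar l x * v x * fchar (-k) x))"
        by (subst Bochner_Integration.integral_sum)
          (auto intro!: integrable_continuous_Omega continuous_intros v)
      finally have "coef (\<lambda>x. ?S x * v x) k = (\<Sum>l\<in>F. coef u l * coef (\<lambda>x. fchar l x * v x) k)"
        by (simp add: coef_def sum_divide_distrib)
      then show ?thesis by (simp add: coef_mult_fchar)
    qed
    then have "dist (\<Sum>l\<in>F. coef u l * coef v (k - l)) (coef (\<lambda>x. u x * v x) k)
      = cmod (coef (\<lambda>x. ?S x * v x - u x * v x) k)"
      by (subst coef_diff_cont) (auto intro!: continuous_intros uc v simp: dist_norm)
    also have "\<dots> \<le> e / 2"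
    proof (rule coef_norm_le)
      fix x assume x: "x \<in> Omega"
      have "cmod (?S x - u x) * cmod (v x) \<le> e / (2 * M) * M"
        using elim x M e by (intro mult_mono) (auto simp: dist_norm less_imp_le)
      then show "cmod (?S x * v x - u x * v x) \<le> e / 2"
        using M by (simp add: left_diff_distrib[symmetric] norm_mult)
    qed (intro continuous_intros uc v)
    finally show ?case using e by simp
  qed
qed

text \<open>Cauchy--Schwarz for the convolution of the coefficients, with the weights split so that the
hypothesis on \<open>\<theta> k / (\<mu> l * \<nu> (k - l))\<close> absorbs everything but two independent square sums.  The
product estimates below only choose the weights.\<close>

lemma product_bound:
  assumes u: "reg u" and v: "continuous_on UNIV v"
    and A: "wb \<mu> u A" and B: "wb \<nu> v B" and pos: "\<And>k. \<mu> k > 0" "\<And>k. \<nu> k > 0"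
    and S: "\<And>k L. finite L \<Longrightarrow> (\<Sum>l\<in>L. (\<theta> k / (\<mu> l * \<nu> (k - l)))\<^sup>2) \<le> S"
  shows "wb \<theta> (\<lambda>x. u x * v x) (S * A * B)"
  unfolding wb_def
proof (intro allI impI)
  fix F :: "freq set" assume F: "finite F"
  have A0: "0 \<le> A" and B0: "0 \<le> B" using A B by (auto intro: wb_nonneg)
  have S0: "0 \<le> S" using S[of "{}"] by simp
  have fin: "(\<Sum>k\<in>F. (\<theta> k * cmod (\<Sum>l\<in>L. coef u l * coef v (k - l)))\<^sup>2) \<le> S * A * B" if L: "finite L" for L
  proof -
    have "(\<Sum>k\<in>F. (\<theta> k * cmod (\<Sum>l\<in>L. coef u l * coef v (k - l)))\<^sup>2)
        \<le> (\<Sum>k\<in>F. S * (\<Sum>l\<in>L. (\<mu> l * cmod (coef u l))\<^sup>2 * (\<nu> (k - l) * cmod (coef v (k - l)))\<^sup>2))"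
    proof (rule sum_mono)
      fix k
      have "cmod (\<Sum>l\<in>L. coef u l * coef v (k - l)) \<le> (\<Sum>l\<in>L. cmod (coef u l) * cmod (coef v (k - l)))"
        by (rule order_trans[OF norm_sum]) (simp add: norm_mult)
      then have "(\<theta> k * cmod (\<Sum>l\<in>L. coef u l * coef v (k - l)))\<^sup>2 \<le> (\<theta> k * (\<Sum>l\<in>L. cmod (coef u l) * cmod (coef v (k - l))))\<^sup>2"
        unfolding power_mult_distrib by (intro mult_left_mono power_mono) auto
      also have "\<theta> k * (\<Sum>l\<in>L. cmod (coef u l) * cmod (coef v (k - l))) =
         (\<Sum>l\<in>L. \<theta> k / (\<mu> l * \<nu> (k - l)) * ((\<mu> l * cmod (coef u l)) * (\<nu> (k - l) * cmod (coef v (k - l)))))"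
        unfolding sum_distrib_left
        by (rule sum.cong) (use pos in \<open>auto simp: field_simps less_imp_neq[symmetric]\<close>)
      also have "\<dots>\<^sup>2 \<le> (\<Sum>l\<in>L. (\<theta> k / (\<mu> l * \<nu> (k - l)))\<^sup>2) * (\<Sum>l\<in>L. ((\<mu> l * cmod (coef u l)) * (\<nu> (k - l) * cmod (coef v (k - l))))\<^sup>2)"
        by (rule Cauchy_Schwarz_ineq_sum)
      also have "\<dots> \<le> S * (\<Sum>l\<in>L. ((\<mu> l * cmod (coef u l)) * (\<nu> (k - l) * cmod (coef v (k - l))))\<^sup>2)"
        by (intro mult_right_mono S L sum_nonneg) auto
      finally show "(\<theta> k * cmod (\<Sum>l\<in>L. coef u l * coef v (k - l)))\<^sup>2 \<le>
        S * (\<Sum>l\<in>L. (\<mu> l * cmod (coef u l))\<^sup>2 * (\<nu> (k - l) * cmod (coef v (k - l)))\<^sup>2)"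
        by (simp add: power_mult_distrib)
    qed
    also have "\<dots> = S * (\<Sum>l\<in>L. (\<mu> l * cmod (coef u l))\<^sup>2 * (\<Sum>k\<in>F. (\<nu> (k - l) * cmod (coef v (k - l)))\<^sup>2))"
      by (simp only: sum_distrib_left[symmetric] sum.swap[of _ L F])
    also have "\<dots> \<le> S * (\<Sum>l\<in>L. (\<mu> l * cmod (coef u l))\<^sup>2 * B)"
    proof (intro mult_left_mono sum_mono S0)
      fix l
      have "(\<Sum>k\<in>F. (\<nu> (k - l) * cmod (coef v (k - l)))\<^sup>2) = (\<Sum>k\<in>(\<lambda>k. k - l) ` F. (\<nu> k * cmod (coef v k))\<^sup>2)"
        by (subst sum.reindex) (auto simp: inj_on_def)
      also have "\<dots> \<le> B" using B F by (simp add: wb_def)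
      finally show "(\<Sum>k\<in>F. (\<nu> (k - l) * cmod (coef v (k - l)))\<^sup>2) \<le> B" .
    qed auto
    also have "\<dots> = S * ((\<Sum>l\<in>L. (\<mu> l * cmod (coef u l))\<^sup>2) * B)" by (simp add: sum_distrib_right)
    also have "\<dots> \<le> S * (A * B)"
      using A L by (intro mult_left_mono mult_right_mono S0 B0) (auto simp: wb_def)
    finally show ?thesis by simp
  qed
  have "((\<lambda>L. \<Sum>k\<in>F. (\<theta> k * cmod (\<Sum>l\<in>L. coef u l * coef v (k - l)))\<^sup>2) \<longlongrightarrow>
     (\<Sum>k\<in>F. (\<theta> k * cmod (coef (\<lambda>x. u x * v x) k))\<^sup>2)) (finite_subsets_at_top UNIV)"
    using coef_product[OF u v] unfolding has_sum_def by (intro tendsto_intros)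
  then show "(\<Sum>k\<in>F. (\<theta> k * cmod (coef (\<lambda>x. u x * v x) k))\<^sup>2) \<le> S * A * B"
    by (rule tendsto_upperbound) (auto intro!: eventually_finite_subsets_at_top_weakI fin)
qed

lemma sum_wt_shift_le: "finite L \<Longrightarrow> n \<ge> 4 \<Longrightarrow> (\<Sum>l\<in>L. 1 / wt (k - l) ^ n) \<le> S\<^sub>w"
proof -
  assume L: "finite L" and n: "n \<ge> 4"
  have "(\<Sum>l\<in>L. 1 / wt (k - l) ^ n) = (\<Sum>j\<in>(\<lambda>l. k - l) ` L. 1 / wt j ^ n)"
    by (subst sum.reindex) (auto simp: inj_on_def)
  also have "\<dots> \<le> S\<^sub>w" using L n by (intro sum_wt_pow_le) auto
  finally show ?thesis .
qed

text \<open>By the triangle inequality, the quotient of weights is at most \<open>1 / wt l + 1 / wt (k - l)\<close>, whose powers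
from the fourth on are summable.\<close>

lemma Hb_mult_algebra:
  assumes u: "reg u" and v: "continuous_on UNIV v" and A: "Hb r u A" and B: "Hb r v B" and r: "r \<ge> 2"
  shows "Hb r (\<lambda>x. u x * v x) (4 ^ r * 2 * S\<^sub>w * A * B)"
proof (rule product_bound[OF u v A B])
  fix k :: freq and L :: "freq set" assume L: "finite L"
  have "(\<Sum>l\<in>L. (wt k ^ r / (wt l ^ r * wt (k - l) ^ r))\<^sup>2) \<le> (\<Sum>l\<in>L. 4 ^ r * (1 / wt l ^ (2 * r) + 1 / wt (k - l) ^ (2 * r)))"
  proof (rule sum_mono)
    fix l
    define p q where "p = 1 / wt l" and "q = 1 / wt (k - l)"
    have pq: "p > 0" "q > 0" by (auto simp: p_def q_def)
    have "wt k / (wt l * wt (k - l)) \<le> (wt l + wt (k - l)) / (wt l * wt (k - l))"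
      by (intro divide_right_mono wt_triangle) auto
    also have "\<dots> = p + q" by (simp add: p_def q_def field_simps)
    also have "\<dots> \<le> 2 * max p q" by simp
    finally have "(wt k / (wt l * wt (k - l))) ^ (2 * r) \<le> (2 * max p q) ^ (2 * r)"
      by (rule power_mono) simp
    also have "\<dots> = 4 ^ r * max p q ^ (2 * r)" by (simp add: power_mult_distrib power_mult)
    also have "max p q ^ (2 * r) \<le> p ^ (2 * r) + q ^ (2 * r)" using pq by (auto simp: max_def)
    finally have "(wt k / (wt l * wt (k - l))) ^ (2 * r) \<le> 4 ^ r * (p ^ (2 * r) + q ^ (2 * r))" by simp
    moreover have "(wt k / (wt l * wt (k - l))) ^ (2 * r) = (wt k ^ r / (wt l ^ r * wt (k - l) ^ r))\<^sup>2"
      by (simp add: power_divide power_mult_distrib power_mult[symmetric] mult.commute)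
    ultimately show "(wt k ^ r / (wt l ^ r * wt (k - l) ^ r))\<^sup>2 \<le> 4 ^ r * (1 / wt l ^ (2 * r) + 1 / wt (k - l) ^ (2 * r))"
      by (simp add: p_def q_def power_divide)
  qed
  also have "\<dots> = 4 ^ r * ((\<Sum>l\<in>L. 1 / wt l ^ (2 * r)) + (\<Sum>l\<in>L. 1 / wt (k - l) ^ (2 * r)))"
    by (simp only: sum_distrib_left[symmetric] sum.distrib)
  also have "\<dots> \<le> 4 ^ r * (S\<^sub>w + S\<^sub>w)"
    using r L by (intro mult_left_mono add_mono sum_wt_pow_le sum_wt_shift_le) auto
  finally show "(\<Sum>l\<in>L. (wt k ^ r / (wt l ^ r * wt (k - l) ^ r))\<^sup>2) \<le> 4 ^ r * 2 * S\<^sub>w" by simp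
qed auto

text \<open>Two derivatives in excess on one factor: that factor acts as a multiplier on the functions of
order \<open>r\<close>, even if \<open>r\<close> is too small for these to form an algebra.\<close>

lemma Hb_mult_module:
  assumes u: "reg u" and v: "continuous_on UNIV v" and A: "Hb r u A" and B: "Hb (r + 2) v B"
  shows "Hb r (\<lambda>x. u x * v x) (S\<^sub>w * A * B)"
proof (rule product_bound[OF u v A B])
  fix k :: freq and L :: "freq set" assume L: "finite L"
  have "(\<Sum>l\<in>L. (wt k ^ r / (wt l ^ r * wt (k - l) ^ (r + 2)))\<^sup>2) \<le> (\<Sum>l\<in>L. 1 / wt (k - l) ^ 4)"
  proof (rule sum_mono)
    fix l
    have "wt k \<le> wt l * wt (k - l)" using wt_add_mult[of l "k - l"] by simp
    then have "wt k ^ r \<le> (wt l * wt (k - l)) ^ r" by (intro power_mono) auto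
    then have "wt k ^ r / (wt l ^ r * wt (k - l) ^ (r + 2)) \<le> (wt l * wt (k - l)) ^ r / (wt l ^ r * wt (k - l) ^ (r + 2))"
      by (intro divide_right_mono) auto
    also have "\<dots> = 1 / wt (k - l) ^ 2" by (simp add: power_mult_distrib power_add power2_eq_square)
    finally have "(wt k ^ r / (wt l ^ r * wt (k - l) ^ (r + 2)))\<^sup>2 \<le> (1 / wt (k - l) ^ 2)\<^sup>2"
      by (rule power_mono) simp
    then show "(wt k ^ r / (wt l ^ r * wt (k - l) ^ (r + 2)))\<^sup>2 \<le> 1 / wt (k - l) ^ 4"
      by (simp add: power_divide power_mult[symmetric])
  qed
  also have "\<dots> \<le> S\<^sub>w" by (rule sum_wt_shift_le[OF L]) simp
  finally show "(\<Sum>l\<in>L. (wt k ^ r / (wt l ^ r * wt (k - l) ^ (r + 2)))\<^sup>2) \<le> S\<^sub>w" .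
qed auto

text \<open>The product of two functions of first order is square integrable; used when nothing beyond first order is known.\<close>

lemma Hb_mult_11:
  assumes u: "reg u" and v: "continuous_on UNIV v" and A: "Hb 1 u A" and B: "Hb 1 v B"
  shows "Hb 0 (\<lambda>x. u x * v x) (2 * S\<^sub>w * A * B)"
proof (rule product_bound[OF u v A B])
  fix k :: freq and L :: "freq set" assume L: "finite L"
  have "(\<Sum>l\<in>L. (wt k ^ 0 / (wt l ^ 1 * wt (k - l) ^ 1))\<^sup>2) \<le> (\<Sum>l\<in>L. 1 / wt l ^ 4 + 1 / wt (k - l) ^ 4)"
  proof (rule sum_mono)
    fix l
    define p q where "p = 1 / wt l" and "q = 1 / wt (k - l)"
    have "2 * (p\<^sup>2 * q\<^sup>2) \<le> (p\<^sup>2)\<^sup>2 + (q\<^sup>2)\<^sup>2" using sum_squares_bound[of "p\<^sup>2" "q\<^sup>2"] by simp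
    moreover have "0 \<le> p\<^sup>2 * q\<^sup>2" by simp
    ultimately have "(p * q)\<^sup>2 \<le> (p\<^sup>2)\<^sup>2 + (q\<^sup>2)\<^sup>2" unfolding power_mult_distrib[of p q] by linarith
    then show "(wt k ^ 0 / (wt l ^ 1 * wt (k - l) ^ 1))\<^sup>2 \<le> 1 / wt l ^ 4 + 1 / wt (k - l) ^ 4"
      by (simp add: p_def q_def power_divide power_mult_distrib power_mult[symmetric])
  qed
  also have "\<dots> = (\<Sum>l\<in>L. 1 / wt l ^ 4) + (\<Sum>l\<in>L. 1 / wt (k - l) ^ 4)" by (rule sum.distrib)
  also have "\<dots> \<le> S\<^sub>w + S\<^sub>w" by (intro add_mono sum_wt_pow_le sum_wt_shift_le L) auto
  finally show "(\<Sum>l\<in>L. (wt k ^ 0 / (wt l ^ 1 * wt (k - l) ^ 1))\<^sup>2) \<le> 2 * S\<^sub>w" by simp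
qed auto

lemma wt_powr_interp:
  assumes \<epsilon>: "0 < \<epsilon>" "\<epsilon> \<le> 1"
  shows "wt k powr (7/2) \<le> \<epsilon> * wt k ^ 4 + 1 / \<epsilon> ^ 7"
proof (cases "wt k \<ge> 1 / \<epsilon>\<^sup>2")
  case True
  have "1 / \<epsilon> = sqrt (1 / \<epsilon>\<^sup>2)" using \<epsilon> by (simp add: real_sqrt_divide)
  also have "\<dots> \<le> sqrt (wt k)" using True by simp
  finally have "1 \<le> \<epsilon> * wt k powr (1/2)" using \<epsilon> by (simp add: powr_half_sqrt field_simps)
  then have "1 * wt k powr (7/2) \<le> \<epsilon> * wt k powr (1/2) * wt k powr (7/2)" by (intro mult_right_mono) auto
  also have "\<dots> = \<epsilon> * wt k powr 4" by (simp add: powr_add[symmetric])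
  also have "wt k powr 4 = wt k ^ 4" by (simp add: powr_numeral)
  finally show ?thesis using \<epsilon> by (simp add: add_increasing2)
next
  case False
  then have "wt k powr (7/2) \<le> (1 / \<epsilon>\<^sup>2) powr (7/2)" by (intro powr_mono2) auto
  also have "1 / \<epsilon>\<^sup>2 = (1 / \<epsilon>) powr 2" using \<epsilon> by (simp add: powr_numeral power_divide)
  also have "((1 / \<epsilon>) powr 2) powr (7/2) = (1 / \<epsilon>) powr 7" by (subst powr_powr) simp
  also have "\<dots> = 1 / \<epsilon> ^ 7" using \<epsilon> by (simp add: powr_numeral power_divide)
  finally show ?thesis using \<epsilon> by (simp add: add_increasing)
qed

text \<open>A multiplier of order slightly below two, interpolated between order two with a small factor and order zero.
The small factor lets the term with \<open>A2\<close> be absorbed on the left-hand side of an estimate.\<close>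

lemma Hb_mult_interp:
  assumes u: "reg u" and v: "continuous_on UNIV v" and A: "Hb 2 u A2" "Hb 0 u A0" and B: "Hb 0 v B"
    and \<epsilon>: "0 < \<epsilon>" "\<epsilon> \<le> 1"
  shows "Hb 0 (\<lambda>x. u x * v x) (S\<^sub>w * (\<epsilon> * A2 + A0 / \<epsilon> ^ 7) * B)"
proof (rule product_bound[OF u v _ B, where \<mu> = "\<lambda>k. wt k powr (7/4)"])
  show "wb (\<lambda>k. wt k powr (7 / 4)) u (\<epsilon> * A2 + A0 / \<epsilon> ^ 7)"
    unfolding wb_def
  proof (intro allI impI)
    fix F :: "freq set" assume F: "finite F"
    have "(\<Sum>k\<in>F. (wt k powr (7 / 4) * cmod (coef u k))\<^sup>2) \<le> (\<Sum>k\<in>F. \<epsilon> * (wt k ^ 2 * cmod (coef u k))\<^sup>2 + (wt k ^ 0 * cmod (coef u k))\<^sup>2 / \<epsilon> ^ 7)"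
    proof (rule sum_mono)
      fix k
      have sq: "(wt k powr (7 / 4))\<^sup>2 = wt k powr (7/2)"
        by (simp add: power2_eq_square powr_add[symmetric])
      have "wt k powr (7/2) \<le> \<epsilon> * wt k ^ 4 + 1 / \<epsilon> ^ 7" by (rule wt_powr_interp[OF \<epsilon>])
      then have "wt k powr (7/2) * (cmod (coef u k))\<^sup>2 \<le> (\<epsilon> * wt k ^ 4 + 1 / \<epsilon> ^ 7) * (cmod (coef u k))\<^sup>2"
        by (rule mult_right_mono) simp
      then show "(wt k powr (7 / 4) * cmod (coef u k))\<^sup>2 \<le> \<epsilon> * (wt k ^ 2 * cmod (coef u k))\<^sup>2 + (wt k ^ 0 * cmod (coef u k))\<^sup>2 / \<epsilon> ^ 7"
        by (simp add: power_mult_distrib sq algebra_simps power_mult[symmetric])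
    qed
    also have "\<dots> = \<epsilon> * (\<Sum>k\<in>F. (wt k ^ 2 * cmod (coef u k))\<^sup>2) + (\<Sum>k\<in>F. (wt k ^ 0 * cmod (coef u k))\<^sup>2) / \<epsilon> ^ 7"
      by (simp only: sum.distrib sum_distrib_left sum_divide_distrib)
    also have "\<dots> \<le> \<epsilon> * A2 + A0 / \<epsilon> ^ 7"
      using A F \<epsilon> by (intro add_mono mult_left_mono divide_right_mono) (auto simp: wb_def)
    finally show "(\<Sum>k\<in>F. (wt k powr (7 / 4) * cmod (coef u k))\<^sup>2) \<le> \<epsilon> * A2 + A0 / \<epsilon> ^ 7" .
  qed
  fix k :: freq and L :: "freq set" assume L: "finite L"
  have "(\<Sum>l\<in>L. (wt k ^ 0 / (wt l powr (7 / 4) * wt (k - l) ^ 0))\<^sup>2) = (\<Sum>l\<in>L. wt l powr (- (7/2)))"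
    by (rule sum.cong) (auto simp: power2_eq_square powr_add[symmetric] powr_minus inverse_eq_divide)
  also have "\<dots> \<le> S\<^sub>w" by (rule sum_wt_powr_le[OF L])
  finally show "(\<Sum>l\<in>L. (wt k ^ 0 / (wt l powr (7 / 4) * wt (k - l) ^ 0))\<^sup>2) \<le> S\<^sub>w" .
qed auto

section \<open>Twice differentiable functions\<close>

text \<open>The eigenvalues of the negative Laplacian.\<close>

definition ksq :: "freq \<Rightarrow> real" where "ksq k = (\<Sum>i\<in>UNIV. (of_int (kc k i))\<^sup>2)"

lemma wt_sq_le: "(wt k)\<^sup>2 \<le> 4 * (1 + ksq k)"
proof -
  have *: "(1 + a + b + c)\<^sup>2 \<le> 4 * (1 + a\<^sup>2 + b\<^sup>2 + c\<^sup>2)" for a b c :: real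
  proof -
    have "0 \<le> (1 - a)\<^sup>2 + (1 - b)\<^sup>2 + (1 - c)\<^sup>2 + (a - b)\<^sup>2 + (a - c)\<^sup>2 + (b - c)\<^sup>2" by (intro add_nonneg_nonneg) auto
    then show ?thesis by (simp add: power2_eq_square algebra_simps)
  qed
  show ?thesis
    using *[of "\<bar>of_int (kc k 1)\<bar>" "\<bar>of_int (kc k 2)\<bar>" "\<bar>of_int (kc k 3)\<bar>"] by (simp add: wt_def ksq_def sum_3 add.assoc)
qed

lemma ksq_nonneg: "0 \<le> ksq k" by (simp add: ksq_def sum_nonneg)

lemma ksq_le: "ksq k \<le> (wt k)\<^sup>2"
proof -
  have *: "a\<^sup>2 + b\<^sup>2 + c\<^sup>2 \<le> (1 + a + b + c)\<^sup>2" if "a \<ge> 0" "b \<ge> 0" "c \<ge> 0" for a b c :: real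
  proof -
    have "0 \<le> 1 + 2 * a + 2 * b + 2 * c + 2 * (a * b) + 2 * (a * c) + 2 * (b * c)" using that by (intro add_nonneg_nonneg) auto
    then show ?thesis by (simp add: power2_eq_square algebra_simps)
  qed
  show ?thesis
    using *[of "\<bar>of_int (kc k 1)\<bar>" "\<bar>of_int (kc k 2)\<bar>" "\<bar>of_int (kc k 3)\<bar>"] by (simp add: wt_def ksq_def sum_3 add.assoc)
qed

lemma C_k_2:
  assumes "C_k 2 f"
  shows "continuous_on UNIV f" "has_pd f i (pdiff i f)" "continuous_on UNIV (pdiff i f)"
    "has_pd (pdiff i f) i (pdiff i (pdiff i f))" "continuous_on UNIV (pdiff i (pdiff i f))"
  using assms C_k_Suc_has_pd[of 1 f i] C_k_Suc_has_pd[of 0 "pdiff i f" i] by (auto simp: numeral_2_eq_2)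

lemma laplacian_facts:
  assumes f: "C_k 2 f" "periodic f"
  shows "continuous_on UNIV (laplacian f)" "periodic (laplacian f)"
    "coef (laplacian f) k = - of_real (ksq k) * coef f k"
proof -
  have eq: "laplacian f = (\<lambda>x. \<Sum>i\<in>UNIV. pdiff i (pdiff i f) x)" by (simp add: fun_eq_iff laplacian_def)
  show "continuous_on UNIV (laplacian f)" unfolding eq by (intro continuous_intros C_k_2[OF f(1)])
  have "periodic (pdiff i (pdiff i f))" for i by (intro periodic_pdiff f)
  then show "periodic (laplacian f)" unfolding eq periodic_def by simp
  have c: "coef (pdiff i (pdiff i f)) k = - of_real ((of_int (kc k i))\<^sup>2) * coef f k" for i
    using coef_pd[OF C_k_2(1)[OF f(1)] f(2) C_k_2(2)[OF f(1), of i] C_k_2(3)[OF f(1), of i], of k]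
      coef_pd[OF C_k_2(3)[OF f(1)] periodic_pdiff[OF f(2)] C_k_2(4)[OF f(1), of i] C_k_2(5)[OF f(1), of i], of k]
    by (simp add: power2_eq_square algebra_simps)
  have "coef (laplacian f) k = (\<Sum>i\<in>UNIV. coef (pdiff i (pdiff i f)) k)"
    unfolding eq coef_def sum_distrib_right sum_divide_distrib[symmetric]
    by (subst Bochner_Integration.integral_sum) (auto intro!: integrable_continuous_Omega continuous_intros C_k_2[OF f(1)])
  then show "coef (laplacian f) k = - of_real (ksq k) * coef f k"
    by (simp add: c ksq_def sum_distrib_right sum_negf)
qed

lemma Hb_0_L2:
  assumes "f \<in> L2" shows "Hb 0 f ((LINT x|lebesgue_on Omega. (cmod (f x))\<^sup>2) / (2 * pi) ^ 3)"
  using bessel[OF assms] by (simp add: wb_def)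

text \<open>Control of \<open>f\<close> and of its Laplacian, of which \<open>g\<close> is any majorant, is control of two more derivatives of
\<open>f\<close>, since \<open>(wt k)\<^sup>2\<close> is comparable with \<open>1 + ksq k\<close>.\<close>

lemma elliptic_gain:
  assumes A: "Hb r f A" and B: "Hb r g B" and g: "\<And>k. ksq k * cmod (coef f k) \<le> cmod (coef g k)"
  shows "Hb (r + 2) f (32 * (A + B))"
  unfolding wb_def
proof (intro allI impI)
  fix F :: "freq set" assume F: "finite F"
  have "(\<Sum>k\<in>F. (wt k ^ (r + 2) * cmod (coef f k))\<^sup>2) \<le> (\<Sum>k\<in>F. 32 * ((wt k ^ r * cmod (coef f k))\<^sup>2 + (wt k ^ r * cmod (coef g k))\<^sup>2))"
  proof (rule sum_mono)
    fix k
    have "(wt k)\<^sup>2 * cmod (coef f k) \<le> 4 * (1 + ksq k) * cmod (coef f k)" by (intro mult_right_mono wt_sq_le) auto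
    also have "\<dots> \<le> 4 * cmod (coef f k) + 4 * cmod (coef g k)" using g[of k] by (simp add: algebra_simps)
    finally have "((wt k)\<^sup>2 * cmod (coef f k))\<^sup>2 \<le> (4 * cmod (coef f k) + 4 * cmod (coef g k))\<^sup>2"
      by (rule power_mono) simp
    also have "\<dots> \<le> 32 * ((cmod (coef f k))\<^sup>2 + (cmod (coef g k))\<^sup>2)"
      using sum_squares_bound[of "cmod (coef f k)" "cmod (coef g k)"] by (simp add: power2_eq_square algebra_simps)
    finally have "(wt k ^ r)\<^sup>2 * ((wt k)\<^sup>2 * cmod (coef f k))\<^sup>2 \<le> (wt k ^ r)\<^sup>2 * (32 * ((cmod (coef f k))\<^sup>2 + (cmod (coef g k))\<^sup>2))"
      by (rule mult_left_mono) simp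
    then show "(wt k ^ (r + 2) * cmod (coef f k))\<^sup>2 \<le> 32 * ((wt k ^ r * cmod (coef f k))\<^sup>2 + (wt k ^ r * cmod (coef g k))\<^sup>2)"
      by (simp add: power_mult_distrib power_add algebra_simps)
  qed
  also have "\<dots> = 32 * ((\<Sum>k\<in>F. (wt k ^ r * cmod (coef f k))\<^sup>2) + (\<Sum>k\<in>F. (wt k ^ r * cmod (coef g k))\<^sup>2))"
    by (simp only: sum_distrib_left[symmetric] sum.distrib)
  also have "\<dots> \<le> 32 * (A + B)" using A B F by (intro mult_left_mono add_mono) (auto simp: wb_def)
  finally show "(\<Sum>k\<in>F. (wt k ^ (r + 2) * cmod (coef f k))\<^sup>2) \<le> 32 * (A + B)" .
qed

lemma C_k_2_reg:
  assumes f: "C_k 2 f" "periodic f" shows "reg f"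
proof -
  have 1: "Hb 0 f ((LINT x|lebesgue_on Omega. (cmod (f x))\<^sup>2) / (2 * pi) ^ 3)"
    by (rule Hb_0_L2[OF continuous_L2[OF C_k_2(1)[OF f(1)]]])
  have 2: "Hb 0 (laplacian f) ((LINT x|lebesgue_on Omega. (cmod (laplacian f x))\<^sup>2) / (2 * pi) ^ 3)"
    by (rule Hb_0_L2[OF continuous_L2[OF laplacian_facts(1)[OF f]]])
  have "\<exists>C. Hb 2 f C"
  proof
    show "Hb 2 f (32 * ((LINT x|lebesgue_on Omega. (cmod (f x))\<^sup>2) / (2 * pi) ^ 3 + (LINT x|lebesgue_on Omega. (cmod (laplacian f x))\<^sup>2) / (2 * pi) ^ 3))"
      using elliptic_gain[OF 1 2] by (simp only: laplacian_facts(3)[OF f] norm_mult norm_minus_cancel norm_of_real abs_of_nonneg[OF ksq_nonneg] one_add_one[symmetric] add_0)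
  qed
  then show ?thesis using f C_k_2(1)[OF f(1)] by (simp add: reg_def)
qed

lemma wb_add:
  "continuous_on UNIV f \<Longrightarrow> continuous_on UNIV g \<Longrightarrow> wb \<theta> f A \<Longrightarrow> wb \<theta> g B \<Longrightarrow>
    wb \<theta> (\<lambda>x. f x + g x) (2 * A + 2 * B)"
  by (rule wb_add_coef) (auto simp: coef_add_cont norm_triangle_ineq)

lemma wb_scale: "wb \<theta> f A \<Longrightarrow> wb \<theta> (\<lambda>x. c * f x) ((cmod c)\<^sup>2 * A)"
  by (rule wb_scale_coef) (auto simp: coef_scale norm_mult)

lemma reg_lincomb:
  assumes "reg f" "reg g" shows "reg (\<lambda>x. a * f x + b * g x)"
proof -
  obtain A B where "Hb 2 f A" "Hb 2 g B" using assms by (auto simp: reg_def)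
  then have "Hb 2 (\<lambda>x. a * f x + b * g x) (2 * ((cmod a)\<^sup>2 * A) + 2 * ((cmod b)\<^sup>2 * B))"
    using assms by (intro wb_add wb_scale) (auto intro!: continuous_intros simp: reg_def)
  then show ?thesis using assms by (auto simp: reg_def periodic_def intro!: continuous_intros)
qed

lemma reg_diff: "reg f \<Longrightarrow> reg g \<Longrightarrow> reg (\<lambda>x. f x - g x)"
  using reg_lincomb[of f g 1 "-1"] by simp

lemma reg_cnj: "reg f \<Longrightarrow> reg (\<lambda>x. cnj (f x))"
  by (auto simp: reg_def periodic_def intro!: continuous_intros intro: Hb_cnj)

section \<open>The cubic nonlinearity\<close>

definition cub :: "(real^3 \<Rightarrow> complex) \<Rightarrow> real^3 \<Rightarrow> complex" where
  "cub w x = w x * (w x * cnj (w x))"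

lemma continuous_cub: "continuous_on UNIV w \<Longrightarrow> continuous_on UNIV (cub w)"
  unfolding cub_def by (intro continuous_intros)

lemma periodic_cub: "periodic w \<Longrightarrow> periodic (cub w)"
  by (simp add: periodic_def cub_def)

lemma cub_cmod: "of_real ((cmod (w x))\<^sup>2) * w x = cub w x"
  by (simp only: cub_def complex_norm_square) (simp add: mult_ac)

lemma cub_Hb:
  assumes w: "reg w" and C: "Hb r w C" and r: "r \<ge> 2"
  shows "Hb r (cub w) ((4 ^ r * 2 * S\<^sub>w)\<^sup>2 * C ^ 3)"
proof -
  have wc: "continuous_on UNIV w" using w by (rule reg_continuous)
  have "Hb r (\<lambda>x. w x * (w x * cnj (w x))) (4 ^ r * 2 * S\<^sub>w * C * (4 ^ r * 2 * S\<^sub>w * C * C))"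
    by (intro Hb_mult_algebra w C r Hb_cnj continuous_intros wc)
  then show ?thesis by (simp add: cub_def[abs_def] power2_eq_square power3_eq_cube mult_ac)
qed

text \<open>The Lipschitz constant of the cubic map on balls of \<open>Hb (r + 2)\<close>, measured in \<open>Hb r\<close>.\<close>

definition KL :: "nat \<Rightarrow> real \<Rightarrow> real" where
  "KL r C = 10 * (S\<^sub>w * (4 ^ (r + 2) * 2 * S\<^sub>w * C * C))"

lemma cub_diff_Hb:
  assumes w: "reg w" "reg z" and C: "Hb (r + 2) w C" "Hb (r + 2) z C" and D: "Hb r (\<lambda>x. w x - z x) D"
  shows "Hb r (\<lambda>x. cub w x - cub z x) (KL r C * D)"
proof -
  have wc: "continuous_on UNIV w" "continuous_on UNIV z" using w by (auto intro: reg_continuous)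
  have rd: "reg (\<lambda>x. w x - z x)" by (rule reg_diff[OF w])
  have rd': "reg (\<lambda>x. cnj (w x - z x))" by (rule reg_cnj[OF rd])
  define X where "X = S\<^sub>w * D * (4 ^ (r + 2) * 2 * S\<^sub>w * C * C)"
  have 1: "Hb r (\<lambda>x. (w x - z x) * (w x * cnj (w x))) X"
    unfolding X_def by (intro Hb_mult_module[OF rd] Hb_mult_algebra w C D Hb_cnj continuous_intros wc) auto
  have 2: "Hb r (\<lambda>x. (w x - z x) * (z x * cnj (w x))) X"
    unfolding X_def by (intro Hb_mult_module[OF rd] Hb_mult_algebra w C D Hb_cnj continuous_intros wc) auto
  have 3: "Hb r (\<lambda>x. cnj (w x - z x) * (z x * z x)) X"
    unfolding X_def by (intro Hb_mult_module[OF rd'] Hb_mult_algebra w C D Hb_cnj continuous_intros wc) auto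
  have "Hb r (\<lambda>x. ((w x - z x) * (w x * cnj (w x)) + (w x - z x) * (z x * cnj (w x))) + cnj (w x - z x) * (z x * z x))
     (2 * (2 * X + 2 * X) + 2 * X)"
    by (intro wb_add 1 2 3 continuous_intros wc)
  also have "(\<lambda>x. ((w x - z x) * (w x * cnj (w x)) + (w x - z x) * (z x * cnj (w x))) + cnj (w x - z x) * (z x * z x))
      = (\<lambda>x. cub w x - cub z x)"
    by (rule ext) (simp add: cub_def algebra_simps)
  finally show ?thesis by (simp add: KL_def X_def mult_ac)
qed

section \<open>Mean value inequalities\<close>

text \<open>Testing against arbitrary finite sequences reduces square sums of vector-valued remainders to
scalar ones, for which the mean value inequality and Taylor expansions are available.\<close>

lemma dual_bound:
  fixes x :: "'k \<Rightarrow> complex"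
  assumes B: "0 \<le> B" and y: "\<And>y. cmod (\<Sum>k\<in>F. y k * x k) \<le> sqrt (\<Sum>k\<in>F. (cmod (y k))\<^sup>2) * B"
  shows "(\<Sum>k\<in>F. (cmod (x k))\<^sup>2) \<le> B\<^sup>2"
proof -
  define X where "X = (\<Sum>k\<in>F. (cmod (x k))\<^sup>2)"
  have X0: "0 \<le> X" by (simp add: X_def sum_nonneg)
  have "(\<Sum>k\<in>F. cnj (x k) * x k) = of_real X"
    unfolding X_def of_real_sum by (rule sum.cong) (auto simp: complex_norm_square[symmetric] mult.commute)
  then have "cmod (\<Sum>k\<in>F. cnj (x k) * x k) = X" using X0 by (simp only: norm_of_real abs_of_nonneg)
  with y[of "\<lambda>k. cnj (x k)"] have "X \<le> sqrt X * B" by (simp only: complex_mod_cnj X_def)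
  then have "sqrt X * sqrt X \<le> sqrt X * B" using X0 by simp
  then have "sqrt X \<le> B"
    using B X0 mult_le_cancel_left_pos[of "sqrt X" "sqrt X" B] by (cases "X = 0") (simp_all del: real_sqrt_mult_self)
  then have "(sqrt X)\<^sup>2 \<le> B\<^sup>2" using X0 by (intro power_mono) auto
  then show ?thesis using X0 by (simp add: X_def)
qed

lemma pairing_bound:
  fixes x y :: "'k \<Rightarrow> complex"
  assumes "(\<Sum>k\<in>F. (cmod (x k))\<^sup>2) \<le> C"
  shows "cmod (\<Sum>k\<in>F. y k * x k) \<le> sqrt (\<Sum>k\<in>F. (cmod (y k))\<^sup>2) * sqrt C"
proof -
  have "cmod (\<Sum>k\<in>F. y k * x k) \<le> (\<Sum>k\<in>F. cmod (y k) * cmod (x k))"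
    by (rule order_trans[OF norm_sum]) (simp add: norm_mult)
  also have "\<dots> \<le> sqrt ((\<Sum>k\<in>F. (cmod (y k))\<^sup>2) * (\<Sum>k\<in>F. (cmod (x k))\<^sup>2))"
    by (rule real_le_rsqrt[OF Cauchy_Schwarz_ineq_sum])
  also have "\<dots> \<le> sqrt ((\<Sum>k\<in>F. (cmod (y k))\<^sup>2) * C)"
    using assms by (intro real_sqrt_le_mono mult_left_mono sum_nonneg) auto
  finally show ?thesis by (simp add: real_sqrt_mult)
qed

lemma scalar_mvt:
  fixes \<phi> \<phi>' :: "real \<Rightarrow> complex"
  assumes "\<And>t. t \<in> {a..b} \<Longrightarrow> (\<phi> has_vector_derivative \<phi>' t) (at t within {a..b})"
    and "\<And>t. t \<in> {a..b} \<Longrightarrow> cmod (\<phi>' t) \<le> B" and "a \<le> b"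
  shows "cmod (\<phi> b - \<phi> a) \<le> B * (b - a)"
proof -
  have "norm (\<phi> b - \<phi> a) \<le> B * norm (b - a)"
  proof (rule differentiable_bound[of "{a..b}" \<phi> "\<lambda>t h. h *\<^sub>R \<phi>' t"])
    fix t assume t: "t \<in> {a..b}"
    show "(\<phi> has_derivative (\<lambda>h. h *\<^sub>R \<phi>' t)) (at t within {a..b})"
      using assms(1)[OF t] by (simp add: has_vector_derivative_def)
    show "onorm (\<lambda>h. h *\<^sub>R \<phi>' t) \<le> B"
      by (rule onorm_le) (use mult_right_mono[OF assms(2)[OF t] abs_ge_zero] in \<open>auto simp: mult.commute\<close>)
  qed (use assms in auto)
  then show ?thesis using assms(3) by simp
qed

text \<open>A mean value inequality in a weighted square-summable space, from the scalar one by duality.\<close>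

lemma mvt_l2:
  fixes \<phi> \<psi> :: "real \<Rightarrow> 'k \<Rightarrow> complex" and \<theta> :: "'k \<Rightarrow> real"
  assumes d: "\<And>t k. t \<in> {a..b} \<Longrightarrow> ((\<lambda>t. \<phi> t k) has_vector_derivative \<psi> t k) (at t within {a..b})"
    and C: "\<And>t. t \<in> {a..b} \<Longrightarrow> (\<Sum>k\<in>F. (\<theta> k * cmod (\<psi> t k))\<^sup>2) \<le> C" and ab: "a \<le> b"
  shows "(\<Sum>k\<in>F. (\<theta> k * cmod (\<phi> b k - \<phi> a k))\<^sup>2) \<le> C * (b - a)\<^sup>2"
proof -
  have C0: "0 \<le> C" proof -
    have "0 \<le> (\<Sum>k\<in>F. (\<theta> k * cmod (\<psi> a k))\<^sup>2)" by (intro sum_nonneg) auto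
    also have "\<dots> \<le> C" using ab by (intro C) auto
    finally show ?thesis .
  qed
  have "(\<Sum>k\<in>F. (cmod (of_real (\<theta> k) * (\<phi> b k - \<phi> a k)))\<^sup>2) \<le> (sqrt C * (b - a))\<^sup>2"
  proof (rule dual_bound)
    show "0 \<le> sqrt C * (b - a)" using C0 ab by simp
    fix y :: "'k \<Rightarrow> complex"
    have "cmod ((\<Sum>k\<in>F. y k * (of_real (\<theta> k) * \<phi> b k)) - (\<Sum>k\<in>F. y k * (of_real (\<theta> k) * \<phi> a k)))
       \<le> (sqrt (\<Sum>k\<in>F. (cmod (y k))\<^sup>2) * sqrt C) * (b - a)"
    proof (rule scalar_mvt[OF _ _ ab])
      fix t assume t: "t \<in> {a..b}"
      show "((\<lambda>t. \<Sum>k\<in>F. y k * (of_real (\<theta> k) * \<phi> t k)) has_vector_derivative (\<Sum>k\<in>F. y k * (of_real (\<theta> k) * \<psi> t k))) (at t within {a..b})"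
        by (intro has_vector_derivative_sum has_vector_derivative_mult_right d t)
      show "cmod (\<Sum>k\<in>F. y k * (of_real (\<theta> k) * \<psi> t k)) \<le> sqrt (\<Sum>k\<in>F. (cmod (y k))\<^sup>2) * sqrt C"
        by (rule pairing_bound) (use C[OF t] in \<open>simp add: norm_mult power_mult_distrib\<close>)
    qed
    then show "cmod (\<Sum>k\<in>F. y k * (of_real (\<theta> k) * (\<phi> b k - \<phi> a k))) \<le> sqrt (\<Sum>k\<in>F. (cmod (y k))\<^sup>2) * (sqrt C * (b - a))"
      by (simp add: sum_subtractf right_diff_distrib mult.assoc)
  qed
  then show ?thesis using C0 by (simp add: norm_mult power_mult_distrib)
qed

section \<open>Time regularity in terms of Fourier coefficients\<close>

lemma H_p_diff_quot:
  assumes H: "v r \<in> H_p s" "v t \<in> H_p s" "v' t \<in> H_p s" and m: "m = nat \<lfloor>s\<rfloor>"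
  shows "fder m (\<lambda>x. (v r x - v t x) /\<^sub>R (r - t) - v' t x)"
    "coef (\<lambda>x. (v r x - v t x) /\<^sub>R (r - t) - v' t x) k = (coef (v r) k - coef (v t) k) /\<^sub>R (r - t) - coef (v' t) k"
proof -
  have f: "fder m (v r)" "fder m (v t)" "fder m (v' t)" using H m by (auto intro: H_p_fder)
  have L: "integrable (lebesgue_on Omega) (v r)" "integrable (lebesgue_on Omega) (v t)" "integrable (lebesgue_on Omega) (v' t)"
    using f by (auto simp: fder_def intro: L2_integrable)
  have eq: "(\<lambda>x. (v r x - v t x) /\<^sub>R (r - t) - v' t x) =
     (\<lambda>x. 1 * (of_real (inverse (r - t)) * v r x + (- of_real (inverse (r - t))) * v t x) + (-1) * v' t x)"
    by (rule ext) (simp add: scaleR_conv_of_real algebra_simps)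
  show "fder m (\<lambda>x. (v r x - v t x) /\<^sub>R (r - t) - v' t x)"
    unfolding eq by (intro fder_lincomb f)
  have L': "integrable (lebesgue_on Omega) (\<lambda>x. of_real (inverse (r - t)) * v r x + (- of_real (inverse (r - t))) * v t x)"
    by (intro Bochner_Integration.integrable_add integrable_mult_right L)
  show "coef (\<lambda>x. (v r x - v t x) /\<^sub>R (r - t) - v' t x) k = (coef (v r) k - coef (v t) k) /\<^sub>R (r - t) - coef (v' t) k"
    unfolding eq by (simp only: coef_lincomb[OF L' L(3)] coef_lincomb[OF L(1,2)])
      (simp add: scaleR_conv_of_real algebra_simps)
qed

lemma fder_Hb: "fder m f \<Longrightarrow> m \<le> nat \<lfloor>s\<rfloor> \<Longrightarrow> Hb m f ((4 ^ m * 2 * sobolev_norm s f)\<^sup>2)"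
  using fder_sobolev_bound by (simp add: wb_def)

lemma Hb_coef: "Hb r f C \<Longrightarrow> cmod (coef f k) \<le> sqrt C"
proof -
  assume "Hb r f C"
  then have "Hb 0 f C" by (rule Hb_le) simp
  then have "(\<Sum>k\<in>{k}. (wt k ^ 0 * cmod (coef f k))\<^sup>2) \<le> C" unfolding wb_def by blast
  then show ?thesis by (simp add: real_le_rsqrt)
qed

lemma scaleR_divide_diff: "c \<noteq> 0 \<Longrightarrow> c *\<^sub>R (X /\<^sub>R c - Y) = X - c *\<^sub>R (Y :: complex)"
  by (simp add: scaleR_right_diff_distrib)

text \<open>Convergence of difference quotients in the Sobolev norm implies their convergence coefficientwise,
and in the weighted square sums of order \<open>m\<close>.\<close>

lemma time_derivative_coef:
  assumes H: "\<And>t. t \<in> {0..T} \<Longrightarrow> v t \<in> H_p s" "\<And>t. t \<in> {0..T} \<Longrightarrow> v' t \<in> H_p s" and m: "m = nat \<lfloor>s\<rfloor>"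
    and lim: "((\<lambda>r. sobolev_norm s (\<lambda>x. (v r x - v t x) /\<^sub>R (r - t) - v' t x)) \<longlongrightarrow> 0) (at t within {0..T})"
    and t: "t \<in> {0..T}"
  shows "((\<lambda>r. coef (v r) k) has_vector_derivative coef (v' t) k) (at t within {0..T})"
    and "e > 0 \<Longrightarrow> \<forall>\<^sub>F r in at t within {0..T}. Hb m (\<lambda>x. (v r x - v t x) /\<^sub>R (r - t) - v' t x) e"
    and "e > 0 \<Longrightarrow> \<forall>\<^sub>F r in at t within {0..T}. Hb m (\<lambda>x. v r x - v t x) e"
proof -
  define n where "n r = sobolev_norm s (\<lambda>x. (v r x - v t x) /\<^sub>R (r - t) - v' t x)" for r
  have hb: "Hb m (\<lambda>x. (v r x - v t x) /\<^sub>R (r - t) - v' t x) ((4 ^ m * 2 * n r)\<^sup>2)" if "r \<in> {0..T}" for r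
    unfolding n_def by (rule fder_Hb) (use that t H m in \<open>auto intro: H_p_diff_quot(1)\<close>)
  have inT: "\<forall>\<^sub>F r in at t within {0..T}. r \<in> {0..T} \<and> r \<noteq> t" by (simp add: eventually_at_filter)
  have nl: "(n \<longlongrightarrow> 0) (at t within {0..T})" using lim by (simp add: n_def[abs_def])
  show "((\<lambda>r. coef (v r) k) has_vector_derivative coef (v' t) k) (at t within {0..T})"
    unfolding has_vector_derivative_def has_derivative_within
  proof (intro conjI bounded_linear_scaleR_left)
    have "((\<lambda>r. (4 ^ m * 2 * n r)) \<longlongrightarrow> 4 ^ m * 2 * 0) (at t within {0..T})" by (intro tendsto_intros nl)
    then have "((\<lambda>r. (4 ^ m * 2 * n r)) \<longlongrightarrow> 0) (at t within {0..T})" by simp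
    then show "((\<lambda>r. (1 / norm (r - t)) *\<^sub>R (coef (v r) k - (coef (v t) k + (r - t) *\<^sub>R coef (v' t) k))) \<longlongrightarrow> 0) (at t within {0..T})"
    proof (rule tendsto_norm_zero_cancel[OF Lim_null_comparison, rotated])
      show "\<forall>\<^sub>F r in at t within {0..T}. norm (norm ((1 / norm (r - t)) *\<^sub>R (coef (v r) k - (coef (v t) k + (r - t) *\<^sub>R coef (v' t) k)))) \<le> 4 ^ m * 2 * n r"
        using inT
      proof eventually_elim
        case (elim r)
        have "coef (v r) k - (coef (v t) k + (r - t) *\<^sub>R coef (v' t) k) = (r - t) *\<^sub>R ((coef (v r) k - coef (v t) k) /\<^sub>R (r - t) - coef (v' t) k)"
          using elim by (subst scaleR_divide_diff) auto
        then have "norm (norm ((1 / norm (r - t)) *\<^sub>R (coef (v r) k - (coef (v t) k + (r - t) *\<^sub>R coef (v' t) k))))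
            = norm ((coef (v r) k - coef (v t) k) /\<^sub>R (r - t) - coef (v' t) k)"
          using elim by simp
        also have "\<dots> = cmod (coef (\<lambda>x. (v r x - v t x) /\<^sub>R (r - t) - v' t x) k)"
          using H_p_diff_quot(2)[where v = v and v' = v' and r = r and t = t, OF H(1)[of r] H(1)[OF t] H(2)[OF t] m, of k] elim by simp
        also have "\<dots> \<le> sqrt ((4 ^ m * 2 * n r)\<^sup>2)" by (rule Hb_coef[OF hb]) (use elim in auto)
        also have "\<dots> = 4 ^ m * 2 * n r" by (simp add: n_def sobolev_norm_nonneg)
        finally show ?case .
      qed
    qed
  qed
  show q: "\<forall>\<^sub>F r in at t within {0..T}. Hb m (\<lambda>x. (v r x - v t x) /\<^sub>R (r - t) - v' t x) e" if e: "e > 0" for e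
  proof -
    have "((\<lambda>r. (4 ^ m * 2 * n r)\<^sup>2) \<longlongrightarrow> (4 ^ m * 2 * 0)\<^sup>2) (at t within {0..T})" by (intro tendsto_intros nl)
    then have "\<forall>\<^sub>F r in at t within {0..T}. (4 ^ m * 2 * n r)\<^sup>2 < e" using e by (intro order_tendstoD(2)) auto
    with inT show ?thesis by eventually_elim (auto intro: wb_mono[OF hb])
  qed
  show "\<forall>\<^sub>F r in at t within {0..T}. Hb m (\<lambda>x. v r x - v t x) e" if e: "e > 0" for e
  proof -
    have f': "Hb m (v' t) ((4 ^ m * 2 * sobolev_norm s (v' t))\<^sup>2)"
      by (rule fder_Hb) (use m H t in \<open>auto intro: H_p_fder\<close>)
    define N where "N = (4 ^ m * 2 * sobolev_norm s (v' t))\<^sup>2"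
    have "((\<lambda>r. (r - t)\<^sup>2 * (2 * 1 + 2 * N)) \<longlongrightarrow> (t - t)\<^sup>2 * (2 * 1 + 2 * N)) (at t within {0..T})"
      by (intro tendsto_intros)
    then have "\<forall>\<^sub>F r in at t within {0..T}. (r - t)\<^sup>2 * (2 * 1 + 2 * N) < e"
      using e by (intro order_tendstoD(2)) auto
    with inT q[of 1, simplified] show ?thesis
    proof eventually_elim
      case (elim r)
      have r: "r \<in> {0..T}" "r \<noteq> t" using elim by auto
      have fd: "v r \<in> L2" "v t \<in> L2" using H_p_fder[OF H(1)[OF r(1)], of m] H_p_fder[OF H(1)[OF t], of m] m by (auto simp: fder_def)
      have "Hb m (\<lambda>x. v r x - v t x) ((\<bar>r - t\<bar>)\<^sup>2 * (2 * 1 + 2 * N))"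
      proof -
        define D where "D k = coef (\<lambda>x. (v r x - v t x) /\<^sub>R (r - t) - v' t x) k" for k
        have D: "coef (v r) k - coef (v t) k = (r - t) *\<^sub>R (D k + coef (v' t) k)" for k
          unfolding D_def H_p_diff_quot(2)[where v = v and v' = v' and r = r and t = t, OF H(1)[OF r(1)] H(1)[OF t] H(2)[OF t] m] using r by simp
        have s: "(\<Sum>k\<in>F. (wt k ^ m * (cmod (D k) + cmod (coef (v' t) k)))\<^sup>2) \<le> 2 * 1 + 2 * N" if F: "finite F" for F
        proof -
          have "(\<Sum>k\<in>F. (wt k ^ m * (cmod (D k) + cmod (coef (v' t) k)))\<^sup>2) \<le> (\<Sum>k\<in>F. 2 * (wt k ^ m * cmod (D k))\<^sup>2 + 2 * (wt k ^ m * cmod (coef (v' t) k))\<^sup>2)"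
          proof (rule sum_mono)
            fix k
            show "(wt k ^ m * (cmod (D k) + cmod (coef (v' t) k)))\<^sup>2 \<le> 2 * (wt k ^ m * cmod (D k))\<^sup>2 + 2 * (wt k ^ m * cmod (coef (v' t) k))\<^sup>2"
              using sum_squares_bound[of "wt k ^ m * cmod (D k)" "wt k ^ m * cmod (coef (v' t) k)"]
              by (simp add: power2_sum distrib_left)
          qed
          also have "\<dots> \<le> 2 * 1 + 2 * N"
            using elim(2) f' F by (simp add: sum.distrib sum_distrib_left[symmetric] wb_def D_def N_def add_mono)
          finally show ?thesis .
        qed
        show ?thesis unfolding wb_def
        proof (intro allI impI)
          fix F :: "freq set" assume F: "finite F"
          have "(\<Sum>k\<in>F. (wt k ^ m * cmod (coef (\<lambda>x. v r x - v t x) k))\<^sup>2) \<le> (\<Sum>k\<in>F. \<bar>r - t\<bar>\<^sup>2 * (wt k ^ m * (cmod (D k) + cmod (coef (v' t) k)))\<^sup>2)"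
          proof (rule sum_mono)
            fix k
            have "cmod (coef (\<lambda>x. v r x - v t x) k) \<le> \<bar>r - t\<bar> * (cmod (D k) + cmod (coef (v' t) k))"
              unfolding coef_diff[OF fd] D norm_scaleR by (intro mult_left_mono norm_triangle_ineq) auto
            then have "(wt k ^ m * cmod (coef (\<lambda>x. v r x - v t x) k))\<^sup>2 \<le> (wt k ^ m * (\<bar>r - t\<bar> * (cmod (D k) + cmod (coef (v' t) k))))\<^sup>2"
              by (intro power_mono mult_left_mono) auto
            then show "(wt k ^ m * cmod (coef (\<lambda>x. v r x - v t x) k))\<^sup>2 \<le> \<bar>r - t\<bar>\<^sup>2 * (wt k ^ m * (cmod (D k) + cmod (coef (v' t) k)))\<^sup>2"
              by (simp only: power_mult_distrib mult_ac)
          qed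
          also have "\<dots> \<le> \<bar>r - t\<bar>\<^sup>2 * (2 * 1 + 2 * N)"
            unfolding sum_distrib_left[symmetric] by (intro mult_left_mono s F) auto
          finally show "(\<Sum>k\<in>F. (wt k ^ m * cmod (coef (\<lambda>x. v r x - v t x) k))\<^sup>2) \<le> \<bar>r - t\<bar>\<^sup>2 * (2 * 1 + 2 * N)" .
        qed
      qed
      then show ?case by (rule wb_mono) (use elim in simp)
    qed
  qed
qed

text \<open>Compactness of the time interval, in the form of bisection.\<close>

lemma time_continuous_bounded:
  fixes v :: "real \<Rightarrow> real^3 \<Rightarrow> complex"
  assumes L: "\<And>t. t \<in> {0..T} \<Longrightarrow> v t \<in> L2"
    and C: "\<And>t. t \<in> {0..T} \<Longrightarrow> \<exists>C. Hb m (v t) C"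
    and cont: "\<And>t. t \<in> {0..T} \<Longrightarrow> \<forall>\<^sub>F r in at t within {0..T}. Hb m (\<lambda>x. v r x - v t x) 1" and T: "0 \<le> T"
  shows "\<exists>C. \<forall>t\<in>{0..T}. Hb m (v t) C"
proof -
  define P where "P a b \<longleftrightarrow> (\<exists>C. \<forall>t\<in>{a..b} \<inter> {0..T}. Hb m (v t) C)" for a b
  have "P 0 T"
  proof (rule Bolzano[OF T])
    fix a b c assume "P a b" "P b c" "a \<le> b" "b \<le> c"
    then obtain C D where "\<forall>t\<in>{a..b} \<inter> {0..T}. Hb m (v t) C" "\<forall>t\<in>{b..c} \<inter> {0..T}. Hb m (v t) D" by (auto simp: P_def)
    then have "\<forall>t\<in>{a..c} \<inter> {0..T}. Hb m (v t) (max C D)"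
      by (metis Int_iff atLeastAtMost_iff linear max.cobounded1 max.cobounded2 wb_mono)
    then show "P a c" by (auto simp: P_def)
  next
    fix t assume t: "0 \<le> t" "t \<le> T"
    then have tT: "t \<in> {0..T}" by simp
    obtain C0 where C0: "Hb m (v t) C0" using C[OF tT] by blast
    obtain d where d: "d > 0" "\<And>r. r \<in> {0..T} \<Longrightarrow> r \<noteq> t \<Longrightarrow> dist r t < d \<Longrightarrow> Hb m (\<lambda>x. v r x - v t x) 1"
      using cont[OF tT] unfolding eventually_at by blast
    have "P a b" if ab: "a \<le> t" "t \<le> b" "b - a < d" for a b
      unfolding P_def
    proof (intro exI ballI)
      fix r assume r: "r \<in> {a..b} \<inter> {0..T}"
      show "Hb m (v r) (2 * 1 + 2 * C0)"
      proof (cases "r = t")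
        case True
        then show ?thesis using wb_mono[OF C0, of "2 * 1 + 2 * C0"] wb_nonneg[OF C0] by simp
      next
        case False
        have "dist r t < d" using r ab by (auto simp: dist_real_def)
        then have h: "Hb m (\<lambda>x. v r x - v t x) 1" using d r False by auto
        show ?thesis
        proof (rule wb_add_coef[OF h C0])
          fix k
          have "coef (v r) k = coef (\<lambda>x. v r x - v t x) k + coef (v t) k"
            using coef_diff[OF L L, of r t k] r tT by simp
          then show "cmod (coef (v r) k) \<le> cmod (coef (\<lambda>x. v r x - v t x) k) + cmod (coef (v t) k)"
            by (metis norm_triangle_ineq)
        qed
      qed
    qed
    then show "\<exists>d>0. \<forall>a b. a \<le> t \<and> t \<le> b \<and> b - a < d \<longrightarrow> P a b" using d by blast
  qed
  then show ?thesis by (auto simp: P_def)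
qed

section \<open>Smoothing: spatial regularity from time regularity\<close>

lemma vector_derivative_quotient:
  fixes f :: "real \<Rightarrow> complex"
  assumes "(f has_vector_derivative D) (at t within S)"
  shows "((\<lambda>r. (f r - f t) /\<^sub>R (r - t)) \<longlongrightarrow> D) (at t within S)"
proof -
  have "((\<lambda>r. (1 / norm (r - t)) *\<^sub>R (f r - (f t + (r - t) *\<^sub>R D))) \<longlongrightarrow> 0) (at t within S)"
    using assms by (simp add: has_vector_derivative_def has_derivative_within)
  then have "((\<lambda>r. norm ((1 / norm (r - t)) *\<^sub>R (f r - (f t + (r - t) *\<^sub>R D)))) \<longlongrightarrow> 0) (at t within S)"
    by (rule tendsto_norm_zero)
  then have "((\<lambda>r. norm ((f r - f t) /\<^sub>R (r - t) - D)) \<longlongrightarrow> 0) (at t within S)"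
  proof (rule Lim_transform_eventually)
    have "\<forall>\<^sub>F r in at t within S. r \<noteq> t" by (simp add: eventually_at_filter)
    then show "\<forall>\<^sub>F r in at t within S. norm ((1 / norm (r - t)) *\<^sub>R (f r - (f t + (r - t) *\<^sub>R D))) = norm ((f r - f t) /\<^sub>R (r - t) - D)"
    proof eventually_elim
      case (elim r)
      then have "f r - (f t + (r - t) *\<^sub>R D) = (r - t) *\<^sub>R ((f r - f t) /\<^sub>R (r - t) - D)"
        by (subst scaleR_divide_diff) auto
      then show ?case using elim by simp
    qed
  qed
  then have "((\<lambda>r. (f r - f t) /\<^sub>R (r - t) - D) \<longlongrightarrow> 0) (at t within S)"
    by (rule tendsto_norm_zero_cancel)
  then show ?thesis by (rule Lim_null[THEN iffD2])
qed

text \<open>What the time regularity with values in \<open>H_p s\<close> says about Fourier coefficients.  The functions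
\<open>v1\<close>, \<open>v2\<close>, \<open>v3\<close> are derivatives with respect to a norm that ignores null sets; they are related to
the pointwise equation only in \<open>link_pos\<close> and \<open>link\<close>.\<close>

locale nls_data =
  fixes \<beta> \<gamma> T :: real and \<psi>\<^sub>0 :: "real^3 \<Rightarrow> complex" and u :: "real \<Rightarrow> real^3 \<Rightarrow> complex"
    and v1 v2 v3 :: "real \<Rightarrow> real^3 \<Rightarrow> complex" and C0 :: real and m :: nat
  assumes gamma: "\<gamma> > 0" and T: "T > 0" and m: "m \<ge> 1"
    and sol: "nls_solution \<beta> \<gamma> T \<psi>\<^sub>0 u"
    and Hbu: "t \<in> {0..T} \<Longrightarrow> Hb m (u t) C0"
    and Hb1: "t \<in> {0..T} \<Longrightarrow> Hb m (v1 t) C0"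
    and Hb2: "t \<in> {0..T} \<Longrightarrow> Hb m (v2 t) C0"
    and Hb3: "t \<in> {0..T} \<Longrightarrow> Hb m (v3 t) C0"
    and D0: "t \<in> {0..T} \<Longrightarrow> ((\<lambda>r. coef (u r) k) has_vector_derivative coef (v1 t) k) (at t within {0..T})"
    and D1: "t \<in> {0..T} \<Longrightarrow> ((\<lambda>r. coef (v1 r) k) has_vector_derivative coef (v2 t) k) (at t within {0..T})"
    and D2: "t \<in> {0..T} \<Longrightarrow> ((\<lambda>r. coef (v2 r) k) has_vector_derivative coef (v3 t) k) (at t within {0..T})"
    and Q: "t \<in> {0..T} \<Longrightarrow> e > 0 \<Longrightarrow> \<forall>\<^sub>F r in at t within {0..T}. Hb m (\<lambda>x. (u r x - u t x) /\<^sub>R (r - t) - v1 t x) e"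
    and L1: "t \<in> {0..T} \<Longrightarrow> v1 t \<in> L2"
begin

lemma C0: "0 \<le> C0" using Hbu[of 0] T by (auto intro: wb_nonneg)

definition cc :: "real \<Rightarrow> complex" where "cc t = of_real (\<beta> * exp (- 2 * \<gamma> * t))"

definition fn :: "real \<Rightarrow> real^3 \<Rightarrow> complex" where "fn t x = cc t * cub (u t) x"

text \<open>The time derivative that the equation prescribes.\<close>

definition ut :: "real \<Rightarrow> real^3 \<Rightarrow> complex" where "ut t x = \<i> * (laplacian (u t) x + fn t x)"

lemma fn_eq: "of_real (\<beta> * exp (- 2 * \<gamma> * t) * (cmod (u t x))\<^sup>2) * u t x = fn t x"
  unfolding fn_def cc_def cub_cmod[symmetric] by simp

lemma norm_cc: "t \<ge> 0 \<Longrightarrow> cmod (cc t) \<le> \<bar>\<beta>\<bar>"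
  using gamma unfolding cc_def norm_of_real by (simp add: abs_mult mult_left_le)

lemma cc_lipschitz: "0 \<le> a \<Longrightarrow> a \<le> b \<Longrightarrow> cmod (cc b - cc a) \<le> 2 * \<bar>\<beta>\<bar> * \<gamma> * (b - a)"
proof (rule scalar_mvt[where \<phi>' = "\<lambda>t. of_real (\<beta> * (exp (- 2 * \<gamma> * t) * (- 2 * \<gamma>)))"])
  fix t assume "0 \<le> a" "t \<in> {a..b}"
  have "((\<lambda>t. \<beta> * exp (- 2 * \<gamma> * t)) has_real_derivative \<beta> * (exp (- 2 * \<gamma> * t) * (- 2 * \<gamma>))) (at t within {a..b})"
    by (auto intro!: derivative_eq_intros)
  from has_vector_derivative_of_real[OF this]
  show "(cc has_vector_derivative of_real (\<beta> * (exp (- 2 * \<gamma> * t) * (- 2 * \<gamma>)))) (at t within {a..b})"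
    by (simp add: cc_def[abs_def])
  have "\<bar>\<beta>\<bar> * (exp (- (2 * \<gamma> * t)) * (2 * \<gamma>)) \<le> \<bar>\<beta>\<bar> * (1 * (2 * \<gamma>))"
    using gamma \<open>0 \<le> a\<close> \<open>t \<in> {a..b}\<close> by (intro mult_left_mono mult_right_mono) auto
  then show "cmod (of_real (\<beta> * (exp (- 2 * \<gamma> * t) * (- 2 * \<gamma>)))) \<le> 2 * \<bar>\<beta>\<bar> * \<gamma>"
    using gamma by (simp only: norm_of_real abs_mult) (simp add: mult_ac)
qed auto

lemma u_C2: "t \<in> {0..T} \<Longrightarrow> C_k 2 (u t)" and u_periodic: "t \<in> {0..T} \<Longrightarrow> periodic (u t)"
  using sol by (auto simp: nls_solution_def)

lemma u_reg: "t \<in> {0..T} \<Longrightarrow> reg (u t)"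
  by (intro C_k_2_reg u_C2 u_periodic)

lemma u_cont: "t \<in> {0..T} \<Longrightarrow> continuous_on UNIV (u t)"
  by (intro reg_continuous u_reg)

lemma fn_cont: "t \<in> {0..T} \<Longrightarrow> continuous_on UNIV (fn t)"
  unfolding fn_def by (intro continuous_intros continuous_cub u_cont)

lemma lap_cont: "t \<in> {0..T} \<Longrightarrow> continuous_on UNIV (laplacian (u t))"
  by (intro laplacian_facts u_C2 u_periodic)

lemma ut_cont: "t \<in> {0..T} \<Longrightarrow> continuous_on UNIV (ut t)"
  unfolding ut_def by (intro continuous_intros lap_cont fn_cont)

lemma ut_periodic: "t \<in> {0..T} \<Longrightarrow> periodic (ut t)"
  using laplacian_facts(2)[OF u_C2 u_periodic] periodic_cub[OF u_periodic]
  by (simp add: ut_def[abs_def] fn_def periodic_def)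

lemma coef_ut: "t \<in> {0..T} \<Longrightarrow> coef (ut t) k = \<i> * (- of_real (ksq k) * coef (u t) k + coef (fn t) k)"
  unfolding ut_def by (simp add: coef_scale coef_add_cont lap_cont fn_cont laplacian_facts(3)[OF u_C2 u_periodic])

lemma ut_pointwise:
  assumes t: "t \<in> {0<..T}" and x: "x \<in> Omega"
  shows "((\<lambda>r. u r x) has_vector_derivative ut t x) (at t within {0..T})"
proof -
  have d: "(\<lambda>r. u r x) differentiable (at t within {0..T})"
    and e: "\<i> * vector_derivative (\<lambda>r. u r x) (at t within {0..T}) + laplacian (u t) x
          + of_real (\<beta> * exp (- 2 * \<gamma> * t) * (cmod (u t x))\<^sup>2) * u t x = 0"
    using sol t x by (auto simp: nls_solution_def)
  let ?D = "vector_derivative (\<lambda>r. u r x) (at t within {0..T})"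
  have "\<i> * ?D = - (laplacian (u t) x + fn t x)"
    by (rule eq_neg_iff_add_eq_0[THEN iffD2]) (use e[unfolded fn_eq] in \<open>simp only: add.assoc\<close>)
  then have "\<i> * (\<i> * ?D) = \<i> * (- (laplacian (u t) x + fn t x))" by (simp only:)
  moreover have "\<i> * (\<i> * ?D) = - ?D" by (simp add: mult.assoc[symmetric])
  ultimately have "- ?D = \<i> * (- (laplacian (u t) x + fn t x))" by (simp only:)
  then have "?D = ut t x" unfolding ut_def by (metis minus_minus mult_minus_right)
  then show ?thesis using d by (simp add: vector_derivative_works)
qed

text \<open>The difference quotients of \<open>u\<close> converge to \<open>ut\<close> pointwise and to \<open>v1\<close> in the square mean.  Fatou's
lemma turns the Cauchy property in the square mean into closeness to the pointwise limit.\<close>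

lemma link_pos:
  assumes t: "t \<in> {0<..T}"
  shows "coef (ut t) k = coef (v1 t) k"
proof -
  have t': "t \<in> {0..T}" "t > 0" using t by auto
  define r where "r n = t - t / (real n + 2)" for n
  have rT: "r n \<in> {0..T}" and rt: "r n \<noteq> t" for n
  proof -
    have "t / (real n + 2) \<le> t" "t / (real n + 2) > 0" using t by (auto simp: field_simps)
    then show "r n \<in> {0..T}" "r n \<noteq> t" using t unfolding r_def by auto
  qed
  have "r \<longlonglongrightarrow> t - t * 0"
  proof -
    have "(\<lambda>n. inverse (real n + 2)) \<longlonglongrightarrow> 0"
      by (intro tendsto_inverse_0_at_top filterlim_at_top_mono[OF filterlim_real_sequentially]) auto
    then show ?thesis unfolding r_def divide_inverse by (intro tendsto_intros)
  qed
  then have rlim: "filterlim r (at t within {0..T}) sequentially"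
    unfolding filterlim_at using rT rt by auto
  define q where "q n x = (u (r n) x - u t x) /\<^sub>R (r n - t)" for n x
  have qeq: "q n = (\<lambda>x. of_real (inverse (r n - t)) * u (r n) x + (- of_real (inverse (r n - t))) * u t x)" for n
    by (rule ext) (simp add: q_def scaleR_conv_of_real algebra_simps)
  have qreg: "reg (q n)" for n unfolding qeq by (intro reg_lincomb u_reg rT t')
  have qcont: "continuous_on UNIV (q n)" for n by (rule reg_continuous[OF qreg])
  have qlim: "(\<lambda>n. q n x) \<longlonglongrightarrow> ut t x" if "x \<in> Omega" for x
    unfolding q_def
    by (rule filterlim_compose[OF vector_derivative_quotient[OF ut_pointwise[OF t that]] rlim])
  have fin: "cmod (coef (ut t) k - coef (v1 t) k) \<le> 3 * sqrt e" if e: "e > 0" for e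
  proof -
    have "\<forall>\<^sub>F n in sequentially. Hb m (\<lambda>x. q n x - v1 t x) e"
      unfolding q_def by (rule eventually_compose_filterlim[OF Q[OF t'(1) e] rlim])
    then obtain N where N: "\<And>n. n \<ge> N \<Longrightarrow> Hb m (\<lambda>x. q n x - v1 t x) e"
      by (auto simp: eventually_sequentially)
    have cq: "coef (\<lambda>x. q n x - v1 t x) k = coef (q n) k - coef (v1 t) k" for n k
      by (intro coef_diff continuous_L2 qcont L1 t')
    have qq: "(LINT x|lebesgue_on Omega. (cmod (q N x - q p x))\<^sup>2) \<le> (2 * pi) ^ 3 * (4 * e)" if "p \<ge> N" for p
    proof (rule parseval_le[OF reg_diff[OF qreg qreg]])
      have "Hb m (\<lambda>x. q N x - q p x) (2 * e + 2 * e)"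
      proof (rule wb_add_coef[OF N[OF order_refl] N[OF that]])
        fix k
        have "coef (\<lambda>x. q N x - q p x) k = (coef (q N) k - coef (v1 t) k) - (coef (q p) k - coef (v1 t) k)"
          by (simp add: coef_diff_cont qcont)
        then show "cmod (coef (\<lambda>x. q N x - q p x) k) \<le> cmod (coef (\<lambda>x. q N x - v1 t x) k) + cmod (coef (\<lambda>x. q p x - v1 t x) k)"
          unfolding cq by (metis norm_triangle_ineq4)
      qed
      then show "Hb 0 (\<lambda>x. q N x - q p x) (4 * e)" by (auto dest: Hb_le[where q = 0])
    qed
    let ?M = "lebesgue_on Omega"
    have int: "integrable ?M (\<lambda>x. (cmod (q N x - q p x))\<^sup>2)" for p
      by (intro integrable_continuous_Omega continuous_intros qcont)
    have intg: "integrable ?M (\<lambda>x. (cmod (q N x - ut t x))\<^sup>2)"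
      by (intro integrable_continuous_Omega continuous_intros qcont ut_cont t')
    \<comment> \<open>Fatou's lemma in \<open>p\<close>, with \<open>N\<close> fixed.\<close>
    have "(\<integral>\<^sup>+x. ennreal ((cmod (q N x - ut t x))\<^sup>2) \<partial>?M) = (\<integral>\<^sup>+x. liminf (\<lambda>p. ennreal ((cmod (q N x - q p x))\<^sup>2)) \<partial>?M)"
    proof (rule nn_integral_cong)
      fix x assume "x \<in> space ?M"
      then have x: "x \<in> Omega" by simp
      have "(\<lambda>p. ennreal ((cmod (q N x - q p x))\<^sup>2)) \<longlonglongrightarrow> ennreal ((cmod (q N x - ut t x))\<^sup>2)"
        by (intro tendsto_ennrealI tendsto_intros qlim x)
      then show "ennreal ((cmod (q N x - ut t x))\<^sup>2) = liminf (\<lambda>p. ennreal ((cmod (q N x - q p x))\<^sup>2))"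
        by (rule lim_imp_Liminf[OF sequentially_bot, symmetric])
    qed
    also have "\<dots> \<le> liminf (\<lambda>p. \<integral>\<^sup>+x. ennreal ((cmod (q N x - q p x))\<^sup>2) \<partial>?M)"
      by (rule nn_integral_liminf) (use int in \<open>auto dest: borel_measurable_integrable\<close>)
    also have "\<dots> \<le> ennreal ((2 * pi) ^ 3 * (4 * e))"
    proof (rule Liminf_le)
      show "\<forall>\<^sub>F p in sequentially. (\<integral>\<^sup>+x. ennreal ((cmod (q N x - q p x))\<^sup>2) \<partial>?M) \<le> ennreal ((2 * pi) ^ 3 * (4 * e))"
        using eventually_ge_at_top[of N]
        by eventually_elim (subst nn_integral_eq_integral[OF int], simp, intro ennreal_leI qq)
    qed simp
    finally have "ennreal (LINT x|?M. (cmod (q N x - ut t x))\<^sup>2) \<le> ennreal ((2 * pi) ^ 3 * (4 * e))"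
      by (subst (asm) nn_integral_eq_integral[OF intg]) auto
    then have I: "(LINT x|?M. (cmod (q N x - ut t x))\<^sup>2) \<le> (2 * pi) ^ 3 * (4 * e)"
      using e by (subst (asm) ennreal_le_iff) auto
    have "(\<Sum>k\<in>{k}. (cmod (coef (\<lambda>x. q N x - ut t x) k))\<^sup>2) \<le> (LINT x|?M. (cmod (q N x - ut t x))\<^sup>2) / (2 * pi) ^ 3"
      by (rule bessel) (intro continuous_L2 continuous_intros qcont ut_cont t', simp)
    also have "\<dots> \<le> 4 * e" using I by (simp add: divide_le_eq mult.commute)
    finally have "cmod (coef (q N) k - coef (ut t) k) \<le> sqrt (4 * e)"
      by (intro real_le_rsqrt) (simp add: coef_diff_cont[OF qcont ut_cont[OF t'(1)]])
    moreover have "cmod (coef (q N) k - coef (v1 t) k) \<le> sqrt e"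
      using Hb_coef[OF N[OF order_refl], of k] unfolding cq .
    moreover have "coef (ut t) k - coef (v1 t) k = (coef (q N) k - coef (v1 t) k) - (coef (q N) k - coef (ut t) k)" by simp
    ultimately show ?thesis
      using norm_triangle_ineq4[of "coef (q N) k - coef (v1 t) k" "coef (q N) k - coef (ut t) k"]
      by (simp add: real_sqrt_mult)
  qed
  have "cmod (coef (ut t) k - coef (v1 t) k) \<le> 0 + e" if "e > 0" for e
    using fin[of "(e / 3)\<^sup>2"] that by simp
  then have "cmod (coef (ut t) k - coef (v1 t) k) \<le> 0" by (rule field_le_epsilon)
  then show ?thesis by simp
qed

lemma coef_lap:
  assumes t: "t \<in> {0..T}" and l: "\<And>k. coef (ut t) k = coef (v1 t) k"
  shows "coef (laplacian (u t)) k = - \<i> * coef (v1 t) k - coef (fn t) k"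
proof -
  have "coef (v1 t) k = \<i> * (coef (laplacian (u t)) k + coef (fn t) k)"
    using l[of k] coef_ut[OF t, of k] laplacian_facts(3)[OF u_C2 u_periodic, OF t t, of k] by simp
  then have "- \<i> * coef (v1 t) k = (- \<i> * \<i>) * (coef (laplacian (u t)) k + coef (fn t) k)" by (simp add: mult.assoc)
  then show ?thesis by simp
qed

text \<open>The equation read as a Poisson equation for \<open>u t\<close>.\<close>

lemma gain:
  assumes t: "t \<in> {0..T}" and l: "\<And>k. coef (ut t) k = coef (v1 t) k"
    and A: "Hb r (u t) A" and B: "Hb r (v1 t) B" and F: "Hb r (fn t) F"
  shows "Hb (r + 2) (u t) (32 * (A + (2 * B + 2 * F)))"
proof (rule elliptic_gain[OF A, of "laplacian (u t)"])
  show "Hb r (laplacian (u t)) (2 * B + 2 * F)"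
  proof (rule wb_add_coef[OF B F])
    fix k
    show "cmod (coef (laplacian (u t)) k) \<le> cmod (coef (v1 t) k) + cmod (coef (fn t) k)"
      unfolding coef_lap[OF t l] using norm_triangle_ineq4[of "- \<i> * coef (v1 t) k" "coef (fn t) k"]
      by (simp add: norm_mult)
  qed
  show "ksq k * cmod (coef (u t) k) \<le> cmod (coef (laplacian (u t)) k)" for k
    by (simp add: laplacian_facts(3)[OF u_C2 u_periodic, OF t t] norm_mult ksq_nonneg)
qed

lemma fn_Hb: "t \<in> {0..T} \<Longrightarrow> Hb r (cub (u t)) A \<Longrightarrow> Hb r (fn t) (\<beta>\<^sup>2 * A)"
proof -
  assume t: "t \<in> {0..T}" and A: "Hb r (cub (u t)) A"
  have "(cmod (cc t))\<^sup>2 * A \<le> \<bar>\<beta>\<bar>\<^sup>2 * A"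
    using norm_cc[of t] t wb_nonneg[OF A] by (intro mult_right_mono power_mono) auto
  then show ?thesis unfolding fn_def by (intro wb_mono[OF wb_scale[OF A]]) simp
qed

text \<open>Order one is all that \<open>1 \<le> m\<close> guarantees at first, and in three dimensions the cube of such a function is not
square integrable with room to spare.  Each \<open>u t\<close> has some bound of order two, because it is
classical; the interpolated product estimate turns a bound \<open>C\<close> into \<open>P + C / 2\<close> with \<open>P\<close>
independent of \<open>t\<close>, and iterating removes the dependence on \<open>t\<close>.\<close>

lemma H2_bound_pos: "\<exists>C. \<forall>t\<in>{0<..T}. Hb 2 (u t) C"
proof -
  define G where "G = 2 * S\<^sub>w * C0 * C0"
  define q where "q = 64 * \<beta>\<^sup>2 * S\<^sub>w * G"
  have G: "0 \<le> G" and q: "0 \<le> q" using S\<^sub>w_nonneg C0 by (auto simp: G_def q_def)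
  define \<epsilon> where "\<epsilon> = 1 / (2 * q + 2)"
  have \<epsilon>: "0 < \<epsilon>" "\<epsilon> \<le> 1" "q * \<epsilon> \<le> 1 / 2" using q by (auto simp: \<epsilon>_def field_simps)
  define P where "P = 96 * C0 + q * (C0 / \<epsilon> ^ 7)"
  have "Hb 2 (u t) (2 * P)" if t: "t \<in> {0<..T}" for t
  proof -
    have t': "t \<in> {0..T}" using t by auto
    have step: "Hb 2 (u t) (P + C / 2)" if C: "Hb 2 (u t) C" for C
    proof -
      have H1: "Hb 1 (u t) C0" and H0: "Hb 0 (u t) C0" "Hb 0 (v1 t) C0"
        by (rule Hb_le[OF Hbu[OF t']] Hb_le[OF Hb1[OF t']], use m in simp)+
      have "Hb 0 (\<lambda>x. u t x * cnj (u t x)) G"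
        unfolding G_def by (intro Hb_mult_11 u_reg t' H1 Hb_cnj continuous_intros u_cont)
      then have "Hb 0 (\<lambda>x. u t x * (u t x * cnj (u t x))) (S\<^sub>w * (\<epsilon> * C + C0 / \<epsilon> ^ 7) * G)"
        by (intro Hb_mult_interp u_reg t' C H0 \<epsilon> continuous_intros u_cont)
      then have "Hb 0 (fn t) (\<beta>\<^sup>2 * (S\<^sub>w * (\<epsilon> * C + C0 / \<epsilon> ^ 7) * G))"
        by (intro fn_Hb t') (simp add: cub_def[abs_def])
      from gain[OF t' link_pos[OF t] H0 this]
      have h: "Hb 2 (u t) (32 * (C0 + (2 * C0 + 2 * (\<beta>\<^sup>2 * (S\<^sub>w * (\<epsilon> * C + C0 / \<epsilon> ^ 7) * G)))))" by (simp only: add_0)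
      have "32 * (C0 + (2 * C0 + 2 * (\<beta>\<^sup>2 * (S\<^sub>w * (\<epsilon> * C + C0 / \<epsilon> ^ 7) * G)))) = P + (q * \<epsilon>) * C"
        by (simp add: P_def q_def algebra_simps)
      also have "\<dots> \<le> P + 1 / 2 * C"
        using \<epsilon>(3) wb_nonneg[OF C] by (intro add_left_mono mult_right_mono) auto
      finally show ?thesis using wb_mono[OF h] by simp
    qed
    obtain C where C: "Hb 2 (u t) C" using u_reg[OF t'] by (auto simp: reg_def)
    have it: "Hb 2 (u t) (2 * P + C / 2 ^ n)" for n
    proof (induction n)
      case 0
      have "0 \<le> P" using C0 q \<epsilon> by (simp add: P_def)
      then show ?case by (intro wb_mono[OF C]) simp
    next
      case (Suc n)
      from step[OF Suc] show ?case by (simp add: field_simps)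
    qed
    show ?thesis unfolding wb_def
    proof (intro allI impI)
      fix F :: "freq set" assume F: "finite F"
      have "(\<lambda>n. 2 * P + C * (1 / 2) ^ n) \<longlonglongrightarrow> 2 * P + C * 0"
        by (intro tendsto_intros LIMSEQ_power_zero) auto
      then have "(\<lambda>n. 2 * P + C / 2 ^ n) \<longlonglongrightarrow> 2 * P" by (simp add: power_divide)
      then show "(\<Sum>k\<in>F. ((wt k)\<^sup>2 * cmod (coef (u t) k))\<^sup>2) \<le> 2 * P"
        by (rule LIMSEQ_le_const) (use it F in \<open>auto simp: wb_def\<close>)
    qed
  qed
  then show ?thesis by blast
qed

lemma H2_bound: "\<exists>C. \<forall>t\<in>{0..T}. Hb 2 (u t) C"
proof -
  obtain C where C: "\<And>t. t \<in> {0<..T} \<Longrightarrow> Hb 2 (u t) C" using H2_bound_pos by blast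
  obtain D where D: "Hb 2 (u 0) D" using u_reg[of 0] T by (auto simp: reg_def)
  have "Hb 2 (u t) (max C D)" if "t \<in> {0..T}" for t
    using that C[of t] D by (cases "t = 0") (auto intro: wb_mono)
  then show ?thesis by blast
qed

lemma mvt_Hb:
  assumes ab: "0 \<le> a" "a \<le> b" "b \<le> T" and B: "\<And>t. t \<in> {0..T} \<Longrightarrow> Hb r (w t) B"
    and D: "\<And>t k. t \<in> {0..T} \<Longrightarrow> ((\<lambda>r. coef (v r) k) has_vector_derivative coef (w t) k) (at t within {0..T})"
    and L: "v a \<in> L2" "v b \<in> L2"
  shows "Hb r (\<lambda>x. v b x - v a x) (B * (b - a)\<^sup>2)"
  unfolding wb_def
proof (intro allI impI)
  fix F :: "freq set" assume F: "finite F"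
  have "(\<Sum>k\<in>F. (wt k ^ r * cmod (coef (v b) k - coef (v a) k))\<^sup>2) \<le> B * (b - a)\<^sup>2"
  proof (rule mvt_l2[where \<phi> = "\<lambda>t. coef (v t)" and \<psi> = "\<lambda>t. coef (w t)"])
    fix t assume "t \<in> {a..b}"
    then have t: "t \<in> {0..T}" using ab by auto
    show "((\<lambda>t. coef (v t) k) has_vector_derivative coef (w t) k) (at t within {a..b})" for k
      by (rule has_vector_derivative_within_subset[OF D[OF t]]) (use ab in auto)
    show "(\<Sum>k\<in>F. (wt k ^ r * cmod (coef (w t) k))\<^sup>2) \<le> B" using B[OF t] F by (simp add: wb_def)
  qed (use ab in auto)
  then show "(\<Sum>k\<in>F. (wt k ^ r * cmod (coef (\<lambda>x. v b x - v a x) k))\<^sup>2) \<le> B * (b - a)\<^sup>2"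
    by (simp add: coef_diff L)
qed

lemma u_L2: "t \<in> {0..T} \<Longrightarrow> u t \<in> L2" by (intro continuous_L2 u_cont)

lemma coef_u_diff: "a \<in> {0..T} \<Longrightarrow> b \<in> {0..T} \<Longrightarrow> coef (\<lambda>x. u b x - u a x) k = coef (u b) k - coef (u a) k"
  by (intro coef_diff u_L2)

text \<open>The damping factor and the cubic map are both Lipschitz.\<close>

lemma fn_diff_Hb:
  assumes C: "\<And>t. t \<in> {0..T} \<Longrightarrow> Hb (r + 2) (u t) C"
    and ab: "0 \<le> a" "a \<le> b" "b \<le> T" and B: "Hb r (\<lambda>x. u b x - u a x) (B * (b - a)\<^sup>2)"
  shows "Hb r (\<lambda>x. fn b x - fn a x)
     ((2 * (\<beta>\<^sup>2 * (KL r C * B)) + 2 * ((2 * \<bar>\<beta>\<bar> * \<gamma>)\<^sup>2 * ((4 ^ (r + 2) * 2 * S\<^sub>w)\<^sup>2 * C ^ 3))) * (b - a)\<^sup>2)"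
proof -
  have abT: "a \<in> {0..T}" "b \<in> {0..T}" using ab by auto
  have 1: "Hb r (\<lambda>x. cub (u b) x - cub (u a) x) (KL r C * (B * (b - a)\<^sup>2))"
    by (intro cub_diff_Hb u_reg abT C B)
  have 2: "Hb r (cub (u a)) ((4 ^ (r + 2) * 2 * S\<^sub>w)\<^sup>2 * C ^ 3)"
    by (rule Hb_le[OF cub_Hb[OF u_reg[OF abT(1)] C[OF abT(1)]]]) auto
  have "Hb r (\<lambda>x. cc b * (cub (u b) x - cub (u a) x) + (cc b - cc a) * cub (u a) x)
     (2 * ((cmod (cc b))\<^sup>2 * (KL r C * (B * (b - a)\<^sup>2))) + 2 * ((cmod (cc b - cc a))\<^sup>2 * ((4 ^ (r + 2) * 2 * S\<^sub>w)\<^sup>2 * C ^ 3)))"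
    by (intro wb_add wb_scale 1 2 continuous_intros continuous_cub u_cont abT)
  then have "Hb r (\<lambda>x. fn b x - fn a x) (2 * ((cmod (cc b))\<^sup>2 * (KL r C * (B * (b - a)\<^sup>2))) + 2 * ((cmod (cc b - cc a))\<^sup>2 * ((4 ^ (r + 2) * 2 * S\<^sub>w)\<^sup>2 * C ^ 3)))"
    by (simp add: fn_def[abs_def] algebra_simps)
  then show ?thesis
  proof (rule wb_mono)
    have "(cmod (cc b))\<^sup>2 \<le> \<bar>\<beta>\<bar>\<^sup>2" using norm_cc[of b] ab by (intro power_mono) auto
    moreover have "(cmod (cc b - cc a))\<^sup>2 \<le> (2 * \<bar>\<beta>\<bar> * \<gamma> * (b - a))\<^sup>2" using cc_lipschitz[of a b] ab by (intro power_mono) auto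
    moreover have "0 \<le> KL r C * (B * (b - a)\<^sup>2)" "0 \<le> (4 ^ (r + 2) * 2 * S\<^sub>w)\<^sup>2 * C ^ 3" using 1 2 by (auto intro: wb_nonneg)
    ultimately have "2 * ((cmod (cc b))\<^sup>2 * (KL r C * (B * (b - a)\<^sup>2))) + 2 * ((cmod (cc b - cc a))\<^sup>2 * ((4 ^ (r + 2) * 2 * S\<^sub>w)\<^sup>2 * C ^ 3))
      \<le> 2 * (\<bar>\<beta>\<bar>\<^sup>2 * (KL r C * (B * (b - a)\<^sup>2))) + 2 * ((2 * \<bar>\<beta>\<bar> * \<gamma> * (b - a))\<^sup>2 * ((4 ^ (r + 2) * 2 * S\<^sub>w)\<^sup>2 * C ^ 3))"
      by (intro add_mono mult_left_mono mult_right_mono) auto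
    also have "\<dots> = (2 * (\<beta>\<^sup>2 * (KL r C * B)) + 2 * ((2 * \<bar>\<beta>\<bar> * \<gamma>)\<^sup>2 * ((4 ^ (r + 2) * 2 * S\<^sub>w)\<^sup>2 * C ^ 3))) * (b - a)\<^sup>2"
      by (simp only: power_mult_distrib power2_abs) (simp add: algebra_simps)
    finally show "2 * ((cmod (cc b))\<^sup>2 * (KL r C * (B * (b - a)\<^sup>2))) + 2 * ((cmod (cc b - cc a))\<^sup>2 * ((4 ^ (r + 2) * 2 * S\<^sub>w)\<^sup>2 * C ^ 3))
      \<le> (2 * (\<beta>\<^sup>2 * (KL r C * B)) + 2 * ((2 * \<bar>\<beta>\<bar> * \<gamma>)\<^sup>2 * ((4 ^ (r + 2) * 2 * S\<^sub>w)\<^sup>2 * C ^ 3))) * (b - a)\<^sup>2" .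
  qed
qed

text \<open>At time zero the differential equation is not assumed; both sides are continuous in time, the
nonlinear term by the uniform bound of order two.\<close>

lemma link:
  assumes t: "t \<in> {0..T}" shows "coef (ut t) k = coef (v1 t) k"
proof (cases "t = 0")
  case False then show ?thesis using link_pos[of t] t by simp
next
  case True
  obtain C where C: "\<And>t. t \<in> {0..T} \<Longrightarrow> Hb 2 (u t) C" using H2_bound by blast
  let ?F = "at (0::real) within {0..T}"
  have z: "0 \<in> {0..T}" using T by auto
  have nt: "?F \<noteq> bot" using T by (simp add: at_within_Icc_at_right)
  define X where "X = (2 * (\<beta>\<^sup>2 * (KL 0 C * C0)) + 2 * ((2 * \<bar>\<beta>\<bar> * \<gamma>)\<^sup>2 * ((4 ^ (0 + 2) * 2 * S\<^sub>w)\<^sup>2 * C ^ 3)))"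
  have inT: "\<forall>\<^sub>F t in ?F. t \<in> {0<..T}" by (auto simp: eventually_at_filter)
  have fl: "((\<lambda>t. coef (fn t) k) \<longlongrightarrow> coef (fn 0) k) ?F"
  proof (rule Lim_null[THEN iffD2, OF Lim_null_comparison])
    have "((\<lambda>t. sqrt (X * (t - 0)\<^sup>2)) \<longlongrightarrow> sqrt (X * (0 - 0)\<^sup>2)) ?F" by (intro tendsto_intros)
    then show "((\<lambda>t. sqrt (X * (t - 0)\<^sup>2)) \<longlongrightarrow> 0) ?F" by simp
    show "\<forall>\<^sub>F t in ?F. norm (coef (fn t) k - coef (fn 0) k) \<le> sqrt (X * (t - 0)\<^sup>2)"
      using inT
    proof eventually_elim
      case (elim t)
      then have tT: "t \<in> {0..T}" by auto
      have "Hb 0 (\<lambda>x. u t x - u 0 x) (C0 * (t - 0)\<^sup>2)"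
        using mvt_Hb[of 0 t 0 v1 C0 u] elim D0 Hb_le[OF Hb1, of _ 0] u_L2[OF z] u_L2[OF tT] by auto
      then have "Hb 0 (\<lambda>x. fn t x - fn 0 x) (X * (t - 0)\<^sup>2)"
        unfolding X_def using elim C by (intro fn_diff_Hb) (auto simp: numeral_2_eq_2)
      from Hb_coef[OF this, of k] show ?case by (simp add: coef_diff_cont[OF fn_cont[OF tT] fn_cont[OF z]])
    qed
  qed
  have cont: "((\<lambda>t. coef (u t) k) \<longlongrightarrow> coef (u 0) k) ?F" "((\<lambda>t. coef (v1 t) k) \<longlongrightarrow> coef (v1 0) k) ?F"
    using has_vector_derivative_continuous[OF D0[OF z, of k]] has_vector_derivative_continuous[OF D1[OF z, of k]]
    by (auto simp: continuous_within)
  have "((\<lambda>t. \<i> * (- of_real (ksq k) * coef (u t) k + coef (fn t) k)) \<longlongrightarrow> \<i> * (- of_real (ksq k) * coef (u 0) k + coef (fn 0) k)) ?F"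
    by (intro tendsto_intros cont fl)
  moreover have "((\<lambda>t. \<i> * (- of_real (ksq k) * coef (u t) k + coef (fn t) k)) \<longlongrightarrow> coef (v1 0) k) ?F"
  proof (rule Lim_transform_eventually[OF cont(2)])
    show "\<forall>\<^sub>F t in ?F. coef (v1 t) k = \<i> * (- of_real (ksq k) * coef (u t) k + coef (fn t) k)"
      using inT by eventually_elim (simp add: link_pos[symmetric] coef_ut)
  qed
  ultimately have "\<i> * (- of_real (ksq k) * coef (u 0) k + coef (fn 0) k) = coef (v1 0) k"
    using tendsto_unique[OF nt] by blast
  then show ?thesis using True coef_ut[OF z] by simp
qed

text \<open>First application of the gain, with the time derivative of order \<open>m\<close>.\<close>

lemma Hm2_bound: "\<exists>C. \<forall>t\<in>{0..T}. Hb (m + 2) (u t) C"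
proof -
  obtain C where C: "\<And>t. t \<in> {0..T} \<Longrightarrow> Hb 2 (u t) C" using H2_bound by blast
  define \<rho> where "\<rho> = max m 2"
  define B where "B = \<beta>\<^sup>2 * ((4 ^ \<rho> * 2 * S\<^sub>w)\<^sup>2 * (max C0 C) ^ 3)"
  have "Hb (m + 2) (u t) (32 * (C0 + (2 * C0 + 2 * B)))" if t: "t \<in> {0..T}" for t
  proof (rule gain[OF t link[OF t] Hbu[OF t] Hb1[OF t]])
    have "Hb \<rho> (cub (u t)) ((4 ^ \<rho> * 2 * S\<^sub>w)\<^sup>2 * (max C0 C) ^ 3)"
      unfolding \<rho>_def by (intro cub_Hb u_reg t Hb_max Hbu C) auto
    then have "Hb \<rho> (fn t) B" unfolding B_def by (rule fn_Hb[OF t])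
    then show "Hb m (fn t) B" by (rule Hb_le) (simp add: \<rho>_def)
  qed
  then show ?thesis by blast
qed

text \<open>The gain is applied to differences: \<open>u b - u a\<close> and the source of its Poisson equation are
Lipschitz in order \<open>m\<close>, hence \<open>u\<close> is Lipschitz in order \<open>m + 2\<close>, and its derivative is bounded in that order.\<close>

lemma v1_bound: "\<exists>C. \<forall>t\<in>{0..T}. Hb (m + 2) (v1 t) C"
proof -
  obtain C where C: "\<And>t. t \<in> {0..T} \<Longrightarrow> Hb (m + 2) (u t) C" using Hm2_bound by blast
  define X where "X = (2 * (\<beta>\<^sup>2 * (KL m C * C0)) + 2 * ((2 * \<bar>\<beta>\<bar> * \<gamma>)\<^sup>2 * ((4 ^ (m + 2) * 2 * S\<^sub>w)\<^sup>2 * C ^ 3)))"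
  define K where "K = 32 * (C0 + (2 * C0 + 2 * X))"
  have lip: "Hb (m + 2) (\<lambda>x. u b x - u a x) (K * (b - a)\<^sup>2)" if ab: "0 \<le> a" "a \<le> b" "b \<le> T" for a b
  proof -
    have abT: "a \<in> {0..T}" "b \<in> {0..T}" using ab by auto
    have 1: "Hb m (\<lambda>x. u b x - u a x) (C0 * (b - a)\<^sup>2)"
      by (rule mvt_Hb[OF ab, of m v1]) (auto intro: Hb1 D0 u_L2 abT)
    have 2: "Hb m (\<lambda>x. v1 b x - v1 a x) (C0 * (b - a)\<^sup>2)"
      by (rule mvt_Hb[OF ab, of m v2]) (auto intro: Hb2 D1 L1 abT)
    have 3: "Hb m (\<lambda>x. fn b x - fn a x) (X * (b - a)\<^sup>2)"
      unfolding X_def by (rule fn_diff_Hb[OF C ab 1])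
    have 4: "Hb m (\<lambda>x. laplacian (u b) x - laplacian (u a) x) (2 * (C0 * (b - a)\<^sup>2) + 2 * (X * (b - a)\<^sup>2))"
    proof (rule wb_add_coef[OF 2 3])
      fix k
      have "coef (\<lambda>x. laplacian (u b) x - laplacian (u a) x) k =
         - \<i> * coef (\<lambda>x. v1 b x - v1 a x) k - coef (\<lambda>x. fn b x - fn a x) k"
        unfolding coef_diff_cont[OF lap_cont[OF abT(2)] lap_cont[OF abT(1)]] coef_lap[OF abT(1) link[OF abT(1)]] coef_lap[OF abT(2) link[OF abT(2)]]
        by (simp add: coef_diff_cont[OF fn_cont[OF abT(2)] fn_cont[OF abT(1)]] coef_diff[OF L1[OF abT(2)] L1[OF abT(1)]] algebra_simps)
      then show "cmod (coef (\<lambda>x. laplacian (u b) x - laplacian (u a) x) k) \<le>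
         cmod (coef (\<lambda>x. v1 b x - v1 a x) k) + cmod (coef (\<lambda>x. fn b x - fn a x) k)"
        using norm_triangle_ineq4[of "- \<i> * coef (\<lambda>x. v1 b x - v1 a x) k" "coef (\<lambda>x. fn b x - fn a x) k"]
        by (simp add: norm_mult)
    qed
    have "Hb (m + 2) (\<lambda>x. u b x - u a x) (32 * (C0 * (b - a)\<^sup>2 + (2 * (C0 * (b - a)\<^sup>2) + 2 * (X * (b - a)\<^sup>2))))"
    proof (rule elliptic_gain[OF 1 4])
      fix k
      have "coef (\<lambda>x. laplacian (u b) x - laplacian (u a) x) k = - of_real (ksq k) * coef (\<lambda>x. u b x - u a x) k"
        using laplacian_facts(3)[OF u_C2 u_periodic, OF abT(1) abT(1)] laplacian_facts(3)[OF u_C2 u_periodic, OF abT(2) abT(2)]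
        by (simp add: coef_diff_cont[OF lap_cont[OF abT(2)] lap_cont[OF abT(1)]] coef_u_diff[OF abT] algebra_simps)
      then show "ksq k * cmod (coef (\<lambda>x. u b x - u a x) k) \<le> cmod (coef (\<lambda>x. laplacian (u b) x - laplacian (u a) x) k)"
        by (simp add: norm_mult ksq_nonneg)
    qed
    then show ?thesis by (simp add: K_def algebra_simps)
  qed
  have "Hb (m + 2) (v1 t) K" if t: "t \<in> {0..T}" for t
    unfolding wb_def
  proof (intro allI impI)
    fix F :: "freq set" assume F: "finite F"
    let ?F = "at t within {0..T}"
    have nt: "?F \<noteq> bot" using T t
      by (simp add: trivial_limit_within islimpt_Icc)
    have "((\<lambda>r. \<Sum>k\<in>F. (wt k ^ (m + 2) * cmod ((coef (u r) k - coef (u t) k) /\<^sub>R (r - t)))\<^sup>2) \<longlongrightarrow>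
        (\<Sum>k\<in>F. (wt k ^ (m + 2) * cmod (coef (v1 t) k))\<^sup>2)) ?F"
      by (intro tendsto_intros vector_derivative_quotient D0 t)
    then show "(\<Sum>k\<in>F. (wt k ^ (m + 2) * cmod (coef (v1 t) k))\<^sup>2) \<le> K"
    proof (rule tendsto_upperbound)
      have "\<forall>\<^sub>F r in ?F. r \<in> {0..T} \<and> r \<noteq> t" by (simp add: eventually_at_filter)
      then show "\<forall>\<^sub>F r in ?F. (\<Sum>k\<in>F. (wt k ^ (m + 2) * cmod ((coef (u r) k - coef (u t) k) /\<^sub>R (r - t)))\<^sup>2) \<le> K"
      proof eventually_elim
        case (elim r)
        have rT: "r \<in> {0..T}" "r \<noteq> t" using elim by auto
        have "(\<Sum>k\<in>F. (wt k ^ (m + 2) * cmod (coef (u r) k - coef (u t) k))\<^sup>2) \<le> K * (r - t)\<^sup>2"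
        proof (cases "t \<le> r")
          case True
          then show ?thesis using lip[of t r] F rT t by (simp add: wb_def coef_u_diff[OF t rT(1)])
        next
          case False
          then show ?thesis using lip[of r t] F rT t
            by (simp add: wb_def coef_u_diff[OF rT(1) t] norm_minus_commute power2_commute)
        qed
        then have "(\<Sum>k\<in>F. (wt k ^ (m + 2) * cmod (coef (u r) k - coef (u t) k))\<^sup>2) / (r - t)\<^sup>2 \<le> K"
          using rT by (simp add: divide_le_eq)
        moreover have "(wt k ^ (m + 2) * cmod ((coef (u r) k - coef (u t) k) /\<^sub>R (r - t)))\<^sup>2 = (wt k ^ (m + 2) * cmod (coef (u r) k - coef (u t) k))\<^sup>2 / (r - t)\<^sup>2" for k
          by (simp add: power_mult_distrib power_divide divide_inverse power_inverse)
        ultimately show ?case by (simp only: sum_divide_distrib)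
      qed
    qed (rule nt)
  qed
  then show ?thesis by blast
qed

text \<open>Second application of the gain, now with the time derivative of order \<open>m + 2\<close>.\<close>

lemma Hm4_bound: "\<exists>C. \<forall>t\<in>{0..T}. Hb (m + 4) (u t) C"
proof -
  obtain C where C: "\<And>t. t \<in> {0..T} \<Longrightarrow> Hb (m + 2) (u t) C" using Hm2_bound by blast
  obtain D where D: "\<And>t. t \<in> {0..T} \<Longrightarrow> Hb (m + 2) (v1 t) D" using v1_bound by blast
  have "Hb (m + 2 + 2) (u t) (32 * (C + (2 * D + 2 * (\<beta>\<^sup>2 * ((4 ^ (m + 2) * 2 * S\<^sub>w)\<^sup>2 * C ^ 3)))))" if t: "t \<in> {0..T}" for t
    by (intro gain[OF t link[OF t] C[OF t] D[OF t]] fn_Hb t cub_Hb u_reg C) auto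
  then have "\<exists>C. \<forall>t\<in>{0..T}. Hb (m + 2 + 2) (u t) C" by blast
  moreover have "m + 2 + 2 = m + 4" by simp
  ultimately show ?thesis by (simp only:)
qed

lemma regularity:
  obtains C where "C \<ge> 0" "\<And>t. t \<in> {0..T} \<Longrightarrow> Hb (m + 4) (u t) C" "\<And>t. t \<in> {0..T} \<Longrightarrow> Hb (m + 2) (ut t) C"
    "\<And>t. t \<in> {0..T} \<Longrightarrow> Hb 0 (v2 t) C" "\<And>t. t \<in> {0..T} \<Longrightarrow> Hb 0 (v3 t) C"
proof -
  obtain A where A: "\<And>t. t \<in> {0..T} \<Longrightarrow> Hb (m + 4) (u t) A" using Hm4_bound by blast
  obtain B where B: "\<And>t. t \<in> {0..T} \<Longrightarrow> Hb (m + 2) (v1 t) B" using v1_bound by blast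
  define C where "C = max (max A B) C0"
  have le: "A \<le> C" "B \<le> C" "C0 \<le> C" by (auto simp: C_def)
  show ?thesis
  proof (rule that)
    fix t assume t: "t \<in> {0..T}"
    show "Hb (m + 4) (u t) C" by (rule wb_mono[OF A[OF t] le(1)])
    show "Hb (m + 2) (ut t) C" using wb_mono[OF B[OF t] le(2)] by (simp add: wb_def link[OF t])
    show "Hb 0 (v2 t) C" by (rule wb_mono[OF Hb_le[OF Hb2[OF t]] le(3)]) simp
    show "Hb 0 (v3 t) C" by (rule wb_mono[OF Hb_le[OF Hb3[OF t]] le(3)]) simp
  qed (use C0 le in simp)
qed

end

section \<open>From the Sobolev hypotheses to the Fourier side\<close>

lemma nls_data_exists:
  assumes "\<gamma> > 0" "T > 0" "s > 3 / 2" "nls_solution \<beta> \<gamma> T \<psi>\<^sub>0 u" and ct: "C_time 3 T (H_p s) (sobolev_norm s) u"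
  obtains v1 v2 v3 C0 where "nls_data \<beta> \<gamma> T \<psi>\<^sub>0 u v1 v2 v3 C0 (nat \<lfloor>s\<rfloor>)"
proof -
  define m where "m = nat \<lfloor>s\<rfloor>"
  have m1: "m \<ge> 1" using assms(3) by (simp add: m_def le_nat_iff le_floor_iff)
  let ?L = "\<lambda>v v' t. ((\<lambda>r. sobolev_norm s (\<lambda>x. (v r x - v t x) /\<^sub>R (r - t) - v' t x)) \<longlongrightarrow> 0) (at t within {0..T})"
  from ct[unfolded numeral_3_eq_3 C_time.simps(2)[of "Suc (Suc 0)"]]
  obtain v1 where u: "\<And>t. t \<in> {0..T} \<Longrightarrow> u t \<in> H_p s" and c2: "C_time (Suc (Suc 0)) T (H_p s) (sobolev_norm s) v1"
    and l0: "\<And>t. t \<in> {0..T} \<Longrightarrow> ?L u v1 t"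
    by blast
  from c2[unfolded C_time.simps(2)[of "Suc 0"]] obtain v2 where v1: "\<And>t. t \<in> {0..T} \<Longrightarrow> v1 t \<in> H_p s" and c1: "C_time (Suc 0) T (H_p s) (sobolev_norm s) v2"
    and l1: "\<And>t. t \<in> {0..T} \<Longrightarrow> ?L v1 v2 t"
    by blast
  from c1[unfolded C_time.simps(2)[of 0]] obtain v3 where v2: "\<And>t. t \<in> {0..T} \<Longrightarrow> v2 t \<in> H_p s" and c0: "C_time 0 T (H_p s) (sobolev_norm s) v3"
    and l2: "\<And>t. t \<in> {0..T} \<Longrightarrow> ?L v2 v3 t"
    by blast
  from c0[unfolded C_time.simps(1)] have v3: "\<And>t. t \<in> {0..T} \<Longrightarrow> v3 t \<in> H_p s"
    and l3: "\<And>t. t \<in> {0..T} \<Longrightarrow> ((\<lambda>r. sobolev_norm s (\<lambda>x. v3 r x - v3 t x)) \<longlongrightarrow> 0) (at t within {0..T})"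
    by blast+
  have fd: "fder m f" if "f \<in> H_p s" for f using that by (rule H_p_fder) (simp add: m_def)
  have L: "f \<in> L2" if "f \<in> H_p s" for f using fd[OF that] by (simp add: fder_def)
  have ex: "\<exists>C. Hb m f C" if "f \<in> H_p s" for f using fder_Hb[OF fd[OF that], of s] by (auto simp: m_def)
  have bd: "\<exists>C. \<forall>t\<in>{0..T}. Hb m (v t) C"
    if "\<And>t. t \<in> {0..T} \<Longrightarrow> v t \<in> H_p s" "\<And>t. t \<in> {0..T} \<Longrightarrow> v' t \<in> H_p s" "\<And>t. t \<in> {0..T} \<Longrightarrow> ?L v v' t" for v v'
    using assms(2)
    by (intro time_continuous_bounded L ex that time_derivative_coef(3)[OF that(1,2) m_def that(3)]) auto
  obtain A0 where A0: "\<And>t. t \<in> {0..T} \<Longrightarrow> Hb m (u t) A0" using bd[OF u v1 l0] by blast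
  obtain A1 where A1: "\<And>t. t \<in> {0..T} \<Longrightarrow> Hb m (v1 t) A1" using bd[OF v1 v2 l1] by blast
  obtain A2 where A2: "\<And>t. t \<in> {0..T} \<Longrightarrow> Hb m (v2 t) A2" using bd[OF v2 v3 l2] by blast
  have "\<exists>C. \<forall>t\<in>{0..T}. Hb m (v3 t) C"
  proof (intro time_continuous_bounded L ex v3)
    fix t assume t: "t \<in> {0..T}"
    have "((\<lambda>r. (4 ^ m * 2 * sobolev_norm s (\<lambda>x. v3 r x - v3 t x))\<^sup>2) \<longlongrightarrow> (4 ^ m * 2 * 0)\<^sup>2) (at t within {0..T})"
      by (intro tendsto_intros l3 t)
    then have "\<forall>\<^sub>F r in at t within {0..T}. (4 ^ m * 2 * sobolev_norm s (\<lambda>x. v3 r x - v3 t x))\<^sup>2 < 1"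
      by (rule order_tendstoD(2)) simp
    moreover have "\<forall>\<^sub>F r in at t within {0..T}. r \<in> {0..T}" by (simp add: eventually_at_filter)
    ultimately show "\<forall>\<^sub>F r in at t within {0..T}. Hb m (\<lambda>x. v3 r x - v3 t x) 1"
    proof eventually_elim
      case (elim r)
      have "fder m (\<lambda>x. v3 r x - v3 t x)"
        using fder_lincomb[OF fd[OF v3[OF elim(2)]] fd[OF v3[OF t]], of 1 "-1"] by simp
      from fder_Hb[OF this, of s] elim(1) show ?case by (auto simp: m_def intro: wb_mono)
    qed
  qed (use assms(2) in auto)
  then obtain A3 where A3: "\<And>t. t \<in> {0..T} \<Longrightarrow> Hb m (v3 t) A3" by blast
  define C where "C = max (max A0 A1) (max A2 A3)"
  have le: "A0 \<le> C" "A1 \<le> C" "A2 \<le> C" "A3 \<le> C" by (auto simp: C_def)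
  have "nls_data \<beta> \<gamma> T \<psi>\<^sub>0 u v1 v2 v3 C m"
  proof (unfold_locales, goal_cases)
    case 5 then show ?case using wb_mono[OF A0 le(1)] by simp
  next
    case 6 then show ?case using wb_mono[OF A1 le(2)] by simp
  next
    case 7 then show ?case using wb_mono[OF A2 le(3)] by simp
  next
    case 8 then show ?case using wb_mono[OF A3 le(4)] by simp
  next
    case (9 t k) then show ?case by (intro time_derivative_coef(1)[OF u v1 m_def l0]) auto
  next
    case (10 t k) then show ?case by (intro time_derivative_coef(1)[OF v1 v2 m_def l1]) auto
  next
    case (11 t k) then show ?case by (intro time_derivative_coef(1)[OF v2 v3 m_def l2]) auto
  next
    case (12 t e) then show ?case by (intro time_derivative_coef(2)[OF u v1 m_def l0]) auto
  qed (use assms m1 L v1 in auto)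
  then show ?thesis using that m_def by simp
qed

section \<open>The discrete Fourier transform\<close>

text \<open>On the grid, character and grid point enter symmetrically; indices and frequencies therefore share
one type.\<close>

definition echar :: "nat \<Rightarrow> freq \<Rightarrow> freq \<Rightarrow> complex" where
  "echar N k j = fchar k (grid_point N j)"

lemma grid_point_nth: "grid_point N j $ i = of_int (kc j i) * mesh N"
  using exhaust_3[of i] by (auto simp: grid_point_def kc_def split: prod.split)

lemma echar_eq: "echar N k j = cis (\<Sum>i\<in>UNIV. of_int (kc k i) * of_int (kc j i) * mesh N)"
  by (simp add: echar_def fchar_def grid_point_nth mult.assoc)

lemma echar_sym: "echar N k j = echar N j k"
  by (simp add: echar_eq mult.commute mult.left_commute)

lemma echar_add: "echar N (k + l) j = echar N k j * echar N l j"
  by (simp add: echar_def fchar_add)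

lemma echar_add_right: "echar N k (j + l) = echar N k j * echar N k l"
  by (metis echar_add echar_sym)

lemma echar_minus: "echar N (- k) j = cnj (echar N k j)"
  by (simp add: echar_def)

lemma echar_minus_right: "echar N k (- j) = cnj (echar N k j)"
  by (metis echar_minus echar_sym)

lemma norm_echar [simp]: "cmod (echar N k j) = 1"
  by (simp add: echar_def)

lemma echar_factor: "echar N k (a, b, c) =
   cis (of_int (fst k) * of_int a * mesh N) * (cis (of_int (fst (snd k)) * of_int b * mesh N) * cis (of_int (snd (snd k)) * of_int c * mesh N))"
  by (simp add: echar_eq sum_3 kc_def cis_mult add.assoc)

lemma cis_mesh_N: assumes "N > 0" shows "cis (of_int (a * int N) * of_int b * mesh N) = 1"
proof -
  have eq: "of_int (a * int N) * of_int b * mesh N = 2 * pi * of_int (a * b)" using assms by (simp add: mesh_def)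
  show ?thesis unfolding eq by (rule cis_multiple_2pi) (rule Ints_of_int)
qed

lemma cis_cong:
  assumes N: "N > 0" and d: "int N dvd k - l"
  shows "cis (of_int k * of_int a * mesh N) = cis (of_int l * of_int a * mesh N)"
proof -
  obtain c where "k - l = int N * c" using d by (auto simp: dvd_def)
  then have k: "k = l + c * int N" by (simp add: mult.commute)
  have "cis (of_int k * of_int a * mesh N) = cis (of_int l * of_int a * mesh N) * cis (of_int (c * int N) * of_int a * mesh N)"
    unfolding k cis_mult by (simp add: algebra_simps)
  then show ?thesis by (simp only: cis_mesh_N[OF N]) simp
qed

lemma sum_cis_1d:
  assumes N: "N > 0"
  shows "(\<Sum>a\<in>{0..<int N}. cis (of_int k * of_int a * mesh N)) = (if int N dvd k then of_nat N else 0)"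
proof (cases "int N dvd k")
  case True
  have "cis (of_int k * of_int a * mesh N) = 1" for a
    using cis_cong[OF N, of k 0 a] True by simp
  then show ?thesis using True by simp
next
  case False
  define z where "z = cis (of_int k * mesh N)"
  have zp: "cis (of_int k * of_int (int n) * mesh N) = z ^ n" for n
    using Complex.DeMoivre[of "of_int k * mesh N" n] by (simp add: z_def mult_ac)
  have z1: "z \<noteq> 1"
  proof
    assume "z = 1"
    then have "cos (of_int k * mesh N) = 1" by (simp add: z_def complex_eq_iff)
    then obtain c :: int where "of_int k * mesh N = of_int c * 2 * pi"
      using cos_one_2pi_int by blast
    then have "of_int k = (of_int c * of_int (int N) :: real)" using N by (simp add: mesh_def field_simps)
    then have "k = c * int N" by (metis of_int_eq_iff of_int_mult)
    then show False using False by simp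
  qed
  have "z ^ N = 1" using cis_cong[OF N, of "int N * 0 + 0" 0 k] zp[of N] cis_mesh_N[OF N, of k 1]
    by (simp add: mult_ac)
  have "(\<Sum>a\<in>{0..<int N}. cis (of_int k * of_int a * mesh N)) = (\<Sum>n\<in>{..<N}. cis (of_int k * of_int (int n) * mesh N))"
    by (rule sum.reindex_bij_witness[of _ int nat]) auto
  also have "\<dots> = (\<Sum>n<N. z ^ n)" by (simp only: zp)
  also have "\<dots> = 0" using z1 \<open>z ^ N = 1\<close> by (simp add: geometric_sum)
  finally show ?thesis using False by simp
qed

text \<open>\<open>dv N (k - l)\<close> says that the frequencies \<open>k\<close> and \<open>l\<close> alias: their characters agree on the grid.\<close>

definition dv :: "nat \<Rightarrow> freq \<Rightarrow> bool" where "dv N k \<longleftrightarrow> (\<forall>i. int N dvd kc k i)"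

lemma dv_alt: "dv N k \<longleftrightarrow> int N dvd fst k \<and> int N dvd fst (snd k) \<and> int N dvd snd (snd k)"
  by (simp add: dv_def forall_3 kc_def)

lemma echar_cong:
  assumes N: "N > 0" and d: "dv N (k - l)" shows "echar N k j = echar N l j"
proof -
  obtain a b c where j: "j = (a, b, c)" by (cases j)
  show ?thesis using d unfolding j echar_factor dv_alt
    by (simp add: cis_cong[OF N, of "fst k" "fst l"] cis_cong[OF N, of "fst (snd k)" "fst (snd l)"] cis_cong[OF N, of "snd (snd k)" "snd (snd l)"])
qed

lemma finite_J_h [simp]: "finite (J_h N)" by (simp add: J_h_def)

lemma card_J_h: "card (J_h N) = N ^ 3" by (simp add: J_h_def card_cartesian_product power3_eq_cube)

lemma sum_echar:
  assumes N: "N > 0"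
  shows "(\<Sum>j\<in>J_h N. echar N k j) = (if dv N k then of_nat N ^ 3 else 0)"
proof -
  have "(\<Sum>j\<in>J_h N. echar N k j) =
     (\<Sum>a\<in>{0..<int N}. cis (of_int (fst k) * of_int a * mesh N)) * ((\<Sum>b\<in>{0..<int N}. cis (of_int (fst (snd k)) * of_int b * mesh N)) *
       (\<Sum>c\<in>{0..<int N}. cis (of_int (snd (snd k)) * of_int c * mesh N)))"
    unfolding J_h_def sum_product sum.cartesian_product
    by (rule sum.cong) (auto simp: echar_factor)
  also have "\<dots> = (if dv N k then of_nat N ^ 3 else 0)"
    unfolding sum_cis_1d[OF N] dv_alt by (auto simp: power3_eq_cube)
  finally show ?thesis .
qed

lemma J_h_dv_eq: "k \<in> J_h N \<Longrightarrow> l \<in> J_h N \<Longrightarrow> dv N (k - l) \<Longrightarrow> k = l"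
proof -
  have *: "a = b" if "0 \<le> a" "a < int N" "0 \<le> b" "b < int N" "int N dvd a - b" for a b
    using that by (metis mod_eq_dvd_iff mod_pos_pos_trivial)
  assume "k \<in> J_h N" "l \<in> J_h N" "dv N (k - l)"
  then show "k = l" by (auto simp: J_h_def dv_alt intro: *)
qed

lemma J_h_dv_iff: "k \<in> J_h N \<Longrightarrow> l \<in> J_h N \<Longrightarrow> dv N (k - l) \<longleftrightarrow> k = l"
  by (intro iffI J_h_dv_eq) (auto simp: dv_def simp del: split_paired_All)

definition dft :: "nat \<Rightarrow> gridfun \<Rightarrow> freq \<Rightarrow> complex" where
  "dft N V k = (\<Sum>j\<in>J_h N. V j * echar N (- k) j) / of_nat N ^ 3"

lemma dft_cong: "(\<And>j. j \<in> J_h N \<Longrightarrow> V j = W j) \<Longrightarrow> dft N V k = dft N W k"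
  by (simp add: dft_def)

lemma dft_periodic: "N > 0 \<Longrightarrow> dv N (k - l) \<Longrightarrow> dft N V k = dft N V l"
proof -
  assume N: "N > 0" and d: "dv N (k - l)"
  have "dv N (- k - - l)" using d by (auto simp: dv_def dvd_diff_commute)
  then show ?thesis unfolding dft_def using echar_cong[OF N, of "-k" "-l"] by simp
qed

lemma dft_add: "dft N (\<lambda>j. V j + W j) k = dft N V k + dft N W k"
  by (simp add: dft_def distrib_right sum.distrib add_divide_distrib)

lemma dft_diff: "dft N (\<lambda>j. V j - W j) k = dft N V k - dft N W k"
  by (simp add: dft_def left_diff_distrib sum_subtractf diff_divide_distrib)

lemma dft_scale: "dft N (\<lambda>j. c * V j) k = c * dft N V k"
  by (simp add: dft_def sum_distrib_left mult.assoc)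

lemma dft_0 [simp]: "dft N (\<lambda>j. 0) k = 0"
  by (simp add: dft_def)

lemma dft_sum: "dft N (\<lambda>j. \<Sum>l\<in>L. V l j) k = (\<Sum>l\<in>L. dft N (V l) k)"
  by (simp add: dft_def sum_distrib_right sum_divide_distrib sum.swap[of _ L])

lemma dft_cnj: "dft N (\<lambda>j. cnj (V j)) k = cnj (dft N V (- k))"
  by (simp add: dft_def echar_minus)

lemma dft_echar:
  assumes N: "N > 0" shows "dft N (echar N l) k = (if dv N (l - k) then 1 else 0)"
proof -
  have "dft N (echar N l) k = (\<Sum>j\<in>J_h N. echar N (l - k) j) / of_nat N ^ 3"
    unfolding dft_def by (simp add: echar_add[symmetric])
  then show ?thesis using N by (simp add: sum_echar)
qed

lemma dft_inversion:
  assumes N: "N > 0" and j: "j \<in> J_h N"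
  shows "V j = (\<Sum>k\<in>J_h N. dft N V k * echar N k j)"
proof -
  have "(\<Sum>k\<in>J_h N. dft N V k * echar N k j) = (\<Sum>k\<in>J_h N. \<Sum>i\<in>J_h N. V i * echar N k (j - i) / of_nat N ^ 3)"
  proof (rule sum.cong[OF refl])
    fix k
    have "echar N (- k) i * echar N k j = echar N k (j - i)" for i
      using echar_add_right[of N k j "- i"] by (simp add: echar_minus_right echar_minus mult.commute)
    then show "dft N V k * echar N k j = (\<Sum>i\<in>J_h N. V i * echar N k (j - i) / of_nat N ^ 3)"
      by (simp add: dft_def sum_distrib_right sum_divide_distrib mult.assoc)
  qed
  also have "\<dots> = (\<Sum>i\<in>J_h N. V i * (\<Sum>k\<in>J_h N. echar N (j - i) k) / of_nat N ^ 3)"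
    by (subst sum.swap) (simp add: sum_distrib_left sum_divide_distrib echar_sym[of N _ "j - _"])
  also have "\<dots> = (\<Sum>i\<in>J_h N. if i = j then V i else 0)"
    by (rule sum.cong[OF refl]) (use N j in \<open>auto simp: sum_echar J_h_dv_iff\<close>)
  also have "\<dots> = V j" using j by simp
  finally show ?thesis ..
qed

text \<open>Change of variables modulo \<open>N\<close>: the map \<open>\<sigma>\<close> is injective on aliasing classes, hence a bijection of
a finite set of representatives.\<close>

lemma sum_J_h_bij:
  fixes G :: "freq \<Rightarrow> real"
  assumes N: "N > 0" and G: "\<And>k l. dv N (k - l) \<Longrightarrow> G k = G l" and inj: "\<And>k l. dv N (\<sigma> k - \<sigma> l) \<Longrightarrow> dv N (k - l)"
  shows "(\<Sum>k\<in>J_h N. G (\<sigma> k)) = (\<Sum>k\<in>J_h N. G k)"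
proof -
  define md where "md k = (fst k mod int N, fst (snd k) mod int N, snd (snd k) mod int N)" for k :: freq
  have dm: "dv N (k - md k)" for k unfolding dv_alt md_def by (simp add: dvd_minus_mod)
  have mJ: "md k \<in> J_h N" for k using N by (simp add: md_def J_h_def)
  have ij: "inj_on (\<lambda>k. md (\<sigma> k)) (J_h N)"
  proof (rule inj_onI)
    fix k l assume kl: "k \<in> J_h N" "l \<in> J_h N" and eq: "md (\<sigma> k) = md (\<sigma> l)"
    have "dv N (\<sigma> k - \<sigma> l)" using eq unfolding md_def dv_alt by (simp add: mod_eq_dvd_iff)
    then show "k = l" using inj kl J_h_dv_eq by blast
  qed
  have "(\<lambda>k. md (\<sigma> k)) ` J_h N = J_h N"
  proof (rule endo_inj_surj[OF finite_J_h _ ij])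
    show "(\<lambda>k. md (\<sigma> k)) ` J_h N \<subseteq> J_h N" using mJ by blast
  qed
  then have "(\<Sum>k\<in>J_h N. G k) = (\<Sum>k\<in>J_h N. G (md (\<sigma> k)))"
    using sum.reindex[OF ij, of G] by simp
  also have "\<dots> = (\<Sum>k\<in>J_h N. G (\<sigma> k))" by (rule sum.cong[OF refl]) (metis G dm)
  finally show ?thesis ..
qed

section \<open>Norms of grid functions\<close>

lemma grid_norm_sq: "(grid_norm N V)\<^sup>2 = mesh N ^ 3 * (\<Sum>j\<in>J_h N. (cmod (V j))\<^sup>2)"
proof -
  have "(\<Sum>j\<in>J_h N. V j * cnj (V j)) = of_real (\<Sum>j\<in>J_h N. (cmod (V j))\<^sup>2)"
    by (simp only: of_real_sum complex_norm_square)
  then have "Re (grid_inner N V V) = mesh N ^ 3 * (\<Sum>j\<in>J_h N. (cmod (V j))\<^sup>2)"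
    by (simp only: grid_inner_def of_real_mult[symmetric] Re_complex_of_real)
  moreover have "0 \<le> mesh N ^ 3 * (\<Sum>j\<in>J_h N. (cmod (V j))\<^sup>2)" by (simp add: mesh_def sum_nonneg)
  ultimately show ?thesis by (simp add: grid_norm_def)
qed

lemma grid_norm_nonneg: "0 \<le> grid_norm N V"
proof -
  have "grid_norm N V = sqrt (mesh N ^ 3 * (\<Sum>j\<in>J_h N. (cmod (V j))\<^sup>2))"
  proof -
    have "(\<Sum>j\<in>J_h N. V j * cnj (V j)) = of_real (\<Sum>j\<in>J_h N. (cmod (V j))\<^sup>2)"
      by (simp only: of_real_sum complex_norm_square)
    then show ?thesis by (simp only: grid_norm_def grid_inner_def of_real_mult[symmetric] Re_complex_of_real)
  qed
  then show ?thesis by (simp add: mesh_def sum_nonneg)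
qed

lemma parseval_grid:
  assumes N: "N > 0"
  shows "(grid_norm N V)\<^sup>2 = (2 * pi) ^ 3 * (\<Sum>k\<in>J_h N. (cmod (dft N V k))\<^sup>2)"
proof -
  have "of_real (\<Sum>j\<in>J_h N. (cmod (V j))\<^sup>2) = (\<Sum>j\<in>J_h N. V j * cnj (V j))"
    by (simp only: of_real_sum complex_norm_square)
  also have "\<dots> = (\<Sum>j\<in>J_h N. (\<Sum>k\<in>J_h N. dft N V k * echar N k j) * cnj (V j))"
    by (rule sum.cong[OF refl]) (simp add: dft_inversion[OF N, of _ V, symmetric])
  also have "\<dots> = (\<Sum>k\<in>J_h N. dft N V k * (\<Sum>j\<in>J_h N. echar N k j * cnj (V j)))"
    by (simp only: sum_distrib_right sum_distrib_left mult.assoc) (rule sum.swap)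
  also have "\<dots> = (\<Sum>k\<in>J_h N. dft N V k * cnj (of_nat N ^ 3 * dft N V k))"
    using N by (simp add: dft_def echar_minus mult.commute)
  also have "\<dots> = of_nat N ^ 3 * (\<Sum>k\<in>J_h N. dft N V k * cnj (dft N V k))"
    by (simp add: sum_distrib_left mult_ac)
  also have "(\<Sum>k\<in>J_h N. dft N V k * cnj (dft N V k)) = of_real (\<Sum>k\<in>J_h N. (cmod (dft N V k))\<^sup>2)"
    by (simp only: of_real_sum complex_norm_square)
  also have "of_nat N ^ 3 * complex_of_real (\<Sum>k\<in>J_h N. (cmod (dft N V k))\<^sup>2) = of_real (real N ^ 3 * (\<Sum>k\<in>J_h N. (cmod (dft N V k))\<^sup>2))"
    by (simp only: of_real_mult of_real_power of_real_of_nat_eq)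
  finally have "(\<Sum>j\<in>J_h N. (cmod (V j))\<^sup>2) = real N ^ 3 * (\<Sum>k\<in>J_h N. (cmod (dft N V k))\<^sup>2)"
    by (simp only: of_real_eq_iff)
  then show ?thesis using N by (simp add: grid_norm_sq mesh_def power_divide)
qed

text \<open>The discrete Wiener algebra norm.  It dominates the maximum norm (\<open>norm_le_wiener\<close>) and is
submultiplicative (\<open>wiener_mult\<close>), which the norm \<open>grid_norm\<close> is not uniformly in \<open>N\<close>.\<close>

definition wiener :: "nat \<Rightarrow> gridfun \<Rightarrow> real" where
  "wiener N V = (\<Sum>k\<in>J_h N. cmod (dft N V k))"

lemma wiener_nonneg: "0 \<le> wiener N V" by (simp add: wiener_def sum_nonneg)

lemma norm_le_wiener: "N > 0 \<Longrightarrow> j \<in> J_h N \<Longrightarrow> cmod (V j) \<le> wiener N V"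
  by (subst dft_inversion) (auto simp: wiener_def norm_mult intro!: order_trans[OF norm_sum])

lemma dft_mult:
  assumes N: "N > 0"
  shows "dft N (\<lambda>j. V j * W j) k = (\<Sum>l\<in>J_h N. dft N V l * dft N W (k - l))"
proof -
  have "(\<Sum>j\<in>J_h N. V j * W j * echar N (- k) j) = (\<Sum>j\<in>J_h N. \<Sum>l\<in>J_h N. dft N V l * (W j * echar N (- (k - l)) j))"
  proof (rule sum.cong[OF refl])
    fix j assume j: "j \<in> J_h N"
    have e: "echar N (- (k - l)) j = echar N l j * echar N (- k) j" for l
      using echar_add[of N l "- k" j] by simp
    have "V j * W j * echar N (- k) j = (\<Sum>l\<in>J_h N. dft N V l * echar N l j) * (W j * echar N (- k) j)"
      by (simp only: dft_inversion[OF N j, of V, symmetric] mult.assoc)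
    also have "\<dots> = (\<Sum>l\<in>J_h N. dft N V l * (W j * echar N (- (k - l)) j))"
      unfolding e sum_distrib_right by (rule sum.cong[OF refl]) (simp only: mult_ac)
    finally show "V j * W j * echar N (- k) j = (\<Sum>l\<in>J_h N. dft N V l * (W j * echar N (- (k - l)) j))" .
  qed
  also have "\<dots> = (\<Sum>l\<in>J_h N. dft N V l * (\<Sum>j\<in>J_h N. W j * echar N (- (k - l)) j))"
    by (subst sum.swap) (simp only: sum_distrib_left)
  finally show ?thesis
    by (simp only: dft_def[of N "\<lambda>j. V j * W j"] dft_def[of N W] sum_divide_distrib[symmetric] times_divide_eq_right)
qed

lemma wiener_mult:
  assumes N: "N > 0" shows "wiener N (\<lambda>j. V j * W j) \<le> wiener N V * wiener N W"
proof -
  have sh: "(\<Sum>k\<in>J_h N. cmod (dft N W (k - l))) = wiener N W" for l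
    unfolding wiener_def
  proof (rule sum_J_h_bij[OF N])
    show "cmod (dft N W k) = cmod (dft N W l)" if "dv N (k - l)" for k l
      using dft_periodic[OF N that] by simp
    have "(k - l) - (k' - l) = k - k'" for k k' :: freq by simp
    then show "dv N (k - k')" if "dv N ((k - l) - (k' - l))" for k k' using that by simp
  qed
  have "wiener N (\<lambda>j. V j * W j) \<le> (\<Sum>k\<in>J_h N. \<Sum>l\<in>J_h N. cmod (dft N V l) * cmod (dft N W (k - l)))"
    unfolding wiener_def dft_mult[OF N]
    by (intro sum_mono order_trans[OF norm_sum]) (simp add: norm_mult)
  also have "\<dots> = (\<Sum>l\<in>J_h N. cmod (dft N V l) * (\<Sum>k\<in>J_h N. cmod (dft N W (k - l))))"
    by (subst sum.swap) (simp only: sum_distrib_left)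
  also have "\<dots> = wiener N V * wiener N W" unfolding sh by (simp add: wiener_def sum_distrib_right)
  finally show ?thesis .
qed

text \<open>What the error recursion needs from a norm: monotonicity in the moduli of the discrete
  Fourier coefficients, which makes it compatible with the unitary part of a step, and products with functions that
  are bounded in the Wiener norm.  Both \<open>wiener\<close> and \<open>grid_norm\<close> qualify, so the recursion is
  derived once.\<close>

locale gnorm =
  fixes N :: nat and nn :: "gridfun \<Rightarrow> real"
  assumes N: "N > 0"
    and nonneg: "0 \<le> nn X"
    and mono: "0 \<le> c \<Longrightarrow> (\<And>k. k \<in> J_h N \<Longrightarrow> cmod (dft N X k) \<le> cmod (dft N Y k) + c * cmod (dft N Z k)) \<Longrightarrow> nn X \<le> nn Y + c * nn Z"
    and zero: "nn (\<lambda>j. 0) = 0"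
    and mult: "nn (\<lambda>j. X j * Y j) \<le> wiener N X * nn Y"
    and cnj_le: "nn (\<lambda>j. cnj (X j)) \<le> nn X"
begin

lemma cong_le: "(\<And>j. j \<in> J_h N \<Longrightarrow> X j = Y j) \<Longrightarrow> nn X \<le> nn Y"
  using mono[of 0 X Y Y] dft_cong[of N X Y] by simp

lemma cong: "(\<And>j. j \<in> J_h N \<Longrightarrow> X j = Y j) \<Longrightarrow> nn X = nn Y"
  by (intro antisym cong_le) auto

lemma add: "nn (\<lambda>j. X j + Y j) \<le> nn X + nn Y"
  using mono[of 1 "\<lambda>j. X j + Y j" X Y] by (simp add: dft_add norm_triangle_ineq)

lemma diff: "nn (\<lambda>j. X j - Y j) \<le> nn X + nn Y"
  using mono[of 1 "\<lambda>j. X j - Y j" X Y] by (simp add: dft_diff norm_triangle_ineq4)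

lemma scale: "nn (\<lambda>j. c * X j) \<le> cmod c * nn X"
  using mono[of "cmod c" "\<lambda>j. c * X j" "\<lambda>j. 0" X] by (simp add: dft_scale norm_mult zero)

end

lemma gnorm_wiener: assumes N: "N > 0" shows "gnorm N (wiener N)"
proof
  show "wiener N (\<lambda>j. cnj (X j)) \<le> wiener N X" for X
  proof -
    have "(\<Sum>k\<in>J_h N. cmod (dft N X (- k))) = (\<Sum>k\<in>J_h N. cmod (dft N X k))"
    proof (rule sum_J_h_bij[OF N])
      show "dv N (k - l)" if "dv N (- k - - l)" for k l using that by (auto simp: dv_def dvd_diff_commute)
    qed (auto intro!: arg_cong[where f = cmod] dft_periodic[OF N])
    then show ?thesis by (simp add: wiener_def dft_cnj)
  qed
  show "wiener N X \<le> wiener N Y + c * wiener N Z"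
    if "\<And>k. k \<in> J_h N \<Longrightarrow> cmod (dft N X k) \<le> cmod (dft N Y k) + c * cmod (dft N Z k)" for X Y Z c
    unfolding wiener_def sum_distrib_left sum.distrib[symmetric] by (rule sum_mono[OF that])
  show "wiener N (\<lambda>j. 0) = 0" by (simp add: wiener_def)
qed (use N in \<open>auto simp: wiener_nonneg wiener_mult\<close>)

lemma gnorm_grid_norm: assumes N: "N > 0" shows "gnorm N (grid_norm N)"
proof
  have eq: "grid_norm N X = sqrt ((2 * pi) ^ 3) * L2_set (\<lambda>k. cmod (dft N X k)) (J_h N)" for X
    unfolding L2_set_def real_sqrt_mult[symmetric] parseval_grid[OF N, symmetric] using grid_norm_nonneg by simp
  show "grid_norm N X \<le> grid_norm N Y + c * grid_norm N Z"
    if c: "0 \<le> c" and *: "\<And>k. k \<in> J_h N \<Longrightarrow> cmod (dft N X k) \<le> cmod (dft N Y k) + c * cmod (dft N Z k)" for X Y Z c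
  proof -
    have "L2_set (\<lambda>k. cmod (dft N X k)) (J_h N) \<le> L2_set (\<lambda>k. cmod (dft N Y k) + c * cmod (dft N Z k)) (J_h N)"
      by (rule L2_set_mono) (use * in auto)
    also have "\<dots> \<le> L2_set (\<lambda>k. cmod (dft N Y k)) (J_h N) + L2_set (\<lambda>k. c * cmod (dft N Z k)) (J_h N)"
      by (rule L2_set_triangle_ineq)
    also have "L2_set (\<lambda>k. c * cmod (dft N Z k)) (J_h N) = c * L2_set (\<lambda>k. cmod (dft N Z k)) (J_h N)"
      using c by (rule L2_set_right_distrib[symmetric])
    finally have "sqrt ((2 * pi) ^ 3) * L2_set (\<lambda>k. cmod (dft N X k)) (J_h N) \<le> sqrt ((2 * pi) ^ 3) * (L2_set (\<lambda>k. cmod (dft N Y k)) (J_h N) + c * L2_set (\<lambda>k. cmod (dft N Z k)) (J_h N))"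
      by (rule mult_left_mono) simp
    then show ?thesis unfolding eq by (simp add: algebra_simps)
  qed
  have mon: "grid_norm N X \<le> B * grid_norm N Y" if B: "0 \<le> B" and *: "\<And>j. j \<in> J_h N \<Longrightarrow> cmod (X j) \<le> B * cmod (Y j)" for X Y B
  proof -
    have "(\<Sum>j\<in>J_h N. (cmod (X j))\<^sup>2) \<le> (\<Sum>j\<in>J_h N. (B * cmod (Y j))\<^sup>2)"
      by (intro sum_mono power_mono *) auto
    also have "\<dots> = B\<^sup>2 * (\<Sum>j\<in>J_h N. (cmod (Y j))\<^sup>2)" by (simp add: power_mult_distrib sum_distrib_left)
    finally have "mesh N ^ 3 * (\<Sum>j\<in>J_h N. (cmod (X j))\<^sup>2) \<le> mesh N ^ 3 * (B\<^sup>2 * (\<Sum>j\<in>J_h N. (cmod (Y j))\<^sup>2))"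
      by (rule mult_left_mono) (simp add: mesh_def)
    then have "(grid_norm N X)\<^sup>2 \<le> (B * grid_norm N Y)\<^sup>2"
      by (simp add: power_mult_distrib grid_norm_sq mult_ac)
    then show ?thesis by (rule power2_le_imp_le) (simp add: B grid_norm_nonneg)
  qed
  show "grid_norm N (\<lambda>j. X j * Y j) \<le> wiener N X * grid_norm N Y" for X Y
    by (rule mon[OF wiener_nonneg]) (auto simp: norm_mult intro!: mult_right_mono norm_le_wiener N)
  show "grid_norm N (\<lambda>j. cnj (X j)) \<le> grid_norm N X" for X
    using mon[of 1 "\<lambda>j. cnj (X j)" X] by simp
  have "(grid_norm N (\<lambda>j. 0))\<^sup>2 = 0" unfolding grid_norm_sq by simp
  then show "grid_norm N (\<lambda>j. 0) = 0" by simp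
qed (use N in \<open>auto simp: grid_norm_nonneg\<close>)

lemma grid_norm_le_sup:
  assumes N: "N > 0" and B: "0 \<le> B" "\<And>j. j \<in> J_h N \<Longrightarrow> cmod (V j) \<le> B"
  shows "grid_norm N V \<le> sqrt ((2 * pi) ^ 3) * B"
proof -
  have "(\<Sum>j\<in>J_h N. (cmod (V j))\<^sup>2) \<le> (\<Sum>j\<in>J_h N. B\<^sup>2)"
    by (intro sum_mono power_mono B) auto
  then have "mesh N ^ 3 * (\<Sum>j\<in>J_h N. (cmod (V j))\<^sup>2) \<le> mesh N ^ 3 * (\<Sum>j\<in>J_h N. B\<^sup>2)"
    by (rule mult_left_mono) (simp add: mesh_def)
  also have "\<dots> = (sqrt ((2 * pi) ^ 3) * B)\<^sup>2"
    using N by (simp add: card_J_h mesh_def power_divide power_mult_distrib)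
  finally have "(grid_norm N V)\<^sup>2 \<le> (sqrt ((2 * pi) ^ 3) * B)\<^sup>2" by (simp add: grid_norm_sq)
  then show ?thesis by (rule power2_le_imp_le) (simp add: B)
qed

section \<open>The pseudo-spectral Laplacian\<close>

text \<open>The eigenvalues of the negative of the matrix \<open>D2\<close>.  For even \<open>N\<close>, one frequency of each
aliasing class is present in the interpolating functions, except that the two frequencies \<open>N / 2\<close> and \<open>- N / 2\<close> share
their class, each with weight one half.\<close>

definition lam1 :: "nat \<Rightarrow> int \<Rightarrow> real" where
  "lam1 N q = (\<Sum>l | l \<in> {- (int N div 2)..int N div 2} \<and> int N dvd q - l. (of_int l)\<^sup>2 / (if \<bar>l\<bar> = int N div 2 then 2 else 1))"

definition lam :: "nat \<Rightarrow> freq \<Rightarrow> real" where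
  "lam N k = (\<Sum>i\<in>UNIV. lam1 N (kc k i))"

lemma lam_nonneg: "0 \<le> lam N k"
  by (auto simp: lam_def lam1_def intro!: sum_nonneg)

lemma D2_eq: assumes N: "N > 0" shows "D2 N k j = (1 / of_nat N) * (\<Sum>l\<in>{- (int N div 2)..int N div 2}. - (of_int l)\<^sup>2 / a_coeff N l * cis (of_int l * of_int (k - j) * mesh N))"
proof -
  define A where "A = {- (int N div 2)..int N div 2}"
  have ac: "a_coeff N l \<noteq> 0" for l by (simp add: a_coeff_def)
  have d1: "(g_basis N j has_vector_derivative (1 / of_nat N) * (\<Sum>l\<in>A. (1 / a_coeff N l) * ((\<i> * of_int l) * exp (\<i> * of_int l * of_real (x - of_int j * mesh N))))) (at x)" for x
  proof -
    have "((\<lambda>z. (1 / of_nat N) * (\<Sum>l\<in>A. (1 / a_coeff N l) * exp (\<i> * of_int l * (z - of_real (of_int j * mesh N))))) has_field_derivative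
       (1 / of_nat N) * (\<Sum>l\<in>A. (1 / a_coeff N l) * ((\<i> * of_int l) * exp (\<i> * of_int l * (of_real x - of_real (of_int j * mesh N)))))) (at (of_real x))"
      using N by (auto intro!: derivative_eq_intros sum.cong simp: mult_ac ac)
    from has_vector_derivative_real_field[OF this] show ?thesis
      by (simp add: g_basis_def[abs_def] A_def)
  qed
  then have e1: "(\<lambda>x. vector_derivative (g_basis N j) (at x)) = (\<lambda>x. (1 / of_nat N) * (\<Sum>l\<in>A. (1 / a_coeff N l) * ((\<i> * of_int l) * exp (\<i> * of_int l * of_real (x - of_int j * mesh N)))))"
    by (auto simp: vector_derivative_at)
  have d2: "((\<lambda>x. (1 / of_nat N) * (\<Sum>l\<in>A. (1 / a_coeff N l) * ((\<i> * of_int l) * exp (\<i> * of_int l * of_real (x - of_int j * mesh N))))) has_vector_derivative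
     (1 / of_nat N) * (\<Sum>l\<in>A. (1 / a_coeff N l) * ((\<i> * of_int l) * ((\<i> * of_int l) * exp (\<i> * of_int l * of_real (x - of_int j * mesh N)))))) (at x)" for x
  proof -
    have "((\<lambda>z. (1 / of_nat N) * (\<Sum>l\<in>A. (1 / a_coeff N l) * ((\<i> * of_int l) * exp (\<i> * of_int l * (z - of_real (of_int j * mesh N)))))) has_field_derivative
       (1 / of_nat N) * (\<Sum>l\<in>A. (1 / a_coeff N l) * ((\<i> * of_int l) * ((\<i> * of_int l) * exp (\<i> * of_int l * (of_real x - of_real (of_int j * mesh N))))))) (at (of_real x))"
      using N by (auto intro!: derivative_eq_intros sum.cong simp: mult_ac ac)
    from has_vector_derivative_real_field[OF this] show ?thesis by simp
  qed
  have "D2 N k j = (1 / of_nat N) * (\<Sum>l\<in>A. (1 / a_coeff N l) * ((\<i> * of_int l) * ((\<i> * of_int l) * exp (\<i> * of_int l * of_real (of_int k * mesh N - of_int j * mesh N)))))"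
    unfolding D2_def e1 by (rule vector_derivative_at[OF d2])
  also have "\<dots> = (1 / of_nat N) * (\<Sum>l\<in>A. - (of_int l)\<^sup>2 / a_coeff N l * cis (of_int l * of_int (k - j) * mesh N))"
  proof -
    have "(1 / a_coeff N l) * ((\<i> * of_int l) * ((\<i> * of_int l) * exp (\<i> * of_int l * of_real (of_int k * mesh N - of_int j * mesh N))))
       = - (of_int l)\<^sup>2 / a_coeff N l * cis (of_int l * of_int (k - j) * mesh N)" for l
    proof -
      have e: "exp (\<i> * of_int l * of_real (of_int k * mesh N - of_int j * mesh N)) = cis (of_int l * of_int (k - j) * mesh N)"
        by (simp add: cis_conv_exp algebra_simps)
      have m: "(\<i> * of_int l) * ((\<i> * of_int l) * z) = - (of_int l)\<^sup>2 * z" for z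
        by (simp add: power2_eq_square algebra_simps)
      show ?thesis unfolding e m by simp
    qed
    then show ?thesis by simp
  qed
  finally show ?thesis by (simp add: A_def)
qed

text \<open>Orthogonality of the one-dimensional characters keeps exactly those frequencies of the interpolant
that alias with \<open>q\<close>.\<close>

lemma D2_cis:
  assumes N: "N > 0"
  shows "(\<Sum>j\<in>{0..<int N}. D2 N p j * cis (of_int q * of_int j * mesh N)) = - of_real (lam1 N q) * cis (of_int q * of_int p * mesh N)"
proof -
  define A where "A = {- (int N div 2)..int N div 2}"
  define c where "c l = - (of_int l)\<^sup>2 / a_coeff N l" for l
  have "(\<Sum>j\<in>{0..<int N}. D2 N p j * cis (of_int q * of_int j * mesh N)) =
    (\<Sum>j\<in>{0..<int N}. \<Sum>l\<in>A. (1 / of_nat N) * (c l * cis (of_int l * of_int p * mesh N)) * cis (of_int (q - l) * of_int j * mesh N))"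
  proof (rule sum.cong[OF refl])
    fix j
    have "cis (of_int l * of_int (p - j) * mesh N) * cis (of_int q * of_int j * mesh N) = cis (of_int l * of_int p * mesh N) * cis (of_int (q - l) * of_int j * mesh N)" for l
      unfolding cis_mult by (simp add: algebra_simps)
    then show "D2 N p j * cis (of_int q * of_int j * mesh N) = (\<Sum>l\<in>A. (1 / of_nat N) * (c l * cis (of_int l * of_int p * mesh N)) * cis (of_int (q - l) * of_int j * mesh N))"
      unfolding D2_eq[OF N] A_def[symmetric] c_def[symmetric] by (simp only: sum_distrib_right sum_distrib_left mult.assoc)
  qed
  also have "\<dots> = (\<Sum>l\<in>A. (1 / of_nat N) * (c l * cis (of_int l * of_int p * mesh N)) * (\<Sum>j\<in>{0..<int N}. cis (of_int (q - l) * of_int j * mesh N)))"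
    by (subst sum.swap) (simp only: sum_distrib_left)
  also have "\<dots> = (\<Sum>l\<in>A. if int N dvd q - l then c l * cis (of_int q * of_int p * mesh N) else 0)"
    unfolding sum_cis_1d[OF N]
    by (rule sum.cong[OF refl]) (use N cis_cong[OF N, of q _ p] in \<open>auto\<close>)
  also have "\<dots> = (\<Sum>l | l \<in> A \<and> int N dvd q - l. c l * cis (of_int q * of_int p * mesh N))"
    by (simp add: A_def sum.inter_filter[symmetric])
  also have "\<dots> = - of_real (lam1 N q) * cis (of_int q * of_int p * mesh N)"
  proof -
    have "c l = - of_real ((of_int l)\<^sup>2 / (if \<bar>l\<bar> = int N div 2 then 2 else 1))" for l
      by (simp add: c_def a_coeff_def)
    then show ?thesis by (simp only: lam1_def A_def of_real_sum sum_distrib_right[symmetric] sum_negf)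
  qed
  finally show ?thesis .
qed

lemma Delta_h_echar:
  assumes N: "N > 0" shows "Delta_h N (echar N q) j = - of_real (lam N q) * echar N q j"
proof -
  obtain a b c where j: "j = (a, b, c)" by (cases j)
  obtain q1 q2 q3 where q: "q = (q1, q2, q3)" by (cases q)
  define X Y Z where "X = cis (of_int q1 * of_int a * mesh N)" and "Y = cis (of_int q2 * of_int b * mesh N)" and "Z = cis (of_int q3 * of_int c * mesh N)"
  have "Delta_h N (echar N q) j =
     (\<Sum>j\<in>{0..<int N}. D2 N a j * cis (of_int q1 * of_int j * mesh N)) * (Y * Z) +
     (\<Sum>j\<in>{0..<int N}. D2 N b j * cis (of_int q2 * of_int j * mesh N)) * (X * Z) +
     (\<Sum>j\<in>{0..<int N}. D2 N c j * cis (of_int q3 * of_int j * mesh N)) * (X * Y)"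
    unfolding j q Delta_h_def echar_factor X_def Y_def Z_def by (simp add: sum_distrib_right sum_distrib_left mult_ac)
  also have "\<dots> = - of_real (lam N q) * (X * (Y * Z))"
    unfolding D2_cis[OF N] by (simp add: lam_def sum_3 kc_def q X_def Y_def Z_def algebra_simps)
  finally show ?thesis unfolding j q echar_factor X_def Y_def Z_def by simp
qed

lemma Delta_h_cong:
  assumes "j \<in> J_h N" "\<And>j. j \<in> J_h N \<Longrightarrow> V j = W j"
  shows "Delta_h N V j = Delta_h N W j"
proof -
  obtain a b c where j: "j = (a, b, c)" by (cases j)
  show ?thesis using assms unfolding j Delta_h_def J_h_def by auto
qed

lemma Delta_h_sum: "Delta_h N (\<lambda>j. \<Sum>k\<in>K. c k * W k j) j = (\<Sum>k\<in>K. c k * Delta_h N (W k) j)"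
proof -
  obtain a b d where j: "j = (a, b, d)" by (cases j)
  have *: "(\<Sum>i\<in>A. D i * (\<Sum>k\<in>K. c k * f k i)) = (\<Sum>k\<in>K. c k * (\<Sum>i\<in>A. D i * f k i))" for A :: "int set" and D f
    by (simp add: sum_distrib_left mult.left_commute) (rule sum.swap)
  show ?thesis unfolding j Delta_h_def by (simp add: * sum.distrib distrib_left)
qed

lemma Delta_h_diff: "Delta_h N (\<lambda>j. V j - W j) j = Delta_h N V j - Delta_h N W j"
  by (cases j) (simp add: Delta_h_def right_diff_distrib sum_subtractf)

lemma dft_Delta_h:
  assumes N: "N > 0" and k: "k \<in> J_h N"
  shows "dft N (Delta_h N V) k = - of_real (lam N k) * dft N V k"
proof -
  have "dft N (Delta_h N V) k = dft N (\<lambda>j. \<Sum>l\<in>J_h N. (- of_real (lam N l) * dft N V l) * echar N l j) k"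
  proof (rule dft_cong)
    fix j assume j: "j \<in> J_h N"
    have "Delta_h N V j = Delta_h N (\<lambda>j. \<Sum>l\<in>J_h N. dft N V l * echar N l j) j"
      by (rule Delta_h_cong[OF j]) (rule dft_inversion[OF N])
    then show "Delta_h N V j = (\<Sum>l\<in>J_h N. (- of_real (lam N l) * dft N V l) * echar N l j)"
      by (simp add: Delta_h_sum Delta_h_echar[OF N] mult_ac)
  qed
  also have "\<dots> = (\<Sum>l\<in>J_h N. (- of_real (lam N l) * dft N V l) * (if dv N (l - k) then 1 else 0))"
    by (simp only: dft_sum dft_scale dft_echar[OF N])
  also have "\<dots> = (\<Sum>l\<in>J_h N. if l = k then - of_real (lam N l) * dft N V l else 0)"
    by (rule sum.cong[OF refl]) (use k in \<open>auto simp: J_h_dv_iff\<close>)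
  also have "\<dots> = - of_real (lam N k) * dft N V k" using k by simp
  finally show ?thesis .
qed

lemma lam1_small:
  assumes N: "N > 0" "even N" and q: "\<bar>q\<bar> \<le> int N div 2" shows "lam1 N q = (of_int q)\<^sup>2"
proof -
  define n where "n = int N div 2"
  have n: "int N = 2 * n" "n > 0" using N by (auto simp: n_def elim!: evenE)
  let ?S = "{l. l \<in> {- n..n} \<and> int N dvd q - l}"
  have dvdc: "q - l = 0 \<or> \<bar>q - l\<bar> \<ge> 2 * n" if "int N dvd q - l" for l
    using that dvd_imp_le_int[of "q - l" "int N"] n by auto
  show ?thesis
  proof (cases "\<bar>q\<bar> = n")
    case True
    have "?S = {n, - n}"
    proof (intro equalityI subsetI)
      fix l assume l: "l \<in> ?S"
      then have "q - l = 0 \<or> \<bar>q - l\<bar> \<ge> 2 * n" using dvdc by auto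
      then show "l \<in> {n, - n}" using l True by auto
    next
      fix l assume l: "l \<in> {n, - n}"
      have "q = n \<or> q = - n" using True by auto
      then have "q - l = 0 \<or> q - l = 2 * n \<or> q - l = - (2 * n)" using l by auto
      then have "int N dvd q - l" unfolding n by auto
      then show "l \<in> ?S" using l n by auto
    qed
    then have "lam1 N q = (\<Sum>l\<in>{n, - n}. (of_int l)\<^sup>2 / (if \<bar>l\<bar> = n then 2 else 1))"
      unfolding lam1_def n_def[symmetric] by simp
    also have "\<dots> = (of_int n)\<^sup>2" using n by simp
    also have "\<dots> = (of_int q)\<^sup>2" using True by (metis power2_abs of_int_abs)
    finally show ?thesis .
  next
    case False
    have "?S = {q}"
    proof (intro equalityI subsetI)
      fix l assume l: "l \<in> ?S"
      then have "q - l = 0 \<or> \<bar>q - l\<bar> \<ge> 2 * n" using dvdc by auto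
      then show "l \<in> {q}" using l False q by (auto simp: n_def[symmetric])
    qed (use q in \<open>auto simp: n_def[symmetric]\<close>)
    then have "lam1 N q = (\<Sum>l\<in>{q}. (of_int l)\<^sup>2 / (if \<bar>l\<bar> = n then 2 else 1))"
      unfolding lam1_def n_def[symmetric] by simp
    then show ?thesis using False by simp
  qed
qed

lemma lam1_le:
  assumes N: "N > 0" "even N" shows "lam1 N q \<le> (of_int q)\<^sup>2"
proof (cases "\<bar>q\<bar> \<le> int N div 2")
  case True then show ?thesis using lam1_small[OF N True] by simp
next
  case False
  define n where "n = int N div 2"
  have n: "int N = 2 * n" "n > 0" using N by (auto simp: n_def elim!: evenE)
  define r where "r = (q + n) mod int N - n"
  have "0 \<le> (q + n) mod int N" "(q + n) mod int N < int N" using N by auto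
  then have r: "\<bar>r\<bar> \<le> n" unfolding r_def n(1) by auto
  have "int N dvd (q + n) - (q + n) mod int N" by (rule dvd_minus_mod)
  then have d: "int N dvd q - r" by (simp add: r_def algebra_simps)
  have "int N dvd q - l \<longleftrightarrow> int N dvd r - l" for l
    using dvd_diff[OF _ d, of "q - l"] dvd_add[OF _ d, of "r - l"] by (auto simp: algebra_simps)
  then have "lam1 N q = lam1 N r" by (simp add: lam1_def)
  also have "\<dots> = (of_int r)\<^sup>2" using lam1_small[OF N] r by (simp add: n_def)
  also have "\<dots> \<le> (of_int q)\<^sup>2"
  proof -
    have "\<bar>r\<bar> \<le> \<bar>q\<bar>" using r False by (simp add: n_def)
    then have "\<bar>real_of_int r\<bar> \<le> \<bar>real_of_int q\<bar>" by linarith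
    then show ?thesis by (simp add: abs_le_square_iff)
  qed
  finally show ?thesis .
qed

text \<open>The matrix sees every frequency through its representative of least modulus.\<close>

lemma lam_le: "N > 0 \<Longrightarrow> even N \<Longrightarrow> lam N k \<le> ksq k"
  unfolding lam_def ksq_def by (intro sum_mono lam1_le)

lemma lam_small: "N > 0 \<Longrightarrow> even N \<Longrightarrow> (\<And>i. \<bar>kc k i\<bar> \<le> int N div 2) \<Longrightarrow> lam N k = ksq k"
  unfolding lam_def ksq_def by (intro sum.cong refl lam1_small)

section \<open>One step of the Crank--Nicolson type scheme\<close>

text \<open>On the frequency \<open>k\<close> the equation reads \<open>x * p = y * q - g\<close> with \<open>p\<close> and \<open>q\<close> of equal modulus, namely \<open>p = - cnj q\<close>,
and of modulus at least \<open>1 / \<kappa>\<close>.  Thus the step is unitary up to the source.\<close>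

lemma cn_step:
  assumes N: "N > 0" and \<kappa>: "\<kappa> > 0" and k: "k \<in> J_h N"
    and eq: "\<And>j. j \<in> J_h N \<Longrightarrow> \<i> * ((X j - Y j) / of_real \<kappa>) + Delta_h N (\<lambda>j. (X j + Y j) / 2) j + G j = 0"
  shows "cmod (dft N X k) \<le> cmod (dft N Y k) + \<kappa> * cmod (dft N G k)"
proof -
  define x y g where "x = dft N X k" and "y = dft N Y k" and "g = dft N G k"
  define l where "l = lam N k"
  have "dft N (\<lambda>j. (\<i> / of_real \<kappa>) * (X j - Y j) + Delta_h N (\<lambda>j. (1/2) * (X j + Y j)) j + G j) k = dft N (\<lambda>j. 0) k"
    by (rule dft_cong) (use eq in simp)
  then have e: "(\<i> / of_real \<kappa>) * (x - y) - of_real l * ((1/2) * (x + y)) + g = 0"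
    by (simp only: dft_add dft_scale dft_diff dft_Delta_h[OF N k] dft_0 x_def y_def g_def l_def) simp
  define p where "p = \<i> / of_real \<kappa> - of_real (l / 2)"
  define q where "q = \<i> / of_real \<kappa> + of_real (l / 2)"
  define P where "P = \<i> / of_real \<kappa>"
  have "x * p - (y * q - g) = P * (x - y) - of_real l * ((1/2) * (x + y)) + g"
    by (simp add: p_def q_def P_def[symmetric] algebra_simps)
  then have "x * p - (y * q - g) = 0" using e[folded P_def] by (simp only:)
  then have "x * p = y * q - g" by simp
  then have "cmod x * cmod p \<le> cmod y * cmod q + cmod g"
    by (metis norm_mult norm_triangle_ineq4)
  moreover have "cmod q = cmod p"
    by (simp add: p_def q_def cmod_def)
  moreover have "cmod p \<ge> 1 / \<kappa>"
    using abs_Im_le_cmod[of p] \<kappa> by (simp add: p_def)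
  ultimately have *: "cmod x * cmod p \<le> cmod y * cmod p + cmod g" "1 / \<kappa> \<le> cmod p" by auto
  have p0: "cmod p > 0" using *(2) \<kappa> by (meson divide_pos_pos less_le_trans zero_less_one)
  have "cmod g \<le> \<kappa> * cmod g * cmod p"
  proof -
    have "cmod g * 1 \<le> cmod g * (\<kappa> * cmod p)" using *(2) \<kappa> by (intro mult_left_mono) (auto simp: field_simps)
    then show ?thesis by (simp add: mult_ac)
  qed
  with *(1) have "cmod x * cmod p \<le> (cmod y + \<kappa> * cmod g) * cmod p" by (simp add: algebra_simps)
  then have "cmod x \<le> cmod y + \<kappa> * cmod g" using p0 by simp
  then show ?thesis by (simp add: x_def y_def g_def)
qed

section \<open>Restriction to the grid and aliasing\<close>

definition gr :: "nat \<Rightarrow> (real^3 \<Rightarrow> complex) \<Rightarrow> gridfun" where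
  "gr N f j = f (grid_point N j)"

lemma grid_point_Omega: "N > 0 \<Longrightarrow> j \<in> J_h N \<Longrightarrow> grid_point N j \<in> Omega"
proof -
  assume N: "N > 0" and j: "j \<in> J_h N"
  have "0 \<le> kc j i \<and> kc j i \<le> int N" for i using j by (auto simp: J_h_def kc_def)
  then have b: "0 \<le> kc j i" "real_of_int (kc j i) \<le> real N" for i by (auto simp: of_int_le_iff[where 'a = real, of _ "int N", symmetric] simp del: of_int_le_iff)
  have "real_of_int (kc j i) * mesh N \<le> real N * mesh N" for i
    using b by (intro mult_right_mono) (auto simp: mesh_def)
  then show ?thesis using N b by (auto simp: Omega_def grid_point_nth mesh_def)
qed

text \<open>The grid function \<open>V\<close> is the restriction of a Fourier series with coefficients \<open>c\<close>.  Stated for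
coefficient families rather than for functions, so that it applies to residuals in which the discrete Laplacian occurs.\<close>

definition rep :: "nat \<Rightarrow> (freq \<Rightarrow> complex) \<Rightarrow> gridfun \<Rightarrow> bool" where
  "rep N c V \<longleftrightarrow> (\<forall>j\<in>J_h N. ((\<lambda>\<kappa>. c \<kappa> * echar N \<kappa> j) has_sum V j) UNIV)"

lemma rep_gr: "N > 0 \<Longrightarrow> reg f \<Longrightarrow> rep N (coef f) (gr N f)"
  unfolding rep_def gr_def echar_def by (intro ballI fourier_inversion grid_point_Omega)

lemma rep_add: "rep N c V \<Longrightarrow> rep N d W \<Longrightarrow> rep N (\<lambda>k. c k + d k) (\<lambda>j. V j + W j)"
  unfolding rep_def by (auto simp: distrib_right intro: has_sum_add)

lemma rep_scale: "rep N c V \<Longrightarrow> rep N (\<lambda>k. a * c k) (\<lambda>j. a * V j)"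
  unfolding rep_def by (auto simp: mult.assoc intro: has_sum_cmult_right)

lemma rep_diff: "rep N c V \<Longrightarrow> rep N d W \<Longrightarrow> rep N (\<lambda>k. c k - d k) (\<lambda>j. V j - W j)"
  using rep_add[OF _ rep_scale[of N d W "-1"], of c V] by simp

text \<open>A discrete Fourier coefficient is the sum of the coefficients over its aliasing class.\<close>

lemma rep_dft:
  assumes N: "N > 0" and r: "rep N c V"
  shows "((\<lambda>F. \<Sum>\<kappa>\<in>F. if dv N (\<kappa> - k) then c \<kappa> else 0) \<longlongrightarrow> dft N V k) (finite_subsets_at_top UNIV)"
proof -
  have eq: "dft N (\<lambda>j. \<Sum>\<kappa>\<in>F. c \<kappa> * echar N \<kappa> j) k = (\<Sum>\<kappa>\<in>F. if dv N (\<kappa> - k) then c \<kappa> else 0)" for F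
    by (simp only: dft_sum dft_scale dft_echar[OF N]) (simp add: if_distrib cong: if_cong)
  have "((\<lambda>F. dft N (\<lambda>j. \<Sum>\<kappa>\<in>F. c \<kappa> * echar N \<kappa> j) k) \<longlongrightarrow> dft N V k) (finite_subsets_at_top UNIV)"
    unfolding dft_def by (intro tendsto_intros) (use r N in \<open>auto simp: rep_def has_sum_def simp del: split_paired_All\<close>)
  then show ?thesis by (simp only: eq)
qed

lemma rep_Delta_h:
  assumes N: "N > 0" and r: "rep N c V"
  shows "rep N (\<lambda>\<kappa>. - of_real (lam N \<kappa>) * c \<kappa>) (Delta_h N V)"
  unfolding rep_def
proof
  fix j assume j: "j \<in> J_h N"
  have eq: "Delta_h N (\<lambda>j. \<Sum>\<kappa>\<in>F. c \<kappa> * echar N \<kappa> j) j = (\<Sum>\<kappa>\<in>F. - of_real (lam N \<kappa>) * c \<kappa> * echar N \<kappa> j)" for F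
    by (simp add: Delta_h_sum Delta_h_echar[OF N] mult_ac)
  obtain p q s where pqs: "j = (p, q, s)" by (cases j)
  have lim: "((\<lambda>F. \<Sum>\<kappa>\<in>F. c \<kappa> * echar N \<kappa> j) \<longlongrightarrow> V j) (finite_subsets_at_top UNIV)" if "j \<in> J_h N" for j
    using r that by (auto simp: rep_def has_sum_def simp del: split_paired_All)
  have "((\<lambda>F. Delta_h N (\<lambda>j. \<Sum>\<kappa>\<in>F. c \<kappa> * echar N \<kappa> j) j) \<longlongrightarrow> Delta_h N V j) (finite_subsets_at_top UNIV)"
    unfolding pqs Delta_h_def prod.case
    by (intro tendsto_intros lim) (use j pqs in \<open>auto simp: J_h_def\<close>)
  then show "((\<lambda>\<kappa>. - of_real (lam N \<kappa>) * c \<kappa> * echar N \<kappa> j) has_sum Delta_h N V j) UNIV"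
    unfolding has_sum_def eq .
qed

lemma dv_left: "dv N (c - b) \<Longrightarrow> dv N (c - a) \<Longrightarrow> dv N (a - b)"
  and dv_right: "dv N (a - c) \<Longrightarrow> dv N (b - c) \<Longrightarrow> dv N (a - b)"
proof -
  show "dv N (a - b)" if "dv N (c - b)" "dv N (c - a)"
    unfolding dv_def
  proof
    fix i
    have "int N dvd kc (c - b) i" "int N dvd kc (c - a) i" using that unfolding dv_def by blast+
    from dvd_diff[OF this] have "int N dvd (kc c i - kc b i) - (kc c i - kc a i)" by (simp only: kc_diff)
    then show "int N dvd kc (a - b) i" by simp
  qed
  show "dv N (a - b)" if "dv N (a - c)" "dv N (b - c)"
    unfolding dv_def
  proof
    fix i
    have "int N dvd kc (a - c) i" "int N dvd kc (b - c) i" using that unfolding dv_def by blast+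
    from dvd_diff[OF this] have "int N dvd (kc a i - kc c i) - (kc b i - kc c i)" by (simp only: kc_diff)
    then show "int N dvd kc (a - b) i" by simp
  qed
qed

text \<open>Distinct indices represent distinct aliasing classes.\<close>

lemma sum_classes_le:
  fixes g :: "freq \<Rightarrow> real"
  assumes g: "\<And>k. 0 \<le> g k"
  shows "(\<Sum>k\<in>J_h N. \<Sum>\<kappa>\<in>F. if dv N (\<kappa> - k) then g \<kappa> else 0) \<le> (\<Sum>\<kappa>\<in>F. g \<kappa>)"
proof -
  have "(\<Sum>k\<in>J_h N. \<Sum>\<kappa>\<in>F. if dv N (\<kappa> - k) then g \<kappa> else 0) = (\<Sum>\<kappa>\<in>F. \<Sum>k\<in>J_h N. if dv N (\<kappa> - k) then g \<kappa> else 0)"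
    by (rule sum.swap)
  also have "\<dots> \<le> (\<Sum>\<kappa>\<in>F. g \<kappa>)"
  proof (rule sum_mono)
    fix \<kappa>
    show "(\<Sum>k\<in>J_h N. if dv N (\<kappa> - k) then g \<kappa> else 0) \<le> g \<kappa>"
    proof (cases "\<exists>k0\<in>J_h N. dv N (\<kappa> - k0)")
      case True
      then obtain k0 where k0: "k0 \<in> J_h N" "dv N (\<kappa> - k0)" by blast
      have "(\<Sum>k\<in>J_h N. if dv N (\<kappa> - k) then g \<kappa> else 0) = (\<Sum>k\<in>J_h N. if k = k0 then g \<kappa> else 0)"
      proof (rule sum.cong[OF refl])
        fix k assume k: "k \<in> J_h N"
        have "k = k0" if "dv N (\<kappa> - k)"
          by (rule J_h_dv_eq[OF k k0(1) dv_left[OF k0(2) that]])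
        then have "dv N (\<kappa> - k) \<longleftrightarrow> k = k0" using k0(2) by blast
        then show "(if dv N (\<kappa> - k) then g \<kappa> else 0) = (if k = k0 then g \<kappa> else 0)"
          by (simp only:)
      qed
      then show ?thesis using k0 by simp
    next
      case False
      then have "(\<Sum>k\<in>J_h N. if dv N (\<kappa> - k) then g \<kappa> else 0) = 0" by (intro sum.neutral) auto
      then show ?thesis using g[of \<kappa>] by simp
    qed
  qed
  finally show ?thesis .
qed

lemma rep_wiener:
  assumes N: "N > 0" and r: "rep N c V" and B: "\<And>F. finite F \<Longrightarrow> (\<Sum>\<kappa>\<in>F. cmod (c \<kappa>)) \<le> B"
  shows "wiener N V \<le> B"
proof -
  have "((\<lambda>F. \<Sum>k\<in>J_h N. cmod (\<Sum>\<kappa>\<in>F. if dv N (\<kappa> - k) then c \<kappa> else 0)) \<longlongrightarrow> wiener N V) (finite_subsets_at_top UNIV)"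
    unfolding wiener_def by (intro tendsto_intros rep_dft[OF N r])
  then show ?thesis
  proof (rule tendsto_upperbound)
    show "\<forall>\<^sub>F F in finite_subsets_at_top UNIV. (\<Sum>k\<in>J_h N. cmod (\<Sum>\<kappa>\<in>F. if dv N (\<kappa> - k) then c \<kappa> else 0)) \<le> B"
    proof (rule eventually_finite_subsets_at_top_weakI)
      fix F :: "freq set" assume F: "finite F"
      have "(\<Sum>k\<in>J_h N. cmod (\<Sum>\<kappa>\<in>F. if dv N (\<kappa> - k) then c \<kappa> else 0)) \<le> (\<Sum>k\<in>J_h N. \<Sum>\<kappa>\<in>F. if dv N (\<kappa> - k) then cmod (c \<kappa>) else 0)"
        by (intro sum_mono order_trans[OF norm_sum]) (simp add: if_distrib cong: if_cong)
      also have "\<dots> \<le> (\<Sum>\<kappa>\<in>F. cmod (c \<kappa>))" by (rule sum_classes_le) simp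
      also have "\<dots> \<le> B" by (rule B[OF F])
      finally show "(\<Sum>k\<in>J_h N. cmod (\<Sum>\<kappa>\<in>F. if dv N (\<kappa> - k) then c \<kappa> else 0)) \<le> B" .
    qed
  qed simp
qed

text \<open>The representatives of the aliasing classes around zero.\<close>

definition low :: "nat \<Rightarrow> freq \<Rightarrow> bool" where
  "low N k \<longleftrightarrow> (\<forall>i. - (int N div 2) \<le> kc k i \<and> kc k i < int N div 2)"

lemma low_rep_exists:
  assumes N: "N > 0" "even N" obtains k0 where "low N k0" "dv N (k - k0)"
proof -
  define n where "n = int N div 2"
  have n: "int N = 2 * n" "n > 0" using N by (auto simp: n_def elim!: evenE)
  define f where "f a = (a + n) mod int N - n" for a
  have f: "- n \<le> f a" "f a < n" "int N dvd a - f a" for a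
  proof -
    have "0 \<le> (a + n) mod int N" "(a + n) mod int N < int N" using N by auto
    then show "- n \<le> f a" "f a < n" unfolding f_def n(1) by auto
    have "int N dvd (a + n) - (a + n) mod int N" by (rule dvd_minus_mod)
    then show "int N dvd a - f a" by (simp add: f_def algebra_simps)
  qed
  show ?thesis
    by (rule that[of "(f (fst k), f (fst (snd k)), f (snd (snd k)))"])
      (use f in \<open>auto simp: low_def dv_alt kc_def n_def\<close>)
qed

lemma low_unique:
  assumes N: "N > 0" "even N" and "low N k" "low N l" "dv N (k - l)" shows "k = l"
proof -
  have "kc k i = kc l i" for i
  proof (rule ccontr)
    assume "kc k i \<noteq> kc l i"
    moreover have "int N dvd kc k i - kc l i" using assms by (auto simp: dv_def)
    ultimately have "int N \<le> \<bar>kc k i - kc l i\<bar>" using dvd_imp_le_int[of "kc k i - kc l i" "int N"] by auto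
    moreover have "- (int N div 2) \<le> kc k i" "kc k i < int N div 2" "- (int N div 2) \<le> kc l i" "kc l i < int N div 2"
      using assms by (auto simp: low_def)
    moreover have "2 * (int N div 2) = int N" using N by auto
    ultimately show False by linarith
  qed
  then show ?thesis by (simp add: kc_eq_iff)
qed

text \<open>A shift by \<open>N * l\<close> with \<open>l \<noteq> 0\<close> moves a frequency of the fundamental cube by at least twice its size in each
nonzero direction of \<open>l\<close>, so at least half of the shift survives.\<close>

lemma wt_high_class:
  assumes N: "N > 0" "even N" and k0: "low N k0" and l: "l \<noteq> 0" and \<kappa>: "\<And>i. kc \<kappa> i = kc k0 i + int N * kc l i"
  shows "real N / 4 * wt l \<le> wt \<kappa>"
proof -
  have half: "real N / 2 * \<bar>real_of_int (kc l i)\<bar> \<le> \<bar>real_of_int (kc \<kappa> i)\<bar>" for i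
  proof (cases "kc l i = 0")
    case False
    have "\<bar>kc k0 i\<bar> \<le> int N div 2" using k0 by (auto simp: low_def abs_le_iff) (smt (verit))+
    moreover have "2 * (int N div 2) = int N" using N by auto
    ultimately have "2 * \<bar>kc k0 i\<bar> \<le> int N" by linarith
    moreover have "int N * 1 \<le> int N * \<bar>kc l i\<bar>" using False by (intro mult_left_mono) auto
    moreover have "int N * \<bar>kc l i\<bar> \<le> \<bar>kc \<kappa> i\<bar> + \<bar>kc k0 i\<bar>"
    proof -
      have "int N * \<bar>kc l i\<bar> = \<bar>int N * kc l i\<bar>" by (simp add: abs_mult)
      then show ?thesis unfolding \<kappa> by linarith
    qed
    ultimately have "int N * \<bar>kc l i\<bar> \<le> 2 * \<bar>kc \<kappa> i\<bar>" by (simp only: mult_1_right)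
    then have "real_of_int (int N * \<bar>kc l i\<bar>) \<le> real_of_int (2 * \<bar>kc \<kappa> i\<bar>)" by (simp only: of_int_le_iff)
    then show ?thesis by simp
  qed simp
  obtain i0 where "kc l i0 \<noteq> 0" using l by (auto simp: kc_eq_iff)
  then have "1 \<le> \<bar>real_of_int (kc l i0)\<bar>" by linarith
  also have "\<dots> \<le> (\<Sum>i\<in>UNIV. \<bar>real_of_int (kc l i)\<bar>)" by (rule member_le_sum) auto
  finally have S: "wt l \<le> 2 * (\<Sum>i\<in>UNIV. \<bar>real_of_int (kc l i)\<bar>)" by (simp add: wt_def)
  have "real N / 4 * wt l \<le> real N / 4 * (2 * (\<Sum>i\<in>UNIV. \<bar>real_of_int (kc l i)\<bar>))"
    by (intro mult_left_mono S) auto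
  also have "\<dots> = (\<Sum>i\<in>UNIV. real N / 2 * \<bar>real_of_int (kc l i)\<bar>)" by (simp add: sum_distrib_left)
  also have "\<dots> \<le> (\<Sum>i\<in>UNIV. \<bar>real_of_int (kc \<kappa> i)\<bar>)" by (intro sum_mono half)
  also have "\<dots> \<le> wt \<kappa>" by (simp add: wt_def)
  finally show ?thesis .
qed

lemma high_class_sum:
  assumes N: "N > 0" "even N" and F: "finite F" and n: "n \<ge> 4"
    and cl: "\<And>\<kappa>. \<kappa> \<in> F \<Longrightarrow> dv N (\<kappa> - k) \<and> \<not> low N \<kappa>"
  shows "(\<Sum>\<kappa>\<in>F. 1 / wt \<kappa> ^ n) \<le> (4 / real N) ^ n * S\<^sub>w"
proof -
  obtain k0 where k0: "low N k0" "dv N (k - k0)" using low_rep_exists[OF N] by blast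
  define L where "L \<kappa> = ((fst \<kappa> - fst k0) div int N, (fst (snd \<kappa>) - fst (snd k0)) div int N, (snd (snd \<kappa>) - snd (snd k0)) div int N)" for \<kappa> :: freq
  have eq: "kc \<kappa> i = kc k0 i + int N * kc (L \<kappa>) i" if "\<kappa> \<in> F" for \<kappa> i
  proof -
    have "int N dvd (kc \<kappa> i - kc k i) + (kc k i - kc k0 i)" for i
      using cl[OF that] k0(2) by (intro dvd_add) (auto simp: dv_def)
    then have d: "int N dvd kc \<kappa> i - kc k0 i" for i by simp
    have "kc (L \<kappa>) i = (kc \<kappa> i - kc k0 i) div int N" by (simp add: L_def kc_def)
    then show ?thesis using d[of i] by simp
  qed
  have L0: "L \<kappa> \<noteq> 0" if "\<kappa> \<in> F" for \<kappa>
  proof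
    assume "L \<kappa> = 0"
    then have "kc \<kappa> i = kc k0 i" for i using eq[OF that, of i] by simp
    then have "\<kappa> = k0" by (simp add: kc_eq_iff)
    then show False using cl[OF that] k0 by simp
  qed
  have inj: "inj_on L F"
  proof (rule inj_onI)
    fix x y assume "x \<in> F" "y \<in> F" "L x = L y"
    then have "kc x i = kc y i" for i using eq[of x i] eq[of y i] by simp
    then show "x = y" by (simp add: kc_eq_iff)
  qed
  have "(\<Sum>\<kappa>\<in>F. 1 / wt \<kappa> ^ n) \<le> (\<Sum>\<kappa>\<in>F. (4 / real N) ^ n * (1 / wt (L \<kappa>) ^ n))"
  proof (rule sum_mono)
    fix \<kappa> assume k: "\<kappa> \<in> F"
    have "(real N / 4 * wt (L \<kappa>)) ^ n \<le> wt \<kappa> ^ n"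
      by (intro power_mono wt_high_class[OF N k0(1) L0[OF k] eq[OF k]]) auto
    then have "1 / wt \<kappa> ^ n \<le> 1 / (real N / 4 * wt (L \<kappa>)) ^ n"
      using N by (intro divide_left_mono) auto
    also have "\<dots> = (4 / real N) ^ n * (1 / wt (L \<kappa>) ^ n)" by (simp add: power_mult_distrib power_divide)
    finally show "1 / wt \<kappa> ^ n \<le> (4 / real N) ^ n * (1 / wt (L \<kappa>) ^ n)" .
  qed
  also have "\<dots> = (4 / real N) ^ n * (\<Sum>l\<in>L ` F. 1 / wt l ^ n)"
    by (simp add: sum.reindex[OF inj] sum_distrib_left)
  also have "\<dots> \<le> (4 / real N) ^ n * S\<^sub>w"
    using F n by (intro mult_left_mono sum_wt_pow_le) auto
  finally show ?thesis .
qed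

text \<open>In each aliasing class the representative in the fundamental cube contributes through the
unweighted square sum.  The tail of the class is handled by Cauchy--Schwarz with the weight
\<open>wt \<kappa> ^ q\<close>, and its sum of inverse weights is small by \<open>high_class_sum\<close>.\<close>

lemma rep_grid_norm:
  assumes N: "N > 0" "even N" and r: "rep N c V" and q: "q \<ge> 2"
    and B0: "\<And>F. finite F \<Longrightarrow> (\<Sum>\<kappa>\<in>F. (cmod (c \<kappa>))\<^sup>2) \<le> B0"
    and Bq: "\<And>F. finite F \<Longrightarrow> (\<Sum>\<kappa>\<in>F. (wt \<kappa> ^ q * cmod (c \<kappa>))\<^sup>2) \<le> Bq"
  shows "(grid_norm N V)\<^sup>2 \<le> (2 * pi) ^ 3 * (2 * B0 + 2 * ((4 / real N) ^ (2 * q) * S\<^sub>w * Bq))"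
proof -
  let ?s = "\<lambda>F k. (\<Sum>\<kappa>\<in>F. if dv N (\<kappa> - k) then c \<kappa> else 0)"
  have fin: "(\<Sum>k\<in>J_h N. (cmod (?s F k))\<^sup>2) \<le> 2 * B0 + 2 * ((4 / real N) ^ (2 * q) * S\<^sub>w * Bq)" if F: "finite F" for F
  proof -
    define FL where "FL = {\<kappa>\<in>F. low N \<kappa>}"
    define FH where "FH = {\<kappa>\<in>F. \<not> low N \<kappa>}"
    have fin: "finite FL" "finite FH" using F by (auto simp: FL_def FH_def)
    have split: "?s F k = ?s FL k + ?s FH k" for k
      using F by (subst sum.union_disjoint[symmetric]) (auto simp: FL_def FH_def intro!: sum.cong)
    have low: "(cmod (?s FL k))\<^sup>2 \<le> (\<Sum>\<kappa>\<in>FL. if dv N (\<kappa> - k) then (cmod (c \<kappa>))\<^sup>2 else 0)" for k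
    proof (cases "\<exists>k0\<in>FL. dv N (k0 - k)")
      case True
      then obtain k0 where k0: "k0 \<in> FL" "dv N (k0 - k)" by blast
      have un: "dv N (\<kappa> - k) \<longleftrightarrow> \<kappa> = k0" if "\<kappa> \<in> FL" for \<kappa>
      proof
        assume d: "dv N (\<kappa> - k)"
        have "dv N (\<kappa> - k0)" by (rule dv_right[OF d k0(2)])
        then show "\<kappa> = k0" using low_unique[OF N] that k0(1) by (simp add: FL_def)
      qed (use k0 in simp)
      have "?s FL k = (\<Sum>\<kappa>\<in>FL. if \<kappa> = k0 then c \<kappa> else 0)" by (rule sum.cong[OF refl]) (simp add: un)
      moreover have "(\<Sum>\<kappa>\<in>FL. if dv N (\<kappa> - k) then (cmod (c \<kappa>))\<^sup>2 else 0) = (\<Sum>\<kappa>\<in>FL. if \<kappa> = k0 then (cmod (c \<kappa>))\<^sup>2 else 0)"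
        by (rule sum.cong[OF refl]) (simp add: un)
      ultimately show ?thesis using k0 fin by simp
    next
      case False
      then have "?s FL k = 0" by (intro sum.neutral) auto
      then show ?thesis by (simp add: sum_nonneg)
    qed
    have high: "(cmod (?s FH k))\<^sup>2 \<le> (4 / real N) ^ (2 * q) * S\<^sub>w * (\<Sum>\<kappa>\<in>FH. if dv N (\<kappa> - k) then (wt \<kappa> ^ q * cmod (c \<kappa>))\<^sup>2 else 0)" for k
    proof -
      define G where "G = {\<kappa>\<in>FH. dv N (\<kappa> - k)}"
      have G: "finite G" using fin by (simp add: G_def)
      have "cmod (?s FH k) = cmod (\<Sum>\<kappa>\<in>G. c \<kappa>)" using fin by (simp add: G_def sum.inter_filter)
      also have "\<dots> \<le> (\<Sum>\<kappa>\<in>G. 1 / wt \<kappa> ^ q * (wt \<kappa> ^ q * cmod (c \<kappa>)))"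
        by (rule order_trans[OF norm_sum]) simp
      finally have "(cmod (?s FH k))\<^sup>2 \<le> (\<Sum>\<kappa>\<in>G. 1 / wt \<kappa> ^ q * (wt \<kappa> ^ q * cmod (c \<kappa>)))\<^sup>2"
        by (rule power_mono) simp
      also have "\<dots> \<le> (\<Sum>\<kappa>\<in>G. (1 / wt \<kappa> ^ q)\<^sup>2) * (\<Sum>\<kappa>\<in>G. (wt \<kappa> ^ q * cmod (c \<kappa>))\<^sup>2)"
        by (rule Cauchy_Schwarz_ineq_sum)
      also have "(\<Sum>\<kappa>\<in>G. (1 / wt \<kappa> ^ q)\<^sup>2) = (\<Sum>\<kappa>\<in>G. 1 / wt \<kappa> ^ (2 * q))"
        by (simp add: power_divide power_mult[symmetric] mult.commute)
      also have "(\<Sum>\<kappa>\<in>G. 1 / wt \<kappa> ^ (2 * q)) * (\<Sum>\<kappa>\<in>G. (wt \<kappa> ^ q * cmod (c \<kappa>))\<^sup>2) \<le> (4 / real N) ^ (2 * q) * S\<^sub>w * (\<Sum>\<kappa>\<in>G. (wt \<kappa> ^ q * cmod (c \<kappa>))\<^sup>2)"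
        by (intro mult_right_mono high_class_sum[OF N G, of _ k] sum_nonneg) (use q in \<open>auto simp: G_def FH_def\<close>)
      also have "(\<Sum>\<kappa>\<in>G. (wt \<kappa> ^ q * cmod (c \<kappa>))\<^sup>2) = (\<Sum>\<kappa>\<in>FH. if dv N (\<kappa> - k) then (wt \<kappa> ^ q * cmod (c \<kappa>))\<^sup>2 else 0)"
        using fin by (simp add: G_def sum.inter_filter)
      finally show ?thesis .
    qed
    have "(\<Sum>k\<in>J_h N. (cmod (?s F k))\<^sup>2) \<le> (\<Sum>k\<in>J_h N. 2 * (cmod (?s FL k))\<^sup>2 + 2 * (cmod (?s FH k))\<^sup>2)"
    proof (rule sum_mono)
      fix k
      have "(cmod (?s F k))\<^sup>2 \<le> (cmod (?s FL k) + cmod (?s FH k))\<^sup>2"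
        unfolding split by (intro power_mono norm_triangle_ineq) auto
      also have "\<dots> \<le> 2 * (cmod (?s FL k))\<^sup>2 + 2 * (cmod (?s FH k))\<^sup>2"
        using sum_squares_bound[of "cmod (?s FL k)" "cmod (?s FH k)"] by (simp only: power2_sum)
      finally show "(cmod (?s F k))\<^sup>2 \<le> 2 * (cmod (?s FL k))\<^sup>2 + 2 * (cmod (?s FH k))\<^sup>2" .
    qed
    also have "\<dots> = 2 * (\<Sum>k\<in>J_h N. (cmod (?s FL k))\<^sup>2) + 2 * (\<Sum>k\<in>J_h N. (cmod (?s FH k))\<^sup>2)"
      by (simp only: sum.distrib sum_distrib_left)
    also have "\<dots> \<le> 2 * B0 + 2 * ((4 / real N) ^ (2 * q) * S\<^sub>w * Bq)"
    proof (intro add_mono mult_left_mono)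
      have "(\<Sum>k\<in>J_h N. (cmod (?s FL k))\<^sup>2) \<le> (\<Sum>k\<in>J_h N. \<Sum>\<kappa>\<in>FL. if dv N (\<kappa> - k) then (cmod (c \<kappa>))\<^sup>2 else 0)"
        by (intro sum_mono low)
      also have "\<dots> \<le> (\<Sum>\<kappa>\<in>FL. (cmod (c \<kappa>))\<^sup>2)" by (rule sum_classes_le) simp
      also have "\<dots> \<le> B0" by (rule B0[OF fin(1)])
      finally show "(\<Sum>k\<in>J_h N. (cmod (?s FL k))\<^sup>2) \<le> B0" .
      have "(\<Sum>k\<in>J_h N. (cmod (?s FH k))\<^sup>2) \<le> (\<Sum>k\<in>J_h N. (4 / real N) ^ (2 * q) * S\<^sub>w * (\<Sum>\<kappa>\<in>FH. if dv N (\<kappa> - k) then (wt \<kappa> ^ q * cmod (c \<kappa>))\<^sup>2 else 0))"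
        by (intro sum_mono high)
      also have "\<dots> = (4 / real N) ^ (2 * q) * S\<^sub>w * (\<Sum>k\<in>J_h N. \<Sum>\<kappa>\<in>FH. if dv N (\<kappa> - k) then (wt \<kappa> ^ q * cmod (c \<kappa>))\<^sup>2 else 0)"
        by (simp only: sum_distrib_left)
      also have "\<dots> \<le> (4 / real N) ^ (2 * q) * S\<^sub>w * (\<Sum>\<kappa>\<in>FH. (wt \<kappa> ^ q * cmod (c \<kappa>))\<^sup>2)"
        using S\<^sub>w_nonneg by (intro mult_left_mono sum_classes_le) auto
      also have "\<dots> \<le> (4 / real N) ^ (2 * q) * S\<^sub>w * Bq"
        using S\<^sub>w_nonneg by (intro mult_left_mono Bq[OF fin(2)]) auto
      finally show "(\<Sum>k\<in>J_h N. (cmod (?s FH k))\<^sup>2) \<le> (4 / real N) ^ (2 * q) * S\<^sub>w * Bq" .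
    qed auto
    finally show ?thesis .
  qed
  have "((\<lambda>F. \<Sum>k\<in>J_h N. (cmod (?s F k))\<^sup>2) \<longlongrightarrow> (\<Sum>k\<in>J_h N. (cmod (dft N V k))\<^sup>2)) (finite_subsets_at_top UNIV)"
    by (intro tendsto_intros rep_dft[OF N(1) r])
  then have "(\<Sum>k\<in>J_h N. (cmod (dft N V k))\<^sup>2) \<le> 2 * B0 + 2 * ((4 / real N) ^ (2 * q) * S\<^sub>w * Bq)"
    by (rule tendsto_upperbound) (auto intro!: eventually_finite_subsets_at_top_weakI fin)
  then show ?thesis unfolding parseval_grid[OF N(1)] by (rule mult_left_mono) simp
qed

section \<open>Scalar Taylor estimates\<close>

text \<open>The remainder and its first derivative vanish at \<open>a\<close>, and the second derivative is
\<open>- (x - a) * \<phi>c x / 2\<close>; two applications of the mean value inequality suffice.\<close>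

lemma trapezoid_error:
  fixes \<phi> \<phi>a \<phi>b \<phi>c :: "real \<Rightarrow> complex"
  assumes ab: "a \<le> b"
    and d0: "\<And>s. s \<in> {a..b} \<Longrightarrow> (\<phi> has_vector_derivative \<phi>a s) (at s within {a..b})"
    and d1: "\<And>s. s \<in> {a..b} \<Longrightarrow> (\<phi>a has_vector_derivative \<phi>b s) (at s within {a..b})"
    and d2: "\<And>s. s \<in> {a..b} \<Longrightarrow> (\<phi>b has_vector_derivative \<phi>c s) (at s within {a..b})"
    and B: "\<And>s. s \<in> {a..b} \<Longrightarrow> cmod (\<phi>c s) \<le> B"
  shows "cmod (\<phi> b - \<phi> a - of_real (b - a) * ((\<phi>a b + \<phi>a a) / 2)) \<le> B * (b - a) ^ 3"
proof -
  have B0: "0 \<le> B" by (rule order_trans[OF norm_ge_zero B[of a]]) (use ab in auto)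
  define \<omega> where "\<omega> s = \<phi>a s - \<phi>a a - of_real (s - a) * \<phi>b s" for s
  have r: "((\<lambda>s. of_real (s - a)) has_vector_derivative (1::complex)) (at s within S)" for s S
  proof -
    have "((\<lambda>s. s - a) has_real_derivative 1) (at s within S)" by (auto intro!: derivative_eq_intros)
    from has_vector_derivative_of_real[OF this] show ?thesis by simp
  qed
  have \<omega>: "cmod (\<omega> s) \<le> B * (b - a)\<^sup>2" if s: "s \<in> {a..b}" for s
  proof -
    have "cmod (\<omega> s - \<omega> a) \<le> (B * (b - a)) * (s - a)"
    proof (rule scalar_mvt[where \<phi>' = "\<lambda>s. - of_real (s - a) * \<phi>c s"])
      fix x assume x: "x \<in> {a..s}"
      then have x': "x \<in> {a..b}" using s by auto
      have "((\<lambda>s. \<phi>a s - \<phi>a a - of_real (s - a) * \<phi>b s) has_vector_derivative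
         (\<phi>b x - 0 - (of_real (x - a) * \<phi>c x + 1 * \<phi>b x))) (at x within {a..b})"
        by (rule has_vector_derivative_diff[OF has_vector_derivative_diff[OF d1[OF x'] has_vector_derivative_const] has_vector_derivative_mult[OF r d2[OF x']]])
      moreover have "\<phi>b x - 0 - (of_real (x - a) * \<phi>c x + 1 * \<phi>b x) = - of_real (x - a) * \<phi>c x" by (simp add: algebra_simps)
      ultimately have "(\<omega> has_vector_derivative - of_real (x - a) * \<phi>c x) (at x within {a..b})"
        by (simp only: \<omega>_def[abs_def])
      then show "(\<omega> has_vector_derivative - of_real (x - a) * \<phi>c x) (at x within {a..s})"
        by (rule has_vector_derivative_within_subset) (use s in auto)
      have "\<bar>x - a\<bar> * cmod (\<phi>c x) \<le> (b - a) * B"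
        using x' B[OF x'] by (intro mult_mono) auto
      then show "cmod (- of_real (x - a) * \<phi>c x) \<le> B * (b - a)"
        by (simp only: norm_mult norm_minus_cancel norm_of_real) (simp add: mult.commute)
    qed (use s in auto)
    also have "\<dots> \<le> (B * (b - a)) * (b - a)" using s B0 by (intro mult_left_mono) auto
    finally show ?thesis by (simp add: \<omega>_def power2_eq_square mult.assoc)
  qed
  define \<psi> where "\<psi> s = \<phi> s - \<phi> a - of_real (s - a) * ((\<phi>a s + \<phi>a a) / 2)" for s
  have "cmod (\<psi> b - \<psi> a) \<le> (B * (b - a)\<^sup>2) * (b - a)"
  proof (rule scalar_mvt[where \<phi>' = "\<lambda>s. \<omega> s / 2"])
    fix s assume s: "s \<in> {a..b}"
    have "((\<lambda>s. \<phi> s - \<phi> a - of_real (s - a) * (1/2 * (\<phi>a s + \<phi>a a))) has_vector_derivative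
       (\<phi>a s - 0 - (of_real (s - a) * (1/2 * (\<phi>b s + 0)) + 1 * (1/2 * (\<phi>a s + \<phi>a a))))) (at s within {a..b})"
      by (rule has_vector_derivative_diff[OF has_vector_derivative_diff[OF d0[OF s] has_vector_derivative_const]
          has_vector_derivative_mult[OF r has_vector_derivative_mult_right[OF has_vector_derivative_add[OF d1[OF s] has_vector_derivative_const]]]])
    moreover have "\<phi>a s - 0 - (of_real (s - a) * (1/2 * (\<phi>b s + 0)) + 1 * (1/2 * (\<phi>a s + \<phi>a a))) = \<omega> s / 2"
      by (simp add: \<omega>_def field_simps)
    moreover have "\<psi> = (\<lambda>s. \<phi> s - \<phi> a - of_real (s - a) * (1/2 * (\<phi>a s + \<phi>a a)))"
      by (simp add: \<psi>_def[abs_def])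
    ultimately show "(\<psi> has_vector_derivative \<omega> s / 2) (at s within {a..b})"
      by (simp only:)
    have "cmod (\<omega> s) / 2 \<le> cmod (\<omega> s)" by simp
    moreover have "cmod (\<omega> s / 2) = cmod (\<omega> s) / 2" by (simp add: norm_divide)
    ultimately show "cmod (\<omega> s / 2) \<le> B * (b - a)\<^sup>2" using \<omega>[OF s] by linarith
  qed (rule ab)
  then show ?thesis by (simp add: \<psi>_def power2_eq_square power3_eq_cube mult.assoc)
qed

lemma second_difference:
  fixes \<phi> \<phi>a \<phi>b :: "real \<Rightarrow> complex"
  assumes \<tau>: "0 \<le> \<tau>"
    and d0: "\<And>s. s \<in> {t-\<tau>..t+\<tau>} \<Longrightarrow> (\<phi> has_vector_derivative \<phi>a s) (at s within {t-\<tau>..t+\<tau>})"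
    and d1: "\<And>s. s \<in> {t-\<tau>..t+\<tau>} \<Longrightarrow> (\<phi>a has_vector_derivative \<phi>b s) (at s within {t-\<tau>..t+\<tau>})"
    and B: "\<And>s. s \<in> {t-\<tau>..t+\<tau>} \<Longrightarrow> cmod (\<phi>b s) \<le> B"
  shows "cmod (\<phi> (t+\<tau>) - 2 * \<phi> t + \<phi> (t-\<tau>)) \<le> 2 * B * \<tau>\<^sup>2"
proof -
  let ?I = "{t-\<tau>..t+\<tau>}"
  have B0: "0 \<le> B" by (rule order_trans[OF norm_ge_zero B[of t]]) (use \<tau> in auto)
  have p1: "cmod (\<phi>a s - \<phi>a t) \<le> B * \<tau>" if s: "s \<in> ?I" for s
  proof (cases "t \<le> s")
    case True
    have "cmod (\<phi>a s - \<phi>a t) \<le> B * (s - t)"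
      by (rule scalar_mvt[where \<phi>' = \<phi>b, OF has_vector_derivative_within_subset[OF d1] B True]) (use s True in auto)
    also have "\<dots> \<le> B * \<tau>" using s B0 by (intro mult_left_mono) auto
    finally show ?thesis .
  next
    case False
    then have le: "s \<le> t" by simp
    have "cmod (\<phi>a t - \<phi>a s) \<le> B * (t - s)"
      by (rule scalar_mvt[where \<phi>' = \<phi>b, OF has_vector_derivative_within_subset[OF d1] B le]) (use s le in auto)
    also have "\<dots> \<le> B * \<tau>" using s B0 by (intro mult_left_mono) auto
    finally show ?thesis by (simp add: norm_minus_commute)
  qed
  define \<omega> where "\<omega> s = \<phi> s - of_real s * \<phi>a t" for s
  have r: "((\<lambda>s. of_real s) has_vector_derivative (1::complex)) (at s within S)" for s S
  proof -
    have "((\<lambda>s. s) has_real_derivative 1) (at s within S)" by (rule DERIV_ident)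
    from has_vector_derivative_of_real[OF this] show ?thesis by simp
  qed
  have d: "(\<omega> has_vector_derivative \<phi>a s - \<phi>a t) (at s within ?I)" if s: "s \<in> ?I" for s
  proof -
    have "((\<lambda>s. \<phi> s - of_real s * \<phi>a t) has_vector_derivative (\<phi>a s - (of_real s * 0 + 1 * \<phi>a t))) (at s within ?I)"
      by (rule has_vector_derivative_diff[OF d0[OF s] has_vector_derivative_mult[OF r has_vector_derivative_const]])
    then show ?thesis by (simp add: \<omega>_def[abs_def])
  qed
  have "cmod (\<omega> (t+\<tau>) - \<omega> t) \<le> (B * \<tau>) * (t + \<tau> - t)"
    by (rule scalar_mvt[where \<phi>' = "\<lambda>s. \<phi>a s - \<phi>a t", OF has_vector_derivative_within_subset[OF d] p1]) (use \<tau> in auto)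
  moreover have "cmod (\<omega> t - \<omega> (t-\<tau>)) \<le> (B * \<tau>) * (t - (t-\<tau>))"
    by (rule scalar_mvt[where \<phi>' = "\<lambda>s. \<phi>a s - \<phi>a t", OF has_vector_derivative_within_subset[OF d] p1]) (use \<tau> in auto)
  moreover have "\<phi> (t+\<tau>) - 2 * \<phi> t + \<phi> (t-\<tau>) = (\<omega> (t+\<tau>) - \<omega> t) - (\<omega> t - \<omega> (t-\<tau>))"
    by (simp add: \<omega>_def algebra_simps)
  ultimately show ?thesis
    using norm_triangle_ineq4[of "\<omega> (t+\<tau>) - \<omega> t" "\<omega> t - \<omega> (t-\<tau>)"] by (simp add: power2_eq_square)
qed

lemma cubic_expansion:
  fixes z p :: complex
  shows "(z + p) * ((z + p) * cnj (z + p)) - z * (z * cnj z) =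
    (2 * (z * cnj z) * p + z * z * cnj p) + (2 * z * (p * cnj p) + cnj z * (p * p) + p * (p * cnj p))"
  by (simp add: algebra_simps)

text \<open>The scheme freezes the modulus at the middle of the step, while the equation asks for the average
of the cubic term over the two ends.  With \<open>p\<close> and \<open>q\<close> the two increments, the terms
linear in them combine to \<open>p + q\<close>, a second difference, and all other terms are quadratic in the step.\<close>

lemma nonlinear_consistency:
  fixes z p q :: complex and c cp cm :: complex
  assumes R: "0 \<le> R" "cmod z \<le> R" and p: "cmod p \<le> R * \<tau>" "cmod q \<le> R * \<tau>" and \<tau>: "0 \<le> \<tau>" "\<tau> \<le> 1"
    and c: "cmod c \<le> \<beta>" "cmod (cp - c) \<le> g * \<tau>" "cmod (cm - c) \<le> g * \<tau>" "cmod (cp + cm - 2 * c) \<le> h * \<tau>\<^sup>2"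
  defines "F \<equiv> \<lambda>w. w * (w * cnj w)"
  shows "cmod (c * (z * cnj z) * ((z + p) + (z + q)) - (cp * F (z + p) + cm * F (z + q)))
    \<le> 4 * \<beta> * R\<^sup>2 * cmod (p + q) + (8 * \<beta> + h + 14 * g) * R ^ 3 * \<tau>\<^sup>2"
proof -
  define lin where "lin x = 2 * (z * cnj z) * x + z * z * cnj x" for x
  define Q where "Q x = 2 * z * (x * cnj x) + cnj z * (x * x) + x * (x * cnj x)" for x
  have ex: "F (z + x) = F z + (lin x + Q x)" for x
    using cubic_expansion[of z x] by (simp add: F_def lin_def Q_def algebra_simps)
  have z2: "cmod z * cmod z \<le> R\<^sup>2" using R by (simp add: power2_eq_square mult_mono)
  have \<beta>: "0 \<le> \<beta>" using c(1) norm_ge_zero order_trans by blast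
  have sq: "cmod x * cmod x \<le> R\<^sup>2 * \<tau>\<^sup>2" if "cmod x \<le> R * \<tau>" for x
  proof -
    have "cmod x * cmod x \<le> (R * \<tau>) * (R * \<tau>)" using that R \<tau> by (intro mult_mono) auto
    then show ?thesis by (simp add: power2_eq_square mult_ac)
  qed
  have Qb: "cmod (Q x) \<le> 4 * R ^ 3 * \<tau>\<^sup>2" if x: "cmod x \<le> R * \<tau>" for x
  proof -
    have xR: "cmod x \<le> R" using x R \<tau> mult_left_le[of \<tau> R] by linarith
    have "cmod (Q x) \<le> cmod (2 * z * (x * cnj x)) + cmod (cnj z * (x * x)) + cmod (x * (x * cnj x))"
      unfolding Q_def by (intro order_trans[OF norm_triangle_ineq] add_mono norm_triangle_ineq order_refl)
    also have "\<dots> = (2 * cmod z + cmod z + cmod x) * (cmod x * cmod x)" by (simp add: norm_mult algebra_simps)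
    also have "\<dots> \<le> (2 * R + R + R) * (R\<^sup>2 * \<tau>\<^sup>2)" by (rule mult_mono[OF _ sq[OF x]]) (use R xR in auto)
    also have "\<dots> = 4 * R ^ 3 * \<tau>\<^sup>2" by (simp add: power2_eq_square power3_eq_cube algebra_simps)
    finally show ?thesis .
  qed
  have linb: "cmod (lin x) \<le> 3 * R\<^sup>2 * cmod x" for x
  proof -
    have "cmod (lin x) \<le> cmod (2 * (z * cnj z) * x) + cmod (z * z * cnj x)" unfolding lin_def by (rule norm_triangle_ineq)
    also have "\<dots> = 3 * (cmod z * cmod z) * cmod x" by (simp add: norm_mult)
    also have "\<dots> \<le> 3 * R\<^sup>2 * cmod x" by (intro mult_right_mono mult_left_mono z2) auto
    finally show ?thesis .
  qed
  have Fz: "cmod (F z) \<le> R ^ 3"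
  proof -
    have "cmod (F z) = (cmod z) ^ 3" by (simp add: F_def norm_mult power3_eq_cube)
    then show ?thesis using R by (simp add: power_mono)
  qed
  have Fd: "cmod (F (z + x) - F z) \<le> 7 * R ^ 3 * \<tau>" if x: "cmod x \<le> R * \<tau>" for x
  proof -
    have "cmod (F (z + x) - F z) \<le> cmod (lin x) + cmod (Q x)" unfolding ex by (simp add: norm_triangle_ineq)
    also have "\<dots> \<le> 3 * R\<^sup>2 * (R * \<tau>) + 4 * R ^ 3 * \<tau>\<^sup>2"
    proof (rule add_mono[OF _ Qb[OF x]])
      have "3 * R\<^sup>2 * cmod x \<le> 3 * R\<^sup>2 * (R * \<tau>)" using x by (intro mult_left_mono) auto
      then show "cmod (lin x) \<le> 3 * R\<^sup>2 * (R * \<tau>)" using linb[of x] by linarith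
    qed
    also have "\<dots> \<le> 3 * R ^ 3 * \<tau> + 4 * R ^ 3 * \<tau>"
    proof -
      have "\<tau>\<^sup>2 \<le> \<tau>" using \<tau> by (simp add: power2_eq_square mult_left_le)
      then have "4 * R ^ 3 * \<tau>\<^sup>2 \<le> 4 * R ^ 3 * \<tau>" using R by (intro mult_left_mono) auto
      then show ?thesis by (simp add: power2_eq_square power3_eq_cube mult_ac)
    qed
    finally show ?thesis by (simp add: mult_ac)
  qed
  have linadd: "lin (p + q) = lin p + lin q" by (simp add: lin_def algebra_simps)
  \<comment> \<open>Symmetry of the step: the first-order parts of the two increments appear only through their sum.\<close>
  have eq: "c * (z * cnj z) * ((z + p) + (z + q)) - (cp * F (z + p) + cm * F (z + q)) =
     c * ((z * cnj z) * (p + q) - lin (p + q)) - (c * Q p + c * Q q)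
     - ((cp + cm - 2 * c) * F z + ((cp - c) * (F (z + p) - F z) + (cm - c) * (F (z + q) - F z)))"
    unfolding linadd ex by (simp add: F_def algebra_simps)
  have 1: "cmod (c * ((z * cnj z) * (p + q) - lin (p + q))) \<le> 4 * \<beta> * R\<^sup>2 * cmod (p + q)"
  proof -
    have "cmod ((z * cnj z) * (p + q) - lin (p + q)) \<le> cmod ((z * cnj z) * (p + q)) + cmod (lin (p + q))"
      by (rule norm_triangle_ineq4)
    also have "\<dots> \<le> R\<^sup>2 * cmod (p + q) + 3 * R\<^sup>2 * cmod (p + q)"
      using mult_right_mono[OF z2, of "cmod (p + q)"] by (intro add_mono linb) (simp add: norm_mult)
    finally have "cmod ((z * cnj z) * (p + q) - lin (p + q)) \<le> 4 * R\<^sup>2 * cmod (p + q)" by (simp add: mult_ac)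
    then have "cmod c * cmod ((z * cnj z) * (p + q) - lin (p + q)) \<le> \<beta> * (4 * R\<^sup>2 * cmod (p + q))"
      using c(1) \<beta> by (intro mult_mono) auto
    then show ?thesis by (simp add: norm_mult mult_ac)
  qed
  have 2: "cmod (c * Q p + c * Q q) \<le> 8 * \<beta> * R ^ 3 * \<tau>\<^sup>2"
  proof -
    have "cmod (c * Q p + c * Q q) \<le> cmod c * cmod (Q p) + cmod c * cmod (Q q)"
      by (metis norm_mult norm_triangle_ineq)
    also have "\<dots> \<le> \<beta> * (4 * R ^ 3 * \<tau>\<^sup>2) + \<beta> * (4 * R ^ 3 * \<tau>\<^sup>2)"
      using c(1) \<beta> by (intro add_mono mult_mono Qb p) auto
    finally show ?thesis by simp
  qed
  have 3: "cmod ((cp + cm - 2 * c) * F z) \<le> h * R ^ 3 * \<tau>\<^sup>2"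
  proof -
    have "cmod (cp + cm - 2 * c) * cmod (F z) \<le> (h * \<tau>\<^sup>2) * R ^ 3"
      by (rule mult_mono[OF c(4) Fz]) (use norm_ge_zero[of "cp + cm - 2 * c"] c(4) in linarith, simp)
    then show ?thesis by (simp add: norm_mult mult_ac)
  qed
  have 4: "cmod ((c' - c) * (F (z + x) - F z)) \<le> 7 * g * R ^ 3 * \<tau>\<^sup>2" if "cmod (c' - c) \<le> g * \<tau>" "cmod x \<le> R * \<tau>" for c' x
  proof -
    have "cmod (c' - c) * cmod (F (z + x) - F z) \<le> (g * \<tau>) * (7 * R ^ 3 * \<tau>)"
      by (rule mult_mono[OF that(1) Fd[OF that(2)]]) (use norm_ge_zero[of "c' - c"] that(1) in linarith, simp)
    then show ?thesis by (simp add: norm_mult power2_eq_square mult_ac)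
  qed
  have "cmod (c * (z * cnj z) * ((z + p) + (z + q)) - (cp * F (z + p) + cm * F (z + q))) \<le>
     4 * \<beta> * R\<^sup>2 * cmod (p + q) + 8 * \<beta> * R ^ 3 * \<tau>\<^sup>2 + (h * R ^ 3 * \<tau>\<^sup>2 + (7 * g * R ^ 3 * \<tau>\<^sup>2 + 7 * g * R ^ 3 * \<tau>\<^sup>2))"
    unfolding eq
    by (intro order_trans[OF norm_triangle_ineq4] add_mono 1 2 order_trans[OF norm_triangle_ineq] 3 4[OF c(2) p(1)] 4[OF c(3) p(2)])
  also have "\<dots> = 4 * \<beta> * R\<^sup>2 * cmod (p + q) + (8 * \<beta> + h + 14 * g) * R ^ 3 * \<tau>\<^sup>2" by (simp add: algebra_simps)
  finally show ?thesis .
qed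

text \<open>The constant function one has norm \<open>sqrt ((2 * pi) ^ 3)\<close> on every grid.\<close>

lemma grid_norm_affine:
  assumes N: "N > 0" and ab: "0 \<le> a" "0 \<le> b" and le: "\<And>j. j \<in> J_h N \<Longrightarrow> cmod (X j) \<le> a * cmod (Y j) + b"
  shows "grid_norm N X \<le> a * grid_norm N Y + sqrt ((2 * pi) ^ 3) * b"
proof -
  have eq: "grid_norm N V = sqrt (mesh N ^ 3) * L2_set (\<lambda>j. cmod (V j)) (J_h N)" for V
  proof -
    have "grid_norm N V = sqrt ((grid_norm N V)\<^sup>2)" using grid_norm_nonneg by simp
    then show ?thesis unfolding grid_norm_sq by (simp add: real_sqrt_mult L2_set_def)
  qed
  have "L2_set (\<lambda>j. cmod (X j)) (J_h N) \<le> L2_set (\<lambda>j. a * cmod (Y j) + b) (J_h N)"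
    by (rule L2_set_mono) (use le in auto)
  also have "\<dots> \<le> L2_set (\<lambda>j. a * cmod (Y j)) (J_h N) + L2_set (\<lambda>j. b) (J_h N)" by (rule L2_set_triangle_ineq)
  also have "L2_set (\<lambda>j. a * cmod (Y j)) (J_h N) = a * L2_set (\<lambda>j. cmod (Y j)) (J_h N)"
    using ab(1) by (rule L2_set_right_distrib[symmetric])
  finally have "sqrt (mesh N ^ 3) * L2_set (\<lambda>j. cmod (X j)) (J_h N) \<le> sqrt (mesh N ^ 3) * (a * L2_set (\<lambda>j. cmod (Y j)) (J_h N) + L2_set (\<lambda>j. b) (J_h N))"
    by (rule mult_left_mono) (simp add: mesh_def)
  then have "grid_norm N X \<le> a * grid_norm N Y + sqrt (mesh N ^ 3) * L2_set (\<lambda>j. b) (J_h N)"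
    unfolding eq by (simp add: algebra_simps)
  also have "sqrt (mesh N ^ 3) * L2_set (\<lambda>j. b) (J_h N) = grid_norm N (\<lambda>j. of_real b)"
    unfolding eq using ab by simp
  also have "grid_norm N (\<lambda>j. of_real b) \<le> sqrt ((2 * pi) ^ 3) * b"
    by (rule grid_norm_le_sup[OF N]) (use ab in auto)
  finally show ?thesis by simp
qed

section \<open>Consistency in time and space\<close>

text \<open>One constant for all bounds provided by \<open>regularity\<close>.\<close>

locale nls_reg = nls_data +
  fixes C :: real
  assumes C1': "C \<ge> 1"
    and HU: "t \<in> {0..T} \<Longrightarrow> Hb (m + 4) (u t) C"
    and HT: "t \<in> {0..T} \<Longrightarrow> Hb (m + 2) (ut t) C"
    and H2: "t \<in> {0..T} \<Longrightarrow> Hb 0 (v2 t) C"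
    and H3: "t \<in> {0..T} \<Longrightarrow> Hb 0 (v3 t) C"
begin

lemma C0': "0 \<le> C" using C1' by simp

text \<open>A bound in the Wiener norm for the exact solution on the grid, uniform in time and in \<open>N\<close>.\<close>

definition R where "R = sqrt (S\<^sub>w * C)"

lemma R0: "0 \<le> R" using S\<^sub>w_nonneg C0' by (simp add: R_def)

lemma ut_reg: "t \<in> {0..T} \<Longrightarrow> reg (ut t)"
  unfolding reg_def using ut_cont ut_periodic Hb_le[OF HT, of t 2] by auto

lemma HU2: "t \<in> {0..T} \<Longrightarrow> Hb (m + 2) (u t) C"
  by (rule Hb_le[OF HU]) auto

lemma wiener_Hb2:
  assumes N: "N > 0" and r: "rep N c V" and c: "\<And>F. finite F \<Longrightarrow> (\<Sum>\<kappa>\<in>F. ((wt \<kappa>)\<^sup>2 * cmod (c \<kappa>))\<^sup>2) \<le> B"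
  shows "wiener N V \<le> sqrt (S\<^sub>w * B)"
  by (rule rep_wiener[OF N r l1_le_weighted_l2[OF c]])

lemma wiener_reg: "N > 0 \<Longrightarrow> reg f \<Longrightarrow> Hb 2 f B \<Longrightarrow> wiener N (gr N f) \<le> sqrt (S\<^sub>w * B)"
  by (rule wiener_Hb2[OF _ rep_gr]) (auto simp: wb_def)

lemma wiener_u: "N > 0 \<Longrightarrow> t \<in> {0..T} \<Longrightarrow> wiener N (gr N (u t)) \<le> R"
  unfolding R_def by (rule wiener_reg[OF _ u_reg Hb_le[OF HU2]]) auto

lemma wiener_ut: "N > 0 \<Longrightarrow> t \<in> {0..T} \<Longrightarrow> wiener N (gr N (ut t)) \<le> R"
  unfolding R_def by (rule wiener_reg[OF _ ut_reg Hb_le[OF HT]]) auto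

lemma u_lip_Hb:
  assumes "0 \<le> a" "a \<le> b" "b \<le> T" shows "Hb (m + 2) (\<lambda>x. u b x - u a x) (C * (b - a)\<^sup>2)"
proof (rule mvt_Hb[OF assms, of "m + 2" v1])
  show "Hb (m + 2) (v1 t) C" if "t \<in> {0..T}" for t using HT[OF that] by (simp add: wb_def link[OF that])
qed (use assms in \<open>auto intro: D0 u_L2\<close>)

lemma wiener_u_lip:
  assumes N: "N > 0" and ab: "0 \<le> a" "a \<le> b" "b \<le> T"
  shows "wiener N (\<lambda>j. gr N (u b) j - gr N (u a) j) \<le> R * (b - a)"
proof -
  have abT: "a \<in> {0..T}" "b \<in> {0..T}" using ab by auto
  have "wiener N (gr N (\<lambda>x. u b x - u a x)) \<le> sqrt (S\<^sub>w * (C * (b - a)\<^sup>2))"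
    by (rule wiener_reg[OF N reg_diff[OF u_reg u_reg] Hb_le[OF u_lip_Hb[OF ab]]]) (use abT in auto)
  then show ?thesis using ab by (simp add: gr_def[abs_def] R_def real_sqrt_mult)
qed

text \<open>The size of the aliasing error and of the defect of the discrete Laplacian for functions with \<open>m + 2\<close>
and \<open>m + 4\<close> derivatives, respectively.\<close>

definition \<delta> :: "nat \<Rightarrow> real" where "\<delta> N = (4 / real N) ^ (m + 2)"

lemma \<delta>0: "0 \<le> \<delta> N" by (simp add: \<delta>_def)

definition K where "K = sqrt ((2 * pi) ^ 3 * 32 * (1 + S\<^sub>w) * C)"

lemma K0: "0 \<le> K" using S\<^sub>w_nonneg C0' by (simp add: K_def)

text \<open>The form of the aliasing estimate shared by all parts of the residual: small in the unweighted sum,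
merely bounded with the weight of order \<open>m + 2\<close>.\<close>

lemma gn_bound:
  assumes N: "N > 0" "even N" and r: "rep N c V" and p: "0 \<le> p"
    and B0: "\<And>F. finite F \<Longrightarrow> (\<Sum>\<kappa>\<in>F. (cmod (c \<kappa>))\<^sup>2) \<le> 16 * C * p\<^sup>2"
    and Bq: "\<And>F. finite F \<Longrightarrow> (\<Sum>\<kappa>\<in>F. (wt \<kappa> ^ (m + 2) * cmod (c \<kappa>))\<^sup>2) \<le> 16 * C"
  shows "grid_norm N V \<le> K * (p + \<delta> N)"
proof -
  have "(grid_norm N V)\<^sup>2 \<le> (2 * pi) ^ 3 * (2 * (16 * C * p\<^sup>2) + 2 * ((4 / real N) ^ (2 * (m + 2)) * S\<^sub>w * (16 * C)))"
    by (rule rep_grid_norm[OF N r _ B0 Bq]) auto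
  also have "(4 / real N) ^ (2 * (m + 2)) = (\<delta> N)\<^sup>2" by (simp only: \<delta>_def power_mult[symmetric] mult.commute[of 2])
  also have "(2 * pi) ^ 3 * (2 * (16 * C * p\<^sup>2) + 2 * ((\<delta> N)\<^sup>2 * S\<^sub>w * (16 * C))) = (2 * pi) ^ 3 * (32 * C * (p\<^sup>2 + S\<^sub>w * (\<delta> N)\<^sup>2))"
    by (simp add: algebra_simps)
  also have "\<dots> \<le> (2 * pi) ^ 3 * (32 * C * ((1 + S\<^sub>w) * (p + \<delta> N)\<^sup>2))"
  proof (intro mult_left_mono)
    have "p\<^sup>2 \<le> (p + \<delta> N)\<^sup>2" "(\<delta> N)\<^sup>2 \<le> (p + \<delta> N)\<^sup>2" using p \<delta>0[of N] by (auto intro!: power_mono)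
    then show "p\<^sup>2 + S\<^sub>w * (\<delta> N)\<^sup>2 \<le> (1 + S\<^sub>w) * (p + \<delta> N)\<^sup>2"
      using mult_left_mono[of "(\<delta> N)\<^sup>2" "(p + \<delta> N)\<^sup>2" S\<^sub>w] S\<^sub>w_nonneg by (simp add: distrib_right)
  qed (use C0' in auto)
  also have "\<dots> = (K * (p + \<delta> N))\<^sup>2"
    using S\<^sub>w_nonneg C0' by (simp add: K_def power_mult_distrib mult_ac)
  finally show ?thesis by (rule power2_le_imp_le) (use K0 p \<delta>0[of N] in simp)
qed

definition time_defect_coef where "time_defect_coef a b k = (coef (u b) k - coef (u a) k) / of_real (b - a) - (coef (ut b) k + coef (ut a) k) / 2"

text \<open>The defect of the trapezoidal rule applied to the time derivative, on the grid; \<open>time_defect_coef\<close> is the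
corresponding family of Fourier coefficients.\<close>

definition time_defect where "time_defect N a b j = (gr N (u b) j - gr N (u a) j) / of_real (b - a) - (gr N (ut b) j + gr N (ut a) j) / 2"

lemma rep_time_defect: assumes "N > 0" "a \<in> {0..T}" "b \<in> {0..T}" shows "rep N (time_defect_coef a b) (time_defect N a b)"
proof -
  have "rep N (\<lambda>k. (1 / of_real (b - a)) * (coef (u b) k - coef (u a) k) - 1/2 * (coef (ut b) k + coef (ut a) k))
     (\<lambda>j. (1 / of_real (b - a)) * (gr N (u b) j - gr N (u a) j) - 1/2 * (gr N (ut b) j + gr N (ut a) j))"
    using assms by (intro rep_diff rep_scale rep_add rep_gr u_reg ut_reg)
  then show ?thesis by (simp add: time_defect_coef_def[abs_def] time_defect_def[abs_def])
qed

lemma time_defect_coef_l2: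
  assumes ab: "0 \<le> a" "a < b" "b \<le> T" and F: "finite F"
  shows "(\<Sum>k\<in>F. (cmod (time_defect_coef a b k))\<^sup>2) \<le> C * (b - a) ^ 4"
proof -
  have "(\<Sum>k\<in>F. (cmod (of_real (b - a) * time_defect_coef a b k))\<^sup>2) \<le> (sqrt C * (b - a) ^ 3)\<^sup>2"
  proof (rule dual_bound)
    show "0 \<le> sqrt C * (b - a) ^ 3" using C0' ab by simp
    fix y :: "freq \<Rightarrow> complex"
    let ?P = "\<lambda>v s. \<Sum>k\<in>F. y k * coef (v s) k"
    have d: "(?P v has_vector_derivative ?P w s) (at s within {a..b})"
      if "s \<in> {a..b}" "\<And>t k. t \<in> {0..T} \<Longrightarrow> ((\<lambda>r. coef (v r) k) has_vector_derivative coef (w t) k) (at t within {0..T})" for v w s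
      by (intro has_vector_derivative_sum has_vector_derivative_mult_right has_vector_derivative_within_subset[OF that(2)])
        (use ab that(1) in auto)
    have "cmod (?P u b - ?P u a - of_real (b - a) * ((?P v1 b + ?P v1 a) / 2)) \<le> (sqrt (\<Sum>k\<in>F. (cmod (y k))\<^sup>2) * sqrt C) * (b - a) ^ 3"
    proof (rule trapezoid_error[where \<phi>a = "?P v1" and \<phi>b = "?P v2" and \<phi>c = "?P v3"])
      show "cmod (?P v3 s) \<le> sqrt (\<Sum>k\<in>F. (cmod (y k))\<^sup>2) * sqrt C" if "s \<in> {a..b}" for s
        using H3[of s] that ab F by (intro pairing_bound) (auto simp: wb_def)
    qed (use ab d D0 D1 D2 in auto)
    moreover have "?P u b - ?P u a - of_real (b - a) * ((?P v1 b + ?P v1 a) / 2) = (\<Sum>k\<in>F. y k * (of_real (b - a) * time_defect_coef a b k))"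
    proof -
      have "of_real (b - a) * time_defect_coef a b k = coef (u b) k - coef (u a) k - of_real (b - a) * ((coef (v1 b) k + coef (v1 a) k) / 2)" for k
        using ab link[of a] link[of b] unfolding time_defect_coef_def right_diff_distrib by simp
      then show ?thesis by (simp only: sum.distrib[symmetric] sum_subtractf[symmetric] sum_distrib_left sum_divide_distrib)
        (rule sum.cong[OF refl], simp add: algebra_simps add_divide_distrib)
    qed
    ultimately show "cmod (\<Sum>k\<in>F. y k * (of_real (b - a) * time_defect_coef a b k)) \<le> sqrt (\<Sum>k\<in>F. (cmod (y k))\<^sup>2) * (sqrt C * (b - a) ^ 3)"
      by (simp only: mult.assoc)
  qed
  also have "(sqrt C * (b - a) ^ 3)\<^sup>2 = (b - a)\<^sup>2 * (C * (b - a) ^ 4)" using C0' by (simp add: power_mult_distrib power_mult[symmetric] power_add[symmetric])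
  also have "(\<Sum>k\<in>F. (cmod (of_real (b - a) * time_defect_coef a b k))\<^sup>2) = (b - a)\<^sup>2 * (\<Sum>k\<in>F. (cmod (time_defect_coef a b k))\<^sup>2)"
    by (simp only: norm_mult norm_of_real power_mult_distrib power2_abs sum_distrib_left)
  finally show ?thesis using ab by simp
qed

lemma time_defect_coef_high:
  assumes ab: "0 \<le> a" "a < b" "b \<le> T" and F: "finite F"
  shows "(\<Sum>k\<in>F. (wt k ^ (m + 2) * cmod (time_defect_coef a b k))\<^sup>2) \<le> 4 * C"
proof -
  have abT: "a \<in> {0..T}" "b \<in> {0..T}" using ab by auto
  let ?w = "\<lambda>k. wt k ^ (m + 2)"
  have "(\<Sum>k\<in>F. (?w k * cmod (time_defect_coef a b k))\<^sup>2) \<le> (\<Sum>k\<in>F. 2 / (b - a)\<^sup>2 * (?w k * cmod (coef (\<lambda>x. u b x - u a x) k))\<^sup>2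
      + ((?w k * cmod (coef (ut b) k))\<^sup>2 + (?w k * cmod (coef (ut a) k))\<^sup>2))"
  proof (rule sum_mono)
    fix k
    define X Y Z where "X = ?w k * cmod (coef (\<lambda>x. u b x - u a x) k) / (b - a)" and "Y = ?w k * cmod (coef (ut b) k)" and "Z = ?w k * cmod (coef (ut a) k)"
    have "cmod (time_defect_coef a b k) \<le> cmod (coef (\<lambda>x. u b x - u a x) k) / (b - a) + (cmod (coef (ut b) k) + cmod (coef (ut a) k)) / 2"
      unfolding time_defect_coef_def coef_u_diff[OF abT]
      by (rule order_trans[OF norm_triangle_ineq4], intro add_mono)
        (use ab in \<open>auto simp: norm_divide intro!: divide_right_mono norm_triangle_ineq simp del: of_real_diff\<close>)
    then have "?w k * cmod (time_defect_coef a b k) \<le> ?w k * (cmod (coef (\<lambda>x. u b x - u a x) k) / (b - a) + (cmod (coef (ut b) k) + cmod (coef (ut a) k)) / 2)"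
      by (rule mult_left_mono) simp
    also have "\<dots> = X + (Y + Z) / 2" by (simp add: X_def Y_def Z_def algebra_simps add_divide_distrib)
    finally have "(?w k * cmod (time_defect_coef a b k))\<^sup>2 \<le> (X + (Y + Z) / 2)\<^sup>2" by (rule power_mono) simp
    also have "\<dots> \<le> 2 * X\<^sup>2 + (Y\<^sup>2 + Z\<^sup>2)"
    proof -
      have "0 \<le> (X - (Y + Z) / 2)\<^sup>2 + (Y - Z)\<^sup>2 / 2" by simp
      then show ?thesis by (simp add: power2_eq_square algebra_simps add_divide_distrib diff_divide_distrib)
    qed
    also have "2 * X\<^sup>2 = 2 / (b - a)\<^sup>2 * (?w k * cmod (coef (\<lambda>x. u b x - u a x) k))\<^sup>2" by (simp add: X_def power_divide)
    finally show "(?w k * cmod (time_defect_coef a b k))\<^sup>2 \<le> 2 / (b - a)\<^sup>2 * (?w k * cmod (coef (\<lambda>x. u b x - u a x) k))\<^sup>2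
      + ((?w k * cmod (coef (ut b) k))\<^sup>2 + (?w k * cmod (coef (ut a) k))\<^sup>2)" by (simp add: Y_def Z_def)
  qed
  also have "\<dots> = 2 / (b - a)\<^sup>2 * (\<Sum>k\<in>F. (?w k * cmod (coef (\<lambda>x. u b x - u a x) k))\<^sup>2)
      + ((\<Sum>k\<in>F. (?w k * cmod (coef (ut b) k))\<^sup>2) + (\<Sum>k\<in>F. (?w k * cmod (coef (ut a) k))\<^sup>2))"
    by (simp only: sum.distrib sum_distrib_left)
  also have "\<dots> \<le> 2 / (b - a)\<^sup>2 * (C * (b - a)\<^sup>2) + (C + C)"
    using u_lip_Hb[of a b] HT[OF abT(1)] HT[OF abT(2)] ab F by (intro add_mono mult_left_mono) (auto simp: wb_def)
  also have "\<dots> = 4 * C" using ab by simp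
  finally show ?thesis .
qed

lemma time_defect_grid_norm:
  assumes N: "N > 0" "even N" and ab: "0 \<le> a" "a < b" "b \<le> T"
  shows "grid_norm N (time_defect N a b) \<le> K * ((b - a)\<^sup>2 + \<delta> N)"
proof (rule gn_bound[OF N rep_time_defect[OF N(1)]])
  fix F :: "freq set" assume F: "finite F"
  show "(\<Sum>\<kappa>\<in>F. (cmod (time_defect_coef a b \<kappa>))\<^sup>2) \<le> 16 * C * ((b - a)\<^sup>2)\<^sup>2"
  proof (rule order_trans[OF time_defect_coef_l2[OF ab F]])
    have "C * (b - a) ^ 4 \<le> 16 * C * (b - a) ^ 4" using C0' by (intro mult_right_mono) auto
    then show "C * (b - a) ^ 4 \<le> 16 * C * ((b - a)\<^sup>2)\<^sup>2" by simp
  qed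
  show "(\<Sum>\<kappa>\<in>F. (wt \<kappa> ^ (m + 2) * cmod (time_defect_coef a b \<kappa>))\<^sup>2) \<le> 16 * C"
    using time_defect_coef_high[OF ab F] C0' by linarith
qed (use ab in auto)

text \<open>The defect is of second order without weight and bounded with weight \<open>m + 2 \<ge> 3\<close>.  Since the Wiener norm is
controlled by the weight of order \<open>7/4 < 2\<close>, interpolation leaves a positive power of the step.\<close>

lemma time_defect_wiener:
  assumes N: "N > 0" and ab: "0 \<le> a" "a < b" "b \<le> T" "b - a \<le> 1"
  shows "wiener N (time_defect N a b) \<le> sqrt (5 * S\<^sub>w * C * sqrt (b - a))"
proof (rule rep_wiener[OF N rep_time_defect[OF N]])
  fix F :: "freq set" assume F: "finite F"
  \<comment> \<open>Chosen so that both terms of the interpolation inequality are of size \<open>\<epsilon>\<close>: \<open>1 / \<epsilon> ^ 7\<close> is compensated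
    by \<open>(b - a) ^ 4 = \<epsilon> ^ 8\<close>.\<close>
  define \<epsilon> where "\<epsilon> = sqrt (b - a)"
  have \<epsilon>: "0 < \<epsilon>" "\<epsilon> \<le> 1" and e2: "b - a = \<epsilon>\<^sup>2" using ab by (auto simp: \<epsilon>_def)
  have "(\<Sum>k\<in>F. cmod (time_defect_coef a b k))\<^sup>2 = (\<Sum>k\<in>F. wt k powr (- (7/4)) * (wt k powr (7/4) * cmod (time_defect_coef a b k)))\<^sup>2"
    by (simp add: mult.assoc[symmetric] powr_add[symmetric])
  also have "\<dots> \<le> (\<Sum>k\<in>F. (wt k powr (- (7/4)))\<^sup>2) * (\<Sum>k\<in>F. (wt k powr (7/4) * cmod (time_defect_coef a b k))\<^sup>2)"
    by (rule Cauchy_Schwarz_ineq_sum)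
  also have "\<dots> \<le> S\<^sub>w * (5 * C * \<epsilon>)"
  proof (rule mult_mono)
    have "(wt k powr (- (7/4)))\<^sup>2 = wt k powr (- (7/2))" for k by (simp add: power2_eq_square powr_add[symmetric])
    then show "(\<Sum>k\<in>F. (wt k powr (- (7/4)))\<^sup>2) \<le> S\<^sub>w" using sum_wt_powr_le[OF F] by simp
    have "(\<Sum>k\<in>F. (wt k powr (7/4) * cmod (time_defect_coef a b k))\<^sup>2) \<le> (\<Sum>k\<in>F. \<epsilon> * (wt k ^ (m + 2) * cmod (time_defect_coef a b k))\<^sup>2 + 1 / \<epsilon> ^ 7 * (cmod (time_defect_coef a b k))\<^sup>2)"
    proof (rule sum_mono)
      fix k
      have "wt k powr (7/2) \<le> \<epsilon> * wt k ^ 4 + 1 / \<epsilon> ^ 7" by (rule wt_powr_interp[OF \<epsilon>])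
      also have "\<dots> \<le> \<epsilon> * (wt k ^ (m + 2))\<^sup>2 + 1 / \<epsilon> ^ 7"
      proof -
        have "wt k ^ 4 \<le> wt k ^ ((m + 2) * 2)" by (rule power_increasing) (use wt_ge_1 in auto)
        then have "wt k ^ 4 \<le> (wt k ^ (m + 2))\<^sup>2" by (simp only: power_mult)
        then show ?thesis using \<epsilon> by simp
      qed
      finally have "wt k powr (7/2) * (cmod (time_defect_coef a b k))\<^sup>2 \<le> (\<epsilon> * (wt k ^ (m + 2))\<^sup>2 + 1 / \<epsilon> ^ 7) * (cmod (time_defect_coef a b k))\<^sup>2"
        by (rule mult_right_mono) simp
      moreover have "(wt k powr (7/4))\<^sup>2 = wt k powr (7/2)" by (simp add: power2_eq_square powr_add[symmetric])
      ultimately show "(wt k powr (7/4) * cmod (time_defect_coef a b k))\<^sup>2 \<le> \<epsilon> * (wt k ^ (m + 2) * cmod (time_defect_coef a b k))\<^sup>2 + 1 / \<epsilon> ^ 7 * (cmod (time_defect_coef a b k))\<^sup>2"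
        by (simp only: power_mult_distrib distrib_right mult.assoc)
    qed
    also have "\<dots> = \<epsilon> * (\<Sum>k\<in>F. (wt k ^ (m + 2) * cmod (time_defect_coef a b k))\<^sup>2) + 1 / \<epsilon> ^ 7 * (\<Sum>k\<in>F. (cmod (time_defect_coef a b k))\<^sup>2)"
      by (simp only: sum.distrib sum_distrib_left)
    also have "\<dots> \<le> \<epsilon> * (4 * C) + 1 / \<epsilon> ^ 7 * (C * (b - a) ^ 4)"
      by (intro add_mono mult_left_mono time_defect_coef_high time_defect_coef_l2 ab F) (use \<epsilon> in auto)
    also have "1 / \<epsilon> ^ 7 * (C * (b - a) ^ 4) = \<epsilon> * C"
    proof -
      have "(b - a) ^ 4 = \<epsilon> ^ 8" unfolding e2 by (simp add: power_mult[symmetric])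
      also have "\<dots> = \<epsilon> ^ 7 * \<epsilon>" by (simp add: power_Suc2[symmetric])
      finally show ?thesis using \<epsilon> by simp
    qed
    finally show "(\<Sum>k\<in>F. (wt k powr (7/4) * cmod (time_defect_coef a b k))\<^sup>2) \<le> 5 * C * \<epsilon>" by (simp add: algebra_simps)
  qed (use S\<^sub>w_nonneg in \<open>auto intro: sum_nonneg\<close>)
  finally show "(\<Sum>k\<in>F. cmod (time_defect_coef a b k)) \<le> sqrt (5 * S\<^sub>w * C * sqrt (b - a))"
    unfolding \<epsilon>_def by (intro real_le_rsqrt) (simp add: mult_ac)
qed (use ab in auto)

definition space_defect where "space_defect N t j = Delta_h N (gr N (u t)) j - gr N (laplacian (u t)) j"

lemma lap_reg: "t \<in> {0..T} \<Longrightarrow> reg (laplacian (u t))"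
proof -
  assume t: "t \<in> {0..T}"
  have "Hb 2 (laplacian (u t)) C"
  proof (rule wb_coef_le[OF HU[OF t]])
    fix k
    have "cmod (coef (laplacian (u t)) k) \<le> (wt k)\<^sup>2 * cmod (coef (u t) k)"
      using ksq_le[of k] by (simp add: laplacian_facts(3)[OF u_C2 u_periodic, OF t t] norm_mult ksq_nonneg mult_right_mono)
    then have "wt k ^ 2 * cmod (coef (laplacian (u t)) k) \<le> wt k ^ 2 * ((wt k)\<^sup>2 * cmod (coef (u t) k))" by (rule mult_left_mono) simp
    also have "\<dots> = wt k ^ 4 * cmod (coef (u t) k)" by (simp add: mult.assoc[symmetric] power_add[symmetric])
    also have "\<dots> \<le> wt k ^ (m + 4) * cmod (coef (u t) k)" using wt_ge_1 by (intro mult_right_mono power_increasing) auto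
    finally show "\<bar>wt k ^ 2\<bar> * cmod (coef (laplacian (u t)) k) \<le> \<bar>wt k ^ (m + 4)\<bar> * cmod (coef (u t) k)" by simp
  qed
  then show ?thesis unfolding reg_def using laplacian_facts(1,2)[OF u_C2 u_periodic, OF t t] by blast
qed

definition space_defect_coef where "space_defect_coef N t k = of_real (ksq k - lam N k) * coef (u t) k"

lemma rep_space_defect: assumes "N > 0" "t \<in> {0..T}" shows "rep N (space_defect_coef N t) (space_defect N t)"
proof -
  have "rep N (\<lambda>k. - of_real (lam N k) * coef (u t) k - coef (laplacian (u t)) k) (\<lambda>j. Delta_h N (gr N (u t)) j - gr N (laplacian (u t)) j)"
    using assms by (intro rep_diff rep_Delta_h rep_gr u_reg lap_reg)
  moreover have "- of_real (lam N k) * coef (u t) k - coef (laplacian (u t)) k = space_defect_coef N t k" for k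
    unfolding laplacian_facts(3)[OF u_C2 u_periodic, OF assms(2) assms(2)] by (simp add: space_defect_coef_def algebra_simps)
  ultimately show ?thesis by (simp add: space_defect_def[abs_def])
qed

text \<open>The discrete Laplacian is exact on frequencies up to \<open>N / 2\<close>, and beyond them any number of factors
\<open>2 * wt k / N \<ge> 1\<close> may be inserted.\<close>

lemma space_defect_coef_bound:
  assumes N: "N > 0" "even N" shows "cmod (space_defect_coef N t k) \<le> (2 / real N) ^ p * (wt k ^ (p + 2) * cmod (coef (u t) k))"
proof (cases "\<forall>i. \<bar>kc k i\<bar> \<le> int N div 2")
  case True
  then have "space_defect_coef N t k = 0" using lam_small[OF N] by (simp add: space_defect_coef_def)
  then show ?thesis by simp
next
  case False
  then obtain i where i: "\<bar>kc k i\<bar> > int N div 2" by (auto simp: not_le)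
  have "2 * (int N div 2) = int N" using N by auto
  then have "int N \<le> 2 * \<bar>kc k i\<bar>" using i by linarith
  then have "real_of_int (int N) \<le> real_of_int (2 * \<bar>kc k i\<bar>)" by (simp only: of_int_le_iff)
  then have "real N / 2 \<le> \<bar>real_of_int (kc k i)\<bar>" by simp
  also have "\<dots> \<le> (\<Sum>i\<in>UNIV. \<bar>real_of_int (kc k i)\<bar>)" by (rule member_le_sum) auto
  also have "\<dots> \<le> wt k" by (simp add: wt_def)
  finally have "1 \<le> 2 / real N * wt k" using N by (simp add: field_simps)
  then have 1: "1 \<le> (2 / real N * wt k) ^ p" by (rule one_le_power)
  have "cmod (space_defect_coef N t k) = (ksq k - lam N k) * cmod (coef (u t) k)"
    using lam_le[OF N, of k] by (simp only: space_defect_coef_def norm_mult norm_of_real)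
  also have "\<dots> \<le> (wt k)\<^sup>2 * cmod (coef (u t) k)"
    using lam_nonneg[of N k] ksq_le[of k] by (intro mult_right_mono) auto
  also have "\<dots> \<le> (2 / real N * wt k) ^ p * ((wt k)\<^sup>2 * cmod (coef (u t) k))"
    using mult_right_mono[OF 1, of "(wt k)\<^sup>2 * cmod (coef (u t) k)"] by simp
  also have "\<dots> = (2 / real N) ^ p * (wt k ^ (p + 2) * cmod (coef (u t) k))"
    unfolding power_mult_distrib power_add by (simp only: mult_ac)
  finally show ?thesis .
qed

lemma space_defect_coef_sum:
  assumes N: "N > 0" "even N" and t: "t \<in> {0..T}" and F: "finite F" and pq: "p + q \<le> m + 2"
  shows "(\<Sum>k\<in>F. (wt k ^ q * cmod (space_defect_coef N t k))\<^sup>2) \<le> ((2 / real N) ^ p)\<^sup>2 * C"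
proof -
  have "(\<Sum>k\<in>F. (wt k ^ q * cmod (space_defect_coef N t k))\<^sup>2) \<le> (\<Sum>k\<in>F. ((2 / real N) ^ p)\<^sup>2 * (wt k ^ (m + 4) * cmod (coef (u t) k))\<^sup>2)"
  proof (rule sum_mono)
    fix k
    have "wt k ^ q * cmod (space_defect_coef N t k) \<le> wt k ^ q * ((2 / real N) ^ p * (wt k ^ (p + 2) * cmod (coef (u t) k)))"
      by (intro mult_left_mono space_defect_coef_bound N) auto
    also have "\<dots> = (2 / real N) ^ p * (wt k ^ (q + (p + 2)) * cmod (coef (u t) k))" unfolding power_add by (simp only: mult_ac)
    also have "\<dots> \<le> (2 / real N) ^ p * (wt k ^ (m + 4) * cmod (coef (u t) k))"
      using wt_ge_1 pq by (intro mult_left_mono mult_right_mono power_increasing) auto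
    finally have "(wt k ^ q * cmod (space_defect_coef N t k))\<^sup>2 \<le> ((2 / real N) ^ p * (wt k ^ (m + 4) * cmod (coef (u t) k)))\<^sup>2"
      by (rule power_mono) simp
    then show "(wt k ^ q * cmod (space_defect_coef N t k))\<^sup>2 \<le> ((2 / real N) ^ p)\<^sup>2 * (wt k ^ (m + 4) * cmod (coef (u t) k))\<^sup>2"
      by (simp only: power_mult_distrib)
  qed
  also have "\<dots> = ((2 / real N) ^ p)\<^sup>2 * (\<Sum>k\<in>F. (wt k ^ (m + 4) * cmod (coef (u t) k))\<^sup>2)" by (simp only: sum_distrib_left)
  also have "\<dots> \<le> ((2 / real N) ^ p)\<^sup>2 * C" using HU[OF t] F by (intro mult_left_mono) (auto simp: wb_def)
  finally show ?thesis .
qed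

lemma space_defect_grid_norm:
  assumes N: "N > 0" "even N" and t: "t \<in> {0..T}"
  shows "grid_norm N (space_defect N t) \<le> 2 * K * \<delta> N"
proof -
  have "grid_norm N (space_defect N t) \<le> K * (\<delta> N + \<delta> N)"
  proof (rule gn_bound[OF N rep_space_defect[OF N(1) t] \<delta>0])
    fix F :: "freq set" assume F: "finite F"
    have "(\<Sum>k\<in>F. (cmod (space_defect_coef N t k))\<^sup>2) \<le> ((2 / real N) ^ (m + 2))\<^sup>2 * C"
      using space_defect_coef_sum[OF N t F, of "m + 2" 0] by simp
    also have "\<dots> \<le> (\<delta> N)\<^sup>2 * C"
      unfolding \<delta>_def using N C0' by (intro mult_right_mono power_mono divide_right_mono) auto
    also have "\<dots> \<le> (\<delta> N)\<^sup>2 * (16 * C)" using C0' by (intro mult_left_mono) auto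
    finally show "(\<Sum>k\<in>F. (cmod (space_defect_coef N t k))\<^sup>2) \<le> 16 * C * (\<delta> N)\<^sup>2" by (simp only: mult_ac)
    have "(\<Sum>k\<in>F. (wt k ^ (m + 2) * cmod (space_defect_coef N t k))\<^sup>2) \<le> ((2 / real N) ^ 0)\<^sup>2 * C" by (rule space_defect_coef_sum[OF N t F]) simp
    then show "(\<Sum>k\<in>F. (wt k ^ (m + 2) * cmod (space_defect_coef N t k))\<^sup>2) \<le> 16 * C" using C0' by simp
  qed
  then show ?thesis by simp
qed

lemma space_defect_wiener:
  assumes N: "N > 0" "even N" and t: "t \<in> {0..T}"
  shows "wiener N (space_defect N t) \<le> 2 / real N * R"
proof -
  have "wiener N (space_defect N t) \<le> sqrt (S\<^sub>w * (((2 / real N) ^ 1)\<^sup>2 * C))"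
    by (rule wiener_Hb2[OF N(1) rep_space_defect[OF N(1) t]]) (use space_defect_coef_sum[OF N t, of _ 1 2] m in auto)
  also have "\<dots> = 2 / real N * R" unfolding R_def by (simp add: real_sqrt_mult real_sqrt_divide)
  finally show ?thesis .
qed

end

section \<open>A discrete Gronwall inequality\<close>

text \<open>The recursion couples levels at distance two, so the induction bounds both predecessors by
  the same increasing majorant.  The factor \<open>1 + 8 * z\<close> satisfies
  \<open>1 + 3 * z \<le> (1 - z) * (1 + 8 * z)\<close> for \<open>z \<le> 1/2\<close>, which absorbs the implicit term.\<close>

lemma gronwall_two_step:
  fixes x :: "nat \<Rightarrow> real"
  assumes nn: "\<And>n. 0 \<le> x n" and x0: "x 0 = 0" and x1: "x 1 \<le> X1"
    and \<tau>: "0 \<le> \<tau>" and L: "0 \<le> L" "\<tau> * L \<le> 1/2" and \<rho>: "0 \<le> \<rho>"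
    and rec: "\<And>n. 1 \<le> n \<Longrightarrow> n < M \<Longrightarrow> x (n + 1) \<le> x (n - 1) + \<tau> * L * (x (n + 1) + x (n - 1)) + 2 * \<tau> * L * x n + 2 * \<tau> * \<rho>"
    and n: "n \<le> M"
  shows "x n \<le> exp (8 * \<tau> * L * n) * (X1 + 4 * \<tau> * \<rho> * n)"
proof -
  define z where "z = \<tau> * L"
  have z: "0 \<le> z" "z \<le> 1/2" using \<tau> L by (auto simp: z_def)
  have X1: "0 \<le> X1" using nn[of 1] x1 by simp
  have "x n \<le> (1 + 8 * z) ^ n * (X1 + 4 * \<tau> * \<rho> * n)" if "n \<le> M" for n
    using that
  proof (induction n rule: less_induct)
    case (less n)
    consider "n = 0" | "n = 1" | k where "n = k + 1" "1 \<le> k" by (cases n) (auto simp: Suc_le_eq)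
    then show ?case
    proof cases
      case 1 then show ?thesis using x0 X1 by simp
    next
      case 2
      have "x 1 \<le> 1 * (X1 + 0)" using x1 by simp
      also have "\<dots> \<le> (1 + 8 * z) ^ 1 * (X1 + 4 * \<tau> * \<rho> * 1)" using z X1 \<tau> \<rho> by (intro mult_mono add_left_mono) auto
      finally show ?thesis using 2 by simp
    next
      case 3
      define Y where "Y = (1 + 8 * z) ^ k * (X1 + 4 * \<tau> * \<rho> * k)"
      have Y1: "x k \<le> Y" using less.IH[of k] less.prems 3 by (simp add: Y_def)
      have Y2: "x (k - 1) \<le> Y"
      proof -
        have "x (k - 1) \<le> (1 + 8 * z) ^ (k - 1) * (X1 + 4 * \<tau> * \<rho> * (k - 1))" using less.IH[of "k - 1"] less.prems 3 by simp
        also have "\<dots> \<le> Y" unfolding Y_def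
          using z X1 \<tau> \<rho> by (intro mult_mono power_increasing add_left_mono mult_left_mono) auto
        finally show ?thesis .
      qed
      have r: "x (k + 1) \<le> x (k - 1) + z * (x (k + 1) + x (k - 1)) + 2 * z * x k + 2 * \<tau> * \<rho>"
        using rec[of k] 3 less.prems by (simp add: z_def)
      also have "\<dots> \<le> Y + z * (x (k + 1) + Y) + 2 * z * Y + 2 * \<tau> * \<rho>"
        using Y1 Y2 z by (intro add_mono mult_left_mono order_refl) auto
      finally have a: "(1 - z) * x (k + 1) \<le> (1 + 3 * z) * Y + 2 * \<tau> * \<rho>" by (simp add: algebra_simps)
      have Y0: "0 \<le> Y" using Y1 nn[of k] by linarith
      have "(1 + 3 * z) * Y + 2 * \<tau> * \<rho> \<le> (1 - z) * ((1 + 8 * z) * Y + 4 * \<tau> * \<rho>)"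
      proof -
        have "0 \<le> z * (1 - 2 * z)" using z by simp
        then have "1 + 3 * z \<le> (1 - z) * (1 + 8 * z)" by (simp add: algebra_simps)
        then have "(1 + 3 * z) * Y \<le> (1 - z) * (1 + 8 * z) * Y" using Y0 by (rule mult_right_mono)
        moreover have "2 * (\<tau> * \<rho>) \<le> (1 - z) * 4 * (\<tau> * \<rho>)" using z \<tau> \<rho> by (intro mult_right_mono) auto
        ultimately show ?thesis by (simp add: algebra_simps)
      qed
      with a have "(1 - z) * x (k + 1) \<le> (1 - z) * ((1 + 8 * z) * Y + 4 * \<tau> * \<rho>)" by linarith
      then have "x (k + 1) \<le> (1 + 8 * z) * Y + 4 * \<tau> * \<rho>" using z by (subst (asm) mult_le_cancel_left_pos) auto
      also have "\<dots> \<le> (1 + 8 * z) * Y + (1 + 8 * z) ^ (k + 1) * (4 * \<tau> * \<rho>)"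
        using z \<tau> \<rho> mult_right_mono[OF one_le_power[of "1 + 8 * z" "k + 1"], of "4 * \<tau> * \<rho>"] by simp
      also have "\<dots> = (1 + 8 * z) ^ (k + 1) * (X1 + 4 * \<tau> * \<rho> * real (k + 1))" by (simp add: Y_def algebra_simps)
      finally show ?thesis using 3 by simp
    qed
  qed
  from this[OF n] have "x n \<le> (1 + 8 * z) ^ n * (X1 + 4 * \<tau> * \<rho> * n)" .
  also have "\<dots> \<le> exp (8 * \<tau> * L * n) * (X1 + 4 * \<tau> * \<rho> * n)"
  proof (rule mult_right_mono)
    have "(1 + 8 * z) ^ n \<le> exp (8 * z) ^ n" using z by (intro power_mono exp_ge_add_one_self) auto
    also have "\<dots> = exp (8 * \<tau> * L * n)" by (simp add: exp_of_nat_mult[symmetric] z_def mult_ac)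
    finally show "(1 + 8 * z) ^ n \<le> exp (8 * \<tau> * L * n)" .
  qed (use X1 \<tau> \<rho> in simp)
  finally show ?thesis .
qed

section \<open>The residual of the exact solution\<close>

context nls_reg
begin

lemma R1: "1 \<le> R"
proof -
  have "1 \<le> S\<^sub>w" using sum_wt_powr_le[of "{0}"] by (simp add: wt_def)
  then have "1 * 1 \<le> S\<^sub>w * C" using C1' by (intro mult_mono) auto
  then show ?thesis by (simp add: R_def)
qed

definition second_diff_coef where "second_diff_coef t \<tau> k = coef (u (t + \<tau>)) k - 2 * coef (u t) k + coef (u (t - \<tau>)) k"

lemma second_difference_grid_norm:
  assumes N: "N > 0" "even N" and \<tau>: "0 \<le> \<tau>" "0 \<le> t - \<tau>" "t + \<tau> \<le> T"
  shows "grid_norm N (\<lambda>j. gr N (u (t + \<tau>)) j - 2 * gr N (u t) j + gr N (u (t - \<tau>)) j) \<le> K * (\<tau>\<^sup>2 + \<delta> N)"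
proof (rule gn_bound[OF N, where c = "second_diff_coef t \<tau>"])
  have tT: "t + \<tau> \<in> {0..T}" "t \<in> {0..T}" "t - \<tau> \<in> {0..T}" using \<tau> by auto
  show "rep N (second_diff_coef t \<tau>) (\<lambda>j. gr N (u (t + \<tau>)) j - 2 * gr N (u t) j + gr N (u (t - \<tau>)) j)"
    unfolding second_diff_coef_def[abs_def] by (intro rep_add rep_diff rep_scale rep_gr u_reg tT N)
  fix F :: "freq set" assume F: "finite F"
  have "(\<Sum>k\<in>F. (cmod (second_diff_coef t \<tau> k))\<^sup>2) \<le> (2 * sqrt C * \<tau>\<^sup>2)\<^sup>2"
  proof (rule dual_bound)
    fix y :: "freq \<Rightarrow> complex"
    let ?P = "\<lambda>v s. \<Sum>k\<in>F. y k * coef (v s) k"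
    have d: "(?P v has_vector_derivative ?P w s) (at s within {t-\<tau>..t+\<tau>})"
      if "s \<in> {t-\<tau>..t+\<tau>}" "\<And>t k. t \<in> {0..T} \<Longrightarrow> ((\<lambda>r. coef (v r) k) has_vector_derivative coef (w t) k) (at t within {0..T})" for v w s
      by (intro has_vector_derivative_sum has_vector_derivative_mult_right has_vector_derivative_within_subset[OF that(2)])
        (use \<tau> that(1) in auto)
    have "cmod (?P u (t + \<tau>) - 2 * ?P u t + ?P u (t - \<tau>)) \<le> 2 * (sqrt (\<Sum>k\<in>F. (cmod (y k))\<^sup>2) * sqrt C) * \<tau>\<^sup>2"
    proof (rule second_difference[where \<phi>a = "?P v1" and \<phi>b = "?P v2"])
      show "cmod (?P v2 s) \<le> sqrt (\<Sum>k\<in>F. (cmod (y k))\<^sup>2) * sqrt C" if "s \<in> {t-\<tau>..t+\<tau>}" for s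
        using H2[of s] that \<tau> F by (intro pairing_bound) (auto simp: wb_def)
    qed (use \<tau> d D0 D1 in auto)
    moreover have "?P u (t + \<tau>) - 2 * ?P u t + ?P u (t - \<tau>) = (\<Sum>k\<in>F. y k * second_diff_coef t \<tau> k)"
      unfolding second_diff_coef_def by (simp add: sum_distrib_left sum.distrib sum_subtractf algebra_simps)
    ultimately show "cmod (\<Sum>k\<in>F. y k * second_diff_coef t \<tau> k) \<le> sqrt (\<Sum>k\<in>F. (cmod (y k))\<^sup>2) * (2 * sqrt C * \<tau>\<^sup>2)"
      by (simp add: mult_ac)
  qed (use C0' in simp)
  also have "\<dots> = 4 * C * (\<tau>\<^sup>2)\<^sup>2" using C0' by (simp add: power_mult_distrib)
  also have "\<dots> \<le> 16 * C * (\<tau>\<^sup>2)\<^sup>2" using C0' by (intro mult_right_mono) auto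
  finally show "(\<Sum>k\<in>F. (cmod (second_diff_coef t \<tau> k))\<^sup>2) \<le> 16 * C * (\<tau>\<^sup>2)\<^sup>2" .
  let ?w = "\<lambda>k. wt k ^ (m + 2)"
  have "(\<Sum>k\<in>F. (?w k * cmod (second_diff_coef t \<tau> k))\<^sup>2) \<le> (\<Sum>k\<in>F. 4 * (?w k * cmod (coef (u (t + \<tau>)) k))\<^sup>2 + 8 * (?w k * cmod (coef (u t) k))\<^sup>2 + 4 * (?w k * cmod (coef (u (t - \<tau>)) k))\<^sup>2)"
  proof (rule sum_mono)
    fix k
    define X Y Z where "X = ?w k * cmod (coef (u (t + \<tau>)) k)" and "Y = ?w k * cmod (coef (u t) k)" and "Z = ?w k * cmod (coef (u (t - \<tau>)) k)"
    have "cmod (second_diff_coef t \<tau> k) \<le> cmod (coef (u (t + \<tau>)) k) + cmod (2 * coef (u t) k) + cmod (coef (u (t - \<tau>)) k)"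
      unfolding second_diff_coef_def by (intro order_trans[OF norm_triangle_ineq] add_mono norm_triangle_ineq4 order_refl)
    then have "?w k * cmod (second_diff_coef t \<tau> k) \<le> ?w k * (cmod (coef (u (t + \<tau>)) k) + cmod (2 * coef (u t) k) + cmod (coef (u (t - \<tau>)) k))"
      by (rule mult_left_mono) simp
    also have "\<dots> = X + 2 * Y + Z" by (simp add: X_def Y_def Z_def norm_mult algebra_simps)
    finally have "(?w k * cmod (second_diff_coef t \<tau> k))\<^sup>2 \<le> (X + 2 * Y + Z)\<^sup>2" by (rule power_mono) simp
    also have "\<dots> \<le> 4 * X\<^sup>2 + 8 * Y\<^sup>2 + 4 * Z\<^sup>2"
    proof -
      have "0 \<le> 2 * (X - Y)\<^sup>2 + (X - Z)\<^sup>2 + 2 * (Y - Z)\<^sup>2" by simp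
      then show ?thesis by (simp add: power2_eq_square algebra_simps)
    qed
    finally show "(?w k * cmod (second_diff_coef t \<tau> k))\<^sup>2 \<le> 4 * (?w k * cmod (coef (u (t + \<tau>)) k))\<^sup>2 + 8 * (?w k * cmod (coef (u t) k))\<^sup>2 + 4 * (?w k * cmod (coef (u (t - \<tau>)) k))\<^sup>2"
      by (simp add: X_def Y_def Z_def)
  qed
  also have "\<dots> = 4 * (\<Sum>k\<in>F. (?w k * cmod (coef (u (t + \<tau>)) k))\<^sup>2) + 8 * (\<Sum>k\<in>F. (?w k * cmod (coef (u t) k))\<^sup>2) + 4 * (\<Sum>k\<in>F. (?w k * cmod (coef (u (t - \<tau>)) k))\<^sup>2)"
    by (simp only: sum.distrib sum_distrib_left)
  also have "\<dots> \<le> 4 * C + 8 * C + 4 * C"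
    using HU2[OF tT(1)] HU2[OF tT(2)] HU2[OF tT(3)] F by (intro add_mono mult_left_mono) (auto simp: wb_def)
  finally show "(\<Sum>k\<in>F. (wt k ^ (m + 2) * cmod (second_diff_coef t \<tau> k))\<^sup>2) \<le> 16 * C" by simp
qed simp

lemma cc_deriv: "(cc has_vector_derivative of_real (- 2 * \<gamma>) * cc s) (at s within S)"
proof -
  have "((\<lambda>t. \<beta> * exp (- 2 * \<gamma> * t)) has_real_derivative (- 2 * \<gamma>) * (\<beta> * exp (- 2 * \<gamma> * s))) (at s within S)"
    by (auto intro!: derivative_eq_intros)
  from has_vector_derivative_of_real[OF this] show ?thesis
    by (simp only: cc_def[abs_def] of_real_mult)
qed

lemma cc_second_difference:
  assumes "0 \<le> \<tau>" "0 \<le> t - \<tau>"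
  shows "cmod (cc (t + \<tau>) - 2 * cc t + cc (t - \<tau>)) \<le> 8 * \<bar>\<beta>\<bar> * \<gamma>\<^sup>2 * \<tau>\<^sup>2"
proof -
  have "cmod (cc (t + \<tau>) - 2 * cc t + cc (t - \<tau>)) \<le> 2 * (4 * \<gamma>\<^sup>2 * \<bar>\<beta>\<bar>) * \<tau>\<^sup>2"
  proof (rule second_difference[OF assms(1), where \<phi>a = "\<lambda>s. of_real (- 2 * \<gamma>) * cc s" and \<phi>b = "\<lambda>s. of_real (- 2 * \<gamma>) * (of_real (- 2 * \<gamma>) * cc s)"])
    fix s assume "s \<in> {t-\<tau>..t+\<tau>}"
    then have "cmod (cc s) \<le> \<bar>\<beta>\<bar>" using assms by (intro norm_cc) auto
    then have "4 * \<gamma>\<^sup>2 * cmod (cc s) \<le> 4 * \<gamma>\<^sup>2 * \<bar>\<beta>\<bar>" by (rule mult_left_mono) simp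
    then show "cmod (of_real (- 2 * \<gamma>) * (of_real (- 2 * \<gamma>) * cc s)) \<le> 4 * \<gamma>\<^sup>2 * \<bar>\<beta>\<bar>"
      using gamma by (simp add: norm_mult power2_eq_square)
  qed (intro cc_deriv has_vector_derivative_mult_right)+
  then show ?thesis by (simp add: mult_ac)
qed

text \<open>The cubic term of the scheme, linearised at a grid function \<open>q\<close> with coefficient \<open>c\<close>, against the average of the
exact one.  The function \<open>q\<close> is the solution at the middle of a double step, or the
predictor in the first step.\<close>

definition nonlin_defect where "nonlin_defect N a b q c j = c * of_real ((cmod (q j))\<^sup>2) * ((gr N (u b) j + gr N (u a) j) / 2) - (gr N (fn b) j + gr N (fn a) j) / 2"

lemma sq_cnj: "of_real ((cmod z)\<^sup>2) = z * cnj z"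
  by (rule complex_norm_square)

lemma nonlin_defect_grid_norm:
  assumes N: "N > 0" "even N" and \<tau>: "0 \<le> \<tau>" "\<tau> \<le> 1" "0 \<le> t - \<tau>" "t + \<tau> \<le> T"
  shows "grid_norm N (nonlin_defect N (t - \<tau>) (t + \<tau>) (gr N (u t)) (cc t)) \<le>
    2 * \<bar>\<beta>\<bar> * R\<^sup>2 * (K * (\<tau>\<^sup>2 + \<delta> N)) + sqrt ((2 * pi) ^ 3) * ((4 * \<bar>\<beta>\<bar> + 4 * \<bar>\<beta>\<bar> * \<gamma>\<^sup>2 + 14 * \<bar>\<beta>\<bar> * \<gamma>) * R ^ 3 * \<tau>\<^sup>2)"
proof -
  have tT: "t + \<tau> \<in> {0..T}" "t \<in> {0..T}" "t - \<tau> \<in> {0..T}" using \<tau> by auto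
  let ?P = "\<lambda>j. gr N (u (t + \<tau>)) j - 2 * gr N (u t) j + gr N (u (t - \<tau>)) j"
  define B where "B = (4 * \<bar>\<beta>\<bar> + 4 * \<bar>\<beta>\<bar> * \<gamma>\<^sup>2 + 14 * \<bar>\<beta>\<bar> * \<gamma>) * R ^ 3 * \<tau>\<^sup>2"
  have B0: "0 \<le> B" using gamma R0 by (simp add: B_def)
  have "grid_norm N (nonlin_defect N (t - \<tau>) (t + \<tau>) (gr N (u t)) (cc t)) \<le> 2 * \<bar>\<beta>\<bar> * R\<^sup>2 * grid_norm N ?P + sqrt ((2 * pi) ^ 3) * B"
  proof (rule grid_norm_affine[OF N(1)])
    fix j assume j: "j \<in> J_h N"
    define z p q where "z = gr N (u t) j" and "p = gr N (u (t + \<tau>)) j - gr N (u t) j" and "q = gr N (u (t - \<tau>)) j - gr N (u t) j"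
    have z: "cmod z \<le> R" unfolding z_def by (rule order_trans[OF norm_le_wiener[OF N(1) j] wiener_u[OF N(1) tT(2)]])
    have p: "cmod p \<le> R * \<tau>"
      using order_trans[OF norm_le_wiener[OF N(1) j] wiener_u_lip[OF N(1), of t "t + \<tau>"]] \<tau> by (simp add: p_def)
    have q: "cmod q \<le> R * \<tau>"
      using order_trans[OF norm_le_wiener[OF N(1) j] wiener_u_lip[OF N(1), of "t - \<tau>" t]] \<tau> by (simp add: q_def norm_minus_commute)
    define F where "F w = w * (w * cnj w)" for w :: complex
    have main: "cmod (cc t * (z * cnj z) * ((z + p) + (z + q)) - (cc (t + \<tau>) * F (z + p) + cc (t - \<tau>) * F (z + q)))
      \<le> 4 * \<bar>\<beta>\<bar> * R\<^sup>2 * cmod (p + q) + (8 * \<bar>\<beta>\<bar> + 8 * \<bar>\<beta>\<bar> * \<gamma>\<^sup>2 + 14 * (2 * \<bar>\<beta>\<bar> * \<gamma>)) * R ^ 3 * \<tau>\<^sup>2"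
      unfolding F_def
    proof (rule nonlinear_consistency[OF R0 z p q \<tau>(1,2)])
      show "cmod (cc t) \<le> \<bar>\<beta>\<bar>" using tT by (intro norm_cc) auto
      show "cmod (cc (t + \<tau>) - cc t) \<le> 2 * \<bar>\<beta>\<bar> * \<gamma> * \<tau>" using cc_lipschitz[of t "t + \<tau>"] tT \<tau> by simp
      show "cmod (cc (t - \<tau>) - cc t) \<le> 2 * \<bar>\<beta>\<bar> * \<gamma> * \<tau>" using cc_lipschitz[of "t - \<tau>" t] tT \<tau> by (simp add: norm_minus_commute)
      show "cmod (cc (t + \<tau>) + cc (t - \<tau>) - 2 * cc t) \<le> 8 * \<bar>\<beta>\<bar> * \<gamma>\<^sup>2 * \<tau>\<^sup>2"
        using cc_second_difference[OF \<tau>(1,3)] by (simp add: algebra_simps)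
    qed
    have zp: "z + p = gr N (u (t + \<tau>)) j" "z + q = gr N (u (t - \<tau>)) j" by (auto simp: z_def p_def q_def)
    have fe: "cc s * F (gr N (u s) j) = gr N (fn s) j" for s by (simp add: F_def gr_def fn_def cub_def)
    have half: "2 * (A * ((B + D) / 2) - (E + G) / 2) = A * (B + D) - (E + G)" for A B D E G :: complex
      by (simp add: field_simps)
    have "2 * nonlin_defect N (t - \<tau>) (t + \<tau>) (gr N (u t)) (cc t) j = cc t * (z * cnj z) * ((z + p) + (z + q)) - (cc (t + \<tau>) * F (z + p) + cc (t - \<tau>) * F (z + q))"
      unfolding zp fe nonlin_defect_def sq_cnj half unfolding z_def by (rule refl)
    with main have "cmod (2 * nonlin_defect N (t - \<tau>) (t + \<tau>) (gr N (u t)) (cc t) j) \<le> 4 * \<bar>\<beta>\<bar> * R\<^sup>2 * cmod (p + q) + (8 * \<bar>\<beta>\<bar> + 8 * \<bar>\<beta>\<bar> * \<gamma>\<^sup>2 + 14 * (2 * \<bar>\<beta>\<bar> * \<gamma>)) * R ^ 3 * \<tau>\<^sup>2"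
      by (simp only:)
    also have "(8 * \<bar>\<beta>\<bar> + 8 * \<bar>\<beta>\<bar> * \<gamma>\<^sup>2 + 14 * (2 * \<bar>\<beta>\<bar> * \<gamma>)) * R ^ 3 * \<tau>\<^sup>2 = 2 * B" by (simp add: B_def algebra_simps)
    finally have "cmod (2 * nonlin_defect N (t - \<tau>) (t + \<tau>) (gr N (u t)) (cc t) j) \<le> 4 * \<bar>\<beta>\<bar> * R\<^sup>2 * cmod (p + q) + 2 * B" .
    moreover have "p + q = ?P j" by (simp add: p_def q_def)
    ultimately show "cmod (nonlin_defect N (t - \<tau>) (t + \<tau>) (gr N (u t)) (cc t) j) \<le> 2 * \<bar>\<beta>\<bar> * R\<^sup>2 * cmod (?P j) + B"
      by (simp add: norm_mult)
  qed (use B0 in auto)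
  also have "\<dots> \<le> 2 * \<bar>\<beta>\<bar> * R\<^sup>2 * (K * (\<tau>\<^sup>2 + \<delta> N)) + sqrt ((2 * pi) ^ 3) * B"
    by (intro add_right_mono mult_left_mono second_difference_grid_norm N \<tau>) auto
  finally show ?thesis by (simp only: B_def)
qed

definition L3 where "L3 = (8 * \<bar>\<beta>\<bar> * \<gamma> + 6 * \<bar>\<beta>\<bar>) * R ^ 3"

lemma L30: "0 \<le> L3" using gamma R0 by (simp add: L3_def)

text \<open>Only first order in the step is needed in the Wiener norm, so the frozen modulus is compared with
each end of the step separately.\<close>

lemma wiener_nl:
  assumes N: "N > 0" and q: "wiener N q \<le> 2 * R" and z: "wiener N z \<le> R" and d: "wiener N (\<lambda>j. q j - z j) \<le> 2 * R * \<tau>" and \<tau>: "0 \<le> \<tau>"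
    and c: "cmod (c - c') \<le> 2 * \<bar>\<beta>\<bar> * \<gamma> * \<tau>" "cmod c' \<le> \<bar>\<beta>\<bar>"
  shows "wiener N (\<lambda>j. c * of_real ((cmod (q j))\<^sup>2) * z j - c' * of_real ((cmod (z j))\<^sup>2) * z j) \<le> L3 * \<tau>"
proof -
  interpret A: gnorm N "wiener N" by (rule gnorm_wiener[OF N])
  have cq: "wiener N (\<lambda>j. cnj (q j)) \<le> 2 * R" by (rule order_trans[OF A.cnj_le q])
  have cd: "wiener N (\<lambda>j. cnj (q j - z j)) \<le> 2 * R * \<tau>" by (rule order_trans[OF A.cnj_le d])
  have m: "wiener N (\<lambda>j. X j * Y j) \<le> a * b" if "wiener N X \<le> a" "wiener N Y \<le> b" for X Y a b
    by (rule order_trans[OF A.mult mult_mono[OF that]]) (use that wiener_nonneg[of N X] wiener_nonneg[of N Y] in linarith)+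
  have s: "wiener N (\<lambda>j. a * X j) \<le> b * x" if "cmod a \<le> b" "wiener N X \<le> x" for a b x X
    by (rule order_trans[OF A.scale mult_mono[OF that]]) (use that norm_ge_zero[of a] wiener_nonneg[of N X] in linarith)+
  have eq: "c * of_real ((cmod (q j))\<^sup>2) * z j - c' * of_real ((cmod (z j))\<^sup>2) * z j =
     (c - c') * (q j * (cnj (q j) * z j)) + c' * ((q j - z j) * (cnj (q j) * z j) + z j * (cnj (q j - z j) * z j))" for j
    unfolding sq_cnj by (simp add: algebra_simps)
  have "wiener N (\<lambda>j. (c - c') * (q j * (cnj (q j) * z j)) + c' * ((q j - z j) * (cnj (q j) * z j) + z j * (cnj (q j - z j) * z j)))
    \<le> (2 * \<bar>\<beta>\<bar> * \<gamma> * \<tau>) * (2 * R * (2 * R * R)) + \<bar>\<beta>\<bar> * (2 * R * \<tau> * (2 * R * R) + R * (2 * R * \<tau> * R))"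
    by (intro order_trans[OF A.add] add_mono s m c q z d cq cd)
  also have "\<dots> = L3 * \<tau>" by (simp add: L3_def power3_eq_cube algebra_simps)
  finally show ?thesis by (simp only: eq)
qed

lemma nonlin_defect_wiener:
  assumes N: "N > 0" and ab: "a \<in> {0..T}" "b \<in> {0..T}" and q: "wiener N q \<le> 2 * R" and \<tau>: "0 \<le> \<tau>"
    and d: "wiener N (\<lambda>j. q j - gr N (u a) j) \<le> 2 * R * \<tau>" "wiener N (\<lambda>j. q j - gr N (u b) j) \<le> 2 * R * \<tau>"
    and c: "cmod (c - cc a) \<le> 2 * \<bar>\<beta>\<bar> * \<gamma> * \<tau>" "cmod (c - cc b) \<le> 2 * \<bar>\<beta>\<bar> * \<gamma> * \<tau>"
  shows "wiener N (nonlin_defect N a b q c) \<le> L3 * \<tau>"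
proof -
  interpret A: gnorm N "wiener N" by (rule gnorm_wiener[OF N])
  let ?X = "\<lambda>s j. c * of_real ((cmod (q j))\<^sup>2) * gr N (u s) j - cc s * of_real ((cmod (gr N (u s) j))\<^sup>2) * gr N (u s) j"
  have fe: "cc s * of_real ((cmod (gr N (u s) j))\<^sup>2) * gr N (u s) j = gr N (fn s) j" for s j
    using cub_cmod[of "u s" "grid_point N j"] by (simp add: gr_def fn_def mult.assoc)
  have eq: "nonlin_defect N a b q c = (\<lambda>j. (1/2) * ?X b j + (1/2) * ?X a j)"
    unfolding fe by (rule ext) (simp add: nonlin_defect_def algebra_simps add_divide_distrib)
  have X: "wiener N (?X s) \<le> L3 * \<tau>" if "s \<in> {0..T}" "wiener N (\<lambda>j. q j - gr N (u s) j) \<le> 2 * R * \<tau>" "cmod (c - cc s) \<le> 2 * \<bar>\<beta>\<bar> * \<gamma> * \<tau>" for s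
    using that by (intro wiener_nl N q wiener_u \<tau> norm_cc) auto
  have "wiener N (nonlin_defect N a b q c) \<le> cmod (1/2) * wiener N (?X b) + cmod (1/2) * wiener N (?X a)"
    unfolding eq by (intro order_trans[OF A.add] add_mono A.scale)
  then show ?thesis using X[OF ab(1) d(1) c(1)] X[OF ab(2) d(2) c(2)] by simp
qed

text \<open>What is left when the exact solution is inserted into a step from \<open>a\<close> to \<open>b\<close>.\<close>

definition residual where "residual N a b q c j = \<i> * ((gr N (u b) j - gr N (u a) j) / of_real (b - a))
   + Delta_h N (\<lambda>j. (gr N (u b) j + gr N (u a) j) / 2) j + c * of_real ((cmod (q j))\<^sup>2) * ((gr N (u b) j + gr N (u a) j) / 2)"

text \<open>The differential equation, solved for the time derivative \<open>ut\<close>, splits the residual into the three defects.\<close>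

lemma residual_eq: "residual N a b q c = (\<lambda>j. \<i> * time_defect N a b j + ((1/2) * (space_defect N b j + space_defect N a j) + nonlin_defect N a b q c j))"
proof
  fix j
  have D: "Delta_h N (\<lambda>j. (gr N (u b) j + gr N (u a) j) / 2) j = (1/2) * (Delta_h N (gr N (u b)) j + Delta_h N (gr N (u a)) j)"
    by (cases j) (simp add: Delta_h_def distrib_left sum.distrib add_divide_distrib sum_divide_distrib)
  have ute: "gr N (ut s) j = \<i> * (gr N (laplacian (u s)) j + gr N (fn s) j)" for s by (simp add: gr_def ut_def)
  define X where "X = (gr N (u b) j - gr N (u a) j) / of_real (b - a)"
  have i2: "\<i> * (\<i> * w) = - w" for w by (simp add: mult.assoc[symmetric])
  have e1: "\<i> * time_defect N a b j = \<i> * X + 1/2 * (gr N (laplacian (u b)) j + gr N (fn b) j + (gr N (laplacian (u a)) j + gr N (fn a) j))"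
    unfolding time_defect_def X_def[symmetric] ute by (simp add: right_diff_distrib distrib_left i2 add_divide_distrib diff_divide_distrib)
  show "residual N a b q c j = \<i> * time_defect N a b j + ((1/2) * (space_defect N b j + space_defect N a j) + nonlin_defect N a b q c j)"
    unfolding e1 residual_def D space_defect_def nonlin_defect_def X_def[symmetric]
    by (simp add: algebra_simps add_divide_distrib diff_divide_distrib)
qed

lemma residual_norm:
  assumes "gnorm N nn"
  shows "nn (residual N a b q c) \<le> nn (time_defect N a b) + (1/2 * (nn (space_defect N b) + nn (space_defect N a)) + nn (nonlin_defect N a b q c))"
proof -
  interpret gnorm N nn by fact
  have "nn (residual N a b q c) \<le> nn (\<lambda>j. \<i> * time_defect N a b j) + (nn (\<lambda>j. (1/2) * (space_defect N b j + space_defect N a j)) + nn (nonlin_defect N a b q c))"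
    unfolding residual_eq by (intro order_trans[OF add] add_mono order_refl add)
  also have "\<dots> \<le> cmod \<i> * nn (time_defect N a b) + (cmod (1/2) * nn (\<lambda>j. space_defect N b j + space_defect N a j) + nn (nonlin_defect N a b q c))"
    by (intro add_mono scale order_refl)
  also have "\<dots> \<le> nn (time_defect N a b) + (1/2 * (nn (space_defect N b) + nn (space_defect N a)) + nn (nonlin_defect N a b q c))"
    using add[of "space_defect N b" "space_defect N a"] by simp
  finally show ?thesis .
qed

text \<open>A bound for the residual in the Wiener norm that is monotone in both arguments and vanishes at zero.\<close>

definition \<omega> where "\<omega> \<tau> h = sqrt (5 * S\<^sub>w * C * sqrt \<tau>) + h * R + L3 * \<tau>"

lemma residual_wiener:
  assumes N: "N > 0" "even N" and \<tau>: "0 < \<tau>" "2 * \<tau> \<le> 1" "0 \<le> t - \<tau>" "t + \<tau> \<le> T"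
  shows "wiener N (residual N (t - \<tau>) (t + \<tau>) (gr N (u t)) (cc t)) \<le> \<omega> (2 * \<tau>) (mesh N)"
proof -
  have tT: "t + \<tau> \<in> {0..T}" "t \<in> {0..T}" "t - \<tau> \<in> {0..T}" using \<tau> by auto
  have m: "2 / real N \<le> mesh N" using N pi_ge_two by (simp add: mesh_def divide_right_mono)
  have 1: "wiener N (time_defect N (t - \<tau>) (t + \<tau>)) \<le> sqrt (5 * S\<^sub>w * C * sqrt (2 * \<tau>))"
    using time_defect_wiener[OF N(1), of "t - \<tau>" "t + \<tau>"] \<tau> by simp
  have 2: "wiener N (space_defect N s) \<le> mesh N * R" if "s \<in> {0..T}" for s
    by (rule order_trans[OF space_defect_wiener[OF N that] mult_right_mono[OF m R0]])
  have 3: "wiener N (nonlin_defect N (t - \<tau>) (t + \<tau>) (gr N (u t)) (cc t)) \<le> L3 * \<tau>"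
  proof (rule nonlin_defect_wiener[OF N(1) tT(3,1)])
    have Rt: "R * \<tau> \<le> 2 * R * \<tau>" using R0 \<tau> by simp
    show "wiener N (gr N (u t)) \<le> 2 * R" using wiener_u[OF N(1) tT(2)] R0 by linarith
    show "wiener N (\<lambda>j. gr N (u t) j - gr N (u (t - \<tau>)) j) \<le> 2 * R * \<tau>"
    proof -
      have "wiener N (\<lambda>j. gr N (u t) j - gr N (u (t - \<tau>)) j) \<le> R * (t - (t - \<tau>))" by (rule wiener_u_lip[OF N(1)]) (use \<tau> in auto)
      also have "\<dots> = R * \<tau>" by simp
      finally show ?thesis using Rt by linarith
    qed
    interpret A: gnorm N "wiener N" by (rule gnorm_wiener[OF N(1)])
    have "wiener N (\<lambda>j. (-1) * (gr N (u (t + \<tau>)) j - gr N (u t) j)) \<le> cmod (-1) * wiener N (\<lambda>j. gr N (u (t + \<tau>)) j - gr N (u t) j)"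
      by (rule A.scale)
    also have "\<dots> = wiener N (\<lambda>j. gr N (u (t + \<tau>)) j - gr N (u t) j)" by simp
    also have "\<dots> \<le> R * (t + \<tau> - t)" by (rule wiener_u_lip[OF N(1)]) (use \<tau> in auto)
    also have "\<dots> = R * \<tau>" by simp
    also note Rt
    finally show "wiener N (\<lambda>j. gr N (u t) j - gr N (u (t + \<tau>)) j) \<le> 2 * R * \<tau>" by simp
    show "cmod (cc t - cc (t - \<tau>)) \<le> 2 * \<bar>\<beta>\<bar> * \<gamma> * \<tau>" using cc_lipschitz[of "t - \<tau>" t] \<tau> by simp
    show "cmod (cc t - cc (t + \<tau>)) \<le> 2 * \<bar>\<beta>\<bar> * \<gamma> * \<tau>" using cc_lipschitz[of t "t + \<tau>"] \<tau> by (simp add: norm_minus_commute)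
  qed (use \<tau> in simp)
  have "L3 * \<tau> \<le> L3 * (2 * \<tau>)" using L30 \<tau> by (intro mult_left_mono) auto
  note e3 = order_trans[OF 3 this]
  have "wiener N (residual N (t - \<tau>) (t + \<tau>) (gr N (u t)) (cc t)) \<le> sqrt (5 * S\<^sub>w * C * sqrt (2 * \<tau>)) + (1/2 * (mesh N * R + mesh N * R) + L3 * (2 * \<tau>))"
    by (intro order_trans[OF residual_norm[OF gnorm_wiener[OF N(1)]]] add_mono mult_left_mono 1 2 tT e3) auto
  then show ?thesis by (simp add: \<omega>_def)
qed

definition K1 where "K1 = 6 * K + 2 * \<bar>\<beta>\<bar> * R\<^sup>2 * K + sqrt ((2 * pi) ^ 3) * ((4 * \<bar>\<beta>\<bar> + 4 * \<bar>\<beta>\<bar> * \<gamma>\<^sup>2 + 14 * \<bar>\<beta>\<bar> * \<gamma>) * R ^ 3 + L3)"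

lemma K10: "0 \<le> K1"
  using K0 R0 gamma L30 by (simp add: K1_def)

lemma residual_grid_norm:
  assumes N: "N > 0" "even N" and \<tau>: "0 < \<tau>" "2 * \<tau> \<le> 1" "0 \<le> t - \<tau>" "t + \<tau> \<le> T"
  shows "grid_norm N (residual N (t - \<tau>) (t + \<tau>) (gr N (u t)) (cc t)) \<le> K1 * (\<tau>\<^sup>2 + \<delta> N)"
proof -
  have tT: "t + \<tau> \<in> {0..T}" "t \<in> {0..T}" "t - \<tau> \<in> {0..T}" using \<tau> by auto
  define W where "W = (4 * \<bar>\<beta>\<bar> + 4 * \<bar>\<beta>\<bar> * \<gamma>\<^sup>2 + 14 * \<bar>\<beta>\<bar> * \<gamma>) * R ^ 3"
  have W0: "0 \<le> W" using gamma R0 by (simp add: W_def)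
  have "grid_norm N (residual N (t - \<tau>) (t + \<tau>) (gr N (u t)) (cc t)) \<le>
     K * ((2 * \<tau>)\<^sup>2 + \<delta> N) + (1/2 * (2 * K * \<delta> N + 2 * K * \<delta> N) + (2 * \<bar>\<beta>\<bar> * R\<^sup>2 * (K * (\<tau>\<^sup>2 + \<delta> N)) + sqrt ((2 * pi) ^ 3) * (W * \<tau>\<^sup>2)))"
  proof (rule order_trans[OF residual_norm[OF gnorm_grid_norm[OF N(1)]]], intro add_mono mult_left_mono)
    show "grid_norm N (time_defect N (t - \<tau>) (t + \<tau>)) \<le> K * ((2 * \<tau>)\<^sup>2 + \<delta> N)" using time_defect_grid_norm[OF N, of "t - \<tau>" "t + \<tau>"] \<tau> by simp
    show "grid_norm N (nonlin_defect N (t - \<tau>) (t + \<tau>) (gr N (u t)) (cc t)) \<le> 2 * \<bar>\<beta>\<bar> * R\<^sup>2 * (K * (\<tau>\<^sup>2 + \<delta> N)) + sqrt ((2 * pi) ^ 3) * (W * \<tau>\<^sup>2)"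
      using nonlin_defect_grid_norm[OF N, of \<tau> t] \<tau> by (simp add: W_def)
  qed (intro space_defect_grid_norm N tT | simp)+
  also have "\<dots> \<le> K1 * (\<tau>\<^sup>2 + \<delta> N)"
  proof -
    have "sqrt ((2 * pi) ^ 3) * (W * \<tau>\<^sup>2) \<le> sqrt ((2 * pi) ^ 3) * ((W + L3) * (\<tau>\<^sup>2 + \<delta> N))"
      using W0 L30 \<delta>0[of N] by (intro mult_left_mono mult_mono) auto
    moreover have "K * ((2 * \<tau>)\<^sup>2 + \<delta> N) + 1/2 * (2 * K * \<delta> N + 2 * K * \<delta> N) \<le> 6 * K * (\<tau>\<^sup>2 + \<delta> N)"
      using mult_nonneg_nonneg[OF K0 \<delta>0[of N]] mult_nonneg_nonneg[OF K0, of "\<tau>\<^sup>2"] by (simp add: power_mult_distrib algebra_simps)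
    ultimately show ?thesis unfolding K1_def W_def[symmetric] by (simp add: algebra_simps)
  qed
  finally show ?thesis .
qed

definition predicted where "predicted N \<tau> j = gr N (u 0) j + of_real (\<tau> / 2) * gr N (ut 0) j"

lemma predictor_eq: "predictor \<beta> N \<tau> (u 0) = predicted N \<tau>"
  by (rule ext) (simp add: predictor_def predicted_def gr_def ut_def fn_eq[of 0, symmetric] Let_def mult.assoc)

lemma first_step_facts:
  assumes N: "N > 0" and \<tau>: "0 < \<tau>" "\<tau> \<le> 1" "\<tau> \<le> T"
  shows "wiener N (predicted N \<tau>) \<le> 2 * R" "wiener N (\<lambda>j. predicted N \<tau> j - gr N (u 0) j) \<le> 2 * R * \<tau>" "wiener N (\<lambda>j. predicted N \<tau> j - gr N (u \<tau>) j) \<le> 2 * R * \<tau>"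
proof -
  interpret A: gnorm N "wiener N" by (rule gnorm_wiener[OF N])
  have z: "0 \<in> {0..T}" using T by simp
  have "wiener N (\<lambda>j. of_real (\<tau> / 2) * gr N (ut 0) j) \<le> cmod (of_real (\<tau> / 2)) * wiener N (gr N (ut 0))" by (rule A.scale)
  also have "\<dots> = \<tau> / 2 * wiener N (gr N (ut 0))" using \<tau> by (simp add: norm_divide)
  also have "\<dots> \<le> \<tau> / 2 * R" by (rule mult_left_mono[OF wiener_ut[OF N z]]) (use \<tau> in simp)
  finally have d: "wiener N (\<lambda>j. of_real (\<tau> / 2) * gr N (ut 0) j) \<le> \<tau> / 2 * R" .
  have Rt: "\<tau> * R \<le> R" "0 \<le> \<tau> * R" using \<tau> R0 by (auto simp: mult_le_cancel_right1 mult_left_le_one_le)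
  have "wiener N (predicted N \<tau>) \<le> wiener N (gr N (u 0)) + wiener N (\<lambda>j. of_real (\<tau> / 2) * gr N (ut 0) j)"
    unfolding predicted_def[abs_def] by (rule A.add)
  then show "wiener N (predicted N \<tau>) \<le> 2 * R" using d wiener_u[OF N z] Rt by linarith
  show "wiener N (\<lambda>j. predicted N \<tau> j - gr N (u 0) j) \<le> 2 * R * \<tau>" using d Rt by (simp add: predicted_def mult_ac)
  have "wiener N (\<lambda>j. of_real (\<tau> / 2) * gr N (ut 0) j - (gr N (u \<tau>) j - gr N (u 0) j)) \<le> \<tau> / 2 * R + R * (\<tau> - 0)"
    by (intro order_trans[OF A.diff] add_mono d wiener_u_lip N) (use \<tau> in auto)
  then show "wiener N (\<lambda>j. predicted N \<tau> j - gr N (u \<tau>) j) \<le> 2 * R * \<tau>" using Rt by (simp add: predicted_def algebra_simps)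
qed

lemma first_step_nonlin_defect:
  assumes N: "N > 0" and \<tau>: "0 < \<tau>" "\<tau> \<le> 1" "\<tau> \<le> T"
  shows "wiener N (nonlin_defect N 0 \<tau> (predicted N \<tau>) (cc (\<tau> / 2))) \<le> L3 * \<tau>"
proof (rule nonlin_defect_wiener[OF N _ _ first_step_facts(1)[OF N \<tau>] _ first_step_facts(2,3)[OF N \<tau>]])
  have g: "2 * \<bar>\<beta>\<bar> * \<gamma> * (\<tau> / 2) \<le> 2 * \<bar>\<beta>\<bar> * \<gamma> * \<tau>" using gamma \<tau> by (intro mult_left_mono) auto
  have "cmod (cc (\<tau> / 2) - cc 0) \<le> 2 * \<bar>\<beta>\<bar> * \<gamma> * (\<tau> / 2 - 0)" by (rule cc_lipschitz) (use \<tau> in auto)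
  then show "cmod (cc (\<tau> / 2) - cc 0) \<le> 2 * \<bar>\<beta>\<bar> * \<gamma> * \<tau>" using g by (simp only: diff_zero)
  have "cmod (cc \<tau> - cc (\<tau> / 2)) \<le> 2 * \<bar>\<beta>\<bar> * \<gamma> * (\<tau> - \<tau> / 2)" by (rule cc_lipschitz) (use \<tau> in auto)
  also have "\<tau> - \<tau> / 2 = \<tau> / 2" by simp
  finally show "cmod (cc (\<tau> / 2) - cc \<tau>) \<le> 2 * \<bar>\<beta>\<bar> * \<gamma> * \<tau>" using g by (subst norm_minus_commute) linarith
qed (use \<tau> in auto)

lemma first_step_wiener:
  assumes N: "N > 0" "even N" and \<tau>: "0 < \<tau>" "\<tau> \<le> 1" "\<tau> \<le> T"
  shows "wiener N (residual N 0 \<tau> (predicted N \<tau>) (cc (\<tau> / 2))) \<le> \<omega> \<tau> (mesh N)"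
proof -
  have tT: "0 \<in> {0..T}" "\<tau> \<in> {0..T}" using \<tau> by auto
  have m: "2 / real N \<le> mesh N" using N pi_ge_two by (simp add: mesh_def divide_right_mono)
  have 2: "wiener N (space_defect N s) \<le> mesh N * R" if "s \<in> {0..T}" for s
    by (rule order_trans[OF space_defect_wiener[OF N that] mult_right_mono[OF m R0]])
  have 1: "wiener N (time_defect N 0 \<tau>) \<le> sqrt (5 * S\<^sub>w * C * sqrt \<tau>)" using time_defect_wiener[OF N(1), of 0 \<tau>] \<tau> by simp
  have "wiener N (residual N 0 \<tau> (predicted N \<tau>) (cc (\<tau> / 2))) \<le> sqrt (5 * S\<^sub>w * C * sqrt \<tau>) + (1/2 * (mesh N * R + mesh N * R) + L3 * \<tau>)"
    by (intro order_trans[OF residual_norm[OF gnorm_wiener[OF N(1)]]] add_mono mult_left_mono 1 2 tT first_step_nonlin_defect[OF N(1) \<tau>]) auto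
  then show ?thesis by (simp add: \<omega>_def)
qed

lemma grid_norm_le_wiener:
  assumes N: "N > 0" shows "grid_norm N V \<le> sqrt ((2 * pi) ^ 3) * wiener N V"
  by (rule grid_norm_le_sup[OF N wiener_nonneg norm_le_wiener[OF N]])

text \<open>First order in time is enough for the first step: it is taken only once, so its residual contributes
to the error with one more factor \<open>\<tau>\<close>.\<close>

lemma first_step_grid_norm:
  assumes N: "N > 0" "even N" and \<tau>: "0 < \<tau>" "\<tau> \<le> 1" "\<tau> \<le> T"
  shows "grid_norm N (residual N 0 \<tau> (predicted N \<tau>) (cc (\<tau> / 2))) \<le> K1 * (\<tau> + \<delta> N)"
proof -
  have tT: "0 \<in> {0..T}" "\<tau> \<in> {0..T}" using \<tau> by auto
  define W where "W = (4 * \<bar>\<beta>\<bar> + 4 * \<bar>\<beta>\<bar> * \<gamma>\<^sup>2 + 14 * \<bar>\<beta>\<bar> * \<gamma>) * R ^ 3"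
  have W0: "0 \<le> W" using gamma R0 by (simp add: W_def)
  have "grid_norm N (residual N 0 \<tau> (predicted N \<tau>) (cc (\<tau> / 2))) \<le>
     K * (\<tau>\<^sup>2 + \<delta> N) + (1/2 * (2 * K * \<delta> N + 2 * K * \<delta> N) + sqrt ((2 * pi) ^ 3) * (L3 * \<tau>))"
  proof (rule order_trans[OF residual_norm[OF gnorm_grid_norm[OF N(1)]]], intro add_mono mult_left_mono)
    show "grid_norm N (time_defect N 0 \<tau>) \<le> K * (\<tau>\<^sup>2 + \<delta> N)" using time_defect_grid_norm[OF N, of 0 \<tau>] \<tau> by simp
    show "grid_norm N (nonlin_defect N 0 \<tau> (predicted N \<tau>) (cc (\<tau> / 2))) \<le> sqrt ((2 * pi) ^ 3) * (L3 * \<tau>)"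
      by (rule order_trans[OF grid_norm_le_wiener[OF N(1)] mult_left_mono[OF first_step_nonlin_defect[OF N(1) \<tau>]]]) simp
  qed (intro space_defect_grid_norm N tT | simp)+
  also have "\<dots> \<le> K1 * (\<tau> + \<delta> N)"
  proof -
    have t2: "\<tau>\<^sup>2 \<le> \<tau>" using \<tau> by (simp add: power2_eq_square mult_left_le)
    have "sqrt ((2 * pi) ^ 3) * (L3 * \<tau>) \<le> sqrt ((2 * pi) ^ 3) * ((W + L3) * (\<tau> + \<delta> N))"
      using W0 L30 \<delta>0[of N] \<tau> by (intro mult_left_mono mult_mono) auto
    moreover have "K * (\<tau>\<^sup>2 + \<delta> N) + 1/2 * (2 * K * \<delta> N + 2 * K * \<delta> N) \<le> 6 * K * (\<tau> + \<delta> N)"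
      using mult_nonneg_nonneg[OF K0 \<delta>0[of N]] mult_left_mono[OF t2 K0] mult_nonneg_nonneg[OF K0, of \<tau>] \<tau> by (simp add: algebra_simps)
    moreover have "0 \<le> 2 * \<bar>\<beta>\<bar> * R\<^sup>2 * K * (\<tau> + \<delta> N)" using K0 \<tau> \<delta>0[of N] by simp
    ultimately show ?thesis unfolding K1_def W_def[symmetric] by (simp add: algebra_simps)
  qed
  finally show ?thesis .
qed

end

section \<open>Error propagation and convergence\<close>

context nls_reg
begin

definition L where "L = 4 * \<bar>\<beta>\<bar> * R\<^sup>2"

lemma L0: "0 \<le> L" by (simp add: L_def)

text \<open>The error satisfies the linear step with source
\<open>c * \<bar>Q\<bar>\<^sup>2 * (X + Y) / 2 + c * (\<bar>q\<bar>\<^sup>2 - \<bar>Q\<bar>\<^sup>2) * w\<close> minus the residual, where \<open>w\<close> is the average of the exact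
solution.  Each product contains exactly one error, and its other factors are bounded in the Wiener norm.\<close>

lemma error_step:
  assumes nn: "gnorm N nn" and ab: "0 \<le> a" "a < b" "b \<le> T" and c: "cmod c \<le> \<bar>\<beta>\<bar>"
    and q: "wiener N q \<le> 2 * R" and Q: "wiener N Q \<le> 2 * R"
    and scheme: "\<And>j. j \<in> J_h N \<Longrightarrow> \<i> * ((V j - W j) / of_real (b - a)) + Delta_h N (\<lambda>j. (V j + W j) / 2) j
        + c * of_real ((cmod (Q j))\<^sup>2) * ((V j + W j) / 2) = 0"
  shows "nn (\<lambda>j. gr N (u b) j - V j) \<le> nn (\<lambda>j. gr N (u a) j - W j)
     + (b - a) * (L / 2 * (nn (\<lambda>j. gr N (u b) j - V j) + nn (\<lambda>j. gr N (u a) j - W j)) + L * nn (\<lambda>j. q j - Q j) + nn (residual N a b q c))"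
proof -
  interpret nn: gnorm N nn by fact
  interpret A: gnorm N "wiener N" by (rule gnorm_wiener[OF nn.N])
  define X Y e where "X j = gr N (u b) j - V j" and "Y j = gr N (u a) j - W j" and "e j = q j - Q j" for j
  define w where "w j = (gr N (u b) j + gr N (u a) j) / 2" for j
  define G where "G j = c * (Q j * cnj (Q j)) * ((X j + Y j) / 2) + c * (e j * cnj (q j) + Q j * cnj (e j)) * w j - residual N a b q c j" for j
  have abT: "a \<in> {0..T}" "b \<in> {0..T}" using ab by auto
  have w: "wiener N w \<le> R"
  proof -
    have "wiener N (\<lambda>j. (1/2) * (gr N (u b) j + gr N (u a) j)) \<le> cmod (1/2) * wiener N (\<lambda>j. gr N (u b) j + gr N (u a) j)"
      by (rule A.scale)
    also have "\<dots> \<le> 1/2 * (R + R)"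
      using order_trans[OF A.add add_mono[OF wiener_u[OF nn.N abT(2)] wiener_u[OF nn.N abT(1)]]] by simp
    finally show ?thesis by (simp add: w_def[abs_def])
  qed
  have m: "nn (\<lambda>j. x j * (y j * z j)) \<le> r * p * nn z" if "wiener N x \<le> r" "wiener N y \<le> p" for x y z r p
  proof -
    have "nn (\<lambda>j. x j * y j * z j) \<le> wiener N (\<lambda>j. x j * y j) * nn z" by (rule nn.mult)
    also have "\<dots> \<le> (wiener N x * wiener N y) * nn z" by (intro mult_right_mono A.mult nn.nonneg)
    also have "\<dots> \<le> r * p * nn z"
      using that wiener_nonneg[of N x] wiener_nonneg[of N y] by (intro mult_right_mono mult_mono nn.nonneg) linarith+
    finally show ?thesis by (simp add: mult.assoc)
  qed
  have cQ: "wiener N (\<lambda>j. cnj (Q j)) \<le> 2 * R" by (rule order_trans[OF A.cnj_le Q])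
  have cq: "wiener N (\<lambda>j. cnj (q j)) \<le> 2 * R" by (rule order_trans[OF A.cnj_le q])
  have nG: "nn G \<le> L / 2 * (nn X + nn Y) + L * nn e + nn (residual N a b q c)"
  proof -
    have eq: "G = (\<lambda>j. c * (1/2 * (Q j * (cnj (Q j) * (X j + Y j))) + (w j * (cnj (q j) * e j) + w j * (Q j * cnj (e j)))) - residual N a b q c j)"
      by (rule ext) (simp add: G_def algebra_simps add_divide_distrib)
    have "nn G \<le> cmod c * nn (\<lambda>j. 1/2 * (Q j * (cnj (Q j) * (X j + Y j))) + (w j * (cnj (q j) * e j) + w j * (Q j * cnj (e j)))) + nn (residual N a b q c)"
      unfolding eq by (intro order_trans[OF nn.diff] add_right_mono nn.scale)
    also have "\<dots> \<le> \<bar>\<beta>\<bar> * (1/2 * (2 * R * (2 * R) * (nn X + nn Y)) + (R * (2 * R) * nn e + R * (2 * R) * nn e)) + nn (residual N a b q c)"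
    proof (intro add_right_mono mult_mono c order_trans[OF nn.add] add_mono)
      have "nn (\<lambda>j. 1/2 * (Q j * (cnj (Q j) * (X j + Y j)))) \<le> cmod (1/2) * nn (\<lambda>j. Q j * (cnj (Q j) * (X j + Y j)))" by (rule nn.scale)
      also have "\<dots> \<le> 1/2 * (2 * R * (2 * R) * nn (\<lambda>j. X j + Y j))" by (intro mult_mono m[OF Q cQ] nn.nonneg) auto
      also have "\<dots> \<le> 1/2 * (2 * R * (2 * R) * (nn X + nn Y))" using R0 by (intro mult_left_mono nn.add) auto
      finally show "nn (\<lambda>j. 1/2 * (Q j * (cnj (Q j) * (X j + Y j)))) \<le> 1/2 * (2 * R * (2 * R) * (nn X + nn Y))" .
      show "nn (\<lambda>j. w j * (cnj (q j) * e j)) \<le> R * (2 * R) * nn e" by (rule m[OF w cq])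
      show "nn (\<lambda>j. w j * (Q j * cnj (e j))) \<le> R * (2 * R) * nn e"
        using R0 by (intro order_trans[OF m[OF w Q]] mult_left_mono nn.cnj_le) auto
    qed (use nn.nonneg in auto)
    finally show ?thesis by (simp add: L_def power2_eq_square algebra_simps)
  qed
  have "nn X \<le> nn Y + (b - a) * nn G"
  proof (rule nn.mono)
    fix k assume k: "k \<in> J_h N"
    show "cmod (dft N X k) \<le> cmod (dft N Y k) + (b - a) * cmod (dft N G k)"
    proof (rule cn_step[OF nn.N _ k])
      fix j assume j: "j \<in> J_h N"
      have D: "Delta_h N (\<lambda>j. (X j + Y j) / 2) j = Delta_h N w j - Delta_h N (\<lambda>j. (V j + W j) / 2) j"
      proof -
        have "(\<lambda>j. (X j + Y j) / 2) = (\<lambda>j. w j - (V j + W j) / 2)"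
          by (rule ext) (simp add: X_def Y_def w_def field_simps)
        then show ?thesis by (simp only: Delta_h_diff)
      qed
      have T: "(X j - Y j) / of_real (b - a) = (gr N (u b) j - gr N (u a) j) / of_real (b - a) - (V j - W j) / of_real (b - a)"
        by (simp add: X_def Y_def diff_divide_distrib)
      have V: "(V j + W j) / 2 = w j - (X j + Y j) / 2"
        by (simp add: X_def Y_def w_def field_simps)
      have xi: "residual N a b q c j = \<i> * ((gr N (u b) j - gr N (u a) j) / of_real (b - a)) + Delta_h N w j + c * (q j * cnj (q j)) * w j"
        by (simp only: residual_def w_def[abs_def] sq_cnj)
      have "\<i> * ((V j - W j) / of_real (b - a)) + Delta_h N (\<lambda>j. (V j + W j) / 2) j + c * (Q j * cnj (Q j)) * (w j - (X j + Y j) / 2) = 0"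
        using scheme[OF j] by (simp only: sq_cnj V[symmetric])
      then show "\<i> * ((X j - Y j) / of_real (b - a)) + Delta_h N (\<lambda>j. (X j + Y j) / 2) j + G j = 0"
        unfolding D T G_def xi e_def by (simp add: algebra_simps)
    qed (use ab in simp)
  qed (use ab in simp)
  also have "\<dots> \<le> nn Y + (b - a) * (L / 2 * (nn X + nn Y) + L * nn e + nn (residual N a b q c))"
    using ab by (intro add_left_mono mult_left_mono nG) auto
  finally show ?thesis by (simp only: X_def[abs_def] Y_def[abs_def] e_def[abs_def])
qed

context
  fixes N M :: nat and \<tau> :: real and U :: "nat \<Rightarrow> gridfun"
  assumes N: "N > 0" "even N" and M: "M > 0" and tau: "\<tau> = T / real M"
    and scheme: "LI_CFP \<beta> \<gamma> T \<psi>\<^sub>0 u N M U"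
begin

lemma tau_pos: "0 < \<tau>" using T M by (simp add: tau)

lemma n_tau: "n \<le> M \<Longrightarrow> real n * \<tau> \<le> T"
  using T M by (simp add: tau field_simps)

lemma tau_T: "\<tau> \<le> T" using n_tau[of 1] M by simp

definition err where "err n j = gr N (u (real n * \<tau>)) j - U n j"

lemma scheme_start: "j \<in> J_h N \<Longrightarrow> U 0 j = gr N (u 0) j"
  using scheme sol grid_point_Omega[OF N(1)] unfolding LI_CFP_def nls_solution_def Let_def gr_def by auto

lemma scheme_first:
  assumes "j \<in> J_h N"
  shows "\<i> * ((U 1 j - U 0 j) / of_real (\<tau> - 0)) + Delta_h N (\<lambda>j. (U 1 j + U 0 j) / 2) j
     + cc (\<tau> / 2) * of_real ((cmod (predicted N \<tau> j))\<^sup>2) * ((U 1 j + U 0 j) / 2) = 0"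
proof -
  have "\<i> * delta_t_plus \<tau> U 0 j + Delta_h N (avg_half U 0) j
          + of_real (\<beta> * exp (- 2 * \<gamma> * (\<tau> / 2)) * (cmod (predicted N \<tau> j))\<^sup>2) * avg_half U 0 j = 0"
    using scheme assms unfolding LI_CFP_def Let_def tau[symmetric] predictor_eq by blast
  then show ?thesis
    by (simp only: delta_t_plus_def avg_half_def cc_def of_real_mult add_0 diff_zero)
qed

lemma scheme_step:
  assumes "j \<in> J_h N" "1 \<le> n" "n < M"
  shows "\<i> * ((U (n + 1) j - U (n - 1) j) / of_real ((real n * \<tau> + \<tau>) - (real n * \<tau> - \<tau>))) + Delta_h N (\<lambda>j. (U (n + 1) j + U (n - 1) j) / 2) j
     + cc (real n * \<tau>) * of_real ((cmod (U n j))\<^sup>2) * ((U (n + 1) j + U (n - 1) j) / 2) = 0"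
proof -
  have "n \<le> M - 1" using assms by simp
  then have "\<i> * delta_t \<tau> U n j + Delta_h N (avg_hat U n) j
          + of_real (\<beta> * exp (- 2 * \<gamma> * (real n * \<tau>)) * (cmod (U n j))\<^sup>2) * avg_hat U n j = 0"
    using scheme assms unfolding LI_CFP_def Let_def tau[symmetric] by blast
  moreover have "(real n * \<tau> + \<tau>) - (real n * \<tau> - \<tau>) = 2 * \<tau>" by simp
  ultimately show ?thesis
    by (simp only: delta_t_def avg_hat_def cc_def of_real_mult)
qed

lemma err_0: "gnorm N nn \<Longrightarrow> nn (err 0) = 0"
proof -
  assume "gnorm N nn"
  then interpret gnorm N nn .
  show ?thesis using cong[of "err 0" "\<lambda>j. 0"] by (simp add: zero err_def scheme_start)
qed

text \<open>The recursion with the Gronwall inequality.  Only bounds on the numerical solution at earlier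
levels are assumed, so the lemma can establish such bounds inductively.\<close>

lemma error_bound:
  assumes nn: "gnorm N nn" and small: "2 * \<tau> \<le> 1" "\<tau> * L \<le> 1/2"
    and bdd: "\<And>k. k < n \<Longrightarrow> wiener N (U k) \<le> 2 * R" and n: "n \<le> M"
    and A: "nn (residual N 0 \<tau> (predicted N \<tau>) (cc (\<tau> / 2))) \<le> A"
    and \<rho>: "0 \<le> \<rho>" "\<And>t. 0 \<le> t - \<tau> \<Longrightarrow> t + \<tau> \<le> T \<Longrightarrow> nn (residual N (t - \<tau>) (t + \<tau>) (gr N (u t)) (cc t)) \<le> \<rho>"
  shows "nn (err n) \<le> exp (8 * T * L) * (2 * \<tau> * A + 4 * T * \<rho>)"
proof -
  interpret nn: gnorm N nn by fact
  have A0: "0 \<le> A" using A nn.nonneg order_trans by blast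
  show ?thesis
  proof (cases "n = 0")
    case True
    then show ?thesis using err_0[OF nn] A0 \<rho>(1) tau_pos T by simp
  next
    case False
    have "nn (err n) \<le> exp (8 * \<tau> * L * n) * (2 * \<tau> * A + 4 * \<tau> * \<rho> * n)"
    proof (rule gronwall_two_step[where M = n and x = "\<lambda>n. nn (err n)"])
      have P: "wiener N (predicted N \<tau>) \<le> 2 * R" by (rule first_step_facts(1)[OF N(1) tau_pos _ tau_T]) (use small tau_pos in simp)
      have "nn (\<lambda>j. gr N (u \<tau>) j - U 1 j) \<le> nn (\<lambda>j. gr N (u 0) j - U 0 j) + (\<tau> - 0) * (L / 2 * (nn (\<lambda>j. gr N (u \<tau>) j - U 1 j)
          + nn (\<lambda>j. gr N (u 0) j - U 0 j)) + L * nn (\<lambda>j. predicted N \<tau> j - predicted N \<tau> j) + nn (residual N 0 \<tau> (predicted N \<tau>) (cc (\<tau> / 2))))"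
        by (rule error_step[OF nn _ _ _ _ P P scheme_first]) (use tau_pos tau_T norm_cc in auto)
      moreover have "nn (\<lambda>j. gr N (u 0) j - U 0 j) = 0" using err_0[OF nn] by (simp add: err_def[abs_def])
      moreover have "(\<lambda>j. gr N (u \<tau>) j - U 1 j) = err 1" by (simp add: err_def[abs_def])
      ultimately have "nn (err 1) \<le> \<tau> * (L / 2 * nn (err 1) + nn (residual N 0 \<tau> (predicted N \<tau>) (cc (\<tau> / 2))))"
        by (simp add: nn.zero)
      also have "\<dots> \<le> \<tau> * (L / 2 * nn (err 1) + A)" using A tau_pos by (intro mult_left_mono add_left_mono) auto
      also have "\<dots> = (\<tau> * L) * (nn (err 1) / 2) + \<tau> * A" by (simp add: algebra_simps)
      also have "\<dots> \<le> 1/2 * (nn (err 1) / 2) + \<tau> * A" using small nn.nonneg by (intro add_right_mono mult_right_mono) auto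
      finally have "nn (err 1) \<le> 1/4 * nn (err 1) + \<tau> * A" by simp
      then show "nn (err 1) \<le> 2 * \<tau> * A" using nn.nonneg[of "err 1"] mult_nonneg_nonneg[of \<tau> A] A0 tau_pos by linarith
    next
      fix k assume k: "1 \<le> k" "k < n"
      define t where "t = real k * \<tau>"
      have rk: "real (k + 1) * \<tau> = t + \<tau>" "real (k - 1) * \<tau> = t - \<tau>" using k by (auto simp: t_def algebra_simps of_nat_diff)
      have t: "0 \<le> t - \<tau>" "t + \<tau> \<le> T" using n_tau[of "k + 1"] k n tau_pos by (auto simp: rk[symmetric])
      have tT: "t \<in> {0..T}" using t tau_pos by auto
      have e: "err (k + 1) = (\<lambda>j. gr N (u (t + \<tau>)) j - U (k + 1) j)" "err (k - 1) = (\<lambda>j. gr N (u (t - \<tau>)) j - U (k - 1) j)" "err k = (\<lambda>j. gr N (u t) j - U k j)"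
        unfolding err_def[abs_def] rk t_def[symmetric] by (rule refl)+
      have "nn (err (k + 1)) \<le> nn (err (k - 1)) + ((t + \<tau>) - (t - \<tau>)) * (L / 2 * (nn (err (k + 1)) + nn (err (k - 1))) + L * nn (err k) + nn (residual N (t - \<tau>) (t + \<tau>) (gr N (u t)) (cc t)))"
        unfolding e
      proof (rule error_step[OF nn])
        show "wiener N (gr N (u t)) \<le> 2 * R" using wiener_u[OF N(1) tT] R0 by linarith
        show "\<i> * ((U (k + 1) j - U (k - 1) j) / of_real ((t + \<tau>) - (t - \<tau>))) + Delta_h N (\<lambda>j. (U (k + 1) j + U (k - 1) j) / 2) j
           + cc t * of_real ((cmod (U k j))\<^sup>2) * ((U (k + 1) j + U (k - 1) j) / 2) = 0" if "j \<in> J_h N" for j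
          unfolding t_def by (rule scheme_step[OF that k(1)]) (use k n in simp)
      qed (use t tT k tau_pos norm_cc bdd in auto)
      also have "\<dots> \<le> nn (err (k - 1)) + ((t + \<tau>) - (t - \<tau>)) * (L / 2 * (nn (err (k + 1)) + nn (err (k - 1))) + L * nn (err k) + \<rho>)"
        using tau_pos \<rho>(2)[OF t] by (intro add_left_mono mult_left_mono) auto
      finally show "nn (err (k + 1)) \<le> nn (err (k - 1)) + \<tau> * L * (nn (err (k + 1)) + nn (err (k - 1))) + 2 * \<tau> * L * nn (err k) + 2 * \<tau> * \<rho>"
        by (simp add: algebra_simps)
    qed (use nn.nonneg err_0[OF nn] tau_pos small L0 \<rho> in auto)
    also have "\<dots> \<le> exp (8 * T * L) * (2 * \<tau> * A + 4 * T * \<rho>)"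
    proof (rule mult_mono)
      have "(real n * \<tau>) * (8 * L) \<le> T * (8 * L)" using n_tau[OF n] L0 by (intro mult_right_mono) auto
      then show "exp (8 * \<tau> * L * n) \<le> exp (8 * T * L)" by (simp add: mult_ac)
      have "(real n * \<tau>) * (4 * \<rho>) \<le> T * (4 * \<rho>)" using n_tau[OF n] \<rho> by (intro mult_right_mono) auto
      then show "2 * \<tau> * A + 4 * \<tau> * \<rho> * n \<le> 2 * \<tau> * A + 4 * T * \<rho>" by (simp add: mult_ac)
    qed (use tau_pos A0 \<rho> in auto)
    finally show ?thesis .
  qed
qed

text \<open>Smallness of the residual, not its order, keeps the error in the Wiener norm below one,
and \<open>1 \<le> R\<close>.\<close>

lemma wiener_scheme_bounded:
  assumes small: "2 * \<tau> \<le> 1" "\<tau> * L \<le> 1/2" and \<omega>0: "0 \<le> \<omega> (2 * \<tau>) (mesh N)"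
    and \<omega>: "exp (8 * T * L) * (2 * \<tau> * \<omega> \<tau> (mesh N) + 4 * T * \<omega> (2 * \<tau>) (mesh N)) \<le> 1"
    and n: "n \<le> M"
  shows "wiener N (U n) \<le> 2 * R"
  using n
proof (induction n rule: less_induct)
  case (less n)
  interpret A: gnorm N "wiener N" by (rule gnorm_wiener[OF N(1)])
  have "wiener N (err n) \<le> exp (8 * T * L) * (2 * \<tau> * \<omega> \<tau> (mesh N) + 4 * T * \<omega> (2 * \<tau>) (mesh N))"
    by (rule error_bound[OF gnorm_wiener[OF N(1)] small less.IH less.prems first_step_wiener[OF N tau_pos _ tau_T] \<omega>0 residual_wiener[OF N tau_pos small(1)]])
      (use less.prems small tau_pos in auto)
  also note \<omega>
  also note R1
  finally have e: "wiener N (err n) \<le> R" .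
  have tT: "real n * \<tau> \<in> {0..T}" using n_tau[OF less.prems] tau_pos by simp
  have "wiener N (\<lambda>j. gr N (u (real n * \<tau>)) j - err n j) \<le> wiener N (gr N (u (real n * \<tau>))) + wiener N (err n)" by (rule A.diff)
  also have "\<dots> \<le> R + R" by (intro add_mono e wiener_u[OF N(1) tT])
  finally show ?case by (simp add: err_def[abs_def])
qed

lemma convergence:
  assumes small: "2 * \<tau> \<le> 1" "\<tau> * L \<le> 1/2" and \<omega>0: "0 \<le> \<omega> (2 * \<tau>) (mesh N)"
    and \<omega>: "exp (8 * T * L) * (2 * \<tau> * \<omega> \<tau> (mesh N) + 4 * T * \<omega> (2 * \<tau>) (mesh N)) \<le> 1"
    and n: "n \<le> M"
  shows "grid_norm N (err n) \<le> exp (8 * T * L) * ((2 + 4 * T) * K1) * (\<delta> N + \<tau>\<^sup>2)"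
proof -
  have t1: "\<tau> \<le> 1" using small tau_pos by simp
  have "grid_norm N (err n) \<le> exp (8 * T * L) * (2 * \<tau> * (K1 * (\<tau> + \<delta> N)) + 4 * T * (K1 * (\<tau>\<^sup>2 + \<delta> N)))"
    by (rule error_bound[OF gnorm_grid_norm[OF N(1)] small wiener_scheme_bounded[OF small \<omega>0 \<omega>] n
        first_step_grid_norm[OF N tau_pos t1 tau_T] _ residual_grid_norm[OF N tau_pos small(1)]])
      (use n K10 \<delta>0[of N] in auto)
  also have "\<dots> \<le> exp (8 * T * L) * (2 * (K1 * (\<tau>\<^sup>2 + \<delta> N)) + 4 * T * (K1 * (\<tau>\<^sup>2 + \<delta> N)))"
  proof (intro mult_left_mono add_right_mono)
    have "\<tau> * \<delta> N \<le> \<delta> N" using t1 tau_pos \<delta>0[of N] by (simp add: mult_left_le_one_le)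
    then have "K1 * (\<tau> * (\<tau> + \<delta> N)) \<le> K1 * (\<tau>\<^sup>2 + \<delta> N)"
      using K10 by (intro mult_left_mono) (simp_all add: power2_eq_square algebra_simps)
    then have "2 * (K1 * (\<tau> * (\<tau> + \<delta> N))) \<le> 2 * (K1 * (\<tau>\<^sup>2 + \<delta> N))" by (rule mult_left_mono) simp
    then show "2 * \<tau> * (K1 * (\<tau> + \<delta> N)) \<le> 2 * (K1 * (\<tau>\<^sup>2 + \<delta> N))" by (simp only: mult_ac)
  qed simp
  also have "\<dots> = exp (8 * T * L) * ((2 + 4 * T) * K1) * (\<delta> N + \<tau>\<^sup>2)" by (simp add: algebra_simps)
  finally show ?thesis .
qed

end

lemma \<omega>_mono:
  assumes "0 \<le> t" "t \<le> t'" "0 \<le> h" "h \<le> h'"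
  shows "0 \<le> \<omega> t h" "\<omega> t h \<le> \<omega> t' h'"
proof -
  show "0 \<le> \<omega> t h" using assms S\<^sub>w_nonneg C0' R0 L30 by (simp add: \<omega>_def)
  show "\<omega> t h \<le> \<omega> t' h'"
    unfolding \<omega>_def using assms S\<^sub>w_nonneg C0' R0 L30
    by (intro add_mono mult_right_mono mult_left_mono real_sqrt_le_mono) auto
qed

text \<open>The majorant vanishes at zero and is continuous there; being monotone in \<open>\<tau>\<close> and \<open>h\<close> separately, it is
controlled by its value on the diagonal.\<close>

lemma small_parameters:
  obtains s0 where "s0 > 0"
    "\<And>\<tau> h. 0 < \<tau> \<Longrightarrow> \<tau> \<le> s0 \<Longrightarrow> 0 < h \<Longrightarrow> h \<le> s0 \<Longrightarrow>
       2 * \<tau> \<le> 1 \<and> \<tau> * L \<le> 1/2 \<and> exp (8 * T * L) * (2 * \<tau> * \<omega> \<tau> h + 4 * T * \<omega> (2 * \<tau>) h) \<le> 1"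
proof -
  define F where "F x = 2 * x + 2 * x * L + exp (8 * T * L) * (2 * x * \<omega> x x + 4 * T * \<omega> (2 * x) x)" for x
  have "isCont F 0" unfolding F_def[abs_def] \<omega>_def by (intro continuous_intros)
  then have "(F \<longlongrightarrow> F 0) (at 0)" by (simp add: isCont_def)
  moreover have "F 0 = 0" by (simp add: F_def \<omega>_def)
  ultimately have "\<forall>\<^sub>F x in at 0. F x < 1" by (auto intro: order_tendstoD)
  then obtain d where d: "d > 0" "\<And>x. x \<noteq> 0 \<Longrightarrow> dist x 0 < d \<Longrightarrow> F x < 1" unfolding eventually_at by auto
  show thesis
  proof (rule that[of "d / 2"])
    fix \<tau> h assume \<tau>: "0 < \<tau>" "\<tau> \<le> d / 2" and h: "0 < h" "h \<le> d / 2"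
    have F: "F (d / 2) < 1" by (rule d(2)) (use d in auto)
    have "0 \<le> \<omega> (d/2) (d/2)" "0 \<le> \<omega> (2 * (d/2)) (d/2)" using d by (auto intro!: \<omega>_mono(1))
    then have a: "0 \<le> exp (8 * T * L) * (2 * (d / 2) * \<omega> (d/2) (d/2) + 4 * T * \<omega> (2 * (d/2)) (d/2))" using T d by (intro mult_nonneg_nonneg add_nonneg_nonneg) auto
    have b: "0 \<le> 2 * (d/2) * L" using d L0 by simp
    have 1: "2 * \<tau> \<le> 2 * (d/2)" using \<tau> by simp
    have 2: "2 * \<tau> * L \<le> 2 * (d/2) * L" by (rule mult_right_mono[OF 1 L0])
    have 3: "exp (8 * T * L) * (2 * \<tau> * \<omega> \<tau> h + 4 * T * \<omega> (2 * \<tau>) h) \<le> exp (8 * T * L) * (2 * (d / 2) * \<omega> (d/2) (d/2) + 4 * T * \<omega> (2 * (d/2)) (d/2))"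
      using \<tau> h T d by (intro mult_left_mono add_mono mult_mono \<omega>_mono) auto
    show "2 * \<tau> \<le> 1 \<and> \<tau> * L \<le> 1/2 \<and> exp (8 * T * L) * (2 * \<tau> * \<omega> \<tau> h + 4 * T * \<omega> (2 * \<tau>) h) \<le> 1"
      using F[unfolded F_def] a b 1 2 3 d by (intro conjI) linarith+
  qed (use d in simp)
qed

end

lemma \<delta>_le_powr:
  assumes N: "N > 0" and s: "s \<le> real p"
  shows "(4 / real N) ^ p \<le> 4 ^ p * real N powr (- s)"
proof -
  have "real N powr (- real p) \<le> real N powr (- s)" using N s by (intro powr_mono) auto
  then have "4 ^ p * (1 / real N ^ p) \<le> 4 ^ p * real N powr (- s)"
    using N by (intro mult_left_mono) (simp_all add: powr_minus powr_realpow divide_inverse)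
  then show ?thesis by (simp add: power_divide)
qed

theorem theorem4p1:
  fixes \<beta> \<gamma> T s :: real
    and \<psi>\<^sub>0 :: "real^3 \<Rightarrow> complex"
    and u \<psi> :: "real \<Rightarrow> real^3 \<Rightarrow> complex"
  assumes "\<gamma> > 0" and "T > 0" and "s > 3 / 2"
    and "nls_solution \<beta> \<gamma> T \<psi>\<^sub>0 u"
    and "C_time 3 T (H_p s) (sobolev_norm s) u"
    and "\<And>t x. \<psi> t x = exp (- \<gamma> * t) *\<^sub>R u t x"
  shows "\<exists>s\<^sub>0>0. \<exists>C\<^sub>0>0. \<forall>(N::nat) (M::nat) (h::real) (\<tau>::real) U.
    even N \<and> N > 0 \<and> M > 0 \<and> h = 2 * pi / real N \<and> \<tau> = T / real M \<and>
    0 < \<tau> \<and> \<tau> \<le> s\<^sub>0 \<and> 0 < h \<and> h \<le> s\<^sub>0 \<and>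
    LI_CFP \<beta> \<gamma> T \<psi>\<^sub>0 u N M U \<longrightarrow>
    (\<forall>n. 1 \<le> n \<and> n \<le> M \<longrightarrow>
       (let t = real n * \<tau> in
        grid_norm N (\<lambda>j. u t (grid_point N j) - U n j)
          \<le> C\<^sub>0 * (real N powr (- s) + \<tau>\<^sup>2) \<and>
        grid_norm N (\<lambda>j. \<psi> t (grid_point N j) - exp (- \<gamma> * t) *\<^sub>R U n j)
          \<le> C\<^sub>0 * exp (- \<gamma> * t) * (real N powr (- s) + \<tau>\<^sup>2)))"
proof -
  define m where "m = nat \<lfloor>s\<rfloor>"
  have sm: "s \<le> real (m + 2)" using assms(3) unfolding m_def by linarith
  obtain v1 v2 v3 B where "nls_data \<beta> \<gamma> T \<psi>\<^sub>0 u v1 v2 v3 B m"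
    using nls_data_exists[OF assms(1-5)] unfolding m_def by blast
  then interpret nls_data \<beta> \<gamma> T \<psi>\<^sub>0 u v1 v2 v3 B m .
  obtain C where "0 \<le> C" and C: "\<And>t. t \<in> {0..T} \<Longrightarrow> Hb (m + 4) (u t) C" "\<And>t. t \<in> {0..T} \<Longrightarrow> Hb (m + 2) (ut t) C"
    "\<And>t. t \<in> {0..T} \<Longrightarrow> Hb 0 (v2 t) C" "\<And>t. t \<in> {0..T} \<Longrightarrow> Hb 0 (v3 t) C"
  proof (rule regularity)
    fix C assume "0 \<le> C" "\<And>t. t \<in> {0..T} \<Longrightarrow> Hb (m + 4) (u t) C" "\<And>t. t \<in> {0..T} \<Longrightarrow> Hb (m + 2) (ut t) C"
      "\<And>t. t \<in> {0..T} \<Longrightarrow> Hb 0 (v2 t) C" "\<And>t. t \<in> {0..T} \<Longrightarrow> Hb 0 (v3 t) C"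
    then show thesis by (rule that)
  qed
  \<comment> \<open>The constant is raised to at least one in order that \<open>1 \<le> R\<close>.\<close>
  interpret nls_reg \<beta> \<gamma> T \<psi>\<^sub>0 u v1 v2 v3 B m "max C 1"
    by unfold_locales (simp, (rule wb_mono[OF C(1)] wb_mono[OF C(2)] wb_mono[OF C(3)] wb_mono[OF C(4)]; simp)+)
  obtain s0 where s0: "s0 > 0" and small: "\<And>\<tau> h. 0 < \<tau> \<Longrightarrow> \<tau> \<le> s0 \<Longrightarrow> 0 < h \<Longrightarrow> h \<le> s0 \<Longrightarrow>
       2 * \<tau> \<le> 1 \<and> \<tau> * L \<le> 1/2 \<and> exp (8 * T * L) * (2 * \<tau> * \<omega> \<tau> h + 4 * T * \<omega> (2 * \<tau>) h) \<le> 1"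
    by (rule small_parameters) (rule that)
  define A where "A = exp (8 * T * L) * ((2 + 4 * T) * K1)"
  have A0: "0 \<le> A" using T K10 by (simp add: A_def)
  define C0 where "C0 = A * 4 ^ (m + 2) + 1"
  have C0: "C0 > 0" using A0 by (simp add: C0_def add_nonneg_pos)
  have main: "grid_norm N (\<lambda>j. u (real n * \<tau>) (grid_point N j) - U n j) \<le> C0 * (real N powr (- s) + \<tau>\<^sup>2)"
    if N: "N > 0" "even N" and M: "M > 0" and \<tau>: "\<tau> = T / real M" "\<tau> \<le> s0" and h: "mesh N \<le> s0"
      and sch: "LI_CFP \<beta> \<gamma> T \<psi>\<^sub>0 u N M U" and n: "n \<le> M" for N M \<tau> U n
  proof -
    have pos: "0 < \<tau>" "0 < mesh N" using T M N by (auto simp: \<tau> mesh_def)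
    note S = small[OF pos(1) \<tau>(2) pos(2) h]
    have w0: "0 \<le> \<omega> (2 * \<tau>) (mesh N)" by (rule \<omega>_mono(1)) (use pos in auto)
    have "grid_norm N (\<lambda>j. u (real n * \<tau>) (grid_point N j) - U n j) \<le> A * (\<delta> N + \<tau>\<^sup>2)"
      using convergence[OF N M \<tau>(1) sch _ _ w0 _ n] S
      unfolding A_def err_def[OF N M \<tau>(1) sch, abs_def] gr_def by blast
    also have "\<dots> \<le> A * (4 ^ (m + 2) * real N powr (- s) + 4 ^ (m + 2) * \<tau>\<^sup>2)"
    proof (intro mult_left_mono add_mono)
      show "\<delta> N \<le> 4 ^ (m + 2) * real N powr (- s)" unfolding \<delta>_def by (rule \<delta>_le_powr[OF N(1) sm])
      have "1 * \<tau>\<^sup>2 \<le> 4 ^ (m + 2) * \<tau>\<^sup>2" by (intro mult_right_mono one_le_power) auto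
      then show "\<tau>\<^sup>2 \<le> 4 ^ (m + 2) * \<tau>\<^sup>2" by simp
    qed (rule A0)
    also have "\<dots> \<le> C0 * (real N powr (- s) + \<tau>\<^sup>2)" by (simp add: C0_def algebra_simps)
    finally show ?thesis .
  qed
  have damped: "grid_norm N (\<lambda>j. \<psi> t (grid_point N j) - exp (- \<gamma> * t) *\<^sub>R V j) \<le> exp (- \<gamma> * t) * grid_norm N (\<lambda>j. u t (grid_point N j) - V j)"
    if N: "N > 0" for N t V
  proof -
    interpret gnorm N "grid_norm N" by (rule gnorm_grid_norm[OF N])
    have "(\<lambda>j. \<psi> t (grid_point N j) - exp (- \<gamma> * t) *\<^sub>R V j) = (\<lambda>j. of_real (exp (- \<gamma> * t)) * (u t (grid_point N j) - V j))"
      by (rule ext) (simp add: assms(6) scaleR_conv_of_real right_diff_distrib)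
    then show ?thesis using scale[of "of_real (exp (- \<gamma> * t))" "\<lambda>j. u t (grid_point N j) - V j"] by simp
  qed
  show ?thesis
    unfolding Let_def
  proof (rule exI[of _ s0], rule conjI[OF s0], rule exI[of _ C0], rule conjI[OF C0], intro allI impI conjI)
    fix N M h \<tau> U n
    assume as: "even N \<and> N > 0 \<and> M > 0 \<and> h = 2 * pi / real N \<and> \<tau> = T / real M \<and>
      0 < \<tau> \<and> \<tau> \<le> s0 \<and> 0 < h \<and> h \<le> s0 \<and> LI_CFP \<beta> \<gamma> T \<psi>\<^sub>0 u N M U" and n: "1 \<le> n \<and> n \<le> M"
    show m: "grid_norm N (\<lambda>j. u (real n * \<tau>) (grid_point N j) - U n j) \<le> C0 * (real N powr (- s) + \<tau>\<^sup>2)"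
      using as n by (intro main[of N M]) (auto simp: mesh_def)
    have "grid_norm N (\<lambda>j. \<psi> (real n * \<tau>) (grid_point N j) - exp (- \<gamma> * (real n * \<tau>)) *\<^sub>R U n j)
      \<le> exp (- \<gamma> * (real n * \<tau>)) * grid_norm N (\<lambda>j. u (real n * \<tau>) (grid_point N j) - U n j)"
      using as by (intro damped) auto
    also have "\<dots> \<le> exp (- \<gamma> * (real n * \<tau>)) * (C0 * (real N powr (- s) + \<tau>\<^sup>2))"
      by (rule mult_left_mono[OF m]) simp
    finally show "grid_norm N (\<lambda>j. \<psi> (real n * \<tau>) (grid_point N j) - exp (- \<gamma> * (real n * \<tau>)) *\<^sub>R U n j)
      \<le> C0 * exp (- \<gamma> * (real n * \<tau>)) * (real N powr (- s) + \<tau>\<^sup>2)" by (simp add: mult_ac)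
  qed
qed

end
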